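(* Let $\varphi:\mathbb{N}\to\mathbb{N}$ be a map such that, for all $n$, $\varphi(n)\le n$ and $\varphi(n)$ has the same parity as $n$, and such that $\varphi(n)/n\to1$ as $n\to\infty$. Then $$\log p^n_{\varphi(n)}\ \sim\ -\frac{n^2}{4}\log 2\qquad(n\to\infty),$$ i.e. $\frac1{n^2}\log p^n_{\varphi(n)}\to-\frac14\log2$. In particular, for every fixed $r\in\mathbb{N}$, $\log p^n_{n-2r}\sim-\frac{n^2}{4}\log2$ as $n\to\infty$.
   Context: For each $n\ge 1$, under $\mathbb{P}$, $M^n$ is an $n\times n$ real Ginibre matrix: its entries are i.i.d. real Gaussian random variables with mean $0$ and variance $1/n$. For $0\le k\le n$, $p^n_k=\mathbb{P}[M^n\text{ has exactly }k\text{ real eigenvalues}]$, eigenvalues being counted with multiplicity. *)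

theory Defs
  imports "HOL-Probability.Probability" "HOL-Library.Landau_Symbols" "Jordan_Normal_Form.Char_Poly"
begin

unbundle asymp_equiv_syntax

(* Multiplicity is algebraic: the order of x as a root of the characteristic polynomial.
   Since the matrix is real, eigenvalue A ranges over the real eigenvalues only. *)
definition num_real_eigenvalues :: "real mat \<Rightarrow> nat" where
  "num_real_eigenvalues A = (\<Sum>x | eigenvalue A x. Polynomial.order x (char_poly A))"

(* The second parameter of normal_density is the standard deviation, so 1 / sqrt n
   gives variance 1 / n. *)
definition real_ginibre :: "'a measure \<Rightarrow> nat \<Rightarrow> ('a \<Rightarrow> real mat) \<Rightarrow> bool" where
  "real_ginibre P n M \<longleftrightarrow>
     (\<forall>\<omega>\<in>space P. M \<omega> \<in> carrier_mat n n) \<and>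
     prob_space.indep_vars P (\<lambda>_. borel) (\<lambda>(i, j) \<omega>. M \<omega> $$ (i, j)) ({..<n} \<times> {..<n}) \<and>
     (\<forall>i<n. \<forall>j<n. distributed P lborel (\<lambda>\<omega>. M \<omega> $$ (i, j)) (normal_density 0 (1 / sqrt (real n))))"

definition prob_real_eigenvalues :: "'a measure \<Rightarrow> ('a \<Rightarrow> real mat) \<Rightarrow> nat \<Rightarrow> real" where
  "prob_real_eigenvalues P M k = measure P {\<omega> \<in> space P. num_real_eigenvalues (M \<omega>) = k}"

end

theory Submission
  imports Defs "HOL-Real_Asymp.Real_Asymp"
begin

text \<open>
  Write \<open>n = m + k\<close> and let \<open>A(n, k, ys)\<close> be the expectation of the product of \<open>\<bar>det (y - B)\<bar>\<close>, \<open>y\<close> ranging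
  over the list \<open>ys\<close>, restricted to the event that the standard Gaussian matrix \<open>B\<close> of size \<open>n\<close> has exactly
  \<open>k\<close> real eigenvalues. Splitting off a real eigenvalue \<open>x\<close> with eigenvector \<open>(u, 1)\<close> (a Kac--Rice
  argument in the corner entry, followed by the linear substitutions that bring the matrix to block triangular form)
  gives a recursion which adds \<open>x\<close> to the list:
  \<open>(k + 1) A(n + 1, k + 1, ys)\<close> is the integral of \<open>exp (- x\<^sup>2 / 2) \<Prod>\<bar>y - x\<bar> A(n, k, x # ys)\<close>, up to an explicit constant.
  After \<open>k\<close> steps the probability of \<open>k\<close> real eigenvalues is a \<open>k\<close>-fold integral of a Vandermonde determinant,
  Gaussian weights and \<open>A(m, 0, ys)\<close>, in which \<open>A(m, 0, ys)\<close> may be replaced by product bounds.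
  From above, \<open>\<bar>det E\<bar> \<le> exp ((\<parallel>E\<parallel>\<^sup>2 - m) / 2)\<close> (norm of Frobenius) suffices. From below, translate the Gaussian measure by
  \<open>2 t J\<close> with \<open>J\<close> a complex structure and \<open>t\<close> of order \<open>sqrt n\<close>: with probability at least one half the
  translated matrix has no real eigenvalue and \<open>\<bar>det (y - B)\<bar> \<ge> t ^ m\<close> for all real \<open>y\<close>.
  The remaining Vandermonde integrals are estimated by the norms of the monic Hermite polynomials, and all errors add up
  to \<open>O(n m + n ln n)\<close>, which is \<open>o(n\<^sup>2)\<close> because \<open>k / n\<close> tends to \<open>1\<close>.
\<close>

section \<open>Products of Lebesgue measure\<close>

text \<open>The characteristic polynomial is affine in the corner entry \<open>a\<close>: it is
  \<open>r - [:a:] * p\<close>, so a real eigenvalue \<open>x\<close> solves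
  \<open>a = r(x) / p(x)\<close> and a one-dimensional area formula suffices. Each split leaves a
  determinant behind, so the probabilities alone satisfy no recursion; the list \<open>ys\<close>
  records these determinants. The constant in the theorem comes from the squared norms
  \<open>hh j = sqrt pi * fact j / 2 ^ j\<close>: their square roots contribute a factor 2 to the
  power \<open>- j / 2\<close>, and these exponents add up to about \<open>- k\<^sup>2 / 4\<close>.
  The obstacle is the scale of the determinants. The factorials in \<open>sqrt (hh j)\<close> and
  \<open>dd (m + j)\<close> combine to about \<open>n\<close> to the power \<open>- m k / 2\<close>,
  whose logarithm is not \<open>o(n\<^sup>2)\<close> when \<open>m / n\<close> tends to 0 slowly.
  Hence both bounds for \<open>An m 0 ys\<close> must carry exactly \<open>sqrt n ^ m\<close> per
  point, up to factors exponential in \<open>m\<close>; this fixes the scale \<open>c = 4 n\<close>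
  above and \<open>t = 52 sqrt n\<close> below. A complex structure exists only in even dimension,
  which is where the parity of \<open>\<phi>\<close> enters.\<close>

interpretation leb: product_sigma_finite "\<lambda>_. lborel :: real measure"
  by standard

text \<open>Functions on an index set rather than Euclidean types, because the dimension varies within the
  proofs.\<close>

abbreviation LB :: "'i set \<Rightarrow> ('i \<Rightarrow> real) measure" where
  "LB I \<equiv> PiM I (\<lambda>_. lborel)"

lemma sigma_finite_LB: "finite I \<Longrightarrow> sigma_finite_measure (LB I)"
  by (rule leb.sigma_finite)

lemma nn_swap:
  assumes "sigma_finite_measure M" "sigma_finite_measure N"
    and "case_prod f \<in> borel_measurable (M \<Otimes>\<^sub>M N)"
  shows "(\<integral>\<^sup>+x. \<integral>\<^sup>+y. f x y \<partial>N \<partial>M) = (\<integral>\<^sup>+y. \<integral>\<^sup>+x. f x y \<partial>M \<partial>N)"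
proof -
  interpret pair_sigma_finite M N using assms by (simp add: pair_sigma_finite_def)
  show ?thesis using Fubini'[of f] assms by simp
qed

lemma restrict_measurable_LB:
  assumes "\<And>i. i \<in> I \<Longrightarrow> (\<lambda>x. g x i) \<in> borel_measurable M"
  shows "(\<lambda>x. \<lambda>i\<in>I. g x i) \<in> measurable M (LB I)"
  by (rule measurable_restrict) (use assms in auto)

text \<open>A product measure is determined by its values on boxes, and the preimage of a box under
  a coordinatewise map is again a box.\<close>

lemma nn_LB_map:
  assumes I: "finite I" 
    and g: "\<And>i. i \<in> I \<Longrightarrow> g i \<in> borel_measurable borel"
    and d: "\<And>i. i \<in> I \<Longrightarrow> distr lborel borel (g i) = lborel"
    and f: "f \<in> borel_measurable (LB I)"
  shows "(\<integral>\<^sup>+x. f (\<lambda>i\<in>I. g i (x i)) \<partial>LB I) = (\<integral>\<^sup>+x. f x \<partial>LB I)"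
proof -
  have m: "(\<lambda>x. \<lambda>i\<in>I. g i (x i)) \<in> measurable (LB I) (LB I)"
    by (rule restrict_measurable_LB) (use g in measurable)
  have "distr (LB I) (LB I) (\<lambda>x. \<lambda>i\<in>I. g i (x i)) = LB I"
  proof (rule leb.PiM_eqI[OF I])
    fix A :: "'a \<Rightarrow> real set" assume A: "\<And>i. i \<in> I \<Longrightarrow> A i \<in> sets lborel"
    have "emeasure (distr (LB I) (LB I) (\<lambda>x. \<lambda>i\<in>I. g i (x i))) (Pi\<^sub>E I A)
        = emeasure (LB I) ((\<lambda>x. \<lambda>i\<in>I. g i (x i)) -` (Pi\<^sub>E I A) \<inter> space (LB I))"
      by (rule emeasure_distr[OF m]) (use I A in \<open>auto intro!: sets_PiM_I_finite\<close>)
    also have "(\<lambda>x. \<lambda>i\<in>I. g i (x i)) -` (Pi\<^sub>E I A) \<inter> space (LB I) = (\<Pi>\<^sub>E i\<in>I. g i -` A i)"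
      by (auto simp: space_PiM PiE_iff)
    also have "emeasure (LB I) \<dots> = (\<Prod>i\<in>I. emeasure lborel (g i -` A i))"
      using A g by (intro leb.emeasure_PiM I) (auto intro: measurable_sets_borel)
    also have "\<dots> = (\<Prod>i\<in>I. emeasure lborel (A i))"
    proof (rule prod.cong[OF refl])
      fix i assume i: "i \<in> I"
      have "emeasure lborel (A i) = emeasure (distr lborel borel (g i)) (A i)" using d[OF i] by simp
      also have "\<dots> = emeasure lborel (g i -` A i)"
        using emeasure_distr[of "g i" lborel borel "A i"] g[OF i] A[OF i] by simp
      finally show "emeasure lborel (g i -` A i) = emeasure lborel (A i)" by simp
    qed
    finally show "emeasure (distr (LB I) (LB I) (\<lambda>x. \<lambda>i\<in>I. g i (x i))) (Pi\<^sub>E I A) = (\<Prod>i\<in>I. emeasure lborel (A i))" .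
  qed simp
  then have "(\<integral>\<^sup>+x. f x \<partial>LB I) = (\<integral>\<^sup>+x. f x \<partial>distr (LB I) (LB I) (\<lambda>x. \<lambda>i\<in>I. g i (x i)))" by simp
  also have "\<dots> = (\<integral>\<^sup>+x. f (\<lambda>i\<in>I. g i (x i)) \<partial>LB I)"
    by (rule nn_integral_distr[OF m]) (use f in simp)
  finally show ?thesis by simp
qed

lemma nn_LB_translate:
  assumes "finite I" "f \<in> borel_measurable (LB I)"
  shows "(\<integral>\<^sup>+x. f (\<lambda>i\<in>I. x i + t i) \<partial>LB I) = (\<integral>\<^sup>+x. f x \<partial>LB I)"
  by (rule nn_LB_map[of I "\<lambda>i x. x + t i"])
     (use assms lborel_distr_plus[where ?'a = real] in \<open>simp_all add: add.commute[of _ "t _"]\<close>)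

lemma measurable_fun_upd_LB:
  assumes "x \<in> space (LB I)" "i \<notin> I"
  shows "(\<lambda>y. x(i := y)) \<in> measurable borel (LB (insert i I))"
  using measurable_component_update[of x I "\<lambda>_. lborel" i] assms by simp

lemma measurable_fun_upd_LB2:
  assumes "i \<notin> I"
  shows "(\<lambda>(x, y). x(i := y)) \<in> measurable (LB I \<Otimes>\<^sub>M borel) (LB (insert i I))"
proof -
  have "(\<lambda>(x, y). x(i := y)) \<in> measurable (LB I \<Otimes>\<^sub>M lborel) (LB (insert i I))" by measurable
  thus ?thesis by simp
qed

section \<open>Linear substitutions in Lebesgue measure\<close>

definition mv :: "nat \<Rightarrow> real mat \<Rightarrow> (nat \<Rightarrow> real) \<Rightarrow> nat \<Rightarrow> real" where
  "mv n A u = (\<lambda>i\<in>{..<n}. \<Sum>j<n. A $$ (i, j) * u j)"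

lemma measurable_mv [measurable]: "mv n A \<in> measurable (LB {..<n}) (LB {..<n})"
  unfolding mv_def by (rule restrict_measurable_LB) measurable

text \<open>Clearing the last column factors \<open>A\<close> as \<open>U * V\<close>, with
  \<open>U\<close> unipotent upper triangular by blocks and \<open>V\<close> lower triangular by
  blocks. The same Schur complement drives the inductions in \<open>nn_LB_linear\<close> and
  \<open>det_psd_le_exp_trace\<close>.\<close>

lemma det_schur_corner:
  fixes A :: "real mat"
  assumes A: "A \<in> carrier_mat (Suc n) (Suc n)" and a: "A $$ (n, n) \<noteq> 0"
  defines "S \<equiv> mat n n (\<lambda>(i, j). A $$ (i, j) - A $$ (i, n) * A $$ (n, j) / A $$ (n, n))"
  shows "det A = A $$ (n, n) * det S"
proof -
  define U where "U = four_block_mat (1\<^sub>m n) (mat n 1 (\<lambda>(i, j). A $$ (i, n) / A $$ (n, n))) (0\<^sub>m 1 n) (1\<^sub>m 1)"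
  define V where "V = four_block_mat S (0\<^sub>m n 1) (mat 1 n (\<lambda>(i, j). A $$ (n, j))) (mat 1 1 (\<lambda>_. A $$ (n, n)))"
  have S: "S \<in> carrier_mat n n" by (simp add: S_def)
  have "A = U * V"
    unfolding U_def V_def
    by (subst mult_four_block_mat[where ?nr1.0 = n and ?n1.0 = n and ?n2.0=1 and ?nr2.0=1 and ?nc1.0=n and ?nc2.0=1])
       (use A a S in \<open>auto intro!: eq_matI simp: S_def scalar_prod_def less_Suc_eq\<close>)
  moreover have "U \<in> carrier_mat (Suc n) (Suc n)" "V \<in> carrier_mat (Suc n) (Suc n)"
    using S by (auto simp: U_def V_def)
  ultimately have "det A = det U * det V" by (simp add: det_mult)
  also have "det U = 1"
    unfolding U_def by (subst det_four_block_mat_lower_left_zero[of _ n _ 1]) auto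
  also have "det V = det S * A $$ (n, n)"
    unfolding V_def by (subst det_four_block_mat_upper_right_zero[of _ n _ 1]) (auto simp: S det_single)
  finally show ?thesis by simp
qed

lemma nn_LB_Suc:
  assumes "f \<in> borel_measurable (LB {..<Suc n})"
  shows "(\<integral>\<^sup>+x. f x \<partial>LB {..<Suc n}) = (\<integral>\<^sup>+x. \<integral>\<^sup>+y. f (x(n := y)) \<partial>lborel \<partial>LB {..<n})"
    "(\<integral>\<^sup>+x. f x \<partial>LB {..<Suc n}) = (\<integral>\<^sup>+y. \<integral>\<^sup>+x. f (x(n := y)) \<partial>LB {..<n} \<partial>lborel)"
  using leb.product_nn_integral_insert[of "{..<n}" n f] leb.product_nn_integral_insert_rev[of "{..<n}" n f] assms
  by (auto simp: lessThan_Suc)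

text \<open>Gaussian elimination, one coordinate at a time. If the corner entry is nonzero, the last
  input is exchanged for the last output; for a fixed last output the other outputs are an affine
  function whose linear part is the Schur complement, to which the induction hypothesis applies. If
  the corner entry vanishes, a shear first makes it nonzero.\<close>

lemma nn_LB_linear:
  fixes A :: "real mat"
  assumes "A \<in> carrier_mat n n" "det A \<noteq> 0" "f \<in> borel_measurable (LB {..<n})"
  shows "(\<integral>\<^sup>+x. f x \<partial>LB {..<n}) = ennreal \<bar>det A\<bar> * (\<integral>\<^sup>+x. f (mv n A x) \<partial>LB {..<n})"
  using assms
proof (induction n arbitrary: A f)
  case 0
  have "mv 0 A x = x" if "x \<in> space (LB {..<0::nat})" for x
    using that by (auto simp: mv_def space_PiM)
  hence "(\<integral>\<^sup>+x. f (mv 0 A x) \<partial>LB {..<0}) = (\<integral>\<^sup>+x. f x \<partial>LB {..<0})"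
    by (intro nn_integral_cong) simp
  thus ?case using 0 by simp
next
  case (Suc n)
  have ne: "(\<integral>\<^sup>+x. f x \<partial>LB {..<Suc n}) = ennreal \<bar>det A\<bar> * (\<integral>\<^sup>+x. f (mv (Suc n) A x) \<partial>LB {..<Suc n})"
    if A: "A \<in> carrier_mat (Suc n) (Suc n)" and d: "det A \<noteq> 0" and a: "A $$ (n, n) \<noteq> 0"
      and f: "f \<in> borel_measurable (LB {..<Suc n})" for A :: "real mat" and f
  proof -
    let ?a = "A $$ (n, n)"
    define r where "r u = (\<Sum>j<n. A $$ (n, j) * u j)" for u
    define S where "S = mat n n (\<lambda>(i, j). A $$ (i, j) - A $$ (i, n) * A $$ (n, j) / ?a)"
    have dS: "det A = ?a * det S" unfolding S_def by (rule det_schur_corner[OF A a])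
    have S: "S \<in> carrier_mat n n" by (simp add: S_def)
    have fm: "(\<lambda>u. f (mv (Suc n) A u)) \<in> borel_measurable (LB {..<Suc n})"
      using f by (rule measurable_compose[OF measurable_mv])
    have r: "r \<in> borel_measurable (LB {..<n})" unfolding r_def by measurable
    \<comment> \<open>The last input is solved for the last output \<open>y\<close>; eliminating it
      from the other rows leaves \<open>S\<close> and a shift proportional to
      \<open>y\<close>.\<close>
    have key: "mv (Suc n) A (u(n := (y - r u) / ?a)) = (\<lambda>i\<in>{..<n}. mv n S u i + A $$ (i, n) * y / ?a)(n := y)" for u y
    proof (rule ext)
      fix i
      have *: "(\<Sum>j<Suc n. A $$ (i, j) * (u(n := (y - r u) / ?a)) j) =
          (\<Sum>j<n. A $$ (i, j) * u j) + A $$ (i, n) * ((y - r u) / ?a)" for i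
        by simp
      consider "i < n" | "i = n" | "i > n" by linarith
      thus "mv (Suc n) A (u(n := (y - r u) / ?a)) i = ((\<lambda>i\<in>{..<n}. mv n S u i + A $$ (i, n) * y / ?a)(n := y)) i"
      proof cases
        case 1
        have "(\<Sum>j<n. S $$ (i, j) * u j) = (\<Sum>j<n. A $$ (i, j) * u j) - A $$ (i, n) / ?a * r u"
          using 1 by (simp add: S_def r_def sum_distrib_left left_diff_distrib sum_subtractf mult.assoc)
        thus ?thesis using 1 a unfolding mv_def * by (simp add: * field_simps del: sum.lessThan_Suc)
      next
        case 2
        have "mv (Suc n) A (u(n := (y - r u) / ?a)) n = (\<Sum>j<Suc n. A $$ (n, j) * (u(n := (y - r u) / ?a)) j)"
          by (simp add: mv_def del: sum.lessThan_Suc fun_upd_apply)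
        also have "\<dots> = y" unfolding * using a by (simp add: r_def[symmetric])
        finally show ?thesis using 2 by simp
      qed (auto simp: mv_def)
    qed
    have inner: "(\<integral>\<^sup>+t. f (mv (Suc n) A (u(n := t))) \<partial>lborel) =
        ennreal (1 / \<bar>?a\<bar>) * (\<integral>\<^sup>+y. f ((\<lambda>i\<in>{..<n}. mv n S u i + A $$ (i, n) * y / ?a)(n := y)) \<partial>lborel)"
      if u: "u \<in> space (LB {..<n})" for u
    proof -
      have m: "(\<lambda>t. f (mv (Suc n) A (u(n := t)))) \<in> borel_measurable borel"
        using measurable_compose[OF measurable_fun_upd_LB[OF u] fm[unfolded lessThan_Suc]] by (simp add: lessThan_Suc)
      have "(\<integral>\<^sup>+t. f (mv (Suc n) A (u(n := t))) \<partial>lborel) =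
          ennreal \<bar>1 / ?a\<bar> * (\<integral>\<^sup>+y. f (mv (Suc n) A (u(n := - r u / ?a + 1 / ?a * y))) \<partial>lborel)"
        using nn_integral_real_affine[OF m, of "1 / ?a" "- r u / ?a"] a by simp
      also have "(\<lambda>y. - r u / ?a + 1 / ?a * y) = (\<lambda>y. (y - r u) / ?a)"
        by (auto simp: diff_divide_distrib)
      hence "\<And>y. - r u / ?a + 1 / ?a * y = (y - r u) / ?a" by metis
      ultimately show ?thesis by (simp add: key)
    qed
    have mm: "(\<lambda>(u, y). (\<lambda>i\<in>{..<n}. mv n S u i + A $$ (i, n) * y / ?a)(n := y)) \<in> measurable (LB {..<n} \<Otimes>\<^sub>M borel) (LB {..<Suc n})"
    proof -
      have "(\<lambda>p. (\<lambda>i\<in>{..<n}. mv n S (fst p) i + A $$ (i, n) * snd p / ?a, snd p)) \<in> measurable (LB {..<n} \<Otimes>\<^sub>M borel) (LB {..<n} \<Otimes>\<^sub>M borel)"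
        by (intro measurable_Pair restrict_measurable_LB) (auto simp: mv_def)
      from measurable_compose[OF this measurable_fun_upd_LB2[of n "{..<n}"]]
      show ?thesis by (simp add: lessThan_Suc split_beta')
    qed
    have mf: "(\<lambda>(u, y). f ((\<lambda>i\<in>{..<n}. mv n S u i + A $$ (i, n) * y / ?a)(n := y))) \<in> borel_measurable (LB {..<n} \<Otimes>\<^sub>M borel)"
      using measurable_compose[OF mm f] by (simp add: split_beta')
    have mf': "(\<lambda>(u, y). f ((\<lambda>i\<in>{..<n}. mv n S u i + A $$ (i, n) * y / ?a)(n := y))) \<in> borel_measurable (LB {..<n} \<Otimes>\<^sub>M lborel)"
      using mf by simp
    have "(\<integral>\<^sup>+x. f (mv (Suc n) A x) \<partial>LB {..<Suc n}) =
        (\<integral>\<^sup>+u. ennreal (1 / \<bar>?a\<bar>) * (\<integral>\<^sup>+y. f ((\<lambda>i\<in>{..<n}. mv n S u i + A $$ (i, n) * y / ?a)(n := y)) \<partial>lborel) \<partial>LB {..<n})"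
      unfolding nn_LB_Suc(1)[OF fm] by (intro nn_integral_cong inner)
    also have "\<dots> = ennreal (1 / \<bar>?a\<bar>) * (\<integral>\<^sup>+u. \<integral>\<^sup>+y. f ((\<lambda>i\<in>{..<n}. mv n S u i + A $$ (i, n) * y / ?a)(n := y)) \<partial>lborel \<partial>LB {..<n})"
      by (rule nn_integral_cmult) (use lborel.borel_measurable_nn_integral[OF mf'] in simp)
    also have "(\<integral>\<^sup>+u. \<integral>\<^sup>+y. f ((\<lambda>i\<in>{..<n}. mv n S u i + A $$ (i, n) * y / ?a)(n := y)) \<partial>lborel \<partial>LB {..<n})
        = (\<integral>\<^sup>+y. \<integral>\<^sup>+u. f ((\<lambda>i\<in>{..<n}. mv n S u i + A $$ (i, n) * y / ?a)(n := y)) \<partial>LB {..<n} \<partial>lborel)"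
      by (rule nn_swap[OF sigma_finite_LB _ mf']) (auto intro: lborel.sigma_finite_measure_axioms)
    also have "\<dots> = (\<integral>\<^sup>+y. ennreal (1 / \<bar>det S\<bar>) * (\<integral>\<^sup>+u. f (u(n := y)) \<partial>LB {..<n}) \<partial>lborel)"
    proof (rule nn_integral_cong)
      fix y :: real
      define g where "g v = f ((\<lambda>i\<in>{..<n}. v i + A $$ (i, n) * y / ?a)(n := y))" for v
      have up: "(\<lambda>v. v(n := y)) \<in> measurable (LB {..<n}) (LB {..<Suc n})"
        using measurable_compose[OF _ measurable_fun_upd_LB2[of n "{..<n}"], of "\<lambda>v. (v, y)" "LB {..<n}"]
        by (simp add: lessThan_Suc)
      have g': "(\<lambda>v. f (v(n := y))) \<in> borel_measurable (LB {..<n})"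
        using measurable_compose[OF up f] .
      have g: "g \<in> borel_measurable (LB {..<n})" unfolding g_def
        by (rule measurable_compose[OF _ g']) (intro restrict_measurable_LB; simp)
      have "det S \<noteq> 0" using dS d by auto
      have "(\<integral>\<^sup>+u. f (u(n := y)) \<partial>LB {..<n}) = (\<integral>\<^sup>+v. g v \<partial>LB {..<n})"
        unfolding g_def using nn_LB_translate[of "{..<n}" "\<lambda>v. f (v(n := y))" "\<lambda>i. A $$ (i, n) * y / ?a"] g' by simp
      also have "\<dots> = ennreal \<bar>det S\<bar> * (\<integral>\<^sup>+v. g (mv n S v) \<partial>LB {..<n})"
        by (rule Suc.IH[OF S \<open>det S \<noteq> 0\<close> g])
      finally have "(\<integral>\<^sup>+u. f (u(n := y)) \<partial>LB {..<n}) = ennreal \<bar>det S\<bar> * (\<integral>\<^sup>+v. g (mv n S v) \<partial>LB {..<n})" .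
      hence "ennreal (1 / \<bar>det S\<bar>) * (\<integral>\<^sup>+u. f (u(n := y)) \<partial>LB {..<n}) = (\<integral>\<^sup>+v. g (mv n S v) \<partial>LB {..<n})"
        using \<open>det S \<noteq> 0\<close> by (simp add: mult.assoc[symmetric] ennreal_mult[symmetric])
      thus "(\<integral>\<^sup>+u. f ((\<lambda>i\<in>{..<n}. mv n S u i + A $$ (i, n) * y / ?a)(n := y)) \<partial>LB {..<n}) =
         ennreal (1 / \<bar>det S\<bar>) * (\<integral>\<^sup>+u. f (u(n := y)) \<partial>LB {..<n})" by (simp add: g_def)
    qed
    also have "\<dots> = ennreal (1 / \<bar>det S\<bar>) * (\<integral>\<^sup>+y. \<integral>\<^sup>+u. f (u(n := y)) \<partial>LB {..<n} \<partial>lborel)"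
    proof (rule nn_integral_cmult)
      have "(\<lambda>(u, y). f (u(n := y))) \<in> borel_measurable (LB {..<n} \<Otimes>\<^sub>M lborel)"
        using measurable_compose[OF measurable_fun_upd_LB2[of n "{..<n}"], of f] f
        by (simp add: lessThan_Suc split_beta')
      from measurable_pair_swap[OF this]
      have "(\<lambda>(y, u). f (u(n := y))) \<in> borel_measurable (lborel \<Otimes>\<^sub>M LB {..<n})"
        by (simp add: split_beta')
      from sigma_finite_measure.borel_measurable_nn_integral[OF sigma_finite_LB[of "{..<n}"] this]
      show "(\<lambda>y. \<integral>\<^sup>+u. f (u(n := y)) \<partial>LB {..<n}) \<in> borel_measurable lborel" by simp
    qed
    also have "(\<integral>\<^sup>+y. \<integral>\<^sup>+u. f (u(n := y)) \<partial>LB {..<n} \<partial>lborel) = (\<integral>\<^sup>+x. f x \<partial>LB {..<Suc n})"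
      using nn_LB_Suc(2)[OF f] by simp
    finally have "(\<integral>\<^sup>+x. f (mv (Suc n) A x) \<partial>LB {..<Suc n}) =
      ennreal (1 / \<bar>?a\<bar>) * (ennreal (1 / \<bar>det S\<bar>) * (\<integral>\<^sup>+x. f x \<partial>LB {..<Suc n}))" .
    thus ?thesis using a d dS by (simp add: mult.assoc[symmetric] ennreal_mult[symmetric] abs_mult)
  qed
  show ?case
  proof (cases "A $$ (n, n) = 0")
    case False
    thus ?thesis using ne Suc.prems by blast
  next
    case True
    have A: "A \<in> carrier_mat (Suc n) (Suc n)" by fact
    have "\<exists>i<n. A $$ (i, n) \<noteq> 0"
    proof (rule ccontr)
      assume "\<not> ?thesis"
      hence z: "A $$ (i, n) = 0" if "i < Suc n" for i using that True less_Suc_eq by metis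
      have "det A = (\<Sum>i<Suc n. A $$ (i, n) * cofactor A i n)"
        by (rule laplace_expansion_column[OF A]) simp
      hence "det A = 0" using z by simp
      thus False using Suc.prems by simp
    qed
    then obtain i where i: "i < n" "A $$ (i, n) \<noteq> 0" by auto
    \<comment> \<open>Adding row \<open>i\<close> to row \<open>n\<close> makes
      \<open>A $$ (i, n)\<close> the corner entry. The function \<open>g\<close> below undoes this
      shear on the outputs; neither the determinant nor the integral changes.\<close>
    define B where "B = addrow 1 n i A"
    have B: "B \<in> carrier_mat (Suc n) (Suc n)" using A by (simp add: B_def)
    have dB: "det B = det A" unfolding B_def using A i by (intro det_addrow) auto
    have Bnn: "B $$ (n, n) \<noteq> 0" using A i True by (simp add: B_def mat_addrow_def)
    define g where "g c = f (c(n := c n - c i))" for c :: "nat \<Rightarrow> real"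
    have "(\<lambda>c. c(n := c n - c i)) \<in> measurable (LB {..<Suc n}) (LB {..<Suc n})"
    proof -
      have "(\<lambda>c. \<lambda>k\<in>{..<Suc n}. (c(n := c n - c i)) k) \<in> measurable (LB {..<Suc n}) (LB {..<Suc n})"
        by (rule restrict_measurable_LB) (use i in \<open>auto simp: fun_upd_def\<close>)
      thus ?thesis
        by (rule measurable_cong[THEN iffD1, rotated]) (auto simp: space_PiM PiE_def extensional_def fun_eq_iff)
    qed
    hence g: "g \<in> borel_measurable (LB {..<Suc n})"
      unfolding g_def using measurable_compose Suc.prems(3) by blast
    have "(\<integral>\<^sup>+x. g x \<partial>LB {..<Suc n}) = (\<integral>\<^sup>+x. \<integral>\<^sup>+y. f (x(n := y - x i)) \<partial>lborel \<partial>LB {..<n})"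
      unfolding nn_LB_Suc(1)[OF g] using i by (simp add: g_def)
    also have "\<dots> = (\<integral>\<^sup>+x. \<integral>\<^sup>+y. f (x(n := y)) \<partial>lborel \<partial>LB {..<n})"
    proof (rule nn_integral_cong)
      fix x assume x: "x \<in> space (LB {..<n})"
      have "(\<lambda>y. f (x(n := y))) \<in> borel_measurable borel"
        using measurable_compose[OF measurable_fun_upd_LB[OF x, of n]] Suc.prems(3) by (simp add: lessThan_Suc)
      from nn_integral_real_affine[OF this, of 1 "- x i"]
      show "(\<integral>\<^sup>+y. f (x(n := y - x i)) \<partial>lborel) = (\<integral>\<^sup>+y. f (x(n := y)) \<partial>lborel)" by simp
    qed
    also have "\<dots> = (\<integral>\<^sup>+x. f x \<partial>LB {..<Suc n})" by (rule nn_LB_Suc(1)[OF Suc.prems(3), symmetric])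
    finally have fg: "(\<integral>\<^sup>+x. g x \<partial>LB {..<Suc n}) = (\<integral>\<^sup>+x. f x \<partial>LB {..<Suc n})" .
    have gm: "g (mv (Suc n) B u) = f (mv (Suc n) A u)" for u
    proof -
      have "(mv (Suc n) B u)(n := mv (Suc n) B u n - mv (Suc n) B u i) = mv (Suc n) A u"
        using i A by (auto simp: mv_def B_def mat_addrow_def fun_eq_iff less_Suc_eq sum.distrib ring_distribs)
      thus ?thesis by (simp add: g_def)
    qed
    show ?thesis using ne[OF B _ Bnn g] dB Suc.prems fg by (simp add: gm)
  qed
qed

section \<open>Area formula for functions on the real line\<close>

text \<open>On a compact interval the inverse of an injective continuous function is continuous on
  the image, and the image of \<open>A\<close> is the preimage of \<open>A\<close> under that
  inverse.\<close>

lemma image_in_borel: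
  fixes g :: "real \<Rightarrow> real"
  assumes "continuous_on {a..b} g" "inj_on g {a..b}" "A \<in> sets borel" "A \<subseteq> {a..b}"
  shows "g ` A \<in> sets borel"
proof -
  define k where "k = the_inv_into {a..b} g"
  have k: "k (g x) = x" if "x \<in> {a..b}" for x
    unfolding k_def using assms(2) that by (rule the_inv_into_f_f)
  have "continuous_on (g ` {a..b}) k"
    by (rule continuous_on_inv) (use assms(1) k in auto)
  hence "k \<in> borel_measurable (restrict_space borel (g ` {a..b}))"
    by (rule borel_measurable_continuous_on_restrict)
  hence "k -` A \<inter> space (restrict_space borel (g ` {a..b})) \<in> sets (restrict_space borel (g ` {a..b}))"
    using assms(3) by (rule measurable_sets)
  moreover have cg: "g ` {a..b} \<in> sets borel"
    using compact_continuous_image[OF assms(1)] by (intro borel_closed compact_imp_closed) auto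
  ultimately have "k -` A \<inter> g ` {a..b} \<in> sets borel"
    by (simp add: sets_restrict_space_iff space_restrict_space)
  also have "k -` A \<inter> g ` {a..b} = g ` A" using k assms(4) by force
  finally show ?thesis .
qed

lemma deriv_pos_increasing:
  fixes g g' :: "real \<Rightarrow> real"
  assumes "x < y" "\<And>z. z \<in> {x..y} \<Longrightarrow> (g has_real_derivative g' z) (at z)" "\<And>z. z \<in> {x..y} \<Longrightarrow> g' z > 0"
  shows "g x < g y"
  by (rule DERIV_pos_imp_increasing[OF assms(1)]) (metis assms(2,3) atLeastAtMost_iff)

lemma deriv_neg_decreasing:
  fixes g g' :: "real \<Rightarrow> real"
  assumes "x < y" "\<And>z. z \<in> {x..y} \<Longrightarrow> (g has_real_derivative g' z) (at z)" "\<And>z. z \<in> {x..y} \<Longrightarrow> g' z < 0"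
  shows "g x > g y"
  by (rule DERIV_neg_imp_decreasing[OF assms(1)]) (metis assms(2,3) atLeastAtMost_iff)

text \<open>The substitution rule is available for whole intervals. Putting the indicator of the
  image of \<open>A\<close> into the integrand reduces Borel subsets to that case, because
  \<open>g\<close> is injective and so \<open>g x\<close> lies in the image of \<open>A\<close> only
  for \<open>x\<close> in \<open>A\<close>.\<close>

lemma nn_integral_image_pos:
  fixes g g' :: "real \<Rightarrow> real" and F :: "real \<Rightarrow> ennreal"
  assumes F: "F \<in> borel_measurable borel" and ab: "a < b"
    and d: "\<And>x. x \<in> {a..b} \<Longrightarrow> (g has_real_derivative g' x) (at x)"
    and c: "continuous_on {a..b} g'" and p: "\<And>x. x \<in> {a..b} \<Longrightarrow> g' x > 0"
    and A: "A \<in> sets borel" "A \<subseteq> {a..b}"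
  shows "(\<integral>\<^sup>+y. F y * indicator (g ` A) y \<partial>lborel) = (\<integral>\<^sup>+x. F (g x) * ennreal \<bar>g' x\<bar> * indicator A x \<partial>lborel)"
proof -
  have cg: "continuous_on {a..b} g" using d by (rule has_real_derivative_imp_continuous_on)
  have mono: "g x < g y" if "x \<in> {a..b}" "y \<in> {a..b}" "x < y" for x y
    by (rule deriv_pos_increasing[of _ _ g g']) (use d p that in auto)
  have inj: "inj_on g {a..b}" by (rule linorder_inj_onI) (use mono in \<open>fastforce, auto\<close>)
  have gA: "g ` A \<in> sets borel" by (rule image_in_borel[OF cg inj A])
  have le: "g x \<in> {g a..g b}" if "x \<in> {a..b}" for x
    using mono[of a x] mono[of x b] that by (cases "x = a"; cases "x = b") (auto intro: less_imp_le)
  let ?F = "\<lambda>y. F y * indicator (g ` A) y"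
  have "(\<integral>\<^sup>+y. ?F y \<partial>lborel) = (\<integral>\<^sup>+y. ?F y * indicator {g a..g b} y \<partial>lborel)"
    by (intro nn_integral_cong) (use le A(2) in \<open>auto split: split_indicator\<close>)
  also have "\<dots> = (\<integral>\<^sup>+x. ?F (g x) * g' x * indicator {a..b} x \<partial>lborel)"
    by (rule nn_integral_substitution_aux[OF _ _ d c _ ab]) (use F gA p in \<open>auto intro: less_imp_le\<close>)
  also have "\<dots> = (\<integral>\<^sup>+x. F (g x) * ennreal \<bar>g' x\<bar> * indicator A x \<partial>lborel)"
  proof (rule nn_integral_cong)
    fix x
    show "?F (g x) * g' x * indicator {a..b} x = F (g x) * ennreal \<bar>g' x\<bar> * indicator A x"
    proof (cases "x \<in> {a..b}")
      case True
      hence "g x \<in> g ` A \<longleftrightarrow> x \<in> A" using inj A(2) by (auto dest: inj_onD)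
      thus ?thesis using True p[OF True] by (auto split: split_indicator)
    qed (use A in \<open>auto split: split_indicator\<close>)
  qed
  finally show ?thesis .
qed

lemma nn_integral_image:
  fixes g g' :: "real \<Rightarrow> real" and F :: "real \<Rightarrow> ennreal"
  assumes F: "F \<in> borel_measurable borel" and ab: "a < b"
    and d: "\<And>x. x \<in> {a..b} \<Longrightarrow> (g has_real_derivative g' x) (at x)"
    and c: "continuous_on {a..b} g'"
    and p: "(\<forall>x\<in>{a..b}. g' x > 0) \<or> (\<forall>x\<in>{a..b}. g' x < 0)"
    and A: "A \<in> sets borel" "A \<subseteq> {a..b}"
  shows "(\<integral>\<^sup>+y. F y * indicator (g ` A) y \<partial>lborel) = (\<integral>\<^sup>+x. F (g x) * ennreal \<bar>g' x\<bar> * indicator A x \<partial>lborel)"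
  using p
proof
  assume "\<forall>x\<in>{a..b}. g' x > 0"
  thus ?thesis using nn_integral_image_pos[OF F ab d c _ A] by auto
next
  assume n: "\<forall>x\<in>{a..b}. g' x < 0"
  have cg: "continuous_on {a..b} g" using d by (rule has_real_derivative_imp_continuous_on)
  have mono: "g x > g y" if "x \<in> {a..b}" "y \<in> {a..b}" "x < y" for x y
    by (rule deriv_neg_decreasing[of _ _ g g']) (use d n that in auto)
  have inj: "inj_on g {a..b}" by (rule linorder_inj_onI) (use mono in \<open>fastforce, auto\<close>)
  have gA: "g ` A \<in> sets borel" by (rule image_in_borel[OF cg inj A])
  have "(\<integral>\<^sup>+y. F y * indicator (g ` A) y \<partial>lborel) = (\<integral>\<^sup>+y. F (- y) * indicator (g ` A) (- y) \<partial>lborel)"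
    using nn_integral_real_affine[of "\<lambda>y. F y * indicator (g ` A) y" "-1" 0] F gA by simp
  also have "\<dots> = (\<integral>\<^sup>+y. F (- y) * indicator ((\<lambda>x. - g x) ` A) y \<partial>lborel)"
    by (intro nn_integral_cong) (force split: split_indicator)
  also have "\<dots> = (\<integral>\<^sup>+x. F (- (- g x)) * ennreal \<bar>- g' x\<bar> * indicator A x \<partial>lborel)"
    by (rule nn_integral_image_pos[OF _ ab _ _ _ A]) 
       (use F c n in \<open>auto intro!: DERIV_minus d continuous_on_minus\<close>)
  finally show ?thesis by simp
qed

lemma suminf_indicator_card:
  assumes "finite S"
  shows "(\<Sum>i. indicator S i :: ennreal) = of_nat (card S)"
proof -
  have "(\<Sum>i. indicator S i :: ennreal) = (\<Sum>i\<in>S. indicator S i)"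
    by (rule suminf_finite[OF assms]) auto
  thus ?thesis using assms by simp
qed

text \<open>The open set is cut into countably many disjoint Borel pieces, each inside an interval
  with rational endpoints on which the derivative has constant sign. On each piece \<open>g\<close>
  is injective and the substitution rule applies; the number of pieces whose image contains
  \<open>y\<close> is the number of solutions of \<open>g x = y\<close>.\<close>

theorem nn_integral_area_formula:
  fixes g g' :: "real \<Rightarrow> real" and F :: "real \<Rightarrow> ennreal"
  assumes F: "F \<in> borel_measurable borel" and V: "open V"
    and d: "\<And>x. x \<in> V \<Longrightarrow> (g has_real_derivative g' x) (at x)"
    and c: "continuous_on V g'" and nz: "\<And>x. x \<in> V \<Longrightarrow> g' x \<noteq> 0"
    and fin: "\<And>y. finite {x \<in> V. g x = y}"
  shows "(\<integral>\<^sup>+y. F y * of_nat (card {x \<in> V. g x = y}) \<partial>lborel) =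
         (\<integral>\<^sup>+x. F (g x) * ennreal \<bar>g' x\<bar> * indicator V x \<partial>lborel)"
proof -
  define good where "good p q \<longleftrightarrow> p < q \<and> {p..q} \<subseteq> V \<and> 
    ((\<forall>x\<in>{p..q}. g' x > 0) \<or> (\<forall>x\<in>{p..q}. g' x < 0))" for p q :: real
  define lo hi where "lo i = (of_rat (fst (from_nat i :: rat \<times> rat)) :: real)"
    and "hi i = (of_rat (snd (from_nat i :: rat \<times> rat)) :: real)" for i
  define I where "I i = (if good (lo i) (hi i) then {lo i..hi i} else {})" for i
  define A where "A = disjointed I"
  have AI: "A i \<subseteq> I i" for i by (simp add: A_def disjointed_subset)
  have Ab: "A i \<in> sets borel" for i
  proof -
    have "range A \<subseteq> sets borel" unfolding A_def by (rule sets.range_disjointed_sets) (auto simp: I_def)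
    thus ?thesis by auto
  qed
  have disj: "disjoint_family A" by (simp add: A_def disjoint_family_disjointed)
  have ginv: "inj_on g (I i)" for i
  proof (cases "good (lo i) (hi i)")
    case True
    hence sub: "{lo i..hi i} \<subseteq> V" and sg: "(\<forall>x\<in>{lo i..hi i}. g' x > 0) \<or> (\<forall>x\<in>{lo i..hi i}. g' x < 0)"
      and I: "I i = {lo i..hi i}" by (auto simp: good_def I_def)
    have "g x \<noteq> g y" if "x \<in> I i" "y \<in> I i" "x < y" for x y
    proof -
      have "z \<in> {lo i..hi i}" if "z \<in> {x..y}" for z using that \<open>x \<in> I i\<close> \<open>y \<in> I i\<close> by (auto simp: I)
      hence z: "z \<in> {lo i..hi i}" "z \<in> V" if "z \<in> {x..y}" for z using that sub by auto
      from sg show ?thesis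
      proof
        assume "\<forall>x\<in>{lo i..hi i}. g' x > 0"
        hence "g x < g y" using z d by (intro deriv_pos_increasing[OF \<open>x < y\<close>, of g g']) auto
        thus ?thesis by simp
      next
        assume "\<forall>x\<in>{lo i..hi i}. g' x < 0"
        hence "g x > g y" using z d by (intro deriv_neg_decreasing[OF \<open>x < y\<close>, of g g']) auto
        thus ?thesis by simp
      qed
    qed
    thus ?thesis by (intro linorder_inj_onI) auto
  qed (simp add: I_def)
  have VI: "V = (\<Union>i. I i)"
  proof
    show "V \<subseteq> (\<Union>i. I i)"
    proof
      fix x assume x: "x \<in> V"
      obtain e where e: "e > 0" "ball x e \<subseteq> V" using V x open_contains_ball by blast
      have "isCont g' x" using c V x continuous_on_eq_continuous_at by blast
      then obtain r where r: "r > 0" "\<And>y. dist y x < r \<Longrightarrow> dist (g' y) (g' x) < \<bar>g' x\<bar>"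
        using nz[OF x] unfolding continuous_at_eps_delta by (meson zero_less_abs_iff)
      define s where "s = min e r"
      have s: "s > 0" using e r by (simp add: s_def)
      obtain p where p: "x - s < of_rat p" "of_rat p < x" using of_rat_dense[of "x - s" x] s by auto
      obtain q where q: "x < of_rat q" "of_rat q < x + s" using of_rat_dense[of x "x + s"] s by auto
      have sub: "dist y x < s" if "y \<in> {real_of_rat p..of_rat q}" for y
        using that p q by (auto simp: dist_real_def abs_if)
      have "good (of_rat p) (of_rat q)" unfolding good_def
      proof (intro conjI)
        show "real_of_rat p < of_rat q" using p q by simp
        show "{real_of_rat p..of_rat q} \<subseteq> V" using sub e by (force simp: s_def dist_commute)
        show "(\<forall>x\<in>{real_of_rat p..of_rat q}. g' x > 0) \<or> (\<forall>x\<in>{real_of_rat p..of_rat q}. g' x < 0)"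
        proof (cases "g' x > 0")
          case True
          have "g' y > 0" if "y \<in> {real_of_rat p..of_rat q}" for y
            using r(2)[of y] sub[OF that] True by (auto simp: s_def dist_real_def abs_if split: if_splits)
          thus ?thesis by blast
        next
          case False
          have "g' y < 0" if "y \<in> {real_of_rat p..of_rat q}" for y
            using r(2)[of y] sub[OF that] False nz[OF x] by (auto simp: s_def dist_real_def abs_if split: if_splits)
          thus ?thesis by blast
        qed
      qed
      hence "x \<in> I (to_nat (p, q))" using p q by (auto simp: I_def lo_def hi_def)
      thus "x \<in> (\<Union>i. I i)" by blast
    qed
    show "(\<Union>i. I i) \<subseteq> V" by (auto simp: I_def good_def split: if_splits)
  qed
  have VA: "V = (\<Union>i. A i)" unfolding VI A_def by (simp add: UN_disjointed_eq)
  have one: "(\<integral>\<^sup>+y. F y * indicator (g ` A i) y \<partial>lborel) = (\<integral>\<^sup>+x. F (g x) * ennreal \<bar>g' x\<bar> * indicator (A i) x \<partial>lborel)" for i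
  proof (cases "good (lo i) (hi i)")
    case True
    have sub: "{lo i..hi i} \<subseteq> V" using True by (simp add: good_def)
    show ?thesis
      by (rule nn_integral_image[of F "lo i" "hi i"])
         (use True F d sub AI[of i] Ab[of i] continuous_on_subset[OF c sub] in \<open>auto simp: good_def I_def\<close>)
  next
    case False
    hence "A i = {}" using AI[of i] by (simp add: I_def)
    thus ?thesis by simp
  qed
  have gAb: "g ` A i \<in> sets borel" for i
  proof (cases "good (lo i) (hi i)")
    case True
    have sub: "{lo i..hi i} \<subseteq> V" using True by (simp add: good_def)
    have "continuous_on {lo i..hi i} g" using d sub by (intro has_real_derivative_imp_continuous_on[of _ g g']) auto
    thus ?thesis using ginv[of i] AI[of i] Ab[of i] True by (intro image_in_borel[of "lo i" "hi i"]) (auto simp: I_def)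
  next
    case False
    hence "A i = {}" using AI[of i] by (simp add: I_def)
    thus ?thesis by simp
  qed
  have card: "(\<Sum>i. indicator (g ` A i) y :: ennreal) = of_nat (card {x \<in> V. g x = y})" for y
  proof -
    \<comment> \<open>\<open>h\<close> sends a solution to the index of its piece. Two solutions
      cannot share a piece, where \<open>g\<close> is injective, so the pieces hit are as many as
      the solutions.\<close>
    define S where "S = {i. y \<in> g ` A i}"
    define h where "h x = (THE i. x \<in> A i)" for x
    have h: "h x = i" if "x \<in> A i" for x i
      unfolding h_def using that disj by (intro the_equality) (auto simp: disjoint_family_on_def)
    have S: "S = h ` {x \<in> V. g x = y}"
      unfolding S_def VA using h by (auto simp: image_iff)
    have inj: "inj_on h {x \<in> V. g x = y}"
    proof (rule inj_onI)
      fix u v assume u: "u \<in> {x \<in> V. g x = y}" and v: "v \<in> {x \<in> V. g x = y}" and uv: "h u = h v"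
      obtain i j where "u \<in> A i" "v \<in> A j" using u v VA by auto
      with uv h have "u \<in> A i" "v \<in> A i" by auto
      thus "u = v" using ginv[of i] AI[of i] u v by (auto dest: inj_onD)
    qed
    have "(\<Sum>i. indicator (g ` A i) y :: ennreal) = (\<Sum>i. indicator S i)"
      by (intro suminf_cong) (auto simp: S_def split: split_indicator)
    also have "\<dots> = of_nat (card S)" by (rule suminf_indicator_card) (simp add: S fin)
    finally show ?thesis by (simp add: S card_image[OF inj])
  qed
  have "(\<integral>\<^sup>+y. F y * of_nat (card {x \<in> V. g x = y}) \<partial>lborel) = (\<integral>\<^sup>+y. (\<Sum>i. F y * indicator (g ` A i) y) \<partial>lborel)"
    by (simp add: card[symmetric])
  also have "\<dots> = (\<Sum>i. \<integral>\<^sup>+y. F y * indicator (g ` A i) y \<partial>lborel)"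
    by (rule nn_integral_suminf) (use F gAb in auto)
  also have "\<dots> = (\<Sum>i. \<integral>\<^sup>+x. F (g x) * ennreal \<bar>g' x\<bar> * indicator (A i) x \<partial>lborel)" by (simp add: one)
  also have "\<dots> = (\<Sum>i. \<integral>\<^sup>+x. (F (g x) * ennreal \<bar>g' x\<bar> * indicator V x) * indicator (A i) x \<partial>lborel)"
    by (intro suminf_cong nn_integral_cong) (auto simp: VA split: split_indicator)
  also have "\<dots> = (\<integral>\<^sup>+x. (\<Sum>i. (F (g x) * ennreal \<bar>g' x\<bar> * indicator V x) * indicator (A i) x) \<partial>lborel)"
  proof (rule nn_integral_suminf[symmetric])
    fix i
    \<comment> \<open>\<open>g\<close> and \<open>g'\<close> are controlled only on
      \<open>V\<close>; multiplication by the indicator turns them into functions that are Borel on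
      the whole line.\<close>
    have gm: "(\<lambda>x. indicator V x *\<^sub>R g x) \<in> borel_measurable borel"
      using V d by (intro borel_measurable_continuous_on_indicator continuous_at_imp_continuous_on)
        (auto intro: DERIV_isCont)
    have gm': "(\<lambda>x. indicator V x *\<^sub>R g' x) \<in> borel_measurable borel"
      using V c by (intro borel_measurable_continuous_on_indicator) auto
    have "(\<lambda>x. F (indicator V x *\<^sub>R g x) * ennreal \<bar>indicator V x *\<^sub>R g' x\<bar> * indicator V x) \<in> borel_measurable borel"
      using V by (intro borel_measurable_times_ennreal measurable_compose[OF gm F] measurable_compose[OF gm'] borel_measurable_indicator) auto
    also have "(\<lambda>x. F (indicator V x *\<^sub>R g x) * ennreal \<bar>indicator V x *\<^sub>R g' x\<bar> * indicator V x) =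
      (\<lambda>x. F (g x) * ennreal \<bar>g' x\<bar> * indicator V x)" by (auto split: split_indicator)
    finally show "(\<lambda>x. F (g x) * ennreal \<bar>g' x\<bar> * indicator V x * indicator (A i) x) \<in> borel_measurable lborel"
      using Ab[of i] by simp
  qed
  also have "\<dots> = (\<integral>\<^sup>+x. F (g x) * ennreal \<bar>g' x\<bar> * indicator V x \<partial>lborel)"
  proof (rule nn_integral_cong)
    fix x
    have "(\<Sum>i. indicator (A i) x :: ennreal) = indicator (\<Union>i. A i) x" by (rule suminf_indicator[OF disj])
    thus "(\<Sum>i. F (g x) * ennreal \<bar>g' x\<bar> * indicator V x * indicator (A i) x) = F (g x) * ennreal \<bar>g' x\<bar> * indicator V x"
      by (auto simp: VA[symmetric] split: split_indicator)
  qed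
  finally show ?thesis .
qed

section \<open>Measurability of the number of real roots\<close>

text \<open>Measurability is meant coefficient by coefficient; this is stable under sums and
  products, hence under the Leibniz formula for characteristic polynomials.\<close>

definition pmeas :: "'a measure \<Rightarrow> ('a \<Rightarrow> real poly) \<Rightarrow> bool" where
  "pmeas M P \<longleftrightarrow> (\<forall>i. (\<lambda>x. coeff (P x) i) \<in> borel_measurable M)"

lemma pmeas_const: "pmeas M (\<lambda>_. p)" by (simp add: pmeas_def)

lemma pmeas_add: "pmeas M P \<Longrightarrow> pmeas M Q \<Longrightarrow> pmeas M (\<lambda>x. P x + Q x)"
  unfolding pmeas_def by (auto intro: borel_measurable_add)

lemma pmeas_mult: "pmeas M P \<Longrightarrow> pmeas M Q \<Longrightarrow> pmeas M (\<lambda>x. P x * Q x)"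
  unfolding pmeas_def coeff_mult by (auto intro!: borel_measurable_sum borel_measurable_times)

lemma pmeas_sum: "(\<And>i. i \<in> I \<Longrightarrow> pmeas M (P i)) \<Longrightarrow> pmeas M (\<lambda>x. \<Sum>i\<in>I. P i x)"
  unfolding pmeas_def coeff_sum by (auto intro!: borel_measurable_sum)

lemma pmeas_prod: "(\<And>i. i \<in> I \<Longrightarrow> pmeas M (P i)) \<Longrightarrow> pmeas M (\<lambda>x. \<Prod>i\<in>I. P i x)"
  by (induction I rule: infinite_finite_induct) (auto intro: pmeas_mult pmeas_const)

lemma pmeas_pderiv: "pmeas M P \<Longrightarrow> pmeas M (\<lambda>x. pderiv (P x))"
  unfolding pmeas_def coeff_pderiv by (auto intro!: borel_measurable_times)

lemma pmeas_pCons: "a \<in> borel_measurable M \<Longrightarrow> pmeas M P \<Longrightarrow> pmeas M (\<lambda>x. pCons (a x) (P x))"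
  unfolding pmeas_def
proof
  fix i assume "a \<in> borel_measurable M" "\<forall>i. (\<lambda>x. coeff (P x) i) \<in> borel_measurable M"
  thus "(\<lambda>x. coeff (pCons (a x) (P x)) i) \<in> borel_measurable M"
    by (cases i) auto
qed

lemma poly_eq_sum_coeff:
  assumes "degree p \<le> d"
  shows "poly p (x :: real) = (\<Sum>i\<le>d. coeff p i * x ^ i)"
  unfolding poly_altdef by (rule sum.mono_neutral_left) (use assms in \<open>auto simp: coeff_eq_0\<close>)

lemma measurable_poly_eval:
  assumes "pmeas M P" "\<And>x. x \<in> space M \<Longrightarrow> degree (P x) \<le> d" "t \<in> borel_measurable M"
  shows "(\<lambda>x. poly (P x) (t x)) \<in> borel_measurable M"
proof -
  have "(\<lambda>x. \<Sum>i\<le>d. coeff (P x) i * t x ^ i) \<in> borel_measurable M"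
    using assms unfolding pmeas_def by (intro borel_measurable_sum borel_measurable_times borel_measurable_power) auto
  thus ?thesis
    by (rule measurable_cong[THEN iffD1, rotated]) (use poly_eq_sum_coeff[OF assms(2)] in auto)
qed

lemma pmeas_char_poly:
  assumes "\<And>i j. i < n \<Longrightarrow> j < n \<Longrightarrow> (\<lambda>x. X x (i, j)) \<in> borel_measurable M"
  shows "pmeas M (\<lambda>x. char_poly (mat n n (X x)))"
proof -
  have c: "char_poly_matrix (mat n n (X x)) \<in> carrier_mat n n" for x by simp
  have "pmeas M (\<lambda>x. \<Sum>p | p permutes {0..<n}. signof p * (\<Prod>i = 0..<n. char_poly_matrix (mat n n (X x)) $$ (i, p i)))"
  proof (intro pmeas_sum pmeas_mult pmeas_const pmeas_prod)
    fix p i assume "p \<in> {p. p permutes {0..<n}}" and i: "i \<in> {0..<n}"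
    hence "p i < n" by (auto dest: permutes_in_image[of _ _ i])
    hence "(\<lambda>x. char_poly_matrix (mat n n (X x)) $$ (i, p i)) = (\<lambda>x. (if i = p i then [:0, 1:] else 0) + [:- X x (i, p i):])"
      using i by (auto simp: char_poly_matrix_def)
    thus "pmeas M (\<lambda>x. char_poly_matrix (mat n n (X x)) $$ (i, p i))"
      using assms i \<open>p i < n\<close> by (auto intro!: pmeas_add pmeas_const pmeas_pCons)
  qed
  thus ?thesis by (simp add: char_poly_def det_def'[OF c])
qed

section \<open>Measurability of the number of zeros\<close>

text \<open>By compactness a continuous function has a zero in the interval iff its absolute value
  gets below every \<open>1 / (m + 1)\<close> at rational points of the interval, a countable
  condition. The hypothesis \<open>a < b\<close> provides rational points even near a zero at an
  endpoint.\<close>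

lemma zero_in_interval_measurable:
  fixes G :: "'a \<Rightarrow> real \<Rightarrow> real"
  assumes cont: "\<And>x. x \<in> space M \<Longrightarrow> continuous_on UNIV (G x)"
    and [measurable]: "\<And>t. (\<lambda>x. G x t) \<in> borel_measurable M" and ab: "a < b"
  shows "{x \<in> space M. \<exists>t\<in>{a..b}. G x t = 0} \<in> sets M"
proof -
  have "(\<exists>t\<in>{a..b}. G x t = 0) \<longleftrightarrow> (\<forall>m::nat. \<exists>q::rat. of_rat q \<in> {a..b} \<and> \<bar>G x (of_rat q)\<bar> < 1 / (real m + 1))"
    if x: "x \<in> space M" for x
  proof
    assume "\<exists>t\<in>{a..b}. G x t = 0"
    then obtain t where t: "t \<in> {a..b}" "G x t = 0" by auto
    show "\<forall>m::nat. \<exists>q::rat. of_rat q \<in> {a..b} \<and> \<bar>G x (of_rat q)\<bar> < 1 / (real m + 1)"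
    proof
      fix m :: nat
      have m: "1 / (real m + 1) > 0" by simp
      have "isCont (G x) t" using cont[OF x] by (simp add: continuous_on_eq_continuous_at)
      then obtain r where r: "r > 0" "\<And>y. dist y t < r \<Longrightarrow> dist (G x y) (G x t) < 1 / (real m + 1)"
        unfolding continuous_at_eps_delta using m by meson
      have "max a (t - r) < min b (t + r)" using t ab r by auto
      then obtain q where "max a (t - r) < of_rat q" "of_rat q < min b (t + r)" using of_rat_dense by blast
      thus "\<exists>q::rat. of_rat q \<in> {a..b} \<and> \<bar>G x (of_rat q)\<bar> < 1 / (real m + 1)"
        using r(2)[of "of_rat q"] t by (intro exI[of _ q]) (auto simp: dist_real_def abs_if)
    qed
  next
    assume R: "\<forall>m::nat. \<exists>q::rat. of_rat q \<in> {a..b} \<and> \<bar>G x (of_rat q)\<bar> < 1 / (real m + 1)"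
    have "continuous_on {a..b} (\<lambda>t. \<bar>G x t\<bar>)" using cont[OF x] by (intro continuous_intros) (auto intro: continuous_on_subset)
    from continuous_attains_inf[OF _ _ this] ab
    obtain t where t: "t \<in> {a..b}" "\<And>s. s \<in> {a..b} \<Longrightarrow> \<bar>G x t\<bar> \<le> \<bar>G x s\<bar>" by auto
    have "\<bar>G x t\<bar> \<le> 0"
    proof (rule ccontr)
      assume "\<not> \<bar>G x t\<bar> \<le> 0"
      then obtain m where "1 / real (Suc m) < \<bar>G x t\<bar>" using nat_approx_posE[of "\<bar>G x t\<bar>"] by auto
      with R[rule_format, of m] t show False by (fastforce simp: add.commute)
    qed
    thus "\<exists>t\<in>{a..b}. G x t = 0" using t by auto
  qed
  hence "{x \<in> space M. \<exists>t\<in>{a..b}. G x t = 0} = {x \<in> space M. \<forall>m::nat. \<exists>q::rat. of_rat q \<in> {a..b} \<and> \<bar>G x (of_rat q)\<bar> < 1 / (real m + 1)}"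
    by blast
  also have "\<dots> \<in> sets M" by measurable
  finally show ?thesis .
qed

lemma rational_separation:
  fixes Z :: "real set"
  assumes "finite Z"
  shows "\<exists>p q :: real \<Rightarrow> rat. (\<forall>z\<in>Z. of_rat (p z) < z \<and> z < of_rat (q z)) \<and>
     (\<forall>z\<in>Z. \<forall>w\<in>Z. z \<noteq> w \<longrightarrow> {of_rat (p z)..of_rat (q z) :: real} \<inter> {of_rat (p w)..of_rat (q w)} = {})"
proof -
  \<comment> \<open>The element 1 keeps the minimum defined when \<open>Z\<close> has fewer than two
    points. Intervals that stay within half the least distance of their centres are
    disjoint.\<close>
  define D where "D = insert 1 ((\<lambda>(z, w). \<bar>z - w\<bar>) ` {(z, w). z \<in> Z \<and> w \<in> Z \<and> z \<noteq> w})"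
  have "finite {(z, w). z \<in> Z \<and> w \<in> Z \<and> z \<noteq> w}" by (rule finite_subset[of _ "Z \<times> Z"]) (use assms in auto)
  hence D: "finite D" by (simp add: D_def)
  have "d > 0" if "d \<in> D" for d using that by (auto simp: D_def)
  hence m: "Min D > 0" using D by (subst Min_gr_iff) (auto simp: D_def)
  define e where "e = Min D / 2"
  have e: "e > 0" using m by (simp add: e_def)
  have "\<forall>z. \<exists>p. z - e < real_of_rat p \<and> real_of_rat p < z" using of_rat_dense e by (metis diff_less_eq less_add_same_cancel1)
  then obtain p where p: "\<And>z. z - e < real_of_rat (p z)" "\<And>z. real_of_rat (p z) < z" by metis
  have "\<forall>z. \<exists>p. z < real_of_rat p \<and> real_of_rat p < z + e" using of_rat_dense e by (metis less_add_same_cancel1)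
  then obtain q where q: "\<And>z. z < real_of_rat (q z)" "\<And>z. real_of_rat (q z) < z + e" by metis
  have "{of_rat (p z)..of_rat (q z) :: real} \<inter> {of_rat (p w)..of_rat (q w)} = {}"
    if "z \<in> Z" "w \<in> Z" "z \<noteq> w" for z w
  proof -
    have "\<bar>z - w\<bar> \<in> D" using that by (auto simp: D_def)
    hence "Min D \<le> \<bar>z - w\<bar>" using D by (intro Min_le)
    hence "2 * e \<le> \<bar>z - w\<bar>" by (simp add: e_def)
    thus ?thesis using p[of z] p[of w] q[of z] q[of w] by (auto simp: abs_if split: if_splits)
  qed
  thus ?thesis using p q by blast
qed

text \<open>There are at least \<open>k\<close> zeros iff some list of \<open>k\<close> pairwise
  disjoint rational intervals has a zero in each. Such lists are countably many, and each condition
  is measurable by \<open>zero_in_interval_measurable\<close>.\<close>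

lemma measurable_card_zeros:
  fixes G :: "'a \<Rightarrow> real \<Rightarrow> real"
  assumes cont: "\<And>x. x \<in> space M \<Longrightarrow> continuous_on UNIV (G x)"
    and meas: "\<And>t. (\<lambda>x. G x t) \<in> borel_measurable M" 
    and fin: "\<And>x. x \<in> space M \<Longrightarrow> finite {t. G x t = 0}"
  shows "(\<lambda>x. card {t. G x t = 0}) \<in> measurable M (count_space UNIV)"
proof -
  have ge: "{x \<in> space M. k \<le> card {t. G x t = 0}} \<in> sets M" for k
  proof -
    define ok where "ok l \<longleftrightarrow> length l = k \<and> (\<forall>i<k. fst (l ! i) < snd (l ! i)) \<and>
      (\<forall>i<k. \<forall>j<k. i \<noteq> j \<longrightarrow> {of_rat (fst (l ! i))..of_rat (snd (l ! i)) :: real} \<inter> {of_rat (fst (l ! j))..of_rat (snd (l ! j))} = {})"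
      for l :: "(rat \<times> rat) list"
    have "k \<le> card {t. G x t = 0} \<longleftrightarrow> (\<exists>l. ok l \<and> (\<forall>i<k. \<exists>t\<in>{of_rat (fst (l ! i))..of_rat (snd (l ! i))}. G x t = 0))"
      if x: "x \<in> space M" for x
    proof
      assume "k \<le> card {t. G x t = 0}"
      then obtain Z where Z: "Z \<subseteq> {t. G x t = 0}" "card Z = k" "finite Z" by (metis obtain_subset_with_card_n)
      obtain zs where zs: "set zs = Z" "distinct zs" using Z(3) finite_distinct_list by blast
      obtain p q where pq: "\<forall>z\<in>Z. real_of_rat (p z) < z \<and> z < of_rat (q z)"
        "\<forall>z\<in>Z. \<forall>w\<in>Z. z \<noteq> w \<longrightarrow> {of_rat (p z)..of_rat (q z) :: real} \<inter> {of_rat (p w)..of_rat (q w)} = {}"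
        using rational_separation[OF Z(3)] by blast
      have len: "length zs = k" using zs Z distinct_card by fastforce
      have zi: "zs ! i \<in> Z" if "i < k" for i using that len zs by (metis nth_mem)
      define l where "l = map (\<lambda>z. (p z, q z)) zs"
      have "real_of_rat (p z) < real_of_rat (q z)" if "z \<in> Z" for z using pq that by force
      moreover have "zs ! i \<noteq> zs ! j" if "i < k" "j < k" "i \<noteq> j" for i j
        using that zs len by (simp add: nth_eq_iff_index_eq)
      ultimately have "ok l" unfolding ok_def using pq(2) zi len by (auto simp: l_def of_rat_less simp del: Int_atLeastAtMost)
      moreover have "\<forall>i<k. \<exists>t\<in>{of_rat (fst (l ! i))..of_rat (snd (l ! i))}. G x t = 0"
      proof (intro allI impI)
        fix i assume i: "i < k"
        thus "\<exists>t\<in>{of_rat (fst (l ! i))..of_rat (snd (l ! i))}. G x t = 0"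
          using zi[OF i] pq(1) Z(1) len by (intro bexI[of _ "zs ! i"]) (auto simp: l_def intro: less_imp_le)
      qed
      ultimately show "\<exists>l. ok l \<and> (\<forall>i<k. \<exists>t\<in>{of_rat (fst (l ! i))..of_rat (snd (l ! i))}. G x t = 0)" by blast
    next
      assume "\<exists>l. ok l \<and> (\<forall>i<k. \<exists>t\<in>{of_rat (fst (l ! i))..of_rat (snd (l ! i))}. G x t = 0)"
      then obtain l where l: "ok l" "\<forall>i<k. \<exists>t\<in>{of_rat (fst (l ! i))..of_rat (snd (l ! i))}. G x t = 0" by blast
      then obtain t where t: "\<And>i. i < k \<Longrightarrow> t i \<in> {of_rat (fst (l ! i))..of_rat (snd (l ! i))} \<and> G x (t i) = 0" by metis
      have "inj_on t {..<k}"
      proof (rule inj_onI)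
        fix i j assume ij: "i \<in> {..<k}" "j \<in> {..<k}" "t i = t j"
        show "i = j"
        proof (rule ccontr)
          assume "i \<noteq> j"
          hence "{real_of_rat (fst (l ! i))..of_rat (snd (l ! i))} \<inter> {of_rat (fst (l ! j))..of_rat (snd (l ! j))} = {}"
            using l(1) ij unfolding ok_def by blast
          thus False using t[of i] t[of j] ij by auto
        qed
      qed
      hence "card (t ` {..<k}) = k" by (simp add: card_image)
      moreover have "t ` {..<k} \<subseteq> {t. G x t = 0}" using t by auto
      ultimately show "k \<le> card {t. G x t = 0}" using card_mono[OF fin[OF x]] by metis
    qed
    hence "{x \<in> space M. k \<le> card {t. G x t = 0}} =
      (\<Union>l\<in>{l. ok l}. {x \<in> space M. \<forall>i\<in>{..<k}. \<exists>t\<in>{of_rat (fst (l ! i))..of_rat (snd (l ! i))}. G x t = 0})"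
      unfolding Ball_def[of "{..<k}"] lessThan_iff by auto
    also have "\<dots> \<in> sets M"
    proof (rule sets.countable_UN'')
      fix l assume "l \<in> {l. ok l}"
      thus "{x \<in> space M. \<forall>i\<in>{..<k}. \<exists>t\<in>{of_rat (fst (l ! i))..of_rat (snd (l ! i))}. G x t = 0} \<in> sets M"
        by (intro sets.sets_Collect_finite_All zero_in_interval_measurable[OF cont meas]) (auto simp: ok_def of_rat_less)
    qed auto
    finally show ?thesis .
  qed
  have "{x \<in> space M. card {t. G x t = 0} = k} = {x \<in> space M. k \<le> card {t. G x t = 0}} - {x \<in> space M. Suc k \<le> card {t. G x t = 0}}" for k
    by auto
  hence "{x \<in> space M. card {t. G x t = 0} = k} \<in> sets M" for k
    by (simp only:) (intro sets.Diff ge)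
  moreover have "(\<lambda>x. card {t. G x t = 0}) -` {k} \<inter> space M = {x \<in> space M. card {t. G x t = 0} = k}" for k by auto
  ultimately show ?thesis by (simp add: measurable_count_space_eq2_countable)
qed

definition nr :: "real poly \<Rightarrow> nat" where
  "nr p = (\<Sum>x | poly p x = 0. order x p)"

lemma le_order_iff:
  fixes p :: "real poly"
  assumes "p \<noteq> 0"
  shows "l \<le> order x p \<longleftrightarrow> (\<forall>i<l. poly ((pderiv ^^ i) p) x = 0)"
  using assms
proof (induction l arbitrary: p)
  case (Suc l)
  show ?case
  proof (cases "poly p x = 0")
    case False
    thus ?thesis by (auto simp: order_root intro!: exI[of _ 0])
  next
    case True
    hence "pderiv p \<noteq> 0" using Suc.prems pderiv_iszero by fastforce
    have "Suc l \<le> order x p \<longleftrightarrow> l \<le> order x (pderiv p)" using order_pderiv[OF Suc.prems True] by simp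
    also have "\<dots> \<longleftrightarrow> (\<forall>i<l. poly ((pderiv ^^ i) (pderiv p)) x = 0)" by (rule Suc.IH) fact
    also have "\<dots> \<longleftrightarrow> (\<forall>i<Suc l. poly ((pderiv ^^ i) p) x = 0)"
      using True by (auto simp: less_Suc_eq_0_disj funpow_Suc_right simp del: funpow.simps)
    finally show ?thesis .
  qed
qed simp

text \<open>Counting by layers: the roots of multiplicity greater than \<open>l\<close> are the
  zeros of one continuous function, the sum of the squares of the derivatives up to order
  \<open>l\<close>. So \<open>measurable_card_zeros\<close> also handles multiplicities.\<close>

lemma nr_eq_sum_card:
  assumes "p \<noteq> 0" "degree p \<le> d"
  shows "nr p = (\<Sum>l<d. card {x. (\<Sum>i\<le>l. (poly ((pderiv ^^ i) p) x)\<^sup>2) = 0})"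
proof -
  have fin: "finite {x. poly p x = 0}" using assms by (simp add: poly_roots_finite)
  have eq: "{x. (\<Sum>i\<le>l. (poly ((pderiv ^^ i) p) x)\<^sup>2) = 0} = {x \<in> {x. poly p x = 0}. l < order x p}" for l
  proof -
    have "(\<Sum>i\<le>l. (poly ((pderiv ^^ i) p) x)\<^sup>2) = 0 \<longleftrightarrow> l < order x p" for x
      using le_order_iff[OF assms(1), of "Suc l" x] by (auto simp: sum_nonneg_eq_0_iff less_Suc_eq_le Suc_le_eq)
    moreover have "l < order x p \<Longrightarrow> poly p x = 0" for x using order_root[of p x] by auto
    ultimately show ?thesis by auto
  qed
  have "nr p = (\<Sum>x | poly p x = 0. \<Sum>l<d. if l < order x p then 1 else 0)"
    unfolding nr_def
  proof (intro sum.cong refl)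
    fix x
    have "order x p \<le> d" using order_degree[OF assms(1), of x] assms(2) by simp
    hence "{..<d} \<inter> {l. l < order x p} = {..<order x p}" by auto
    thus "order x p = (\<Sum>l<d. if l < order x p then 1 else 0)" by (simp add: sum.If_cases)
  qed
  also have "\<dots> = (\<Sum>l<d. \<Sum>x | poly p x = 0. if l < order x p then 1 else 0)" by (rule sum.swap)
  also have "\<dots> = (\<Sum>l<d. card {x \<in> {x. poly p x = 0}. l < order x p})"
    using fin by (simp add: sum.If_cases Int_def)
  finally show ?thesis by (simp add: eq)
qed

lemma pmeas_funpow_pderiv: "pmeas M P \<Longrightarrow> pmeas M (\<lambda>x. (pderiv ^^ i) (P x))"
  by (induction i) (auto intro: pmeas_pderiv)

lemma degree_funpow_pderiv: "degree ((pderiv ^^ i) (p :: real poly)) \<le> degree p"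
  by (induction i) (auto simp: degree_pderiv)

lemma measurable_sum_nat:
  fixes f :: "'i \<Rightarrow> 'a \<Rightarrow> nat"
  assumes "\<And>i. f i \<in> measurable M (count_space UNIV)"
  shows "(\<lambda>x. \<Sum>i\<in>I. f i x) \<in> measurable M (count_space UNIV)"
proof (induction I rule: infinite_finite_induct)
  case (insert i I)
  note [measurable] = assms insert.IH
  have "(\<lambda>x. f i x + (\<Sum>i\<in>I. f i x)) \<in> measurable M (count_space UNIV)" by measurable
  thus ?case using insert by simp
qed auto

lemma measurable_nr:
  assumes "pmeas M P" "\<And>x. x \<in> space M \<Longrightarrow> P x \<noteq> 0" "\<And>x. x \<in> space M \<Longrightarrow> degree (P x) \<le> d"
  shows "(\<lambda>x. nr (P x)) \<in> measurable M (count_space UNIV)"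
proof -
  let ?G = "\<lambda>l x t. \<Sum>i\<le>l. (poly ((pderiv ^^ i) (P x)) t)\<^sup>2"
  have c: "(\<lambda>x. card {t. ?G l x t = 0}) \<in> measurable M (count_space UNIV)" for l
  proof (rule measurable_card_zeros)
    fix t
    show "(\<lambda>x. ?G l x t) \<in> borel_measurable M"
      by (intro borel_measurable_sum borel_measurable_power measurable_poly_eval[where d = d] pmeas_funpow_pderiv assms)
         (use assms(3) degree_funpow_pderiv order_trans in \<open>blast, simp\<close>)
  next
    fix x assume x: "x \<in> space M"
    have "{t. ?G l x t = 0} \<subseteq> {t. poly (P x) t = 0}" by (auto simp: sum_nonneg_eq_0_iff dest!: bspec[of _ _ 0])
    thus "finite {t. ?G l x t = 0}" using poly_roots_finite[OF assms(2)[OF x]] finite_subset by blast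
  qed (auto intro!: continuous_intros)
  have "(\<lambda>x. \<Sum>l<d. card {t. ?G l x t = 0}) \<in> measurable M (count_space UNIV)"
    by (rule measurable_sum_nat[OF c]) 
  thus ?thesis
    by (rule measurable_cong[THEN iffD1, rotated]) (use nr_eq_sum_card[OF assms(2,3)] in auto)
qed

section \<open>Bordered matrices\<close>

abbreviation LM :: "nat \<Rightarrow> (nat \<times> nat \<Rightarrow> real) measure" where
  "LM n \<equiv> LB ({..<n} \<times> {..<n})"

text \<open>Matrices are functions on pairs of indices, so that the product measure applies to them
  directly.\<close>

definition cp :: "nat \<Rightarrow> (nat \<times> nat \<Rightarrow> real) \<Rightarrow> real poly" where
  "cp n M = char_poly (mat n n M)"

lemma cp_monic: "degree (cp n M) = n" "coeff (cp n M) n = 1" "cp n M \<noteq> 0"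
proof -
  have "degree (char_poly (mat n n M)) = n \<and> coeff (char_poly (mat n n M)) n = 1"
    by (rule degree_monic_char_poly) simp
  thus "degree (cp n M) = n" "coeff (cp n M) n = 1" by (auto simp: cp_def)
  thus "cp n M \<noteq> 0" by auto
qed

lemma cp_cong: "(\<And>i j. i < n \<Longrightarrow> j < n \<Longrightarrow> M (i, j) = N (i, j)) \<Longrightarrow> cp n M = cp n N"
  unfolding cp_def by (intro arg_cong[of _ _ char_poly] eq_matI) auto

lemma pmeas_cp:
  assumes "\<And>i j. i < n \<Longrightarrow> j < n \<Longrightarrow> (\<lambda>x. X x (i, j)) \<in> borel_measurable M"
  shows "pmeas M (\<lambda>x. cp n (X x))"
  unfolding cp_def by (rule pmeas_char_poly) (rule assms)

lemma measurable_poly_cp: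
  assumes "\<And>i j. i < n \<Longrightarrow> j < n \<Longrightarrow> (\<lambda>x. X x (i, j)) \<in> borel_measurable M" "t \<in> borel_measurable M"
  shows "(\<lambda>x. poly (cp n (X x)) (t x)) \<in> borel_measurable M"
  by (rule measurable_poly_eval[of _ _ n]) (use assms in \<open>auto intro: pmeas_cp simp: cp_monic\<close>)

lemma measurable_poly_pderiv_cp:
  assumes "\<And>i j. i < n \<Longrightarrow> j < n \<Longrightarrow> (\<lambda>x. X x (i, j)) \<in> borel_measurable M" "t \<in> borel_measurable M"
  shows "(\<lambda>x. poly (pderiv (cp n (X x))) (t x)) \<in> borel_measurable M"
  by (rule measurable_poly_eval[OF pmeas_pderiv[OF pmeas_cp], of n]) (use assms in \<open>auto simp: cp_monic degree_pderiv\<close>)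

lemma poly_cp: "poly (cp n D) x = det (mat n n (\<lambda>(i, j). (if i = j then x else 0) - D (i, j)))"
proof -
  have "poly (cp n D) x = det (- char_matrix (mat n n D) x)"
    unfolding cp_def by (rule char_poly_matrix[of _ n]) simp
  also have "- char_matrix (mat n n D) x = mat n n (\<lambda>(i, j). (if i = j then x else 0) - D (i, j))"
    by (intro eq_matI) (auto simp: char_matrix_def)
  finally show ?thesis .
qed

text \<open>\<open>D\<close> is the leading block, \<open>w\<close> the last row, \<open>c\<close>
  the last column, \<open>a\<close> the corner. The restriction makes the result an element of the
  space of \<open>LM (Suc n)\<close>.\<close>

definition blk :: "nat \<Rightarrow> (nat \<times> nat \<Rightarrow> real) \<Rightarrow> (nat \<Rightarrow> real) \<Rightarrow> (nat \<Rightarrow> real) \<Rightarrow> real \<Rightarrow> nat \<times> nat \<Rightarrow> real" where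
  "blk n D w c a = restrict (\<lambda>(i, j). if i < n then (if j < n then D (i, j) else c i) else (if j < n then w j else a))
     ({..<Suc n} \<times> {..<Suc n})"

lemma blk_simps [simp]:
  "i < n \<Longrightarrow> j < n \<Longrightarrow> blk n D w c a (i, j) = D (i, j)"
  "i < n \<Longrightarrow> blk n D w c a (i, n) = c i"
  "j < n \<Longrightarrow> blk n D w c a (n, j) = w j"
  "blk n D w c a (n, n) = a"
  by (auto simp: blk_def)

lemma measurable_blk:
  assumes "\<And>i j. i < n \<Longrightarrow> j < n \<Longrightarrow> (\<lambda>x. D x (i, j)) \<in> borel_measurable M"
    "\<And>j. j < n \<Longrightarrow> (\<lambda>x. w x j) \<in> borel_measurable M"
    "\<And>i. i < n \<Longrightarrow> (\<lambda>x. c x i) \<in> borel_measurable M" "a \<in> borel_measurable M"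
  shows "(\<lambda>x. blk n (D x) (w x) (c x) (a x)) \<in> measurable M (LM (Suc n))"
  unfolding blk_def
proof (rule restrict_measurable_LB)
  fix p assume "p \<in> {..<Suc n} \<times> {..<Suc n}"
  then obtain i j where p: "p = (i, j)" "i < Suc n" "j < Suc n" by auto
  show "(\<lambda>x. case p of (i, j) \<Rightarrow> if i < n then if j < n then D x (i, j) else c x i else if j < n then w x j else a x) \<in> borel_measurable M"
    using assms p by (cases "i < n"; cases "j < n") auto
qed

lemma all_less_Suc_square:
  "(\<forall>i<Suc n. \<forall>j<Suc n. P i j) \<longleftrightarrow> (\<forall>i<n. \<forall>j<n. P i j) \<and> (\<forall>j<n. P n j) \<and> (\<forall>i<n. P i n) \<and> P n n"
  unfolding less_Suc_eq by blast

text \<open>The corner is the innermost variable and the column comes next: these are the two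
  integrals that the Kac--Rice step transforms with everything else fixed.\<close>

lemma nn_LM_Suc:
  assumes f: "f \<in> borel_measurable (LM (Suc n))"
  shows "(\<integral>\<^sup>+M. f M \<partial>LM (Suc n)) =
    (\<integral>\<^sup>+D. \<integral>\<^sup>+w. \<integral>\<^sup>+c. \<integral>\<^sup>+a. f (blk n D w c a) \<partial>lborel \<partial>LB {..<n} \<partial>LB {..<n} \<partial>LM n)"
proof -
  let ?V = "LB {..<n} :: (nat \<Rightarrow> real) measure"
  let ?N1 = "?V \<Otimes>\<^sub>M lborel :: ((nat \<Rightarrow> real) \<times> real) measure"
  let ?N2 = "?V \<Otimes>\<^sub>M ?N1"
  let ?N3 = "LM n \<Otimes>\<^sub>M ?N2"
  let ?b = "\<lambda>(D, w, c, a). blk n D w c a"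
  have sV: "sigma_finite_measure ?V" by (rule sigma_finite_LB) simp
  have sL: "sigma_finite_measure (LM n)" by (rule sigma_finite_LB) simp
  have s1: "sigma_finite_measure ?N1" by (rule sigma_finite_pair_measure[OF sV lborel.sigma_finite_measure_axioms])
  have s2: "sigma_finite_measure ?N2" by (rule sigma_finite_pair_measure[OF sV s1])
  have b: "?b \<in> measurable ?N3 (LM (Suc n))"
    unfolding split_beta by (rule measurable_blk) measurable
  have "distr ?N3 (LM (Suc n)) ?b = LM (Suc n)"
  proof (rule leb.PiM_eqI)
    fix A :: "nat \<times> nat \<Rightarrow> real set" assume A: "\<And>i. i \<in> {..<Suc n} \<times> {..<Suc n} \<Longrightarrow> A i \<in> sets lborel"
    let ?A1 = "\<Pi>\<^sub>E i\<in>{..<n} \<times> {..<n}. A i"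
    let ?A2 = "\<Pi>\<^sub>E j\<in>{..<n}. A (n, j)"
    let ?A3 = "\<Pi>\<^sub>E i\<in>{..<n}. A (i, n)"
    have s: "?A1 \<in> sets (LM n)" "?A2 \<in> sets ?V" "?A3 \<in> sets ?V" "A (n, n) \<in> sets lborel"
      using A by (auto intro!: sets_PiM_I_finite)
    have "emeasure (distr ?N3 (LM (Suc n)) ?b) (Pi\<^sub>E ({..<Suc n} \<times> {..<Suc n}) A) =
      emeasure ?N3 (?b -` (Pi\<^sub>E ({..<Suc n} \<times> {..<Suc n}) A) \<inter> space ?N3)"
      by (rule emeasure_distr[OF b]) (use A in \<open>auto intro!: sets_PiM_I_finite\<close>)
    also have "?b -` (Pi\<^sub>E ({..<Suc n} \<times> {..<Suc n}) A) \<inter> space ?N3 = ?A1 \<times> ?A2 \<times> ?A3 \<times> A (n, n)"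
    proof -
      have "blk n D w c a \<in> Pi\<^sub>E ({..<Suc n} \<times> {..<Suc n}) A \<longleftrightarrow>
        (\<forall>i<n. \<forall>j<n. D (i, j) \<in> A (i, j)) \<and> (\<forall>j<n. w j \<in> A (n, j)) \<and> (\<forall>i<n. c i \<in> A (i, n)) \<and> a \<in> A (n, n)" for D w c a
      proof -
        have "blk n D w c a \<in> Pi\<^sub>E ({..<Suc n} \<times> {..<Suc n}) A \<longleftrightarrow> (\<forall>i<Suc n. \<forall>j<Suc n. blk n D w c a (i, j) \<in> A (i, j))"
        proof -
          have "blk n D w c a \<in> extensional ({..<Suc n} \<times> {..<Suc n})" by (simp add: blk_def)
          thus ?thesis unfolding PiE_iff split_paired_Ball_Sigma by (simp only: Ball_def lessThan_iff simp_thms)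
        qed
        also have "\<dots> \<longleftrightarrow> (\<forall>i<n. \<forall>j<n. blk n D w c a (i, j) \<in> A (i, j)) \<and> (\<forall>j<n. blk n D w c a (n, j) \<in> A (n, j)) \<and>
            (\<forall>i<n. blk n D w c a (i, n) \<in> A (i, n)) \<and> blk n D w c a (n, n) \<in> A (n, n)"
          by (rule all_less_Suc_square)
        also have "\<dots> \<longleftrightarrow> (\<forall>i<n. \<forall>j<n. D (i, j) \<in> A (i, j)) \<and> (\<forall>j<n. w j \<in> A (n, j)) \<and> (\<forall>i<n. c i \<in> A (i, n)) \<and> a \<in> A (n, n)"
          by (simp del: All_less_Suc)
        finally show ?thesis .
      qed
      note 1 = this
      have A1: "D \<in> ?A1 \<longleftrightarrow> D \<in> space (LM n) \<and> (\<forall>i<n. \<forall>j<n. D (i, j) \<in> A (i, j))" for D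
        unfolding space_PiM PiE_iff split_paired_Ball_Sigma by (simp only: space_lborel space_borel UNIV_I Ball_def lessThan_iff simp_thms conj_commute)
      have A2: "w \<in> ?A2 \<longleftrightarrow> w \<in> space ?V \<and> (\<forall>j<n. w j \<in> A (n, j))" for w
        unfolding space_PiM PiE_iff by (simp only: space_lborel space_borel UNIV_I Ball_def lessThan_iff simp_thms conj_commute)
      have A3: "c \<in> ?A3 \<longleftrightarrow> c \<in> space ?V \<and> (\<forall>i<n. c i \<in> A (i, n))" for c
        unfolding space_PiM PiE_iff by (simp only: space_lborel space_borel UNIV_I Ball_def lessThan_iff simp_thms conj_commute)
      show ?thesis
      proof (rule Set.set_eqI)
        fix z :: "(nat \<times> nat \<Rightarrow> real) \<times> (nat \<Rightarrow> real) \<times> (nat \<Rightarrow> real) \<times> real"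
        obtain D w c a where z: "z = (D, w, c, a)" by (metis prod.exhaust)
        show "z \<in> ?b -` (Pi\<^sub>E ({..<Suc n} \<times> {..<Suc n}) A) \<inter> space ?N3 \<longleftrightarrow> z \<in> ?A1 \<times> ?A2 \<times> ?A3 \<times> A (n, n)"
          unfolding z space_pair_measure vimage_def mem_Times_iff Int_iff mem_Collect_eq prod.case 1 A1 A2 A3 fst_conv snd_conv space_lborel space_borel using UNIV_I[of a] by blast
      qed
    qed
    also have "emeasure ?N3 (?A1 \<times> ?A2 \<times> ?A3 \<times> A (n, n)) = emeasure (LM n) ?A1 * (emeasure ?V ?A2 * (emeasure ?V ?A3 * emeasure lborel (A (n, n))))"
      using s by (simp add: sigma_finite_measure.emeasure_pair_measure_Times[OF s2] sigma_finite_measure.emeasure_pair_measure_Times[OF s1] lborel.emeasure_pair_measure_Times)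
    also have "\<dots> = (\<Prod>i\<in>{..<n} \<times> {..<n}. emeasure lborel (A i)) * ((\<Prod>j<n. emeasure lborel (A (n, j))) * ((\<Prod>i<n. emeasure lborel (A (i, n))) * emeasure lborel (A (n, n))))"
      using A by (subst (1 2 3) leb.emeasure_PiM) auto
    also have "\<dots> = (\<Prod>i\<in>{..<Suc n} \<times> {..<Suc n}. emeasure lborel (A i))"
    proof -
      have "(\<Prod>i\<in>{..<k} \<times> {..<k}. emeasure lborel (A i)) = (\<Prod>i<k. \<Prod>j<k. emeasure lborel (A (i, j)))" for k
        by (simp add: prod.cartesian_product)
      thus ?thesis by (simp add: prod.distrib ac_simps)
    qed
    finally show "emeasure (distr ?N3 (LM (Suc n)) ?b) (Pi\<^sub>E ({..<Suc n} \<times> {..<Suc n}) A) = (\<Prod>i\<in>{..<Suc n} \<times> {..<Suc n}. emeasure lborel (A i))" .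
  qed auto
  hence "(\<integral>\<^sup>+M. f M \<partial>LM (Suc n)) = (\<integral>\<^sup>+M. f M \<partial>distr ?N3 (LM (Suc n)) ?b)" by simp
  also have "\<dots> = (\<integral>\<^sup>+z. f (?b z) \<partial>?N3)" by (rule nn_integral_distr[OF b]) (use f in simp)
  also have "\<dots> = (\<integral>\<^sup>+D. \<integral>\<^sup>+z. f (?b (D, z)) \<partial>?N2 \<partial>LM n)"
    using measurable_compose[OF b f] by (intro sigma_finite_measure.nn_integral_fst[OF s2, symmetric])
  also have "\<dots> = (\<integral>\<^sup>+D. \<integral>\<^sup>+w. \<integral>\<^sup>+z. f (?b (D, w, z)) \<partial>?N1 \<partial>?V \<partial>LM n)"
  proof (rule nn_integral_cong)
    fix D assume "D \<in> space (LM n)"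
    hence [measurable]: "(\<lambda>z. (D, z)) \<in> measurable ?N2 ?N3" by measurable
    have "(\<lambda>z. f (?b (D, z))) \<in> borel_measurable ?N2"
      using measurable_compose[OF _ measurable_compose[OF b f], of "\<lambda>z. (D, z)" ?N2] by simp
    thus "(\<integral>\<^sup>+z. f (?b (D, z)) \<partial>?N2) = (\<integral>\<^sup>+w. \<integral>\<^sup>+z. f (?b (D, w, z)) \<partial>?N1 \<partial>?V)"
      by (intro sigma_finite_measure.nn_integral_fst[OF s1, symmetric])
  qed
  also have "\<dots> = (\<integral>\<^sup>+D. \<integral>\<^sup>+w. \<integral>\<^sup>+c. \<integral>\<^sup>+a. f (?b (D, w, c, a)) \<partial>lborel \<partial>?V \<partial>?V \<partial>LM n)"
  proof (intro nn_integral_cong)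
    fix D w assume "D \<in> space (LM n)" "w \<in> space ?V"
    hence m: "(\<lambda>z. (D, w, z)) \<in> measurable ?N1 ?N3" by measurable
    have "(\<lambda>z. f (?b (D, w, z))) \<in> borel_measurable ?N1"
      using measurable_compose[OF m measurable_compose[OF b f]] by simp
    thus "(\<integral>\<^sup>+z. f (?b (D, w, z)) \<partial>?N1) = (\<integral>\<^sup>+c. \<integral>\<^sup>+a. f (?b (D, w, c, a)) \<partial>lborel \<partial>?V)"
      by (intro lborel.nn_integral_fst[symmetric])
  qed
  finally show ?thesis by simp
qed

section \<open>Characteristic polynomials of bordered matrices\<close>

definition adjp :: "nat \<Rightarrow> (nat \<times> nat \<Rightarrow> real) \<Rightarrow> nat \<Rightarrow> nat \<Rightarrow> real poly" where
  "adjp n D i j = adj_mat (char_poly_matrix (mat n n D)) $$ (i, j)"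

text \<open>The last column of \<open>P\<close> contains the adjugate applied to the border, so that
  the characteristic matrix times \<open>P\<close> is lower triangular by blocks. Both ways of
  taking the determinant contain the factor \<open>det A\<close>, which is cancelled.\<close>

lemma cp_blk_border:
  "cp (Suc n) (blk n D w c a) = [:- a, 1:] * cp n D - (\<Sum>i<n. \<Sum>j<n. [:w i * c j:] * adjp n D i j)"
proof -
  define A where "A = char_poly_matrix (mat n n D)"
  define J where "J = adj_mat A"
  have A: "A \<in> carrier_mat n n" by (simp add: A_def)
  note J = adj_mat[OF A, folded J_def]
  define cc where "cc = mat n 1 (\<lambda>(i, j). [:c i:])"
  define ww where "ww = mat 1 n (\<lambda>(i, j). [:w j:])"
  let ?cm = "char_poly_matrix (mat (Suc n) (Suc n) (blk n D w c a))"
  have cm: "?cm = four_block_mat A (- cc) (- ww) (mat 1 1 (\<lambda>_. [:- a, 1:]))"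
    by (intro eq_matI) (auto simp: char_poly_matrix_def A_def cc_def ww_def less_Suc_eq)
  define P where "P = four_block_mat (1\<^sub>m n) (J * cc) (0\<^sub>m 1 n) (det A \<cdot>\<^sub>m 1\<^sub>m 1)"
  have cc: "cc \<in> carrier_mat n 1" and ww: "ww \<in> carrier_mat 1 n" by (auto simp: cc_def ww_def)
  have AJ: "A * (J * cc) = det A \<cdot>\<^sub>m cc"
    using J A cc by (simp add: assoc_mult_mat[symmetric, of A n n J n cc 1] mult_smult_assoc_mat[of _ n n _ 1])
  define s where "s = (\<Sum>i<n. \<Sum>j<n. [:w i * c j:] * adjp n D i j)"
  have WJ: "ww * (J * cc) = mat 1 1 (\<lambda>_. s)"
  proof (rule eq_matI)
    fix i j :: nat assume "i < dim_row (mat 1 1 (\<lambda>_. s))" "j < dim_col (mat 1 1 (\<lambda>_. s))"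
    hence [simp]: "i = 0" "j = 0" by auto
    have "(ww * (J * cc)) $$ (0, 0) = (\<Sum>i<n. [:w i:] * (\<Sum>j<n. J $$ (i, j) * [:c j:]))"
      using J(1) by (simp add: scalar_prod_def ww_def cc_def lessThan_atLeast0)
    also have "\<dots> = s" unfolding s_def adjp_def J_def A_def sum_distrib_left
      by (intro sum.cong refl) (simp add: mult_ac)
    finally show "(ww * (J * cc)) $$ (i, j) = mat 1 1 (\<lambda>_. s) $$ (i, j)" by simp
  qed (use ww cc J in auto)
  have "?cm * P = four_block_mat A (0\<^sub>m n 1) (- ww) (mat 1 1 (\<lambda>_. [:- a, 1:] * det A - s))"
  proof -
    have "?cm * P = four_block_mat (A * 1\<^sub>m n + (- cc) * 0\<^sub>m 1 n) (A * (J * cc) + (- cc) * (det A \<cdot>\<^sub>m 1\<^sub>m 1))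
      ((- ww) * 1\<^sub>m n + mat 1 1 (\<lambda>_. [:- a, 1:]) * 0\<^sub>m 1 n) ((- ww) * (J * cc) + mat 1 1 (\<lambda>_. [:- a, 1:]) * (det A \<cdot>\<^sub>m 1\<^sub>m 1))"
      unfolding cm P_def by (rule mult_four_block_mat) (use A J cc ww in auto)
    also have "A * (J * cc) + (- cc) * (det A \<cdot>\<^sub>m 1\<^sub>m 1) = 0\<^sub>m n 1"
      unfolding AJ by (rule eq_matI) (use cc in auto)
    also have "(- ww) * (J * cc) + mat 1 1 (\<lambda>_. [:- a, 1:]) * (det A \<cdot>\<^sub>m 1\<^sub>m 1) = mat 1 1 (\<lambda>_. [:- a, 1:] * det A - s)"
    proof -
      have "(- ww) * (J * cc) = - (ww * (J * cc))" using ww J cc by (intro uminus_mult_left_mat) auto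
      thus ?thesis unfolding WJ by (intro eq_matI) (auto simp: scalar_prod_def)
    qed
    finally show ?thesis using A cc ww by simp
  qed
  moreover have "det (?cm * P) = det ?cm * det P"
    by (rule det_mult[of _ "Suc n"]) (auto simp: P_def J cc)
  moreover have "det P = det A"
    unfolding P_def by (subst det_four_block_mat_lower_left_zero[of _ n _ 1]) (use J cc in \<open>auto simp: det_smult\<close>)
  moreover have "det (four_block_mat A (0\<^sub>m n 1) (- ww) (mat 1 1 (\<lambda>_. [:- a, 1:] * det A - s))) = det A * ([:- a, 1:] * det A - s)"
    by (subst det_four_block_mat_upper_right_zero[of _ n _ 1]) (use A ww in \<open>auto simp: det_single\<close>)
  ultimately have "det ?cm * det A = ([:- a, 1:] * det A - s) * det A" by (simp add: mult.commute)
  \<comment> \<open>\<open>det A\<close> is the monic characteristic polynomial of \<open>D\<close>,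
    hence a nonzero element of an integral domain, although it vanishes at the eigenvalues.\<close>
  moreover have "det A \<noteq> 0" using cp_monic(3)[of n D] by (simp add: A_def cp_def char_poly_def)
  ultimately have "det ?cm = [:- a, 1:] * det A - s" by (metis mult_right_cancel)
  thus ?thesis by (simp add: cp_def char_poly_def A_def s_def)
qed

text \<open>This affine dependence is what allows the eigenvalue equation to be solved for the
  corner entry.\<close>

lemma cp_blk_shift_corner: "cp (Suc n) (blk n D w c a) = cp (Suc n) (blk n D w c 0) - [:a:] * cp n D"
proof -
  have "[:- a, 1:] * cp n D = [:- 0, 1:] * cp n D - [:a:] * cp n D"
    by (simp only: left_diff_distrib[symmetric]) simp
  thus ?thesis unfolding cp_blk_border by simp
qed

text \<open>The derivative of the characteristic polynomial is the sum of the principal minors, that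
  is, the trace of the adjugate; where it is nonzero, some diagonal entry is nonzero.\<close>

lemma adjp_nonzero:
  assumes "poly (pderiv (cp n D)) x \<noteq> 0"
  shows "\<exists>i<n. poly (adjp n D i i) x \<noteq> 0"
proof (rule ccontr)
  assume "\<not> ?thesis"
  hence z: "poly (adjp n D i i) x = 0" if "i < n" for i using that by auto
  have "pderiv (cp n D) = (\<Sum>i<n. adjp n D i i)"
    unfolding cp_def pderiv_char_poly[OF mat_carrier[of n n D]]
  proof (intro sum.cong refl)
    fix i assume "i \<in> {..<n}"
    hence i: "i < n" by simp
    have "mat_delete (char_poly_matrix (mat n n D)) i i = char_poly_matrix (mat_delete (mat n n D) i i)"
      using i by (intro eq_matI) (auto simp: mat_delete_def char_poly_matrix_def)
    thus "char_poly (mat_delete (mat n n D) i i) = adjp n D i i"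
      using i carrier_matD[OF char_poly_matrix_closed[OF mat_carrier[of n n D]]]
      by (simp add: adjp_def adj_mat_def cofactor_def char_poly_def)
  qed
  thus False using assms z by (simp add: poly_sum)
qed

text \<open>The bordered matrix is \<open>L * N * Q\<close>, where \<open>L\<close> and
  \<open>Q\<close> are mutually inverse shears by \<open>u\<close> and \<open>N\<close> consists of
  the blocks \<open>B\<close>, 0, \<open>w\<close>, \<open>x\<close>. In other words, the last
  column is chosen such that \<open>(u, 1)\<close> is an eigenvector for \<open>x\<close>, and
  \<open>B\<close> is the matrix induced on the quotient by it.\<close>

lemma cp_blk_conj:
  fixes B :: "nat \<times> nat \<Rightarrow> real" and u w :: "nat \<Rightarrow> real" and x :: real
  defines "D \<equiv> (\<lambda>(i, j). B (i, j) + u i * w j)"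
  shows "cp (Suc n) (blk n D w (\<lambda>i. x * u i - (\<Sum>j<n. D (i, j) * u j)) (x - (\<Sum>j<n. w j * u j))) = [:- x, 1:] * cp n B"
proof -
  let ?M = "mat (Suc n) (Suc n) (blk n D w (\<lambda>i. x * u i - (\<Sum>j<n. D (i, j) * u j)) (x - (\<Sum>j<n. w j * u j)))"
  define W where "W = mat 1 n (\<lambda>(i, j). w j)"
  define U where "U = mat n 1 (\<lambda>(i, j). u i)"
  define L where "L = four_block_mat (1\<^sub>m n) U (0\<^sub>m 1 n) (1\<^sub>m 1)"
  define Q where "Q = four_block_mat (1\<^sub>m n) (- U) (0\<^sub>m 1 n) (1\<^sub>m 1)"
  define N where "N = four_block_mat (mat n n B) (0\<^sub>m n 1) W (mat 1 1 (\<lambda>_. x))"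
  have W: "W \<in> carrier_mat 1 n" and U: "U \<in> carrier_mat n 1" by (auto simp: W_def U_def)
  have LQ: "L * Q = 1\<^sub>m (Suc n)" unfolding L_def Q_def
    by (subst mult_four_block_mat[where ?nr1.0 = n and ?n1.0 = n and ?n2.0=1 and ?nr2.0=1 and ?nc1.0=n and ?nc2.0=1])
       (use U in \<open>auto intro!: eq_matI\<close>)
  have QL: "Q * L = 1\<^sub>m (Suc n)" unfolding L_def Q_def
    by (subst mult_four_block_mat[where ?nr1.0 = n and ?n1.0 = n and ?n2.0=1 and ?nr2.0=1 and ?nc1.0=n and ?nc2.0=1])
       (use U in \<open>auto intro!: eq_matI\<close>)
  have NQ: "N * Q = four_block_mat (mat n n B) (mat n 1 (\<lambda>(i, _). - (\<Sum>j<n. B (i, j) * u j))) W (mat 1 1 (\<lambda>_. x - (\<Sum>j<n. w j * u j)))"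
    unfolding N_def Q_def
    by (subst mult_four_block_mat[where ?nr1.0 = n and ?n1.0 = n and ?n2.0=1 and ?nr2.0=1 and ?nc1.0=n and ?nc2.0=1])
       (use U W in \<open>auto intro!: eq_matI simp: scalar_prod_def U_def W_def lessThan_atLeast0 sum_negf\<close>)
  have "L * (N * Q) = ?M"
    unfolding NQ unfolding L_def
    by (subst mult_four_block_mat[where ?nr1.0 = n and ?n1.0 = n and ?n2.0=1 and ?nr2.0=1 and ?nc1.0=n and ?nc2.0=1])
       (use U W in \<open>auto intro!: eq_matI simp: scalar_prod_def U_def W_def D_def less_Suc_eq algebra_simps sum.distrib sum_distrib_left\<close>)
  moreover have carr: "L \<in> carrier_mat (Suc n) (Suc n)" "N \<in> carrier_mat (Suc n) (Suc n)" "Q \<in> carrier_mat (Suc n) (Suc n)"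
    using W U by (auto simp: L_def N_def Q_def)
  ultimately have "?M = L * N * Q" by (simp add: assoc_mult_mat[OF carr])
  hence "similar_mat ?M N" using carr LQ QL by (intro similar_matI[of _ _ L Q "Suc n"]) auto
  hence "char_poly ?M = char_poly N" by (rule char_poly_similar)
  also have "char_poly N = [:- x, 1:] * cp n B"
  proof -
    have "char_poly_matrix N = four_block_mat (char_poly_matrix (mat n n B)) (0\<^sub>m n 1) (map_mat (\<lambda>a. [:- a:]) W) (mat 1 1 (\<lambda>_. [:- x, 1:]))"
      using W by (intro eq_matI) (auto simp: N_def char_poly_matrix_def W_def less_Suc_eq)
    thus ?thesis unfolding char_poly_def cp_def
      by (simp, subst det_four_block_mat_upper_right_zero[of _ n _ 1]) (use W in \<open>auto simp: det_single\<close>)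
  qed
  finally show ?thesis by (simp add: cp_def)
qed

lemma nr_linear_mult:
  assumes "p \<noteq> 0"
  shows "nr ([:- x, 1:] * p) = Suc (nr p)"
proof -
  let ?q = "[:- x, 1:] * p"
  have q: "?q \<noteq> 0" using assms by (simp del: mult_pCons_left)
  define S where "S = insert x {y. poly p y = 0}"
  have S: "finite S" using assms by (simp add: S_def poly_roots_finite)
  have "nr ?q = (\<Sum>y\<in>S. order y ?q)"
    unfolding nr_def using q S by (intro sum.mono_neutral_left) (auto simp: S_def order_root)
  also have "\<dots> = (\<Sum>y\<in>S. order y [:- x, 1:] + order y p)"
    using q by (intro sum.cong refl order_mult)
  also have "\<dots> = (\<Sum>y\<in>S. if y = x then 1 else 0) + (\<Sum>y\<in>S. order y p)"
  proof -
    have "order y [:- x, 1:] = (if y = x then 1 else 0)" for y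
      using order_power_n_n[of x 1] by (auto simp: order_0I)
    thus ?thesis by (simp add: sum.distrib)
  qed
  also have "(\<Sum>y\<in>S. order y p) = nr p"
    unfolding nr_def using S assms by (intro sum.mono_neutral_right) (auto simp: S_def order_root)
  finally show ?thesis using S by (simp add: S_def)
qed

lemma num_real_eigenvalues_nr:
  assumes "A \<in> carrier_mat n n"
  shows "num_real_eigenvalues A = nr (char_poly A)"
  unfolding num_real_eigenvalues_def nr_def using eigenvalue_root_char_poly[OF assms] by (intro sum.cong) auto

section \<open>Linear substitutions on spaces of matrices\<close>

lemma nn_LB_reindex:
  assumes h: "bij_betw h I K" and I: "finite I" and f: "f \<in> borel_measurable (LB I)"
  shows "(\<integral>\<^sup>+x. f (\<lambda>i\<in>I. x (h i)) \<partial>LB K) = (\<integral>\<^sup>+x. f x \<partial>LB I)"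
proof -
  have K: "finite K" "K = h ` I" and inj: "inj_on h I" using h I by (auto simp: bij_betw_def)
  let ?t = "\<lambda>x. \<lambda>i\<in>I. x (h i)"
  have hK: "h i \<in> K" if "i \<in> I" for i using K that by auto
  have m: "?t \<in> measurable (LB K) (LB I)"
    by (rule restrict_measurable_LB) (use hK in measurable)
  have "distr (LB K) (LB I) ?t = LB I"
  proof (rule leb.PiM_eqI[OF I])
    fix A :: "'a \<Rightarrow> real set" assume A: "\<And>i. i \<in> I \<Longrightarrow> A i \<in> sets lborel"
    define g where "g = the_inv_into I h"
    have g: "g (h i) = i" if "i \<in> I" for i unfolding g_def by (rule the_inv_into_f_f[OF inj that])
    have gK: "g k \<in> I" if "k \<in> K" for k using that K g by auto
    have "emeasure (distr (LB K) (LB I) ?t) (Pi\<^sub>E I A) = emeasure (LB K) (?t -` (Pi\<^sub>E I A) \<inter> space (LB K))"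
      by (rule emeasure_distr[OF m]) (use I A in \<open>auto intro!: sets_PiM_I_finite\<close>)
    also have "?t -` (Pi\<^sub>E I A) \<inter> space (LB K) = (\<Pi>\<^sub>E k\<in>K. A (g k))"
      using K g by (auto simp: space_PiM PiE_iff)
    also have "emeasure (LB K) \<dots> = (\<Prod>k\<in>K. emeasure lborel (A (g k)))"
      using A gK by (intro leb.emeasure_PiM K) auto
    also have "\<dots> = (\<Prod>i\<in>I. emeasure lborel (A i))"
      using inj g unfolding K(2) by (subst prod.reindex) auto
    finally show "emeasure (distr (LB K) (LB I) ?t) (Pi\<^sub>E I A) = (\<Prod>i\<in>I. emeasure lborel (A i))" .
  qed simp
  then have "(\<integral>\<^sup>+x. f x \<partial>LB I) = (\<integral>\<^sup>+x. f x \<partial>distr (LB K) (LB I) ?t)" by simp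
  also have "\<dots> = (\<integral>\<^sup>+x. f (?t x) \<partial>LB K)"
    by (rule nn_integral_distr[OF m]) (use f in simp)
  finally show ?thesis by simp
qed

definition mulL :: "nat \<Rightarrow> nat set \<Rightarrow> real mat \<Rightarrow> (nat \<times> nat \<Rightarrow> real) \<Rightarrow> nat \<times> nat \<Rightarrow> real" where
  "mulL n J X B = restrict (\<lambda>(i, j). \<Sum>k<n. X $$ (i, k) * B (k, j)) ({..<n} \<times> J)"

lemma measurable_mulL [measurable]: "mulL n J X \<in> measurable (LB ({..<n} \<times> J)) (LB ({..<n} \<times> J))"
  unfolding mulL_def by (rule restrict_measurable_LB) (auto simp: split_beta intro!: borel_measurable_sum borel_measurable_times)

text \<open>Left multiplication acts on each column separately, so every column contributes one
  factor \<open>\<bar>det X\<bar>\<close>; the induction adds one column at a time.\<close>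

lemma nn_LB_mulL:
  fixes X :: "real mat"
  assumes X: "X \<in> carrier_mat n n" "det X \<noteq> 0" and J: "finite J"
    and f: "f \<in> borel_measurable (LB ({..<n} \<times> J))"
  shows "(\<integral>\<^sup>+B. f B \<partial>LB ({..<n} \<times> J)) = ennreal (\<bar>det X\<bar> ^ card J) * (\<integral>\<^sup>+B. f (mulL n J X B) \<partial>LB ({..<n} \<times> J))"
  using J f
proof (induction J arbitrary: f)
  case empty
  have "mulL n {} X x = x" if "x \<in> space (LB ({..<n} \<times> {} :: (nat \<times> nat) set))" for x
    using that by (auto simp: mulL_def space_PiM)
  hence "(\<integral>\<^sup>+x. f (mulL n {} X x) \<partial>LB ({..<n} \<times> {})) = (\<integral>\<^sup>+x. f x \<partial>LB ({..<n} \<times> {}))"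
    by (intro nn_integral_cong) simp
  thus ?case by simp
next
  case (insert j J)
  let ?I = "{..<n} \<times> J" and ?K = "{..<n} \<times> {j}"
  have un: "{..<n} \<times> insert j J = ?I \<union> ?K" by auto
  have disj: "?I \<inter> ?K = {}" using insert by auto
  define lift where "lift v = (\<lambda>p\<in>?K. v (fst p))" for v :: "nat \<Rightarrow> real"
  define g where "g x v = f (merge ?I ?K (x, lift v))" for x v
  have sI: "sigma_finite_measure (LB ?I)" and sV: "sigma_finite_measure (LB {..<n})"
    using insert by (auto intro: sigma_finite_LB)
  have lift[measurable]: "lift \<in> measurable (LB {..<n}) (LB ?K)"
    unfolding lift_def by (rule restrict_measurable_LB) auto
  have mg: "(\<lambda>(x, v). g x v) \<in> borel_measurable (LB ?I \<Otimes>\<^sub>M LB {..<n})"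
  proof -
    have f': "f \<in> borel_measurable (LB (?I \<union> ?K))" using insert.prems unfolding un .
    have "(\<lambda>p. merge ?I ?K (fst p, lift (snd p))) \<in> measurable (LB ?I \<Otimes>\<^sub>M LB {..<n}) (LB (?I \<union> ?K))"
      by (rule measurable_compose[OF _ measurable_merge]) measurable
    from measurable_compose[OF this f'] show ?thesis by (simp add: g_def split_beta')
  qed
  have fold: "(\<integral>\<^sup>+B. F B \<partial>LB ({..<n} \<times> insert j J)) = (\<integral>\<^sup>+x. \<integral>\<^sup>+v. F (merge ?I ?K (x, lift v)) \<partial>LB {..<n} \<partial>LB ?I)"
    if F: "F \<in> borel_measurable (LB ({..<n} \<times> insert j J))" for F
  proof -
    have F': "F \<in> borel_measurable (LB (?I \<union> ?K))" using F unfolding un .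
    have "(\<integral>\<^sup>+B. F B \<partial>LB (?I \<union> ?K)) = (\<integral>\<^sup>+x. \<integral>\<^sup>+y. F (merge ?I ?K (x, y)) \<partial>LB ?K \<partial>LB ?I)"
      using leb.product_nn_integral_fold[OF disj _ _ F'] insert by auto
    also have "\<dots> = (\<integral>\<^sup>+x. \<integral>\<^sup>+v. F (merge ?I ?K (x, lift v)) \<partial>LB {..<n} \<partial>LB ?I)"
    proof (rule nn_integral_cong)
      fix x assume x: "x \<in> space (LB ?I)"
      have "(\<lambda>y. merge ?I ?K (x, y)) \<in> measurable (LB ?K) (LB (?I \<union> ?K))"
        by (rule measurable_compose[OF _ measurable_merge]) (use x in measurable)
      from measurable_compose[OF this F']
      have m: "(\<lambda>y. F (merge ?I ?K (x, y))) \<in> borel_measurable (LB ?K)" .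
      have "bij_betw fst ?K {..<n}" by (auto simp: bij_betw_def inj_on_def)
      from nn_LB_reindex[OF this _ m]
      show "(\<integral>\<^sup>+y. F (merge ?I ?K (x, y)) \<partial>LB ?K) = (\<integral>\<^sup>+v. F (merge ?I ?K (x, lift v)) \<partial>LB {..<n})"
        by (simp add: lift_def)
    qed
    finally show ?thesis unfolding un .
  qed
  have key: "mulL n (insert j J) X (merge ?I ?K (x, lift v)) = merge ?I ?K (mulL n J X x, lift (mv n X v))" for x v
  proof (rule ext)
    fix p :: "nat \<times> nat"
    obtain i l where p: "p = (i, l)" by fastforce
    consider "i < n" "l \<in> J" | "i < n" "l = j" | "\<not> (i < n \<and> l \<in> insert j J)" by auto
    thus "mulL n (insert j J) X (merge ?I ?K (x, lift v)) p = merge ?I ?K (mulL n J X x, lift (mv n X v)) p"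
    proof cases
      case 1
      thus ?thesis using insert(2) by (auto simp: p mulL_def merge_def)
    next
      case 2
      thus ?thesis using insert(2) by (auto simp: p mulL_def merge_def lift_def mv_def)
    next
      case 3
      thus ?thesis by (auto simp: p mulL_def merge_def)
    qed
  qed
  have g1: "g x \<in> borel_measurable (LB {..<n})" if "x \<in> space (LB ?I)" for x
    using measurable_compose[OF measurable_Pair1'[OF that] mg] by simp
  have g2: "(\<lambda>x. g x v) \<in> borel_measurable (LB ?I)" if "v \<in> space (LB {..<n})" for v
    using measurable_compose[OF measurable_Pair2'[OF that] mg] by simp
  have mg1: "(\<lambda>(x, v). g x (mv n X v)) \<in> borel_measurable (LB ?I \<Otimes>\<^sub>M LB {..<n})"
  proof -
    have "(\<lambda>p. (fst p, mv n X (snd p))) \<in> measurable (LB ?I \<Otimes>\<^sub>M LB {..<n}) (LB ?I \<Otimes>\<^sub>M LB {..<n})" by measurable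
    from measurable_compose[OF this mg] show ?thesis by (simp add: split_beta')
  qed
  have mg2: "(\<lambda>(x, v). g (mulL n J X x) (mv n X v)) \<in> borel_measurable (LB ?I \<Otimes>\<^sub>M LB {..<n})"
  proof -
    have "(\<lambda>p. (mulL n J X (fst p), mv n X (snd p))) \<in> measurable (LB ?I \<Otimes>\<^sub>M LB {..<n}) (LB ?I \<Otimes>\<^sub>M LB {..<n})" by measurable
    from measurable_compose[OF this mg] show ?thesis by (simp add: split_beta')
  qed
  have mvs: "mv n X v \<in> space (LB {..<n})" for v by (auto simp: mv_def space_PiM)
  have "(\<integral>\<^sup>+B. f B \<partial>LB ({..<n} \<times> insert j J)) = (\<integral>\<^sup>+x. \<integral>\<^sup>+v. g x v \<partial>LB {..<n} \<partial>LB ?I)"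
    using fold[OF insert.prems] by (simp add: g_def)
  also have "\<dots> = (\<integral>\<^sup>+x. ennreal \<bar>det X\<bar> * (\<integral>\<^sup>+v. g x (mv n X v) \<partial>LB {..<n}) \<partial>LB ?I)"
    by (intro nn_integral_cong nn_LB_linear X g1)
  also have "\<dots> = ennreal \<bar>det X\<bar> * (\<integral>\<^sup>+x. \<integral>\<^sup>+v. g x (mv n X v) \<partial>LB {..<n} \<partial>LB ?I)"
    by (rule nn_integral_cmult) (use sigma_finite_measure.borel_measurable_nn_integral[OF sV mg1] in simp)
  also have "(\<integral>\<^sup>+x. \<integral>\<^sup>+v. g x (mv n X v) \<partial>LB {..<n} \<partial>LB ?I) = (\<integral>\<^sup>+v. \<integral>\<^sup>+x. g x (mv n X v) \<partial>LB ?I \<partial>LB {..<n})"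
    by (rule nn_swap[OF sI sV mg1])
  also have "\<dots> = (\<integral>\<^sup>+v. ennreal (\<bar>det X\<bar> ^ card J) * (\<integral>\<^sup>+x. g (mulL n J X x) (mv n X v) \<partial>LB ?I) \<partial>LB {..<n})"
    by (intro nn_integral_cong insert.IH g2 mvs)
  also have "\<dots> = ennreal (\<bar>det X\<bar> ^ card J) * (\<integral>\<^sup>+v. \<integral>\<^sup>+x. g (mulL n J X x) (mv n X v) \<partial>LB ?I \<partial>LB {..<n})"
  proof (rule nn_integral_cmult)
    from measurable_pair_swap[OF mg2]
    have "(\<lambda>(v, x). g (mulL n J X x) (mv n X v)) \<in> borel_measurable (LB {..<n} \<Otimes>\<^sub>M LB ?I)" by (simp add: split_beta')
    from sigma_finite_measure.borel_measurable_nn_integral[OF sI this]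
    show "(\<lambda>v. \<integral>\<^sup>+x. g (mulL n J X x) (mv n X v) \<partial>LB ?I) \<in> borel_measurable (LB {..<n})" by simp
  qed
  also have "(\<integral>\<^sup>+v. \<integral>\<^sup>+x. g (mulL n J X x) (mv n X v) \<partial>LB ?I \<partial>LB {..<n}) = (\<integral>\<^sup>+x. \<integral>\<^sup>+v. g (mulL n J X x) (mv n X v) \<partial>LB {..<n} \<partial>LB ?I)"
    by (rule nn_swap[OF sI sV mg2, symmetric])
  also have "\<dots> = (\<integral>\<^sup>+B. f (mulL n (insert j J) X B) \<partial>LB ({..<n} \<times> insert j J))"
    by (subst fold) (use insert.prems measurable_compose[OF measurable_mulL insert.prems] in \<open>auto simp: key g_def\<close>)
  finally show ?case using insert by (simp add: ennreal_mult mult.assoc)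
qed

definition conjm :: "nat \<Rightarrow> real mat \<Rightarrow> real mat \<Rightarrow> (nat \<times> nat \<Rightarrow> real) \<Rightarrow> nat \<times> nat \<Rightarrow> real" where
  "conjm n S R B = restrict (\<lambda>(i, j). \<Sum>k<n. S $$ (i, k) * (\<Sum>l<n. B (k, l) * R $$ (l, j))) ({..<n} \<times> {..<n})"

text \<open>Right multiplication is left multiplication between two transpositions. The Jacobian is
  therefore \<open>\<bar>det S\<bar> ^ n * \<bar>det R\<bar> ^ n\<close>, which is 1 for inverse
  matrices.\<close>

lemma nn_LM_conj:
  fixes S R :: "real mat"
  assumes S: "S \<in> carrier_mat n n" and R: "R \<in> carrier_mat n n" and RS: "R * S = 1\<^sub>m n"
    and f: "f \<in> borel_measurable (LM n)"
  shows "(\<integral>\<^sup>+B. f (conjm n S R B) \<partial>LM n) = (\<integral>\<^sup>+B. f B \<partial>LM n)"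
proof -
  have d: "det R * det S = 1" using det_mult[OF R S] RS by simp
  have dS: "det S \<noteq> 0" and dR: "det R \<noteq> 0" using d by auto
  let ?I = "{..<n} \<times> {..<n}"
  define tr where "tr B = (\<lambda>p\<in>?I. B (prod.swap p))" for B :: "nat \<times> nat \<Rightarrow> real"
  have bij: "bij_betw prod.swap ?I ?I" by (auto simp: bij_betw_def inj_on_def)
  have tr: "(\<integral>\<^sup>+B. F (tr B) \<partial>LM n) = (\<integral>\<^sup>+B. F B \<partial>LM n)" if "F \<in> borel_measurable (LM n)" for F
    using nn_LB_reindex[OF bij _ that] by (simp add: tr_def)
  have trm: "tr \<in> measurable (LM n) (LM n)" unfolding tr_def by (rule restrict_measurable_LB) auto
  let ?L = "mulL n {..<n}"
  have c: "conjm n S R B = ?L S (tr (?L (transpose_mat R) (tr B)))" for B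
  proof (rule ext)
    fix p :: "nat \<times> nat" obtain i j where p: "p = (i, j)" by fastforce
    show "conjm n S R B p = ?L S (tr (?L (transpose_mat R) (tr B))) p"
      using R by (auto simp: p conjm_def mulL_def tr_def mult.commute intro!: sum.cong arg_cong2[of _ _ _ _ "(*)"])
  qed
  have m1: "(\<lambda>B. f (?L S B)) \<in> borel_measurable (LM n)" by (rule measurable_compose[OF measurable_mulL f])
  have m2: "(\<lambda>B. f (?L S (tr B))) \<in> borel_measurable (LM n)" by (rule measurable_compose[OF trm m1])
  have m3: "(\<lambda>B. f (?L S (tr (?L (transpose_mat R) B)))) \<in> borel_measurable (LM n)" by (rule measurable_compose[OF measurable_mulL m2])
  have "(\<integral>\<^sup>+B. f B \<partial>LM n) = ennreal (\<bar>det S\<bar> ^ n) * (\<integral>\<^sup>+B. f (?L S B) \<partial>LM n)"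
    using nn_LB_mulL[OF S dS _ f] by simp
  also have "(\<integral>\<^sup>+B. f (?L S B) \<partial>LM n) = (\<integral>\<^sup>+B. f (?L S (tr B)) \<partial>LM n)" using tr[OF m1] by simp
  also have "\<dots> = ennreal (\<bar>det R\<bar> ^ n) * (\<integral>\<^sup>+B. f (?L S (tr (?L (transpose_mat R) B))) \<partial>LM n)"
    using nn_LB_mulL[of "transpose_mat R" n "{..<n}", OF _ _ _ m2] R dR by (simp add: det_transpose)
  also have "(\<integral>\<^sup>+B. f (?L S (tr (?L (transpose_mat R) B))) \<partial>LM n) = (\<integral>\<^sup>+B. f (conjm n S R B) \<partial>LM n)"
    using tr[OF m3] by (simp add: c)
  finally have "(\<integral>\<^sup>+B. f B \<partial>LM n) = ennreal (\<bar>det S\<bar> ^ n) * ennreal (\<bar>det R\<bar> ^ n) * (\<integral>\<^sup>+B. f (conjm n S R B) \<partial>LM n)"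
    by (simp add: mult.assoc)
  also have "ennreal (\<bar>det S\<bar> ^ n) * ennreal (\<bar>det R\<bar> ^ n) = ennreal (\<bar>det R * det S\<bar> ^ n)"
    by (subst ennreal_mult[symmetric]) (auto simp: abs_mult power_mult_distrib mult.commute)
  finally show ?thesis using d by simp
qed

lemma cp_conjm:
  fixes S R :: "real mat"
  assumes S: "S \<in> carrier_mat n n" and R: "R \<in> carrier_mat n n" and RS: "R * S = 1\<^sub>m n"
  shows "cp n (conjm n S R B) = cp n B"
proof -
  have SR: "S * R = 1\<^sub>m n" using mat_mult_left_right_inverse[OF R S RS] .
  have "mat n n (conjm n S R B) = S * (mat n n B * R)"
    using S R by (intro eq_matI) (auto simp: conjm_def scalar_prod_def lessThan_atLeast0)
  also have "\<dots> = S * mat n n B * R" using S R by (simp add: assoc_mult_mat[of _ n n _ n _ n])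
  finally have "similar_mat (mat n n (conjm n S R B)) (mat n n B)"
    using S R RS SR by (intro similar_matI[of _ _ S R n]) auto
  thus ?thesis unfolding cp_def by (rule char_poly_similar)
qed

text \<open>The matrix determinant lemma: unipotent factors turn the bordered matrix
  \<open>N\<close> into an upper block triangular one whose corner is the right-hand side.\<close>

lemma det_rank_one_update:
  fixes u w :: "nat \<Rightarrow> real"
  shows "det (mat n n (\<lambda>(i, j). (if i = j then 1 else 0) + u i * w j)) = 1 + (\<Sum>i<n. w i * u i)"
proof -
  define W where "W = mat 1 n (\<lambda>(i, j). w j)"
  define U where "U = mat n 1 (\<lambda>(i, j). u i)"
  let ?A = "mat n n (\<lambda>(i, j). (if i = j then 1 else 0) + u i * w j)"
  define L where "L = four_block_mat (1\<^sub>m n) (0\<^sub>m n 1) W (1\<^sub>m 1)"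
  define Q where "Q = four_block_mat (1\<^sub>m n) (0\<^sub>m n 1) (- W) (1\<^sub>m 1)"
  define N where "N = four_block_mat ?A U (0\<^sub>m 1 n) (1\<^sub>m 1)"
  have W: "W \<in> carrier_mat 1 n" and U: "U \<in> carrier_mat n 1" by (auto simp: W_def U_def)
  have NQ: "N * Q = four_block_mat (1\<^sub>m n) U (- W) (1\<^sub>m 1)"
    unfolding N_def Q_def
    by (subst mult_four_block_mat[where ?nr1.0 = n and ?n1.0 = n and ?n2.0=1 and ?nr2.0=1 and ?nc1.0=n and ?nc2.0=1])
       (use U W in \<open>auto intro!: eq_matI simp: scalar_prod_def U_def W_def\<close>)
  have LNQ: "L * (N * Q) = four_block_mat (1\<^sub>m n) U (0\<^sub>m 1 n) (mat 1 1 (\<lambda>_. 1 + (\<Sum>i<n. w i * u i)))"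
    unfolding NQ unfolding L_def
    by (subst mult_four_block_mat[where ?nr1.0 = n and ?n1.0 = n and ?n2.0=1 and ?nr2.0=1 and ?nc1.0=n and ?nc2.0=1])
       (use U W in \<open>auto intro!: eq_matI simp: scalar_prod_def U_def W_def lessThan_atLeast0\<close>)
  have carr: "L \<in> carrier_mat (Suc n) (Suc n)" "N \<in> carrier_mat (Suc n) (Suc n)" "Q \<in> carrier_mat (Suc n) (Suc n)"
    using W U by (auto simp: L_def N_def Q_def)
  have "det (L * (N * Q)) = det L * (det N * det Q)"
    using carr by (simp add: det_mult[of _ "Suc n"])
  moreover have "det L = 1" "det Q = 1"
    unfolding L_def Q_def using W by (subst det_four_block_mat_upper_right_zero[of _ n _ 1]; auto)+
  moreover have "det N = det ?A"
    unfolding N_def using U by (subst det_four_block_mat_lower_left_zero[of _ n _ 1]) auto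
  moreover have "det (L * (N * Q)) = 1 + (\<Sum>i<n. w i * u i)"
    unfolding LNQ using U by (subst det_four_block_mat_lower_left_zero[of _ n _ 1]) (auto simp: det_single)
  ultimately show ?thesis by simp
qed

section \<open>Gaussian weight of a bordered matrix\<close>

definition sqn :: "'i set \<Rightarrow> ('i \<Rightarrow> real) \<Rightarrow> real" where
  "sqn I x = (\<Sum>i\<in>I. (x i)\<^sup>2)"

definition gw :: "'i set \<Rightarrow> ('i \<Rightarrow> real) \<Rightarrow> real" where
  "gw I x = exp (- sqn I x / 2)"

abbreviation sq2 :: "nat \<Rightarrow> (nat \<times> nat) set" where
  "sq2 n \<equiv> {..<n} \<times> {..<n}"

lemma sum_sq2: "(\<Sum>p\<in>sq2 n. f p) = (\<Sum>i<n. \<Sum>j<n. f (i, j))"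
  by (simp add: sum.cartesian_product)

lemma sqn_blk: "sqn (sq2 (Suc n)) (blk n D w c a) = sqn (sq2 n) D + (\<Sum>j<n. (w j)\<^sup>2) + (\<Sum>i<n. (c i)\<^sup>2) + a\<^sup>2"
  unfolding sqn_def sum_sq2 by (simp add: sum.distrib)

text \<open>The matrices \<open>Rm\<close> and \<open>Sm\<close> are the square root of \<open>1 + u
  u\<^sup>T\<close> and its inverse; conjugation by them turns the Gaussian weight of the bordered matrix into
  a product.\<close>

definition qn :: "nat \<Rightarrow> (nat \<Rightarrow> real) \<Rightarrow> real" where
  "qn n u = sqrt (1 + (\<Sum>i<n. (u i)\<^sup>2))"

definition Rm :: "nat \<Rightarrow> (nat \<Rightarrow> real) \<Rightarrow> real mat" where
  "Rm n u = mat n n (\<lambda>(i, j). (if i = j then 1 else 0) + u i * (u j / (qn n u + 1)))"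

definition Sm :: "nat \<Rightarrow> (nat \<Rightarrow> real) \<Rightarrow> real mat" where
  "Sm n u = mat n n (\<lambda>(i, j). (if i = j then 1 else 0) - u i * (u j / (qn n u * (qn n u + 1))))"

lemma qn_sq: "(qn n u)\<^sup>2 = 1 + (\<Sum>i<n. (u i)\<^sup>2)"
  unfolding qn_def by (simp add: add_nonneg_nonneg sum_nonneg)

lemma qn_ge1: "qn n u \<ge> 1"
  unfolding qn_def by (simp add: sum_nonneg)

lemma Rm_Sm_carrier [simp]: "Rm n u \<in> carrier_mat n n" "Sm n u \<in> carrier_mat n n"
  by (auto simp: Rm_def Sm_def)

lemma det_Rm: "det (Rm n u) = qn n u"
proof -
  let ?q = "qn n u"
  have "det (Rm n u) = 1 + (\<Sum>i<n. u i / (?q + 1) * u i)"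
    unfolding Rm_def by (rule det_rank_one_update)
  also have "(\<Sum>i<n. u i / (?q + 1) * u i) = (?q\<^sup>2 - 1) / (?q + 1)"
    unfolding qn_sq by (simp add: sum_divide_distrib power2_eq_square)
  also have "\<dots> = ?q - 1" using qn_ge1[of n u] by (simp add: field_simps power2_eq_square)
  finally show ?thesis by simp
qed

lemma mult_Rm_row:
  assumes "j < n"
  shows "(\<Sum>l<n. p l * Rm n u $$ (l, j)) = p j + (\<Sum>l<n. p l * u l) * u j / (qn n u + 1)"
proof -
  have "(\<Sum>l<n. p l * Rm n u $$ (l, j)) = (\<Sum>l<n. (if l = j then p l else 0) + p l * u l * u j / (qn n u + 1))"
    using assms by (intro sum.cong) (auto simp: Rm_def algebra_simps)
  also have "\<dots> = p j + (\<Sum>l<n. p l * u l) * u j / (qn n u + 1)"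
    using assms by (simp add: sum.distrib sum_distrib_right sum_divide_distrib)
  finally show ?thesis .
qed

lemma mult_Rm_col:
  assumes "i < n"
  shows "(\<Sum>j<n. Rm n u $$ (i, j) * p j) = p i + (\<Sum>l<n. p l * u l) * u i / (qn n u + 1)"
proof -
  have "(\<Sum>j<n. Rm n u $$ (i, j) * p j) = (\<Sum>l<n. (if l = i then p l else 0) + p l * u l * u i / (qn n u + 1))"
    using assms by (intro sum.cong) (auto simp: Rm_def algebra_simps)
  also have "\<dots> = p i + (\<Sum>l<n. p l * u l) * u i / (qn n u + 1)"
    using assms by (simp add: sum.distrib sum_distrib_right sum_divide_distrib)
  finally show ?thesis .
qed

lemma mult_Sm_col:
  assumes "i < n"
  shows "(\<Sum>j<n. Sm n u $$ (i, j) * p j) = p i - (\<Sum>l<n. p l * u l) * u i / (qn n u * (qn n u + 1))"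
proof -
  have "(\<Sum>j<n. Sm n u $$ (i, j) * p j) = (\<Sum>l<n. (if l = i then p l else 0) - p l * u l * u i / (qn n u * (qn n u + 1)))"
    using assms by (intro sum.cong) (auto simp: Sm_def algebra_simps)
  also have "\<dots> = p i - (\<Sum>l<n. p l * u l) * u i / (qn n u * (qn n u + 1))"
    using assms by (simp add: sum_subtractf sum_distrib_right sum_divide_distrib)
  finally show ?thesis .
qed

lemma Rm_Sm: "Rm n u * Sm n u = 1\<^sub>m n"
proof (rule eq_matI)
  let ?q = "qn n u"
  have q: "?q \<ge> 1" by (rule qn_ge1)
  fix i j assume "i < dim_row (1\<^sub>m n :: real mat)" "j < dim_col (1\<^sub>m n :: real mat)"
  hence ij: "i < n" "j < n" by auto
  have "(Rm n u * Sm n u) $$ (i, j) = (\<Sum>k<n. Rm n u $$ (i, k) * Sm n u $$ (k, j))"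
    using ij by (simp add: Rm_def Sm_def scalar_prod_def lessThan_atLeast0)
  also have "\<dots> = Sm n u $$ (i, j) + (\<Sum>l<n. Sm n u $$ (l, j) * u l) * u i / (?q + 1)"
    by (rule mult_Rm_col[OF ij(1)])
  also have "(\<Sum>l<n. Sm n u $$ (l, j) * u l) = (\<Sum>l<n. Sm n u $$ (j, l) * u l)"
    using ij by (intro sum.cong) (auto simp: Sm_def)
  also have "\<dots> = u j - (\<Sum>l<n. u l * u l) * u j / (?q * (?q + 1))" by (rule mult_Sm_col[OF ij(2)])
  also have "(\<Sum>l<n. u l * u l) = ?q\<^sup>2 - 1" using qn_sq[of n u] by (simp add: power2_eq_square)
  also have "u j - (?q\<^sup>2 - 1) * u j / (?q * (?q + 1)) = u j / ?q"
  proof -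
    have f: "?q\<^sup>2 - 1 = (?q - 1) * (?q + 1)" by (simp add: power2_eq_square algebra_simps)
    show ?thesis unfolding f using q by (simp add: divide_simps) (simp add: algebra_simps)
  qed
  finally show "(Rm n u * Sm n u) $$ (i, j) = 1\<^sub>m n $$ (i, j)"
    using ij q by (simp add: Sm_def)
qed (auto simp: Rm_def Sm_def)

text \<open>For \<open>R = Rm n u\<close> this is the identity \<open>R * R = 1 + u u^T\<close>,
  read as the inner product of \<open>R p\<close> and \<open>R r\<close>.\<close>

lemma Rm_inner:
  "(\<Sum>j<n. (p j + (\<Sum>l<n. p l * u l) * u j / (qn n u + 1)) * (r j + (\<Sum>l<n. r l * u l) * u j / (qn n u + 1)))
   = (\<Sum>j<n. p j * r j) + (\<Sum>l<n. p l * u l) * (\<Sum>l<n. r l * u l)"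
proof -
  let ?q = "qn n u" and ?a = "\<Sum>l<n. p l * u l" and ?b = "\<Sum>l<n. r l * u l"
  have q: "?q \<ge> 1" by (rule qn_ge1)
  have s: "(\<Sum>j<n. u j * u j) = ?q\<^sup>2 - 1" using qn_sq[of n u] by (simp add: power2_eq_square)
  have "(\<Sum>j<n. (p j + ?a * u j / (?q + 1)) * (r j + ?b * u j / (?q + 1)))
    = (\<Sum>j<n. p j * r j + ?b / (?q + 1) * (p j * u j) + ?a / (?q + 1) * (r j * u j) + ?a * ?b / (?q + 1)\<^sup>2 * (u j * u j))"
    by (intro sum.cong) (auto simp: algebra_simps power2_eq_square add_divide_distrib)
  also have "\<dots> = (\<Sum>j<n. p j * r j) + ?b / (?q + 1) * ?a + ?a / (?q + 1) * ?b + ?a * ?b / (?q + 1)\<^sup>2 * (?q\<^sup>2 - 1)"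
    by (simp only: sum.distrib sum_distrib_left[symmetric] s)
  also have "\<dots> = (\<Sum>j<n. p j * r j) + ?a * ?b"
  proof -
    have "1 / (?q + 1) + 1 / (?q + 1) + 1 / (?q + 1)\<^sup>2 * (?q\<^sup>2 - 1) = 1"
    proof -
      have f: "?q\<^sup>2 - 1 = (?q - 1) * (?q + 1)" by (simp add: power2_eq_square algebra_simps)
      show ?thesis unfolding f using q by (simp add: divide_simps power2_eq_square) (simp add: algebra_simps)
    qed
    hence "?a * ?b * (1 / (?q + 1) + 1 / (?q + 1) + 1 / (?q + 1)\<^sup>2 * (?q\<^sup>2 - 1)) = ?a * ?b" by simp
    thus ?thesis by (simp add: algebra_simps)
  qed
  finally show ?thesis .
qed

text \<open>For \<open>S = Sm n u\<close> this is the identity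
  \<open>S * S = 1 - u u^T / q\<^sup>2\<close>, read as the squared length of
  \<open>S p\<close>.\<close>

lemma Sm_sq:
  "(\<Sum>j<n. (p j - (\<Sum>l<n. p l * u l) * u j / (qn n u * (qn n u + 1)))\<^sup>2)
   = (\<Sum>j<n. (p j)\<^sup>2) - (\<Sum>l<n. p l * u l)\<^sup>2 / (qn n u)\<^sup>2"
proof -
  let ?q = "qn n u" and ?a = "\<Sum>l<n. p l * u l"
  have q: "?q \<ge> 1" by (rule qn_ge1)
  let ?s = "1 / (?q * (?q + 1))"
  have s: "(\<Sum>j<n. u j * u j) = ?q\<^sup>2 - 1" using qn_sq[of n u] by (simp add: power2_eq_square)
  have "(\<Sum>j<n. (p j - ?a * u j / (?q * (?q + 1)))\<^sup>2)
    = (\<Sum>j<n. (p j)\<^sup>2 - 2 * ?a * ?s * (p j * u j) + ?a\<^sup>2 * ?s\<^sup>2 * (u j * u j))"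
    by (intro sum.cong) (auto simp: algebra_simps power2_eq_square)
  also have "\<dots> = (\<Sum>j<n. (p j)\<^sup>2) - 2 * ?a * ?s * ?a + ?a\<^sup>2 * ?s\<^sup>2 * (?q\<^sup>2 - 1)"
    by (simp only: sum.distrib sum_subtractf sum_distrib_left[symmetric] s)
  also have "\<dots> = (\<Sum>j<n. (p j)\<^sup>2) + ?a\<^sup>2 * (?s\<^sup>2 * (?q\<^sup>2 - 1) - 2 * ?s)"
    by (simp add: algebra_simps power2_eq_square)
  also have "?s\<^sup>2 * (?q\<^sup>2 - 1) - 2 * ?s = - 1 / ?q\<^sup>2"
  proof -
    have "?q * (?q + 1) \<noteq> 0" "?q \<noteq> 0" "?q + 1 \<noteq> 0" using q by auto
    thus ?thesis by (simp add: divide_simps power2_eq_square) (simp add: algebra_simps)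
  qed
  finally show ?thesis by simp
qed

text \<open>Completing the square in the row \<open>w\<close>: its quadratic terms are
  \<open>q\<^sup>2\<close> times the sum of the squared length of \<open>w\<close> and the squared
  inner product of \<open>w\<close> and \<open>u\<close>, which is the squared length of
  \<open>q R w\<close>; the vector \<open>v\<close> absorbs the linear terms. What remains is free
  of \<open>w\<close>: it is \<open>x\<^sup>2\<close> and the squared norm of the conjugated matrix
  \<open>S B R\<close>.\<close>

lemma sqn_blk_conj:
  fixes B :: "nat \<times> nat \<Rightarrow> real" and u w :: "nat \<Rightarrow> real" and x :: real and n :: nat
  defines "D \<equiv> (\<lambda>(i, j). B (i, j) + u i * w j)"
  defines "q \<equiv> qn n u" 
  defines "b \<equiv> (\<lambda>j. \<Sum>i<n. B (i, j) * u i)"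
  defines "v \<equiv> (\<lambda>j. (b j + (\<Sum>l<n. b l * u l) * u j / (q + 1) - x * q * u j) / q)"
  shows "sqn (sq2 (Suc n)) (blk n D w (\<lambda>i. x * u i - (\<Sum>j<n. D (i, j) * u j)) (x - (\<Sum>j<n. w j * u j)))
    = x\<^sup>2 + (\<Sum>j<n. (q * mv n (Rm n u) w j + v j)\<^sup>2) + sqn (sq2 n) (conjm n (Sm n u) (Rm n u) B)"
proof -
  have q: "q \<ge> 1" "q \<noteq> 0" "q + 1 \<noteq> 0" using qn_ge1[of n u] by (auto simp: q_def)
  have s: "(\<Sum>j<n. (u j)\<^sup>2) = q\<^sup>2 - 1" by (simp add: qn_sq q_def)
  define e where "e i = (\<Sum>j<n. B (i, j) * u j)" for i
  define \<beta> where "\<beta> = (\<Sum>l<n. b l * u l)"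
  define \<tau> where "\<tau> = (\<Sum>j<n. w j * u j)"
  define W where "W = (\<Sum>j<n. (w j)\<^sup>2)"
  define BB where "BB = (\<Sum>i<n. \<Sum>j<n. (B (i, j))\<^sup>2)"
  define bw where "bw = (\<Sum>j<n. b j * w j)"
  define b2 where "b2 = (\<Sum>j<n. (b j)\<^sup>2)"
  define e2 where "e2 = (\<Sum>i<n. (e i)\<^sup>2)"
  have eb: "(\<Sum>i<n. e i * u i) = \<beta>"
    unfolding e_def \<beta>_def b_def sum_distrib_right by (subst sum.swap) (simp add: mult_ac)
  have D2: "sqn (sq2 n) D = BB + 2 * bw + (q\<^sup>2 - 1) * W"
  proof -
    have "sqn (sq2 n) D = (\<Sum>i<n. \<Sum>j<n. (B (i, j))\<^sup>2 + 2 * (B (i, j) * u i * w j) + (u i)\<^sup>2 * (w j)\<^sup>2)"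
      unfolding sqn_def sum_sq2 D_def by (intro sum.cong) (auto simp: power2_eq_square algebra_simps)
    also have "\<dots> = BB + 2 * (\<Sum>i<n. \<Sum>j<n. B (i, j) * u i * w j) + (\<Sum>i<n. \<Sum>j<n. (u i)\<^sup>2 * (w j)\<^sup>2)"
      by (simp add: sum.distrib sum_distrib_left BB_def)
    also have "(\<Sum>i<n. \<Sum>j<n. B (i, j) * u i * w j) = bw"
      unfolding bw_def b_def sum_distrib_right by (rule sum.swap)
    also have "(\<Sum>i<n. \<Sum>j<n. (u i)\<^sup>2 * (w j)\<^sup>2) = (q\<^sup>2 - 1) * W"
      unfolding W_def s[symmetric] sum_product ..
    finally show ?thesis .
  qed
  have Du: "x * u i - (\<Sum>j<n. D (i, j) * u j) = (x - \<tau>) * u i - e i" for i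
    by (simp add: D_def e_def \<tau>_def algebra_simps sum.distrib sum_distrib_left)
  have c2: "(\<Sum>i<n. (x * u i - (\<Sum>j<n. D (i, j) * u j))\<^sup>2) = (x - \<tau>)\<^sup>2 * (q\<^sup>2 - 1) - 2 * (x - \<tau>) * \<beta> + e2"
  proof -
    have "(\<Sum>i<n. ((x - \<tau>) * u i - e i)\<^sup>2) = (\<Sum>i<n. (x - \<tau>)\<^sup>2 * (u i)\<^sup>2 - 2 * (x - \<tau>) * (e i * u i) + (e i)\<^sup>2)"
      by (intro sum.cong) (auto simp: power2_eq_square algebra_simps)
    also have "\<dots> = (x - \<tau>)\<^sup>2 * (q\<^sup>2 - 1) - 2 * (x - \<tau>) * \<beta> + e2"
      by (simp only: sum.distrib sum_subtractf sum_distrib_left[symmetric] s eb e2_def)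
    finally show ?thesis unfolding Du .
  qed
  have Rw: "mv n (Rm n u) w j = w j + \<tau> * u j / (q + 1)" if "j < n" for j
    using mult_Rm_col[OF that, of u w] that by (simp add: mv_def \<tau>_def q_def)
  define Rb where "Rb j = b j + \<beta> * u j / (q + 1)" for j
  have R1: "(\<Sum>j<n. (w j + \<tau> * u j / (q + 1))\<^sup>2) = W + \<tau>\<^sup>2"
    using Rm_inner[where n = n and p = w and u = u and r = w] by (simp add: W_def \<tau>_def q_def power2_eq_square)
  have R2: "(\<Sum>j<n. (w j + \<tau> * u j / (q + 1)) * Rb j) = bw + \<tau> * \<beta>"
    using Rm_inner[where n = n and p = w and u = u and r = b] by (simp add: bw_def \<tau>_def \<beta>_def q_def Rb_def mult.commute)
  have R3: "(\<Sum>j<n. (Rb j)\<^sup>2) = b2 + \<beta>\<^sup>2"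
    using Rm_inner[where n = n and p = b and u = u and r = b] by (simp add: b2_def \<beta>_def q_def Rb_def power2_eq_square)
  have lin: "(\<Sum>j<n. (p j + (\<Sum>l<n. p l * u l) * u j / (q + 1)) * u j) = q * (\<Sum>l<n. p l * u l)" for p
  proof -
    have "(\<Sum>j<n. (p j + (\<Sum>l<n. p l * u l) * u j / (q + 1)) * u j) = (\<Sum>l<n. p l * u l) + (\<Sum>l<n. p l * u l) / (q + 1) * (q\<^sup>2 - 1)"
    proof -
      have "(\<Sum>j<n. (p j + (\<Sum>l<n. p l * u l) * u j / (q + 1)) * u j) = (\<Sum>j<n. p j * u j + (\<Sum>l<n. p l * u l) / (q + 1) * (u j)\<^sup>2)"
        by (intro sum.cong) (auto simp: algebra_simps power2_eq_square)
      thus ?thesis unfolding s[symmetric] by (simp only: sum.distrib sum_distrib_left[symmetric])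
    qed
    also have "\<dots> = q * (\<Sum>l<n. p l * u l)"
    proof -
      have "1 + (q\<^sup>2 - 1) / (q + 1) = q" using q by (simp add: field_simps power2_eq_square)
      hence "(\<Sum>l<n. p l * u l) * (1 + (q\<^sup>2 - 1) / (q + 1)) = (\<Sum>l<n. p l * u l) * q" by simp
      thus ?thesis by (simp add: algebra_simps)
    qed
    finally show ?thesis .
  qed
  have R4: "(\<Sum>j<n. (w j + \<tau> * u j / (q + 1)) * u j) = q * \<tau>" using lin[of w] by (simp add: \<tau>_def)
  have R5: "(\<Sum>j<n. Rb j * u j) = q * \<beta>" using lin[of b] by (simp add: \<beta>_def Rb_def)
  have vj: "v j = (Rb j - x * q * u j) / q" for j by (simp add: v_def Rb_def \<beta>_def)
  have Z: "(\<Sum>j<n. (q * mv n (Rm n u) w j + v j)\<^sup>2) =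
      q\<^sup>2 * (W + \<tau>\<^sup>2) + 2 * (bw + \<tau> * \<beta>) - 2 * x * q * (q * \<tau>) + (b2 + \<beta>\<^sup>2) / q\<^sup>2 - 2 * x * \<beta> + x\<^sup>2 * (q\<^sup>2 - 1)"
  proof -
    have "(\<Sum>j<n. (q * mv n (Rm n u) w j + v j)\<^sup>2) = (\<Sum>j<n. q\<^sup>2 * (w j + \<tau> * u j / (q + 1))\<^sup>2
       + 2 * ((w j + \<tau> * u j / (q + 1)) * Rb j) - 2 * x * q * ((w j + \<tau> * u j / (q + 1)) * u j)
       + (1 / q\<^sup>2) * (Rb j)\<^sup>2 - (2 * x / q) * (Rb j * u j) + x\<^sup>2 * (u j)\<^sup>2)"
    proof (intro sum.cong refl)
      fix j assume "j \<in> {..<n}"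
      hence "mv n (Rm n u) w j = w j + \<tau> * u j / (q + 1)" using Rw by simp
      moreover define y where "y = w j + \<tau> * u j / (q + 1)"
      moreover have "(q * y + (Rb j - x * q * u j) / q)\<^sup>2 = q\<^sup>2 * y\<^sup>2 + 2 * (y * Rb j) - 2 * x * q * (y * u j)
         + (1 / q\<^sup>2) * (Rb j)\<^sup>2 - (2 * x / q) * (Rb j * u j) + x\<^sup>2 * (u j)\<^sup>2"
        using q by (simp add: divide_simps power2_eq_square) (simp add: algebra_simps)
      ultimately show "(q * mv n (Rm n u) w j + v j)\<^sup>2 = q\<^sup>2 * (w j + \<tau> * u j / (q + 1))\<^sup>2
       + 2 * ((w j + \<tau> * u j / (q + 1)) * Rb j) - 2 * x * q * ((w j + \<tau> * u j / (q + 1)) * u j)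
       + (1 / q\<^sup>2) * (Rb j)\<^sup>2 - (2 * x / q) * (Rb j * u j) + x\<^sup>2 * (u j)\<^sup>2"
        by (simp add: vj)
    qed
    also have "\<dots> = q\<^sup>2 * (W + \<tau>\<^sup>2) + 2 * (bw + \<tau> * \<beta>) - 2 * x * q * (q * \<tau>) + (1 / q\<^sup>2) * (b2 + \<beta>\<^sup>2) - (2 * x / q) * (q * \<beta>) + x\<^sup>2 * (q\<^sup>2 - 1)"
      by (simp only: sum.distrib sum_subtractf sum_distrib_left[symmetric] s R1 R2 R3 R4 R5)
    finally show ?thesis using q by simp
  qed
  \<comment> \<open>\<open>C\<close> is \<open>B R\<close>, and \<open>S\<close> then acts on the
    columns of \<open>C\<close>. Their inner products with \<open>u\<close> are \<open>Rb j\<close>,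
    so \<open>Sm_sq\<close> subtracts the sum from \<open>R3\<close> divided by
    \<open>q\<^sup>2\<close>.\<close>
  have SBR: "sqn (sq2 n) (conjm n (Sm n u) (Rm n u) B) = BB + e2 - (b2 + \<beta>\<^sup>2) / q\<^sup>2"
  proof -
    define C where "C i j = B (i, j) + e i * u j / (q + 1)" for i j
    have C: "(\<Sum>l<n. B (k, l) * Rm n u $$ (l, j)) = C k j" if "j < n" for k j
      using mult_Rm_row[OF that, of "\<lambda>l. B (k, l)" u] by (simp add: C_def e_def q_def)
    have Cu: "(\<Sum>i<n. C i j * u i) = Rb j" for j
    proof -
      have "(\<Sum>i<n. C i j * u i) = b j + (\<Sum>i<n. e i * u i) * u j / (q + 1)"
        by (simp add: C_def b_def algebra_simps sum.distrib sum_distrib_left sum_divide_distrib)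
      thus ?thesis by (simp add: eb Rb_def)
    qed
    have "sqn (sq2 n) (conjm n (Sm n u) (Rm n u) B) = (\<Sum>j<n. \<Sum>i<n. (C i j - (\<Sum>l<n. C l j * u l) * u i / (q * (q + 1)))\<^sup>2)"
      unfolding sqn_def sum_sq2
    proof (subst sum.swap, intro sum.cong refl)
      fix i j assume "i \<in> {..<n}" "j \<in> {..<n}"
      hence ij: "i < n" "j < n" by auto
      have "conjm n (Sm n u) (Rm n u) B (i, j) = (\<Sum>k<n. Sm n u $$ (i, k) * C k j)"
        using ij by (simp add: conjm_def C)
      also have "\<dots> = C i j - (\<Sum>l<n. C l j * u l) * u i / (q * (q + 1))"
        using mult_Sm_col[OF ij(1), of u "\<lambda>k. C k j"] by (simp add: q_def)
      finally show "(conjm n (Sm n u) (Rm n u) B (i, j))\<^sup>2 = (C i j - (\<Sum>l<n. C l j * u l) * u i / (q * (q + 1)))\<^sup>2" by simp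
    qed
    also have "\<dots> = (\<Sum>j<n. (\<Sum>i<n. (C i j)\<^sup>2) - (Rb j)\<^sup>2 / q\<^sup>2)"
    proof (intro sum.cong refl)
      fix j
      show "(\<Sum>i<n. (C i j - (\<Sum>l<n. C l j * u l) * u i / (q * (q + 1)))\<^sup>2) = (\<Sum>i<n. (C i j)\<^sup>2) - (Rb j)\<^sup>2 / q\<^sup>2"
        using Sm_sq[where n = n and u = u and p = "\<lambda>i. C i j"] unfolding Cu q_def[symmetric] .
    qed
    also have "\<dots> = (\<Sum>i<n. \<Sum>j<n. (C i j)\<^sup>2) - (b2 + \<beta>\<^sup>2) / q\<^sup>2"
      unfolding sum_subtractf R3[symmetric] by (subst sum.swap) (simp add: sum_divide_distrib)
    also have "(\<Sum>i<n. \<Sum>j<n. (C i j)\<^sup>2) = (\<Sum>i<n. (\<Sum>j<n. (B (i, j))\<^sup>2) + (e i)\<^sup>2)"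
      using Rm_inner[where n = n and u = u and p = "\<lambda>j. B (_, j)" and r = "\<lambda>j. B (_, j)"] by (simp add: C_def e_def q_def power2_eq_square)
    also have "\<dots> = BB + e2" by (simp add: sum.distrib BB_def e2_def)
    finally show ?thesis .
  qed
  show ?thesis
    unfolding sqn_blk c2 D2 Z SBR \<tau>_def[symmetric] W_def[symmetric]
    by (simp add: algebra_simps power2_eq_square)
qed

lemma nn_integral_gauss_1: "(\<integral>\<^sup>+x. ennreal (exp (- x\<^sup>2 / 2)) \<partial>lborel) = ennreal (sqrt (2 * pi))"
proof -
  have "(\<integral>\<^sup>+x. ennreal (normal_density 0 1 x) \<partial>lborel) = 1"
    using prob_space.emeasure_space_1[OF prob_space_normal_density[of 1 0]] by (simp add: emeasure_density)
  moreover have "exp (- x\<^sup>2 / 2) = sqrt (2 * pi) * normal_density 0 1 x" for x :: real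
    by (simp add: normal_density_def)
  ultimately show ?thesis
    by (simp add: ennreal_mult nn_integral_cmult)
qed

lemma gw_prod: "finite I \<Longrightarrow> gw I x = (\<Prod>i\<in>I. exp (- (x i)\<^sup>2 / 2))"
  by (simp add: gw_def sqn_def exp_sum[symmetric] sum_negf sum_divide_distrib)

lemma nn_integral_gw:
  assumes "finite I"
  shows "(\<integral>\<^sup>+x. ennreal (gw I x) \<partial>LB I) = ennreal (sqrt (2 * pi) ^ card I)"
proof -
  have "(\<integral>\<^sup>+x. ennreal (gw I x) \<partial>LB I) = (\<integral>\<^sup>+x. (\<Prod>i\<in>I. ennreal (exp (- (x i)\<^sup>2 / 2))) \<partial>LB I)"
    by (simp add: gw_prod[OF assms] prod_ennreal)
  also have "\<dots> = (\<Prod>i\<in>I. \<integral>\<^sup>+x. ennreal (exp (- x\<^sup>2 / 2)) \<partial>lborel)"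
    by (rule leb.product_nn_integral_prod) (use assms in auto)
  also have "\<dots> = ennreal (sqrt (2 * pi) ^ card I)"
    unfolding nn_integral_gauss_1 by (simp add: ennreal_power)
  finally show ?thesis .
qed

lemma measurable_sqn:
  assumes "\<And>i. i \<in> I \<Longrightarrow> (\<lambda>z. X z i) \<in> borel_measurable N"
  shows "(\<lambda>z. sqn I (X z)) \<in> borel_measurable N"
  unfolding sqn_def by (intro borel_measurable_sum borel_measurable_power assms)

lemma measurable_gw:
  assumes "\<And>i. i \<in> I \<Longrightarrow> (\<lambda>z. X z i) \<in> borel_measurable N"
  shows "(\<lambda>z. gw I (X z)) \<in> borel_measurable N"
proof -
  have [measurable]: "(\<lambda>z. sqn I (X z)) \<in> borel_measurable N" by (rule measurable_sqn[OF assms])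
  show ?thesis unfolding gw_def by measurable
qed

text \<open>The matrix \<open>q R\<close> has determinant \<open>q ^ n * q\<close>, whence the
  exponent \<open>Suc n\<close>. Translation invariance removes \<open>v\<close>, so the value stays
  the same when \<open>v\<close> depends on the other variables.\<close>

lemma nn_integral_gauss_Rm:
  "(\<integral>\<^sup>+w. ennreal (exp (- (\<Sum>j<n. (qn n u * mv n (Rm n u) w j + v j)\<^sup>2) / 2)) \<partial>LB {..<n})
    = ennreal (sqrt (2 * pi) ^ n / qn n u ^ Suc n)"
proof -
  let ?q = "qn n u"
  have q: "?q \<ge> 1" by (rule qn_ge1)
  define A where "A = ?q \<cdot>\<^sub>m Rm n u"
  have A: "A \<in> carrier_mat n n" by (simp add: A_def)
  have dA: "det A = ?q ^ Suc n"
    unfolding A_def det_smult det_Rm using carrier_matD(2)[OF Rm_Sm_carrier(1)[of n u]] by simp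
  have mvA: "mv n A w j = ?q * mv n (Rm n u) w j" if "j < n" for w j
    using that carrier_matD[OF Rm_Sm_carrier(1)[of n u]] by (simp add: mv_def A_def sum_distrib_left mult.assoc)
  let ?f = "\<lambda>y. ennreal (gw {..<n} (\<lambda>j\<in>{..<n}. y j + v j))"
  have fm: "?f \<in> borel_measurable (LB {..<n})"
    by (intro measurable_compose[OF measurable_gw measurable_ennreal]) auto
  have "ennreal (sqrt (2 * pi) ^ n) = (\<integral>\<^sup>+y. ennreal (gw {..<n} y) \<partial>LB {..<n})"
    by (simp add: nn_integral_gw)
  also have "\<dots> = (\<integral>\<^sup>+y. ?f y \<partial>LB {..<n})"
    by (rule nn_LB_translate[symmetric]) (auto intro!: measurable_compose[OF measurable_gw measurable_ennreal])
  also have "\<dots> = ennreal (?q ^ Suc n) * (\<integral>\<^sup>+w. ?f (mv n A w) \<partial>LB {..<n})"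
    using nn_LB_linear[OF A _ fm] dA q by simp
  also have "(\<integral>\<^sup>+w. ?f (mv n A w) \<partial>LB {..<n}) = (\<integral>\<^sup>+w. ennreal (exp (- (\<Sum>j<n. (?q * mv n (Rm n u) w j + v j)\<^sup>2) / 2)) \<partial>LB {..<n})"
    by (intro nn_integral_cong) (simp add: gw_def sqn_def mvA)
  finally have *: "ennreal (sqrt (2 * pi) ^ n) = ennreal (?q ^ Suc n) * (\<integral>\<^sup>+w. ennreal (exp (- (\<Sum>j<n. (?q * mv n (Rm n u) w j + v j)\<^sup>2) / 2)) \<partial>LB {..<n})" .
  have "ennreal (sqrt (2 * pi) ^ n / ?q ^ Suc n) = ennreal (1 / ?q ^ Suc n) * ennreal (sqrt (2 * pi) ^ n)"
    using q by (subst ennreal_mult[symmetric]) auto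
  also have "\<dots> = (ennreal (1 / ?q ^ Suc n) * ennreal (?q ^ Suc n)) * (\<integral>\<^sup>+w. ennreal (exp (- (\<Sum>j<n. (?q * mv n (Rm n u) w j + v j)\<^sup>2) / 2)) \<partial>LB {..<n})"
    unfolding * by (simp only: mult.assoc)
  also have "ennreal (1 / ?q ^ Suc n) * ennreal (?q ^ Suc n) = 1"
    using q by (subst ennreal_mult[symmetric]) auto
  finally show ?thesis by simp
qed

section \<open>Splitting off one real eigenvalue\<close>

lemma measurable_nn_integral_snd:
  assumes "sigma_finite_measure M" "(\<lambda>p. f (fst p) (snd p)) \<in> borel_measurable (N \<Otimes>\<^sub>M M)"
  shows "(\<lambda>z. \<integral>\<^sup>+y. f z y \<partial>M) \<in> borel_measurable N"
  using sigma_finite_measure.borel_measurable_nn_integral[OF assms(1), of f N] assms(2) by (simp add: split_beta')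

lemma measurable_coord: "i \<in> I \<Longrightarrow> (\<lambda>c. c i) \<in> borel_measurable (LB I)"
  using measurable_component_singleton[of i I "\<lambda>_. lborel :: real measure"] by simp

lemma measurable_entry: "i < n \<Longrightarrow> j < n \<Longrightarrow> (\<lambda>M. M (i, j)) \<in> borel_measurable (LM n)"
  by (rule measurable_coord) simp

text \<open>Almost everywhere this is the number of real eigenvalues. The condition on the leading principal
  submatrix ensures that the corner entry can be solved for.\<close>

definition Nn :: "nat \<Rightarrow> (nat \<times> nat \<Rightarrow> real) \<Rightarrow> nat" where
  "Nn n M = card {x. poly (cp n M) x \<noteq> 0 \<and> poly (cp (Suc n) M) x = 0 \<and> poly (pderiv (cp (Suc n) M)) x \<noteq> 0}"

text \<open>The defining set contains inequations and is no zero set, so its cardinality is written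
  as a difference of two zero counts; sums of squares encode simultaneous vanishing.\<close>

lemma measurable_Nn: "Nn n \<in> measurable (LM (Suc n)) (count_space UNIV)"
proof -
  let ?P = "\<lambda>M x. poly (cp (Suc n) M) x" and ?T = "\<lambda>M x. poly (cp n M) x * poly (pderiv (cp (Suc n) M)) x"
  have fin: "finite {x. ?P M x = 0}" for M by (simp add: poly_roots_finite cp_monic)
  have eq: "Nn n M = card {x. ?P M x = 0} - card {x. (?P M x)\<^sup>2 + (?T M x)\<^sup>2 = 0}" for M
  proof -
    have "{x. poly (cp n M) x \<noteq> 0 \<and> ?P M x = 0 \<and> poly (pderiv (cp (Suc n) M)) x \<noteq> 0}
      = {x. ?P M x = 0} - {x. (?P M x)\<^sup>2 + (?T M x)\<^sup>2 = 0}"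
      by (auto simp: sum_power2_eq_zero_iff)
    moreover have sub: "{x. (?P M x)\<^sup>2 + (?T M x)\<^sup>2 = 0} \<subseteq> {x. ?P M x = 0}" by (auto simp: sum_power2_eq_zero_iff)
    ultimately show ?thesis
      unfolding Nn_def by (simp only:) (rule card_Diff_subset[OF finite_subset[OF sub fin] sub])
  qed
  have comp: "(\<lambda>M. M (i, j)) \<in> borel_measurable (LM (Suc n))" if "i < Suc n" "j < Suc n" for i j
    using that by (rule measurable_entry)
  have comp': "(\<lambda>M. M (i, j)) \<in> borel_measurable (LM (Suc n))" if "i < n" "j < n" for i j
    using comp that by simp
  have mP: "(\<lambda>M. ?P M t) \<in> borel_measurable (LM (Suc n))" for t
    by (rule measurable_poly_cp) (use comp in auto)
  have mT: "(\<lambda>M. ?T M t) \<in> borel_measurable (LM (Suc n))" for t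
    by (intro borel_measurable_times measurable_poly_cp measurable_poly_pderiv_cp) (use comp comp' in auto)
  have 1: "(\<lambda>M. card {x. ?P M x = 0}) \<in> measurable (LM (Suc n)) (count_space UNIV)"
    by (rule measurable_card_zeros) (auto intro: mP fin continuous_intros)
  have 2: "(\<lambda>M. card {x. (?P M x)\<^sup>2 + (?T M x)\<^sup>2 = 0}) \<in> measurable (LM (Suc n)) (count_space UNIV)"
  proof (rule measurable_card_zeros)
    fix M show "finite {t. (?P M t)\<^sup>2 + (?T M t)\<^sup>2 = 0}"
      by (rule finite_subset[OF _ fin[of M]]) (auto simp: sum_power2_eq_zero_iff)
  qed (auto intro!: continuous_intros borel_measurable_add borel_measurable_power mP mT)
  have "(\<lambda>M. card {x. ?P M x = 0} - card {x. (?P M x)\<^sup>2 + (?T M x)\<^sup>2 = 0}) \<in> measurable (LM (Suc n)) (count_space UNIV)"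
  proof -
    note [measurable] = 1 2
    show ?thesis by measurable
  qed
  moreover have "Nn n = (\<lambda>M. card {x. ?P M x = 0} - card {x. (?P M x)\<^sup>2 + (?T M x)\<^sup>2 = 0})"
    by (rule ext) (rule eq)
  ultimately show ?thesis by (simp only:)
qed

lemma blk_cong:
  "(\<And>i j. i < n \<Longrightarrow> j < n \<Longrightarrow> D (i, j) = D' (i, j)) \<Longrightarrow> (\<And>i. i < n \<Longrightarrow> c i = c' i) \<Longrightarrow> (\<And>j. j < n \<Longrightarrow> w j = w' j)
    \<Longrightarrow> a = a' \<Longrightarrow> blk n D w c a = blk n D' w' c' a'"
  unfolding blk_def by (rule restrict_ext) (auto split: prod.split)

lemma cp_blk_sub: "cp n (blk n D w c a) = cp n D"
  by (rule cp_cong) simp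

text \<open>With all other entries fixed, \<open>x\<close> is an eigenvalue counted by
  \<open>Nn\<close> iff it is a regular point of \<open>r / p\<close> with value \<open>a\<close>.
  So \<open>Nn\<close> counts preimages of \<open>a\<close>, and the area formula exchanges the
  integral over \<open>a\<close> for one over \<open>x\<close>.\<close>

lemma nn_integral_corner:
  fixes D :: "nat \<times> nat \<Rightarrow> real" and w c :: "nat \<Rightarrow> real" and n :: nat
  defines "r \<equiv> cp (Suc n) (blk n D w c 0)" and "p \<equiv> cp n D"
  assumes F: "F \<in> borel_measurable borel"
  shows "(\<integral>\<^sup>+a. F a * of_nat (Nn n (blk n D w c a)) \<partial>lborel) =
    (\<integral>\<^sup>+x. (if poly p x = 0 then 0 else F (poly r x / poly p x) *
      ennreal \<bar>(poly (pderiv r) x * poly p x - poly r x * poly (pderiv p) x) / (poly p x)\<^sup>2\<bar>) \<partial>lborel)"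
proof -
  define g where "g x = poly r x / poly p x" for x
  define g' where "g' x = (poly (pderiv r) x * poly p x - poly r x * poly (pderiv p) x) / (poly p x)\<^sup>2" for x
  define V where "V = {x. poly p x \<noteq> 0 \<and> g' x \<noteq> 0}"
  have V': "V = {x. poly p x \<noteq> 0} \<inter> {x. poly (pderiv r) x * poly p x - poly r x * poly (pderiv p) x \<noteq> 0}"
    by (auto simp: V_def g'_def)
  have "open V" unfolding V' by (intro open_Int open_Collect_neq continuous_intros)
  have shift: "cp (Suc n) (blk n D w c a) = r - [:a:] * p" for a
    unfolding r_def p_def by (rule cp_blk_shift_corner)
  have set: "{x \<in> V. g x = a} = {x. poly (cp n (blk n D w c a)) x \<noteq> 0 \<and> poly (cp (Suc n) (blk n D w c a)) x = 0 \<and>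
      poly (pderiv (cp (Suc n) (blk n D w c a))) x \<noteq> 0}" for a
  proof -
    have pd: "poly (pderiv (r - [:a:] * p)) x = poly (pderiv r) x - a * poly (pderiv p) x" for x
      unfolding pderiv_diff pderiv_mult by (simp add: pderiv_pCons)
    have "x \<in> V \<and> g x = a \<longleftrightarrow> poly p x \<noteq> 0 \<and> poly (r - [:a:] * p) x = 0 \<and> poly (pderiv (r - [:a:] * p)) x \<noteq> 0" for x
    proof (cases "poly p x \<noteq> 0 \<and> poly r x = a * poly p x")
      case True
      \<comment> \<open>At a solution the numerator of \<open>g'\<close> is \<open>p\<close> times
        the derivative of the characteristic polynomial, so the regular points of \<open>g\<close>
        are exactly the simple roots.\<close>
      hence "poly (pderiv r) x * poly p x - poly r x * poly (pderiv p) x = poly p x * (poly (pderiv r) x - a * poly (pderiv p) x)"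
        by (simp add: algebra_simps)
      thus ?thesis using True unfolding pd by (simp add: V' g_def)
    next
      case False
      thus ?thesis by (auto simp: V_def g_def field_simps)
    qed
    thus ?thesis unfolding shift cp_blk_sub p_def[symmetric] by blast
  qed
  have Nn: "Nn n (blk n D w c a) = card {x \<in> V. g x = a}" for a
    unfolding Nn_def set[symmetric] ..
  have fin: "finite {x \<in> V. g x = a}" for a
    unfolding set by (rule finite_subset[OF _ poly_roots_finite[of "cp (Suc n) (blk n D w c a)"]]) (auto simp: cp_monic)
  have "(\<integral>\<^sup>+a. F a * of_nat (Nn n (blk n D w c a)) \<partial>lborel) = (\<integral>\<^sup>+x. F (g x) * ennreal \<bar>g' x\<bar> * indicator V x \<partial>lborel)"
    unfolding Nn
  proof (rule nn_integral_area_formula[OF F \<open>open V\<close>])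
    show "(g has_real_derivative g' x) (at x)" if "x \<in> V" for x
      using that unfolding g_def[abs_def] g'_def V_def
      by (auto intro!: derivative_eq_intros simp: power2_eq_square)
    show "continuous_on V g'" unfolding g'_def[abs_def] V' by (intro continuous_intros) auto
  qed (use fin in \<open>auto simp: V_def\<close>)
  also have "\<dots> = (\<integral>\<^sup>+x. (if poly p x = 0 then 0 else F (g x) * ennreal \<bar>g' x\<bar>) \<partial>lborel)"
    by (intro nn_integral_cong) (auto simp: V_def split: split_indicator)
  finally show ?thesis unfolding g_def g'_def .
qed

text \<open>The last column of a bordered matrix with eigenvector \<open>(u, 1)\<close> and eigenvalue
  \<open>x\<close>.\<close>

definition cvec :: "nat \<Rightarrow> real \<Rightarrow> (nat \<times> nat \<Rightarrow> real) \<Rightarrow> (nat \<Rightarrow> real) \<Rightarrow> nat \<Rightarrow> real" where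
  "cvec n x D u = (\<lambda>i. x * u i - (\<Sum>j<n. D (i, j) * u j))"

definition sub_rank1 :: "(nat \<times> nat \<Rightarrow> real) \<Rightarrow> (nat \<Rightarrow> real) \<Rightarrow> (nat \<Rightarrow> real) \<Rightarrow> nat \<times> nat \<Rightarrow> real" where
  "sub_rank1 D u w = (\<lambda>(i, j). D (i, j) - u i * w j)"

lemma cp_blk_eigen:
  "cp (Suc n) (blk n D w (cvec n x D u) (x - (\<Sum>j<n. w j * u j))) = [:- x, 1:] * cp n (sub_rank1 D u w)"
proof -
  have "(\<lambda>(i, j). sub_rank1 D u w (i, j) + u i * w j) = D" by (auto simp: sub_rank1_def)
  thus ?thesis using cp_blk_conj[of n "sub_rank1 D u w" u w x] by (simp add: cvec_def)
qed

text \<open>The integrand once the bordered matrix is parametrised by the eigenvalue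
  \<open>x\<close>, the eigenvector \<open>(u, 1)\<close>, the row \<open>w\<close> and the block
  \<open>D\<close>. The last factor is what remains of the Kac--Rice density times the Jacobian of
  the column substitution.\<close>

definition Kf :: "nat \<Rightarrow> (real poly \<Rightarrow> ennreal) \<Rightarrow> real \<Rightarrow> (nat \<times> nat \<Rightarrow> real) \<Rightarrow> (nat \<Rightarrow> real) \<Rightarrow> (nat \<Rightarrow> real) \<Rightarrow> ennreal" where
  "Kf n h x D w u = h ([:- x, 1:] * cp n (sub_rank1 D u w)) * 
     ennreal (gw (sq2 (Suc n)) (blk n D w (cvec n x D u) (x - (\<Sum>j<n. w j * u j)))) * ennreal \<bar>poly (cp n (sub_rank1 D u w)) x\<bar>"

text \<open>The substitution \<open>c = (x - D) u\<close> has Jacobian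
  \<open>\<bar>p(x)\<bar>\<close>. Since \<open>r - a p\<close> is the product of the linear factor
  at \<open>x\<close> with a polynomial \<open>\<chi>\<close>, the derivative of
  \<open>r / p\<close> at \<open>x\<close> is \<open>\<chi>(x) / p(x)\<close>, and the two
  occurrences of \<open>p(x)\<close> cancel.\<close>

lemma nn_integral_column:
  fixes D :: "nat \<times> nat \<Rightarrow> real" and w :: "nat \<Rightarrow> real" and n :: nat
  assumes px: "poly (cp n D) x \<noteq> 0"
  assumes hm: "(\<lambda>M. h (cp (Suc n) M)) \<in> borel_measurable (LM (Suc n))"
  defines "r \<equiv> (\<lambda>c. cp (Suc n) (blk n D w c 0))" and "p \<equiv> cp n D"
  defines "\<Phi> \<equiv> (\<lambda>M. h (cp (Suc n) M) * ennreal (gw (sq2 (Suc n)) M))"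
  shows "(\<integral>\<^sup>+c. \<Phi> (blk n D w c (poly (r c) x / poly p x)) *
      ennreal \<bar>(poly (pderiv (r c)) x * poly p x - poly (r c) x * poly (pderiv p) x) / (poly p x)\<^sup>2\<bar> \<partial>LB {..<n})
    = (\<integral>\<^sup>+u. Kf n h x D w u \<partial>LB {..<n})"
proof -
  define A where "A = mat n n (\<lambda>(i, j). (if i = j then x else 0) - D (i, j))"
  have A: "A \<in> carrier_mat n n" and dA: "det A = poly p x" by (auto simp: A_def p_def poly_cp)
  let ?G = "\<lambda>c. \<Phi> (blk n D w c (poly (r c) x / poly p x)) *
      ennreal \<bar>(poly (pderiv (r c)) x * poly p x - poly (r c) x * poly (pderiv p) x) / (poly p x)\<^sup>2\<bar>"
  have \<Phi>m: "\<Phi> \<in> borel_measurable (LM (Suc n))"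
    unfolding \<Phi>_def by (intro borel_measurable_times_ennreal hm measurable_compose[OF measurable_gw measurable_ennreal])
       (auto intro: measurable_coord)
  have c: "(\<lambda>c. c i) \<in> borel_measurable (LB {..<n})" if "i < n" for i using that by (intro measurable_coord) simp
  have ent: "(\<lambda>c. blk n D w c 0 (i, j)) \<in> borel_measurable (LB {..<n})" if "i < Suc n" "j < Suc n" for i j
  proof -
    have "i < n \<or> i = n" "j < n \<or> j = n" using that by auto
    thus ?thesis by (elim disjE) (simp_all add: c)
  qed
  have rm: "(\<lambda>c. poly (r c) x) \<in> borel_measurable (LB {..<n})" "(\<lambda>c. poly (pderiv (r c)) x) \<in> borel_measurable (LB {..<n})"
    unfolding r_def by (auto intro!: measurable_poly_cp measurable_poly_pderiv_cp ent)
  have bm: "(\<lambda>c. blk n D w c (poly (r c) x / poly p x)) \<in> measurable (LB {..<n}) (LM (Suc n))"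
    using rm by (intro measurable_blk) (auto intro: c)
  have G: "?G \<in> borel_measurable (LB {..<n})"
  proof -
    note [measurable] = rm
    show ?thesis by (intro borel_measurable_times_ennreal measurable_compose[OF bm \<Phi>m]) measurable
  qed
  have "(\<integral>\<^sup>+c. ?G c \<partial>LB {..<n}) = ennreal \<bar>poly p x\<bar> * (\<integral>\<^sup>+u. ?G (mv n A u) \<partial>LB {..<n})"
    using nn_LB_linear[OF A _ G] dA px by (simp add: p_def)
  also have "\<dots> = (\<integral>\<^sup>+u. ennreal \<bar>poly p x\<bar> * ?G (mv n A u) \<partial>LB {..<n})"
    by (rule nn_integral_cmult[symmetric]) (rule measurable_compose[OF measurable_mv G])
  also have "\<dots> = (\<integral>\<^sup>+u. Kf n h x D w u \<partial>LB {..<n})"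
  proof (rule nn_integral_cong)
    fix u :: "nat \<Rightarrow> real"
    let ?c = "mv n A u" and ?a = "x - (\<Sum>j<n. w j * u j)" and ?\<chi> = "cp n (sub_rank1 D u w)"
    have ci: "?c i = cvec n x D u i" if "i < n" for i
    proof -
      have "?c i = (\<Sum>j<n. (if j = i then x * u j else 0) - D (i, j) * u j)"
        using that by (auto simp: mv_def A_def algebra_simps intro!: sum.cong)
      thus ?thesis using that by (simp add: cvec_def sum_subtractf)
    qed
    have bl: "blk n D w ?c a = blk n D w (cvec n x D u) a" for a by (rule blk_cong) (auto simp: ci)
    have e: "r ?c - [:?a:] * p = [:- x, 1:] * ?\<chi>"
      using cp_blk_eigen[of n D w x u] cp_blk_shift_corner[of n D w "cvec n x D u" ?a] bl[of 0]
      by (simp add: r_def p_def)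
    have "poly (r ?c - [:?a:] * p) x = 0" unfolding e by simp
    hence ra: "poly (r ?c) x = ?a * poly p x" by simp
    have "poly (pderiv (r ?c - [:?a:] * p)) x = poly ?\<chi> x" unfolding e pderiv_mult by (simp add: pderiv_pCons)
    hence rd: "poly (pderiv (r ?c)) x - ?a * poly (pderiv p) x = poly ?\<chi> x" 
      unfolding pderiv_diff pderiv_mult by (simp add: pderiv_pCons)
    have p0: "poly p x \<noteq> 0" using px by (simp add: p_def)
    have a: "poly (r ?c) x / poly p x = ?a" using ra p0 by simp
    have "(poly (pderiv (r ?c)) x * poly p x - poly (r ?c) x * poly (pderiv p) x) = poly p x * poly ?\<chi> x"
      unfolding ra rd[symmetric] by (simp add: algebra_simps)
    hence d: "(poly (pderiv (r ?c)) x * poly p x - poly (r ?c) x * poly (pderiv p) x) / (poly p x)\<^sup>2 = poly ?\<chi> x / poly p x"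
      using p0 by (simp add: power2_eq_square)
    have "ennreal \<bar>poly p x\<bar> * ennreal \<bar>poly ?\<chi> x / poly p x\<bar> = ennreal \<bar>poly ?\<chi> x\<bar>"
      using p0 by (subst ennreal_mult[symmetric]) (auto simp: abs_divide)
    hence "ennreal \<bar>poly p x\<bar> * (Z * ennreal \<bar>poly ?\<chi> x / poly p x\<bar>) = Z * ennreal \<bar>poly ?\<chi> x\<bar>" for Z
      by (metis mult.left_commute)
    thus "ennreal \<bar>poly p x\<bar> * ?G ?c = Kf n h x D w u"
      unfolding a d bl \<Phi>_def cp_blk_eigen Kf_def .
  qed
  finally show ?thesis .
qed

text \<open>A linear factor times a characteristic polynomial is the characteristic polynomial of a
  matrix with zero border and corner \<open>x\<close>, so the measurability in \<open>hm\<close>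
  carries over.\<close>

lemma measurable_h_linear:
  assumes hm: "(\<lambda>M. h (cp (Suc n) M)) \<in> borel_measurable (LM (Suc n))"
    and B: "\<And>i j. i < n \<Longrightarrow> j < n \<Longrightarrow> (\<lambda>z. B z (i, j)) \<in> borel_measurable N" and x: "x \<in> borel_measurable N"
  shows "(\<lambda>z. h ([:- x z, 1:] * cp n (B z))) \<in> borel_measurable N"
proof -
  have "(\<lambda>z. h (cp (Suc n) (blk n (B z) (\<lambda>_. 0) (\<lambda>_. 0) (x z)))) \<in> borel_measurable N"
    by (rule measurable_compose[OF measurable_blk hm]) (use B x in auto)
  moreover have "cp (Suc n) (blk n (B z) (\<lambda>_. 0) (\<lambda>_. 0) (x z)) = [:- x z, 1:] * cp n (B z)" for z
    unfolding cp_blk_border by simp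
  ultimately show ?thesis by simp
qed

lemma measurable_Kf:
  assumes hm: "(\<lambda>M. h (cp (Suc n) M)) \<in> borel_measurable (LM (Suc n))"
    and D: "\<And>i j. i < n \<Longrightarrow> j < n \<Longrightarrow> (\<lambda>z. D z (i, j)) \<in> borel_measurable N" and x: "x \<in> borel_measurable N"
    and w: "\<And>j. j < n \<Longrightarrow> (\<lambda>z. w z j) \<in> borel_measurable N"
    and u: "\<And>j. j < n \<Longrightarrow> (\<lambda>z. u z j) \<in> borel_measurable N"
  shows "(\<lambda>z. Kf n h (x z) (D z) (w z) (u z)) \<in> borel_measurable N"
proof -
  have s: "(\<lambda>z. sub_rank1 (D z) (u z) (w z) (i, j)) \<in> borel_measurable N" if "i < n" "j < n" for i j
    unfolding sub_rank1_def using that by (auto intro!: borel_measurable_diff borel_measurable_times D u w)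
  have c: "(\<lambda>z. cvec n (x z) (D z) (u z) i) \<in> borel_measurable N" if "i < n" for i
    unfolding cvec_def using that by (intro borel_measurable_diff borel_measurable_times borel_measurable_sum x D u) auto
  have a: "(\<lambda>z. x z - (\<Sum>j<n. w z j * u z j)) \<in> borel_measurable N"
    by (intro borel_measurable_diff borel_measurable_times borel_measurable_sum x w u) auto
  have g: "gw (sq2 (Suc n)) \<in> borel_measurable (LM (Suc n))"
    by (rule measurable_gw) (rule measurable_coord)
  have p: "(\<lambda>z. poly (cp n (sub_rank1 (D z) (u z) (w z))) (x z)) \<in> borel_measurable N"
    by (rule measurable_poly_cp[where n = n and X = "\<lambda>z. sub_rank1 (D z) (u z) (w z)", OF s x])
  show ?thesis
    unfolding Kf_def
    by (intro borel_measurable_times_ennreal measurable_h_linear[where B = "\<lambda>z. sub_rank1 (D z) (u z) (w z)", OF hm s x] measurable_compose[OF _ measurable_ennreal]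
      measurable_compose[OF measurable_blk[where D = D and w = w and c = "\<lambda>z. cvec n (x z) (D z) (u z)", OF D w c a] g] borel_measurable_abs p) auto
qed

text \<open>Contribution of the variables \<open>w\<close> and \<open>u\<close>, which decouple from
  \<open>x\<close> and \<open>B\<close> after the substitutions; evaluated in
  \<open>Kc_eq\<close>.\<close>

definition Kc :: "nat \<Rightarrow> ennreal" where
  "Kc n = ennreal (sqrt (2 * pi) ^ n) * (\<integral>\<^sup>+u. ennreal (1 / qn n u ^ Suc n) \<partial>LB {..<n})"

lemma measurable_qn: "(\<lambda>u. 1 / qn n u ^ Suc n) \<in> borel_measurable (LB {..<n})"
proof -
  have [measurable]: "(\<lambda>u. u i) \<in> borel_measurable (LB {..<n})" if "i \<in> {..<n}" for i
    using that by (rule measurable_coord)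
  have [measurable]: "(\<lambda>u. \<Sum>i<n. (u i)\<^sup>2) \<in> borel_measurable (LB {..<n})"
    by (intro borel_measurable_sum borel_measurable_power) measurable
  show ?thesis unfolding qn_def by measurable
qed

lemma measurable_gauss_1: "(\<lambda>x :: real. ennreal (exp (- x\<^sup>2 / 2))) \<in> borel_measurable lborel"
  by measurable

text \<open>Five substitutions, each with the other variables fixed: the corner becomes the
  eigenvalue \<open>x\<close>, the column the eigenvector \<open>u\<close>, the block
  \<open>D\<close> becomes \<open>B + u w^T\<close>, the row \<open>w\<close> is integrated out as a
  Gaussian, and the conjugation of \<open>B\<close> by the square roots is removed. The interchanges
  in between bring the next variable inward. The function \<open>h\<close> sees only the
  characteristic polynomial, which is known at every stage.\<close>

theorem nn_integral_deflation:
  assumes hm: "(\<lambda>M. h (cp (Suc n) M)) \<in> borel_measurable (LM (Suc n))"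
  shows "(\<integral>\<^sup>+M. of_nat (Nn n M) * (h (cp (Suc n) M) * ennreal (gw (sq2 (Suc n)) M)) \<partial>LM (Suc n)) =
    Kc n * (\<integral>\<^sup>+x. ennreal (exp (- x\<^sup>2 / 2)) *
      (\<integral>\<^sup>+B. h ([:- x, 1:] * cp n B) * ennreal \<bar>poly (cp n B) x\<bar> * ennreal (gw (sq2 n) B) \<partial>LM n) \<partial>lborel)"
proof -
  let ?V = "LB {..<n} :: (nat \<Rightarrow> real) measure"
  define \<Phi> where "\<Phi> M = h (cp (Suc n) M) * ennreal (gw (sq2 (Suc n)) M)" for M
  have sV: "sigma_finite_measure ?V" and sL: "sigma_finite_measure (LM n)" and s1: "sigma_finite_measure (lborel :: real measure)"
    by (auto intro: sigma_finite_LB lborel.sigma_finite_measure_axioms)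
  have \<Phi>m: "\<Phi> \<in> borel_measurable (LM (Suc n))"
    unfolding \<Phi>_def by (intro borel_measurable_times_ennreal hm measurable_compose[OF measurable_gw measurable_ennreal])
       (auto intro: measurable_coord)
  have [measurable]: "(\<lambda>D. D (i, j)) \<in> borel_measurable (LM n)" if "i < n" "j < n" for i j
    using that by (rule measurable_entry)
  have [measurable]: "(\<lambda>u. u i) \<in> borel_measurable ?V" if "i < n" for i
    using that by (intro measurable_coord) simp
  note K = measurable_Kf[OF hm]
  define J where "J D w c x = (if poly (cp n D) x = 0 then 0 else \<Phi> (blk n D w c (poly (cp (Suc n) (blk n D w c 0)) x / poly (cp n D) x)) *
      ennreal \<bar>(poly (pderiv (cp (Suc n) (blk n D w c 0))) x * poly (cp n D) x - poly (cp (Suc n) (blk n D w c 0)) x * poly (pderiv (cp n D)) x) / (poly (cp n D) x)\<^sup>2\<bar>)"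
    for D w c x
  have Jm: "(\<lambda>p. J D w (fst p) (snd p)) \<in> borel_measurable (?V \<Otimes>\<^sub>M lborel)" for D w
  proof -
    let ?N = "?V \<Otimes>\<^sub>M (lborel :: real measure)"
    have c: "(\<lambda>p. fst p i) \<in> borel_measurable ?N" if "i < n" for i using that by measurable
    have s: "snd \<in> borel_measurable ?N" by measurable
    have ent: "(\<lambda>p. blk n D w (fst p) 0 (i, j)) \<in> borel_measurable ?N" if "i < Suc n" "j < Suc n" for i j
    proof -
      have "i < n \<or> i = n" "j < n \<or> j = n" using that by auto
      thus ?thesis by (elim disjE) (simp_all add: c)
    qed
    have r[measurable]: "(\<lambda>p. poly (cp (Suc n) (blk n D w (fst p) 0)) (snd p)) \<in> borel_measurable ?N"
      "(\<lambda>p. poly (pderiv (cp (Suc n) (blk n D w (fst p) 0))) (snd p)) \<in> borel_measurable ?N"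
      by (auto intro!: measurable_poly_cp measurable_poly_pderiv_cp ent s)
    have q[measurable]: "(\<lambda>p. poly (cp n D) (snd p)) \<in> borel_measurable ?N" "(\<lambda>p. poly (pderiv (cp n D)) (snd p)) \<in> borel_measurable ?N"
      by (auto intro!: measurable_poly_cp measurable_poly_pderiv_cp s)
    have bm: "(\<lambda>p. blk n D w (fst p) (poly (cp (Suc n) (blk n D w (fst p) 0)) (snd p) / poly (cp n D) (snd p))) \<in> measurable ?N (LM (Suc n))"
      by (rule measurable_blk) (use c in \<open>auto intro!: borel_measurable_divide r q\<close>)
    have [measurable]: "(\<lambda>p. \<Phi> (blk n D w (fst p) (poly (cp (Suc n) (blk n D w (fst p) 0)) (snd p) / poly (cp n D) (snd p)))) \<in> borel_measurable ?N"
      by (rule measurable_compose[OF bm \<Phi>m])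
    show ?thesis unfolding J_def by measurable
  qed
  have col: "(\<integral>\<^sup>+c. J D w c x \<partial>?V) = (if poly (cp n D) x = 0 then 0 else \<integral>\<^sup>+u. Kf n h x D w u \<partial>?V)" for D w x
    using nn_integral_column[OF _ hm, of D x w] by (simp add: J_def \<Phi>_def)
  \<comment> \<open>The roots of \<open>cp n D\<close> are finitely many, so the guard against
    division by zero may be dropped under the integral over \<open>x\<close>.\<close>
  have ae: "(\<integral>\<^sup>+x. (if poly (cp n D) x = 0 then 0 else G x) \<partial>lborel) = (\<integral>\<^sup>+x. G x \<partial>lborel)" for D G
  proof (rule nn_integral_cong_AE)
    have "finite {x. poly (cp n D) x = 0}" by (simp add: poly_roots_finite cp_monic)
    hence "AE x in lborel. x \<notin> {x. poly (cp n D) x = 0}"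
      by (intro AE_not_in finite_imp_null_set_lborel)
    thus "AE x in lborel. (if poly (cp n D) x = 0 then 0 else G x) = G x" by eventually_elim simp
  qed
  have "(\<integral>\<^sup>+M. of_nat (Nn n M) * (h (cp (Suc n) M) * ennreal (gw (sq2 (Suc n)) M)) \<partial>LM (Suc n)) =
    (\<integral>\<^sup>+M. \<Phi> M * of_nat (Nn n M) \<partial>LM (Suc n))"
    by (simp add: \<Phi>_def mult.commute)
  also have "\<dots> = (\<integral>\<^sup>+D. \<integral>\<^sup>+w. \<integral>\<^sup>+c. \<integral>\<^sup>+a. \<Phi> (blk n D w c a) * of_nat (Nn n (blk n D w c a)) \<partial>lborel \<partial>?V \<partial>?V \<partial>LM n)"
  proof (rule nn_LM_Suc)
    note [measurable] = \<Phi>m measurable_Nn[of n]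
    show "(\<lambda>M. \<Phi> M * of_nat (Nn n M)) \<in> borel_measurable (LM (Suc n))" by measurable
  qed
  also have "\<dots> = (\<integral>\<^sup>+D. \<integral>\<^sup>+w. \<integral>\<^sup>+c. \<integral>\<^sup>+x. J D w c x \<partial>lborel \<partial>?V \<partial>?V \<partial>LM n)"
  proof (rule nn_integral_cong, rule nn_integral_cong, rule nn_integral_cong)
    fix D w c
    have "(\<lambda>a. \<Phi> (blk n D w c a)) \<in> borel_measurable borel"
      by (rule measurable_compose[OF measurable_blk \<Phi>m]) auto
    from nn_integral_corner[OF this]
    show "(\<integral>\<^sup>+a. \<Phi> (blk n D w c a) * of_nat (Nn n (blk n D w c a)) \<partial>lborel) = (\<integral>\<^sup>+x. J D w c x \<partial>lborel)"
      by (simp add: J_def)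
  qed
  also have "\<dots> = (\<integral>\<^sup>+D. \<integral>\<^sup>+w. \<integral>\<^sup>+x. \<integral>\<^sup>+c. J D w c x \<partial>?V \<partial>lborel \<partial>?V \<partial>LM n)"
    by (rule nn_integral_cong, rule nn_integral_cong, intro nn_swap sV s1) (use Jm in \<open>simp add: split_beta'\<close>)
  also have "\<dots> = (\<integral>\<^sup>+D. \<integral>\<^sup>+w. \<integral>\<^sup>+x. \<integral>\<^sup>+u. Kf n h x D w u \<partial>?V \<partial>lborel \<partial>?V \<partial>LM n)"
    by (simp add: col ae)
  also have "\<dots> = (\<integral>\<^sup>+D. \<integral>\<^sup>+x. \<integral>\<^sup>+w. \<integral>\<^sup>+u. Kf n h x D w u \<partial>?V \<partial>?V \<partial>lborel \<partial>LM n)"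
    by (rule nn_integral_cong, intro nn_swap sV s1, unfold split_beta', intro measurable_nn_integral_snd[OF sV] K; measurable)
  also have "\<dots> = (\<integral>\<^sup>+x. \<integral>\<^sup>+D. \<integral>\<^sup>+w. \<integral>\<^sup>+u. Kf n h x D w u \<partial>?V \<partial>?V \<partial>LM n \<partial>lborel)"
    by (intro nn_swap sL s1, unfold split_beta', intro measurable_nn_integral_snd[OF sV] K; measurable)
  also have "\<dots> = (\<integral>\<^sup>+x. \<integral>\<^sup>+D. \<integral>\<^sup>+u. \<integral>\<^sup>+w. Kf n h x D w u \<partial>?V \<partial>?V \<partial>LM n \<partial>lborel)"
    by (rule nn_integral_cong, rule nn_integral_cong, intro nn_swap sV, unfold split_beta', intro K; measurable)
  also have "\<dots> = (\<integral>\<^sup>+x. \<integral>\<^sup>+u. \<integral>\<^sup>+D. \<integral>\<^sup>+w. Kf n h x D w u \<partial>?V \<partial>LM n \<partial>?V \<partial>lborel)"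
    by (rule nn_integral_cong, intro nn_swap sV sL, unfold split_beta', intro measurable_nn_integral_snd[OF sV] K; measurable)
  also have "\<dots> = (\<integral>\<^sup>+x. \<integral>\<^sup>+u. \<integral>\<^sup>+w. \<integral>\<^sup>+D. Kf n h x D w u \<partial>LM n \<partial>?V \<partial>?V \<partial>lborel)"
    by (rule nn_integral_cong, rule nn_integral_cong, intro nn_swap sV sL, unfold split_beta', intro K; measurable)
  \<comment> \<open>With \<open>u\<close> and \<open>w\<close> fixed, passing from \<open>D\<close>
    to \<open>B + u w^T\<close> is a translation of the block; it makes \<open>B\<close> the
    argument of the remaining characteristic polynomial.\<close>
  also have "\<dots> = (\<integral>\<^sup>+x. \<integral>\<^sup>+u. \<integral>\<^sup>+w. \<integral>\<^sup>+B. Kf n h x (\<lambda>p. B p + u (fst p) * w (snd p)) w u \<partial>LM n \<partial>?V \<partial>?V \<partial>lborel)"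
  proof (rule nn_integral_cong, rule nn_integral_cong, rule nn_integral_cong)
    fix x u w
    have cong: "Kf n h x D w u = Kf n h x D' w u" if "\<And>p. p \<in> sq2 n \<Longrightarrow> D p = D' p" for D D'
    proof -
      have "cp n (sub_rank1 D u w) = cp n (sub_rank1 D' u w)" by (rule cp_cong) (simp add: sub_rank1_def that)
      moreover have "blk n D w (cvec n x D u) a = blk n D' w (cvec n x D' u) a" for a
        by (rule blk_cong) (auto simp: that cvec_def)
      ultimately show ?thesis unfolding Kf_def by simp
    qed
    have m: "(\<lambda>D. Kf n h x D w u) \<in> borel_measurable (LM n)" by (intro K; measurable)
    have "(\<integral>\<^sup>+D. Kf n h x D w u \<partial>LM n) = (\<integral>\<^sup>+B. Kf n h x (\<lambda>p\<in>sq2 n. B p + u (fst p) * w (snd p)) w u \<partial>LM n)"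
      using nn_LB_translate[OF _ m, of "\<lambda>p. u (fst p) * w (snd p)"] by simp
    also have "\<dots> = (\<integral>\<^sup>+B. Kf n h x (\<lambda>p. B p + u (fst p) * w (snd p)) w u \<partial>LM n)"
      by (intro nn_integral_cong cong) simp
    finally show "(\<integral>\<^sup>+D. Kf n h x D w u \<partial>LM n) = (\<integral>\<^sup>+B. Kf n h x (\<lambda>p. B p + u (fst p) * w (snd p)) w u \<partial>LM n)" .
  qed
  also have "\<dots> = (\<integral>\<^sup>+x. \<integral>\<^sup>+u. \<integral>\<^sup>+B. \<integral>\<^sup>+w. Kf n h x (\<lambda>p. B p + u (fst p) * w (snd p)) w u \<partial>?V \<partial>LM n \<partial>?V \<partial>lborel)"
    by (rule nn_integral_cong, rule nn_integral_cong, intro nn_swap sV sL, unfold split_beta', intro K; (unfold fst_conv snd_conv)?; measurable)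
  also have "\<dots> = (\<integral>\<^sup>+x. \<integral>\<^sup>+u. ennreal (exp (- x\<^sup>2 / 2)) * (\<integral>\<^sup>+B. h ([:- x, 1:] * cp n B) * ennreal \<bar>poly (cp n B) x\<bar> * ennreal (gw (sq2 n) B) \<partial>LM n) *
       ennreal (sqrt (2 * pi) ^ n) * ennreal (1 / qn n u ^ Suc n) \<partial>?V \<partial>lborel)"
  proof (rule nn_integral_cong, rule nn_integral_cong)
    fix x :: real and u :: "nat \<Rightarrow> real"
    define f where "f B = h ([:- x, 1:] * cp n B) * ennreal \<bar>poly (cp n B) x\<bar> * ennreal (gw (sq2 n) B)" for B
    let ?C = "conjm n (Sm n u) (Rm n u)"
    have fm: "f \<in> borel_measurable (LM n)"
      unfolding f_def
      by (intro borel_measurable_times_ennreal measurable_h_linear[OF hm] measurable_compose[OF _ measurable_ennreal] measurable_gw borel_measurable_abs measurable_poly_cp)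
         (auto intro: measurable_coord)
    \<comment> \<open>\<open>v\<close> depends on \<open>B\<close>, \<open>u\<close> and
      \<open>x\<close> but not on \<open>w\<close>; this makes the integral over \<open>w\<close> a
      shifted Gaussian one.\<close>
    have ex: "\<exists>v. \<forall>w. Kf n h x (\<lambda>p. B p + u (fst p) * w (snd p)) w u =
       (ennreal (exp (- x\<^sup>2 / 2)) * f (?C B)) * ennreal (exp (- (\<Sum>j<n. (qn n u * mv n (Rm n u) w j + v j)\<^sup>2) / 2))" for B
    proof (intro exI allI)
      fix w
      let ?D = "\<lambda>(i, j). B (i, j) + u i * w j"
      define v where "v = (\<lambda>j. ((\<Sum>i<n. B (i, j) * u i) + (\<Sum>l<n. (\<Sum>i<n. B (i, l) * u i) * u l) * u j / (qn n u + 1) - x * qn n u * u j) / qn n u)"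
      have D: "(\<lambda>p. B p + u (fst p) * w (snd p)) = ?D" by (auto simp: split_beta)
      have s: "sub_rank1 ?D u w = B" by (auto simp: sub_rank1_def)
      have g: "gw (sq2 (Suc n)) (blk n ?D w (cvec n x ?D u) (x - (\<Sum>j<n. w j * u j))) =
        exp (- x\<^sup>2 / 2) * gw (sq2 n) (?C B) * exp (- (\<Sum>j<n. (qn n u * mv n (Rm n u) w j + v j)\<^sup>2) / 2)"
        unfolding gw_def cvec_def sqn_blk_conj v_def exp_add[symmetric] by (simp add: algebra_simps add_divide_distrib diff_divide_distrib)
      \<comment> \<open>Conjugation preserves the characteristic polynomial, so weight and remaining
        factors are together the function \<open>f\<close> at the conjugated matrix, and
        \<open>nn_LM_conj\<close> applies.\<close>
      have c: "cp n (?C B) = cp n B" by (rule cp_conjm) (auto simp: Rm_Sm)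
      show "Kf n h x (\<lambda>p. B p + u (fst p) * w (snd p)) w u =
       (ennreal (exp (- x\<^sup>2 / 2)) * f (?C B)) * ennreal (exp (- (\<Sum>j<n. (qn n u * mv n (Rm n u) w j + v j)\<^sup>2) / 2))"
        unfolding D Kf_def s g f_def c by (simp add: ennreal_mult gw_def mult_ac del: mult_pCons_left)
    qed
    have inner: "(\<integral>\<^sup>+w. Kf n h x (\<lambda>p. B p + u (fst p) * w (snd p)) w u \<partial>?V) =
       f (?C B) * (ennreal (exp (- x\<^sup>2 / 2)) * ennreal (sqrt (2 * pi) ^ n / qn n u ^ Suc n))" for B
    proof -
      obtain v where v: "\<And>w. Kf n h x (\<lambda>p. B p + u (fst p) * w (snd p)) w u =
       (ennreal (exp (- x\<^sup>2 / 2)) * f (?C B)) * ennreal (exp (- (\<Sum>j<n. (qn n u * mv n (Rm n u) w j + v j)\<^sup>2) / 2))"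
        using ex by blast
      have [measurable]: "(\<lambda>w. mv n (Rm n u) w j) \<in> borel_measurable ?V" if "j \<in> {..<n}" for j
        using that by (intro measurable_compose[OF measurable_mv measurable_coord])
      have [measurable]: "(\<lambda>w. \<Sum>j<n. (qn n u * mv n (Rm n u) w j + v j)\<^sup>2) \<in> borel_measurable ?V"
        by (intro borel_measurable_sum borel_measurable_power borel_measurable_add borel_measurable_times) measurable
      have "(\<integral>\<^sup>+w. Kf n h x (\<lambda>p. B p + u (fst p) * w (snd p)) w u \<partial>?V) =
        (ennreal (exp (- x\<^sup>2 / 2)) * f (?C B)) * (\<integral>\<^sup>+w. ennreal (exp (- (\<Sum>j<n. (qn n u * mv n (Rm n u) w j + v j)\<^sup>2) / 2)) \<partial>?V)"
        unfolding v by (rule nn_integral_cmult) measurable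
      thus ?thesis unfolding nn_integral_gauss_Rm by (simp only: mult_ac)
    qed
    have "(\<integral>\<^sup>+B. \<integral>\<^sup>+w. Kf n h x (\<lambda>p. B p + u (fst p) * w (snd p)) w u \<partial>?V \<partial>LM n) =
       (\<integral>\<^sup>+B. f B * (ennreal (exp (- x\<^sup>2 / 2)) * ennreal (sqrt (2 * pi) ^ n / qn n u ^ Suc n)) \<partial>LM n)"
      unfolding inner using fm by (intro nn_LM_conj) (auto simp: Rm_Sm)
    also have "\<dots> = (\<integral>\<^sup>+B. f B \<partial>LM n) * (ennreal (exp (- x\<^sup>2 / 2)) * ennreal (sqrt (2 * pi) ^ n / qn n u ^ Suc n))"
      by (rule nn_integral_multc[OF fm])
    also have "ennreal (sqrt (2 * pi) ^ n / qn n u ^ Suc n) = ennreal (sqrt (2 * pi) ^ n) * ennreal (1 / qn n u ^ Suc n)"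
      using qn_ge1[of n u] by (subst ennreal_mult[symmetric]) auto
    finally show "(\<integral>\<^sup>+B. \<integral>\<^sup>+w. Kf n h x (\<lambda>p. B p + u (fst p) * w (snd p)) w u \<partial>?V \<partial>LM n) =
      ennreal (exp (- x\<^sup>2 / 2)) * (\<integral>\<^sup>+B. h ([:- x, 1:] * cp n B) * ennreal \<bar>poly (cp n B) x\<bar> * ennreal (gw (sq2 n) B) \<partial>LM n) *
       ennreal (sqrt (2 * pi) ^ n) * ennreal (1 / qn n u ^ Suc n)"
      unfolding f_def by (simp only: mult_ac)
  qed
  also have "\<dots> = (\<integral>\<^sup>+x. ennreal (exp (- x\<^sup>2 / 2)) * (\<integral>\<^sup>+B. h ([:- x, 1:] * cp n B) * ennreal \<bar>poly (cp n B) x\<bar> * ennreal (gw (sq2 n) B) \<partial>LM n) * Kc n \<partial>lborel)"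
    unfolding Kc_def mult.assoc
    by (rule nn_integral_cong, subst nn_integral_cmult[symmetric]) (use measurable_qn in \<open>auto simp: nn_integral_cmult mult.assoc\<close>)
  also have "\<dots> = (\<integral>\<^sup>+x. ennreal (exp (- x\<^sup>2 / 2)) * (\<integral>\<^sup>+B. h ([:- x, 1:] * cp n B) * ennreal \<bar>poly (cp n B) x\<bar> * ennreal (gw (sq2 n) B) \<partial>LM n) \<partial>lborel) * Kc n"
  proof (rule nn_integral_multc)
    have c: "(\<lambda>p. snd p q) \<in> borel_measurable (lborel \<Otimes>\<^sub>M LM n :: (real \<times> _) measure)" if "q \<in> sq2 n" for q
      by (rule measurable_compose[OF measurable_snd measurable_coord[OF that]])
    have f: "fst \<in> borel_measurable (lborel \<Otimes>\<^sub>M LM n :: (real \<times> _) measure)" by measurable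
    have "(\<lambda>x. \<integral>\<^sup>+B. h ([:- x, 1:] * cp n B) * ennreal \<bar>poly (cp n B) x\<bar> * ennreal (gw (sq2 n) B) \<partial>LM n) \<in> borel_measurable lborel"
      by (intro measurable_nn_integral_snd[OF sL] borel_measurable_times_ennreal measurable_h_linear[OF hm] measurable_compose[OF _ measurable_ennreal]
         measurable_gw borel_measurable_abs measurable_poly_cp c f) auto
    thus "(\<lambda>x. ennreal (exp (- x\<^sup>2 / 2)) * (\<integral>\<^sup>+B. h ([:- x, 1:] * cp n B) * ennreal \<bar>poly (cp n B) x\<bar> * ennreal (gw (sq2 n) B) \<partial>LM n)) \<in> borel_measurable lborel"
      by (rule borel_measurable_times_ennreal[OF measurable_gauss_1])
  qed
  finally show ?thesis by (simp only: mult.commute)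
qed

section \<open>Almost every matrix is generic\<close>

definition simple_roots :: "real poly \<Rightarrow> bool" where
  "simple_roots p \<longleftrightarrow> (\<forall>x. poly p x = 0 \<longrightarrow> poly (pderiv p) x \<noteq> 0)"

definition generic :: "nat \<Rightarrow> (nat \<times> nat \<Rightarrow> real) \<Rightarrow> bool" where
  "generic n M \<longleftrightarrow> (\<forall>x. poly (cp (Suc n) M) x = 0 \<longrightarrow> poly (cp n M) x \<noteq> 0) \<and> simple_roots (cp (Suc n) M)"

lemma nr_simple:
  assumes "p \<noteq> 0" "simple_roots p"
  shows "nr p = card {x. poly p x = 0}"
proof -
  have "order x p = 1" if "poly p x = 0" for x
  proof -
    have "order x (pderiv p) = 0" using that assms by (auto simp: simple_roots_def intro: order_0I)
    thus ?thesis using order_pderiv[OF assms(1) that] by simp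
  qed
  thus ?thesis by (simp add: nr_def)
qed

lemma Nn_generic:
  assumes "generic n M"
  shows "Nn n M = nr (cp (Suc n) M)"
proof -
  have "{x. poly (cp n M) x \<noteq> 0 \<and> poly (cp (Suc n) M) x = 0 \<and> poly (pderiv (cp (Suc n) M)) x \<noteq> 0} = {x. poly (cp (Suc n) M) x = 0}"
    using assms by (auto simp: generic_def simple_roots_def)
  thus ?thesis using assms by (simp add: Nn_def nr_simple cp_monic generic_def)
qed

lemma exists_zero_measurable:
  fixes G :: "'a \<Rightarrow> real \<Rightarrow> real"
  assumes "\<And>x. x \<in> space M \<Longrightarrow> continuous_on UNIV (G x)" "\<And>t. (\<lambda>x. G x t) \<in> borel_measurable M"
  shows "{x \<in> space M. \<exists>t. G x t = 0} \<in> sets M"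
proof -
  have "\<exists>k::nat. t \<in> {- (real k + 1)..real k + 1}" for t :: real
  proof -
    obtain k :: nat where "\<bar>t\<bar> \<le> real k" using real_arch_simple by blast
    thus ?thesis by (intro exI[of _ k]) auto
  qed
  hence "(\<exists>t. G x t = 0) \<longleftrightarrow> (\<exists>k::nat. \<exists>t\<in>{- (real k + 1)..real k + 1}. G x t = 0)" for x
    by metis
  hence "{x \<in> space M. \<exists>t. G x t = 0} = {x \<in> space M. \<exists>k::nat. \<exists>t\<in>{- (real k + 1)..real k + 1}. G x t = 0}"
    by (simp only:)
  also have "\<dots> \<in> sets M"
    by (rule sets.sets_Collect_countable_Ex, rule zero_in_interval_measurable) (use assms in auto)
  finally show ?thesis .
qed

lemma measurable_generic: "{M \<in> space (LM (Suc n)). \<not> generic n M} \<in> sets (LM (Suc n))"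
proof -
  let ?P = "\<lambda>M x. poly (cp (Suc n) M) x" and ?Q = "\<lambda>M x. poly (cp n M) x" and ?R = "\<lambda>M x. poly (pderiv (cp (Suc n) M)) x"
  have mP: "(\<lambda>M. ?P M t) \<in> borel_measurable (LM (Suc n))" for t by (rule measurable_poly_cp) (auto intro: measurable_entry)
  have mR: "(\<lambda>M. ?R M t) \<in> borel_measurable (LM (Suc n))" for t by (rule measurable_poly_pderiv_cp) (auto intro: measurable_entry)
  have mQ: "(\<lambda>M. ?Q M t) \<in> borel_measurable (LM (Suc n))" for t
    by (rule measurable_poly_cp) (simp_all add: measurable_entry)
  have "\<not> generic n M \<longleftrightarrow> (\<exists>x. (?P M x)\<^sup>2 + (?Q M x)\<^sup>2 = 0) \<or> (\<exists>x. (?P M x)\<^sup>2 + (?R M x)\<^sup>2 = 0)" for M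
    unfolding generic_def simple_roots_def sum_power2_eq_zero_iff by metis
  hence "{M \<in> space (LM (Suc n)). \<not> generic n M} = {M \<in> space (LM (Suc n)). (\<exists>x. (?P M x)\<^sup>2 + (?Q M x)\<^sup>2 = 0) \<or> (\<exists>x. (?P M x)\<^sup>2 + (?R M x)\<^sup>2 = 0)}"
    by (simp only:)
  also have "\<dots> \<in> sets (LM (Suc n))"
    by (intro sets.sets_Collect_disj exists_zero_measurable continuous_intros borel_measurable_add borel_measurable_power mP mQ mR)
  finally show ?thesis .
qed

lemma AE_linear_nonzero:
  fixes b :: "nat \<Rightarrow> real"
  assumes "k < n" "b k \<noteq> 0"
  shows "AE c in LB {..<n}. (\<Sum>i<n. b i * c i) \<noteq> 0"
proof -
  let ?I = "{..<n} - {k}"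
  have ins: "insert k ?I = {..<n}" using assms by auto
  have lin: "(\<lambda>c. \<Sum>i<n. b i * c i) \<in> borel_measurable (LB {..<n})"
    by (intro borel_measurable_sum borel_measurable_times measurable_coord) auto
  have S: "{c \<in> space (LB {..<n}). (\<Sum>i<n. b i * c i) = 0} \<in> sets (LB {..<n})"
    using measurable_sets[OF lin, of "{0}"] by (simp add: vimage_def Int_def conj_commute)
  let ?f = "indicator {c \<in> space (LB {..<n}). (\<Sum>i<n. b i * c i) = 0} :: _ \<Rightarrow> ennreal"
  have "(\<integral>\<^sup>+c. ?f c \<partial>LB {..<n}) = (\<integral>\<^sup>+x. \<integral>\<^sup>+y. ?f (x(k := y)) \<partial>lborel \<partial>LB ?I)"
    by (rule leb.product_nn_integral_insert[of ?I k ?f, unfolded ins]) (use S in auto)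
  also have "\<dots> = (\<integral>\<^sup>+x. 0 \<partial>LB ?I)"
  proof (rule nn_integral_cong)
    fix x :: "nat \<Rightarrow> real"
    let ?y = "- (\<Sum>i\<in>?I. b i * x i) / b k"
    have "(\<Sum>i<n. b i * (x(k := y)) i) = b k * y + (\<Sum>i\<in>?I. b i * x i)" for y
    proof -
      have "(\<Sum>i<n. b i * (x(k := y)) i) = (\<Sum>i\<in>insert k ?I. b i * (x(k := y)) i)" by (simp only: ins)
      also have "\<dots> = b k * y + (\<Sum>i\<in>?I. b i * (x(k := y)) i)" by (subst sum.insert) auto
      also have "(\<Sum>i\<in>?I. b i * (x(k := y)) i) = (\<Sum>i\<in>?I. b i * x i)" by (intro sum.cong) auto
      finally show ?thesis .
    qed
    hence z: "?f (x(k := y)) \<le> indicator {?y} y" for y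
      using assms by (auto split: split_indicator simp: field_simps)
    have "(\<integral>\<^sup>+y. ?f (x(k := y)) \<partial>lborel) \<le> (\<integral>\<^sup>+y. indicator {?y} y \<partial>lborel)"
      by (rule nn_integral_mono) (rule z)
    also have "\<dots> = 0" by simp
    finally show "(\<integral>\<^sup>+y. ?f (x(k := y)) \<partial>lborel) = 0" by simp
  qed
  finally have "emeasure (LB {..<n}) {c \<in> space (LB {..<n}). (\<Sum>i<n. b i * c i) = 0} = 0" using S by simp
  thus ?thesis using S by (subst AE_iff_measurable) auto
qed

text \<open>At a root \<open>x\<close> of the leading block's polynomial the border formula reduces,
  up to sign, to the bilinear form in \<open>w\<close> and \<open>c\<close> given by the adjugate. A
  simple root leaves a nonzero entry there, so almost every \<open>w\<close> gives a nonzero linear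
  form in \<open>c\<close>, and almost every \<open>c\<close> a nonzero value.\<close>

lemma AE_border_coprime:
  assumes s: "simple_roots (cp n D)"
  shows "AE w in LB {..<n}. AE c in LB {..<n}. \<forall>x. poly (cp n D) x = 0 \<longrightarrow> poly (cp (Suc n) (blk n D w c 0)) x \<noteq> 0"
proof -
  let ?Z = "{x. poly (cp n D) x = 0}"
  have fin: "finite ?Z" by (simp add: poly_roots_finite cp_monic)
  have one: "AE w in LB {..<n}. AE c in LB {..<n}. poly (cp (Suc n) (blk n D w c 0)) x \<noteq> 0" if x: "x \<in> ?Z" for x
  proof -
    obtain k where k: "k < n" "poly (adjp n D k k) x \<noteq> 0"
      using adjp_nonzero[of n D x] s x by (auto simp: simple_roots_def)
    have "AE w in LB {..<n}. (\<Sum>i<n. poly (adjp n D i k) x * w i) \<noteq> 0"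
      by (rule AE_linear_nonzero[OF k(1)]) (rule k(2))
    thus ?thesis
    proof eventually_elim
      case (elim w)
      have "AE c in LB {..<n}. (\<Sum>j<n. (\<Sum>i<n. poly (adjp n D i j) x * w i) * c j) \<noteq> 0"
        by (rule AE_linear_nonzero[OF k(1)]) (rule elim)
      thus ?case
      proof eventually_elim
        case (elim c)
        have "poly (cp (Suc n) (blk n D w c 0)) x = - (\<Sum>i<n. \<Sum>j<n. w i * c j * poly (adjp n D i j) x)"
          using x unfolding cp_blk_border by (simp add: poly_sum del: mult_pCons_left)
        also have "(\<Sum>i<n. \<Sum>j<n. w i * c j * poly (adjp n D i j) x) = (\<Sum>j<n. (\<Sum>i<n. poly (adjp n D i j) x * w i) * c j)"
          by (subst sum.swap) (simp add: sum_distrib_left sum_distrib_right mult_ac)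
        finally show ?case using elim by simp
      qed
    qed
  qed
  have "AE w in LB {..<n}. \<forall>x\<in>?Z. AE c in LB {..<n}. poly (cp (Suc n) (blk n D w c 0)) x \<noteq> 0"
    by (rule AE_finite_allI[OF fin one])
  thus ?thesis
  proof eventually_elim
    case (elim w)
    have "AE c in LB {..<n}. \<forall>x\<in>?Z. poly (cp (Suc n) (blk n D w c 0)) x \<noteq> 0"
      by (rule AE_finite_allI[OF fin]) (use elim in blast)
    thus ?case by eventually_elim blast
  qed
qed

text \<open>The coefficients of degree \<open>2 n\<close> in the two products are
  \<open>n + 1\<close> and \<open>n\<close>, so they do not cancel.\<close>

lemma wronskian_nonzero:
  fixes r p :: "real poly"
  assumes "degree r = Suc n" "coeff r (Suc n) = 1" "degree p = n" "coeff p n = 1"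
  shows "pderiv r * p - r * pderiv p \<noteq> 0"
proof -
  have 1: "coeff (pderiv r * p) (n + n) = real (Suc n)"
    using coeff_mult_degree_sum[of "pderiv r" p] assms by (simp add: degree_pderiv coeff_pderiv)
  have 2: "coeff (r * pderiv p) (n + n) = real n"
  proof (cases n)
    case 0
    hence "pderiv p = 0" using assms by (simp add: pderiv_eq_0_iff)
    thus ?thesis using 0 by simp
  next
    case (Suc m)
    thus ?thesis using coeff_mult_degree_sum[of r "pderiv p"] assms by (simp add: degree_pderiv coeff_pderiv)
  qed
  have "coeff (pderiv r * p - r * pderiv p) (n + n) = 1" using 1 2 by simp
  thus ?thesis by (metis coeff_0 zero_neq_one)
qed

text \<open>A multiple root \<open>x\<close> of \<open>r - a p\<close> is a zero of the Wronskian
  \<open>W\<close>, and \<open>a\<close> is then the value of \<open>r / p\<close> at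
  \<open>x\<close>. Only finitely many values of \<open>a\<close> are excluded.\<close>

lemma AE_corner_generic:
  assumes c: "\<forall>x. poly (cp n D) x = 0 \<longrightarrow> poly (cp (Suc n) (blk n D w c 0)) x \<noteq> 0"
  shows "AE a in lborel. generic n (blk n D w c a)"
proof -
  define r where "r = cp (Suc n) (blk n D w c 0)"
  define p where "p = cp n D"
  define W where "W = pderiv r * p - r * pderiv p"
  have "W \<noteq> 0" unfolding W_def by (rule wronskian_nonzero[of _ n]) (simp_all add: r_def p_def cp_monic)
  hence fin: "finite ((\<lambda>x. poly r x / poly p x) ` {x. poly W x = 0})" by (simp add: poly_roots_finite)
  have shift: "cp (Suc n) (blk n D w c a) = r - [:a:] * p" for a
    unfolding r_def p_def by (rule cp_blk_shift_corner)
  have "AE a in lborel. a \<notin> (\<lambda>x. poly r x / poly p x) ` {x. poly W x = 0}"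
    by (intro AE_not_in finite_imp_null_set_lborel fin)
  thus ?thesis
  proof eventually_elim
    case (elim a)
    have root: "poly p x \<noteq> 0" if "poly (r - [:a:] * p) x = 0" for x
      using that c by (auto simp: r_def p_def)
    have "poly (pderiv (r - [:a:] * p)) x \<noteq> 0" if z: "poly (r - [:a:] * p) x = 0" for x
    proof
      assume "poly (pderiv (r - [:a:] * p)) x = 0"
      hence "poly (pderiv r) x = a * poly (pderiv p) x"
        unfolding pderiv_diff pderiv_mult by (simp add: pderiv_pCons)
      moreover have "poly r x = a * poly p x" using z by simp
      ultimately have "poly W x = 0" "poly r x / poly p x = a" using root[OF z] by (auto simp: W_def)
      thus False using elim by force
    qed
    thus ?case using root unfolding generic_def simple_roots_def shift cp_blk_sub p_def[symmetric] by blast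
  qed
qed

lemma AE_generic_if_simple:
  assumes "AE D in LM n. simple_roots (cp n D)"
  shows "AE M in LM (Suc n). generic n M"
proof -
  let ?B = "{M \<in> space (LM (Suc n)). \<not> generic n M}"
  have B: "?B \<in> sets (LM (Suc n))" by (rule measurable_generic)
  have "emeasure (LM (Suc n)) ?B = (\<integral>\<^sup>+M. indicator ?B M \<partial>LM (Suc n))" using B by simp
  also have "\<dots> = (\<integral>\<^sup>+D. \<integral>\<^sup>+w. \<integral>\<^sup>+c. \<integral>\<^sup>+a. indicator ?B (blk n D w c a) \<partial>lborel \<partial>LB {..<n} \<partial>LB {..<n} \<partial>LM n)"
    using B by (intro nn_LM_Suc) auto
  also have "\<dots> = (\<integral>\<^sup>+D. 0 \<partial>LM n)"
  proof (rule nn_integral_cong_AE)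
    show "AE D in LM n. (\<integral>\<^sup>+w. \<integral>\<^sup>+c. \<integral>\<^sup>+a. indicator ?B (blk n D w c a) \<partial>lborel \<partial>LB {..<n} \<partial>LB {..<n}) = 0"
      using assms
    proof eventually_elim
      case (elim D)
      from AE_border_coprime[OF this]
      have "AE w in LB {..<n}. (\<integral>\<^sup>+c. \<integral>\<^sup>+a. indicator ?B (blk n D w c a) \<partial>lborel \<partial>LB {..<n}) = 0"
      proof eventually_elim
        case (elim w)
        hence "AE c in LB {..<n}. (\<integral>\<^sup>+a. indicator ?B (blk n D w c a) \<partial>lborel) = 0"
        proof eventually_elim
          case (elim c)
          from AE_corner_generic[OF this]
          have "AE a in lborel. (indicator ?B (blk n D w c a) :: ennreal) = 0"
            by eventually_elim auto
          hence "(\<integral>\<^sup>+a. indicator ?B (blk n D w c a) \<partial>lborel) = (\<integral>\<^sup>+a. 0 \<partial>(lborel :: real measure))"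
            by (rule nn_integral_cong_AE)
          thus ?case by simp
        qed
        hence "(\<integral>\<^sup>+c. \<integral>\<^sup>+a. indicator ?B (blk n D w c a) \<partial>lborel \<partial>LB {..<n}) = (\<integral>\<^sup>+c. 0 \<partial>LB {..<n})"
          by (rule nn_integral_cong_AE)
        thus ?case by simp
      qed
      hence "(\<integral>\<^sup>+w. \<integral>\<^sup>+c. \<integral>\<^sup>+a. indicator ?B (blk n D w c a) \<partial>lborel \<partial>LB {..<n} \<partial>LB {..<n}) = (\<integral>\<^sup>+w. 0 \<partial>LB {..<n})"
        by (rule nn_integral_cong_AE)
      thus ?case by simp
    qed
  qed
  finally have "emeasure (LM (Suc n)) ?B = 0" by simp
  thus ?thesis using B by (subst AE_iff_measurable) auto
qed

text \<open>Induction on the size: simple roots for the leading block make almost every bordered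
  matrix generic, and genericity includes simple roots for the next size.\<close>

lemma AE_simple_roots: "AE D in LM n. simple_roots (cp n D)"
proof (induction n)
  case 0
  have "cp 0 D = 1" for D
    using cp_monic[of 0 D] degree_eq_zeroE[of "cp 0 D"] by (metis coeff_pCons_0 one_pCons)
  thus ?case by (simp add: simple_roots_def)
next
  case (Suc n)
  from AE_generic_if_simple[OF Suc] show ?case by eventually_elim (simp add: generic_def)
qed

lemma AE_Nn: "AE M in LM (Suc n). Nn n M = nr (cp (Suc n) M)"
  using AE_generic_if_simple[OF AE_simple_roots, of n] by eventually_elim (rule Nn_generic)

section \<open>Gaussian expectations over matrices with a given number of real eigenvalues\<close>

text \<open>The absolute moment of order \<open>n\<close> for the weight
  \<open>exp (- r\<^sup>2 / 2)\<close>, see \<open>nn_integral_abs_moment\<close>; the recursion is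
  integration by parts.\<close>

fun dd :: "nat \<Rightarrow> real" where
  "dd 0 = sqrt (2 * pi)"
| "dd (Suc 0) = 2"
| "dd (Suc (Suc n)) = (real n + 1) * dd n"

lemma dd_pos: "dd n > 0"
  by (induction n rule: dd.induct) auto

lemma dd_even: "dd (2 * k) = sqrt (2 * pi) * (fact (2 * k) / (2 ^ k * fact k))"
proof (induction k)
  case (Suc k)
  have f: "fact (2 * Suc k) = (2 * (real k + 1)) * ((2 * real k + 1) * fact (2 * k))" by (simp add: algebra_simps)
  have g: "2 ^ Suc k * fact (Suc k) = (2 * (real k + 1)) * (2 ^ k * fact k)" by (simp add: algebra_simps)
  have "fact (2 * Suc k) / (2 ^ Suc k * fact (Suc k)) = (2 * real k + 1) * fact (2 * k) / (2 ^ k * fact k)"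
    unfolding f g by (rule mult_divide_mult_cancel_left) simp
  moreover have "dd (2 * Suc k) = (2 * real k + 1) * dd (2 * k)" by simp
  ultimately show ?case using Suc by simp
qed simp

lemma dd_odd: "dd (2 * k + 1) = 2 * (2 ^ k * fact k)"
  by (induction k) (auto simp: field_simps)

lemma nn_integral_abs_moment: "(\<integral>\<^sup>+r. ennreal (\<bar>r\<bar> ^ n * exp (- r\<^sup>2 / 2)) \<partial>lborel) = ennreal (dd n)"
proof -
  have "has_bochner_integral lborel (\<lambda>x. std_normal_density x * \<bar>x\<bar> ^ n) (dd n / sqrt (2 * pi))"
  proof (cases "even n")
    case True
    then obtain k where k: "n = 2 * k" by auto
    show ?thesis using std_normal_moment_even[of k] unfolding k dd_even by (simp add: power_mult)
  next
    case False
    then obtain k where k: "n = 2 * k + 1" using oddE by blast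
    have "sqrt (2 / pi) * 2 ^ k * fact k = dd n / sqrt (2 * pi)"
      unfolding k dd_odd by (simp add: real_sqrt_mult real_sqrt_divide field_simps)
    thus ?thesis using std_normal_moment_abs_odd[of k] unfolding k by simp
  qed
  hence 1: "(\<integral>\<^sup>+x. ennreal (std_normal_density x * \<bar>x\<bar> ^ n) \<partial>lborel) = ennreal (dd n / sqrt (2 * pi))"
    by (subst nn_integral_eq_integral) (auto simp: has_bochner_integral_iff)
  have 2: "ennreal (\<bar>r\<bar> ^ n * exp (- r\<^sup>2 / 2)) = ennreal (sqrt (2 * pi)) * ennreal (std_normal_density r * \<bar>r\<bar> ^ n)" for r
    by (subst ennreal_mult[symmetric]) (auto simp: normal_density_def)
  have "(\<integral>\<^sup>+r. ennreal (\<bar>r\<bar> ^ n * exp (- r\<^sup>2 / 2)) \<partial>lborel) = ennreal (sqrt (2 * pi)) * ennreal (dd n / sqrt (2 * pi))"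
    unfolding 2 1[symmetric] by (rule nn_integral_cmult) measurable
  also have "\<dots> = ennreal (dd n)"
    by (subst ennreal_mult[symmetric]) (auto simp: dd_pos less_imp_le)
  finally show ?thesis .
qed

text \<open>In place of polar coordinates,
  \<open>\<bar>r\<bar> ^ n * exp (- (r * qn n u)\<^sup>2 / 2)\<close> is integrated in both orders.
  Over \<open>r\<close> it yields \<open>dd n / qn n u ^ Suc n\<close>, over \<open>u\<close> it
  yields \<open>sqrt (2 * pi) ^ n * exp (- r\<^sup>2 / 2)\<close>.\<close>

lemma nn_integral_qn_power: "(\<integral>\<^sup>+u. ennreal (1 / qn n u ^ Suc n) \<partial>LB {..<n}) = ennreal (sqrt (2 * pi) ^ Suc n / dd n)"
proof -
  let ?V = "LB {..<n} :: (nat \<Rightarrow> real) measure"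
  define F where "F u r = ennreal (\<bar>r\<bar> ^ n * exp (- (r * qn n u)\<^sup>2 / 2))" for u r
  have qm: "(\<lambda>p. qn n (fst p)) \<in> borel_measurable (?V \<Otimes>\<^sub>M (lborel :: real measure))"
  proof -
    have c: "(\<lambda>p. fst p i) \<in> borel_measurable (?V \<Otimes>\<^sub>M (lborel :: real measure))" if "i \<in> {..<n}" for i
      by (rule measurable_compose[OF measurable_fst measurable_coord[OF that]])
    have [measurable]: "(\<lambda>p. \<Sum>i<n. (fst p i)\<^sup>2) \<in> borel_measurable (?V \<Otimes>\<^sub>M (lborel :: real measure))"
      by (intro borel_measurable_sum borel_measurable_power c)
    show ?thesis unfolding qn_def by measurable
  qed
  have Fm: "(\<lambda>(u, r). F u r) \<in> borel_measurable (?V \<Otimes>\<^sub>M lborel)"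
    unfolding F_def split_beta' using qm by measurable
  have s: "sigma_finite_measure ?V" by (rule sigma_finite_LB) simp
  have 1: "(\<integral>\<^sup>+r. F u r \<partial>lborel) = ennreal (dd n) * ennreal (1 / qn n u ^ Suc n)" for u
  proof -
    let ?q = "qn n u"
    have q: "?q \<ge> 1" by (rule qn_ge1)
    have "ennreal (dd n) = (\<integral>\<^sup>+r. ennreal (\<bar>r\<bar> ^ n * exp (- r\<^sup>2 / 2)) \<partial>lborel)" by (rule nn_integral_abs_moment[symmetric])
    also have "\<dots> = ennreal \<bar>?q\<bar> * (\<integral>\<^sup>+r. ennreal (\<bar>0 + ?q * r\<bar> ^ n * exp (- (0 + ?q * r)\<^sup>2 / 2)) \<partial>lborel)"
      by (rule nn_integral_real_affine) (use q in auto)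
    also have "(\<integral>\<^sup>+r. ennreal (\<bar>0 + ?q * r\<bar> ^ n * exp (- (0 + ?q * r)\<^sup>2 / 2)) \<partial>lborel) = (\<integral>\<^sup>+r. ennreal (?q ^ n) * F u r \<partial>lborel)"
      unfolding F_def using q by (intro nn_integral_cong, subst ennreal_mult[symmetric]) (auto simp: abs_mult power_mult_distrib mult_ac)
    also have "\<dots> = ennreal (?q ^ n) * (\<integral>\<^sup>+r. F u r \<partial>lborel)"
      unfolding F_def by (rule nn_integral_cmult) measurable
    finally have "ennreal (dd n) = ennreal (?q ^ Suc n) * (\<integral>\<^sup>+r. F u r \<partial>lborel)"
      using q by (simp add: mult.assoc[symmetric] ennreal_mult[symmetric])
    hence "ennreal (dd n) * ennreal (1 / ?q ^ Suc n) = (ennreal (?q ^ Suc n) * ennreal (1 / ?q ^ Suc n)) * (\<integral>\<^sup>+r. F u r \<partial>lborel)"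
      by (simp only: mult_ac)
    also have "ennreal (?q ^ Suc n) * ennreal (1 / ?q ^ Suc n) = 1"
      using q by (subst ennreal_mult[symmetric]) auto
    finally show ?thesis by simp
  qed
  have 2: "(\<integral>\<^sup>+u. F u r \<partial>?V) = ennreal (sqrt (2 * pi) ^ n) * ennreal (exp (- r\<^sup>2 / 2))" if r: "r \<noteq> 0" for r
  proof -
    have e: "F u r = ennreal (exp (- r\<^sup>2 / 2)) * (ennreal (\<bar>r\<bar> ^ n) * (\<Prod>i<n. ennreal (exp (- (r * u i)\<^sup>2 / 2))))" for u
    proof -
      have "(r * qn n u)\<^sup>2 = r\<^sup>2 + (\<Sum>i<n. (r * u i)\<^sup>2)"
        by (simp add: power_mult_distrib qn_sq algebra_simps sum_distrib_left)
      hence "exp (- (r * qn n u)\<^sup>2 / 2) = exp (- r\<^sup>2 / 2) * (\<Prod>i<n. exp (- (r * u i)\<^sup>2 / 2))"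
        by (simp add: exp_sum[symmetric] exp_add[symmetric] sum_negf sum_divide_distrib[symmetric] add_divide_distrib)
      thus ?thesis unfolding F_def by (simp add: prod_ennreal ennreal_mult[symmetric] prod_nonneg mult_ac)
    qed
    have 1: "(\<integral>\<^sup>+t. ennreal (exp (- (r * t)\<^sup>2 / 2)) \<partial>lborel) = ennreal (sqrt (2 * pi) / \<bar>r\<bar>)"
    proof -
      have "ennreal (sqrt (2 * pi)) = ennreal \<bar>r\<bar> * (\<integral>\<^sup>+t. ennreal (exp (- (0 + r * t)\<^sup>2 / 2)) \<partial>lborel)"
        unfolding nn_integral_gauss_1[symmetric] by (rule nn_integral_real_affine) (use r in auto)
      hence "ennreal (1 / \<bar>r\<bar>) * ennreal (sqrt (2 * pi)) = (ennreal (1 / \<bar>r\<bar>) * ennreal \<bar>r\<bar>) * (\<integral>\<^sup>+t. ennreal (exp (- (r * t)\<^sup>2 / 2)) \<partial>lborel)"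
        by (simp only: mult.assoc add_0)
      also have "ennreal (1 / \<bar>r\<bar>) * ennreal \<bar>r\<bar> = 1" using r by (subst ennreal_mult[symmetric]) auto
      finally show ?thesis by (simp add: ennreal_mult[symmetric])
    qed
    have m: "(\<lambda>u. \<Prod>i<n. ennreal (exp (- (r * u i)\<^sup>2 / 2))) \<in> borel_measurable ?V"
    proof (rule borel_measurable_prod_ennreal)
      fix i assume "i \<in> {..<n}"
      from measurable_coord[OF this] show "(\<lambda>u. ennreal (exp (- (r * u i)\<^sup>2 / 2))) \<in> borel_measurable ?V" by measurable
    qed
    have "(\<integral>\<^sup>+u. F u r \<partial>?V) = ennreal (exp (- r\<^sup>2 / 2)) * (ennreal (\<bar>r\<bar> ^ n) * (\<integral>\<^sup>+u. (\<Prod>i<n. ennreal (exp (- (r * u i)\<^sup>2 / 2))) \<partial>?V))"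
      unfolding e using m by (simp add: nn_integral_cmult)
    also have "(\<integral>\<^sup>+u. (\<Prod>i<n. ennreal (exp (- (r * u i)\<^sup>2 / 2))) \<partial>?V) = (\<Prod>i<n. \<integral>\<^sup>+t. ennreal (exp (- (r * t)\<^sup>2 / 2)) \<partial>lborel)"
      by (rule leb.product_nn_integral_prod) auto
    also have "\<dots> = ennreal ((sqrt (2 * pi) / \<bar>r\<bar>) ^ n)" unfolding 1 by (simp add: ennreal_power)
    also have "ennreal (\<bar>r\<bar> ^ n) * ennreal ((sqrt (2 * pi) / \<bar>r\<bar>) ^ n) = ennreal (sqrt (2 * pi) ^ n)"
      using r by (subst ennreal_mult[symmetric]) (auto simp: power_divide)
    finally show ?thesis by (simp only: mult.commute)
  qed
  have "ennreal (dd n) * (\<integral>\<^sup>+u. ennreal (1 / qn n u ^ Suc n) \<partial>?V) = (\<integral>\<^sup>+u. \<integral>\<^sup>+r. F u r \<partial>lborel \<partial>?V)"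
    unfolding 1 by (rule nn_integral_cmult[symmetric]) (use measurable_qn in auto)
  also have "\<dots> = (\<integral>\<^sup>+r. \<integral>\<^sup>+u. F u r \<partial>?V \<partial>lborel)"
    by (rule nn_swap[OF s _ Fm]) (rule lborel.sigma_finite_measure_axioms)
  also have "\<dots> = (\<integral>\<^sup>+r. ennreal (sqrt (2 * pi) ^ n) * ennreal (exp (- r\<^sup>2 / 2)) \<partial>lborel)"
  proof (rule nn_integral_cong_AE)
    have "AE r in lborel. r \<noteq> (0 :: real)" by (rule AE_lborel_singleton)
    thus "AE r in lborel. (\<integral>\<^sup>+u. F u r \<partial>?V) = ennreal (sqrt (2 * pi) ^ n) * ennreal (exp (- r\<^sup>2 / 2))"
      by eventually_elim (rule 2)
  qed
  also have "\<dots> = ennreal (sqrt (2 * pi) ^ n) * ennreal (sqrt (2 * pi))"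
    unfolding nn_integral_gauss_1[symmetric] by (rule nn_integral_cmult) (rule measurable_gauss_1)
  also have "\<dots> = ennreal (sqrt (2 * pi) ^ Suc n)" by (simp add: ennreal_mult[symmetric] mult.commute)
  finally have *: "ennreal (dd n) * (\<integral>\<^sup>+u. ennreal (1 / qn n u ^ Suc n) \<partial>?V) = ennreal (sqrt (2 * pi) ^ Suc n)" .
  have "ennreal (sqrt (2 * pi) ^ Suc n / dd n) = ennreal (1 / dd n) * ennreal (sqrt (2 * pi) ^ Suc n)"
    using dd_pos[of n] by (subst ennreal_mult[symmetric]) auto
  also have "\<dots> = (ennreal (1 / dd n) * ennreal (dd n)) * (\<integral>\<^sup>+u. ennreal (1 / qn n u ^ Suc n) \<partial>?V)"
    unfolding *[symmetric] by (simp only: mult.assoc)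
  also have "ennreal (1 / dd n) * ennreal (dd n) = 1" using dd_pos[of n] by (subst ennreal_mult[symmetric]) auto
  finally show ?thesis by simp
qed

lemma Kc_eq: "Kc n = ennreal (sqrt (2 * pi) ^ (2 * n + 1) / dd n)"
proof -
  have "2 * n + 1 = n + Suc n" by simp
  hence "sqrt (2 * pi) ^ n * (sqrt (2 * pi) ^ Suc n / dd n) = sqrt (2 * pi) ^ (2 * n + 1) / dd n"
    by (simp only: power_add times_divide_eq_right)
  moreover have "0 \<le> sqrt (2 * pi) ^ n" "0 \<le> sqrt (2 * pi) ^ Suc n / dd n"
    using dd_pos[of n] by (auto intro!: divide_nonneg_pos)
  ultimately show ?thesis unfolding Kc_def nn_integral_qn_power
    by (simp only: ennreal_mult[symmetric])
qed

definition absprod :: "real list \<Rightarrow> real poly \<Rightarrow> real" where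
  "absprod ys p = (\<Prod>y\<leftarrow>ys. \<bar>poly p y\<bar>)"

text \<open>The factor in front normalises the Gaussian weight.\<close>

definition An :: "nat \<Rightarrow> nat \<Rightarrow> real list \<Rightarrow> ennreal" where
  "An n k ys = ennreal (1 / sqrt (2 * pi) ^ n\<^sup>2) *
     (\<integral>\<^sup>+B. (if nr (cp n B) = k then ennreal (absprod ys (cp n B)) else 0) * ennreal (gw (sq2 n) B) \<partial>LM n)"

lemma measurable_nr_cp:
  assumes "\<And>i j. i < n \<Longrightarrow> j < n \<Longrightarrow> (\<lambda>z. B z (i, j)) \<in> borel_measurable N"
  shows "(\<lambda>z. nr (cp n (B z))) \<in> measurable N (count_space UNIV)"
  by (rule measurable_nr[of _ _ n]) (use assms in \<open>auto intro: pmeas_cp simp: cp_monic\<close>)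

text \<open>The list consists of functions of \<open>z\<close> because in the recursion its head is
  itself an integration variable.\<close>

lemma measurable_absprod:
  assumes B: "\<And>i j. i < n \<Longrightarrow> j < n \<Longrightarrow> (\<lambda>z. B z (i, j)) \<in> borel_measurable N"
    and ys: "\<And>f. f \<in> set fs \<Longrightarrow> f \<in> borel_measurable N"
  shows "(\<lambda>z. absprod (map (\<lambda>f. f z) fs) (cp n (B z))) \<in> borel_measurable N"
  using ys
proof (induction fs)
  case (Cons f fs)
  have "(\<lambda>z. \<bar>poly (cp n (B z)) (f z)\<bar> * absprod (map (\<lambda>f. f z) fs) (cp n (B z))) \<in> borel_measurable N"
    by (intro borel_measurable_times borel_measurable_abs measurable_poly_cp B Cons.IH) (use Cons.prems in auto)
  thus ?case by (simp add: absprod_def)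
qed (simp add: absprod_def)

lemma measurable_An_integrand:
  assumes B: "\<And>i j. i < n \<Longrightarrow> j < n \<Longrightarrow> (\<lambda>z. B z (i, j)) \<in> borel_measurable N"
    and ys: "\<And>f. f \<in> set fs \<Longrightarrow> f \<in> borel_measurable N"
  shows "(\<lambda>z. if nr (cp n (B z)) = k then ennreal (absprod (map (\<lambda>f. f z) fs) (cp n (B z))) else 0) \<in> borel_measurable N"
proof -
  note [measurable] = measurable_nr_cp[where n = n and B = B and N = N, OF B] measurable_absprod[where n = n and B = B and N = N and fs = fs, OF B ys]
  show ?thesis by measurable
qed

lemma measurable_An_integrand_const:
  "(\<lambda>B. if nr (cp n B) = k then ennreal (absprod ys (cp n B)) else 0) \<in> borel_measurable (LM n)"
proof -
  have "(\<lambda>B. if nr (cp n B) = k then ennreal (absprod (map (\<lambda>f. f B) (map (\<lambda>y _. y) ys)) (cp n B)) else 0) \<in> borel_measurable (LM n)"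
    by (rule measurable_An_integrand) (auto intro: measurable_entry)
  moreover have "map (\<lambda>f. f B) (map (\<lambda>y _. y) ys) = ys" for B :: "nat \<times> nat \<Rightarrow> real" by (induction ys) auto
  ultimately show ?thesis by (simp only:)
qed

lemma absprod_nonneg: "absprod ys p \<ge> 0"
  by (induction ys) (auto simp: absprod_def)

lemma absprod_linear_mult: "absprod ys ([:- x, 1:] * p) = (\<Prod>y\<leftarrow>ys. \<bar>y - x\<bar>) * absprod ys p"
proof (induction ys)
  case (Cons a ys)
  have "poly ([:- x, 1:] * p) a = (a - x) * poly p a" by (simp add: algebra_simps)
  moreover have "absprod (a # ys) q = \<bar>poly q a\<bar> * absprod ys q" for q by (simp add: absprod_def)
  ultimately show ?case using Cons.IH by (simp add: abs_mult del: mult_pCons_left)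
qed (simp add: absprod_def)

lemma measurable_An_Cons: "(\<lambda>x. An n k (x # ys)) \<in> borel_measurable lborel"
  unfolding An_def
proof (intro borel_measurable_times_ennreal borel_measurable_const measurable_nn_integral_snd sigma_finite_LB)
  have c: "(\<lambda>p. snd p q) \<in> borel_measurable (lborel \<Otimes>\<^sub>M LM n :: (real \<times> _) measure)" if "q \<in> sq2 n" for q
    by (rule measurable_compose[OF measurable_snd measurable_coord[OF that]])
  let ?N = "lborel \<Otimes>\<^sub>M LM n :: (real \<times> _) measure"
  have "(\<lambda>p. if nr (cp n (snd p)) = k then ennreal (absprod (map (\<lambda>f. f p) (fst # map (\<lambda>y _. y) ys)) (cp n (snd p))) else 0) \<in> borel_measurable ?N"
    by (rule measurable_An_integrand) (auto intro: c)
  show "(\<lambda>p. if nr (cp n (snd p)) = k then ennreal (absprod (fst p # ys) (cp n (snd p))) else 0) \<in> borel_measurable ?N"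
  proof -
    have "map (\<lambda>f. f p) (fst # map (\<lambda>y _. y) ys) = fst p # ys" for p :: "real \<times> (nat \<times> nat \<Rightarrow> real)" by (induction ys) auto
    thus ?thesis using \<open>(\<lambda>p. if nr (cp n (snd p)) = k then ennreal (absprod (map (\<lambda>f. f p) (fst # map (\<lambda>y _. y) ys)) (cp n (snd p))) else 0) \<in> borel_measurable ?N\<close>
      by (simp only:)
  qed
  show "(\<lambda>p. ennreal (gw (sq2 n) (snd p))) \<in> borel_measurable (lborel \<Otimes>\<^sub>M LM n :: (real \<times> _) measure)"
    by (intro measurable_compose[OF measurable_gw measurable_ennreal] c)
qed auto

text \<open>The deflation formula is applied to the indicator of \<open>Suc k\<close> real roots
  times the product over \<open>ys\<close>. The root split off contributes the factors
  \<open>\<bar>y - x\<bar>\<close>, and the remaining factor \<open>\<bar>det (x - B)\<bar>\<close>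
  makes \<open>x\<close> a new element of the list.\<close>

theorem An_recursion:
  "of_nat (Suc k) * An (Suc n) (Suc k) ys = ennreal (1 / dd n) *
     (\<integral>\<^sup>+x. ennreal (exp (- x\<^sup>2 / 2) * (\<Prod>y\<leftarrow>ys. \<bar>y - x\<bar>)) * An n k (x # ys) \<partial>lborel)"
proof -
  define h where "h p = (if nr p = Suc k then ennreal (absprod ys p) else 0)" for p
  let ?s = "sqrt (2 * pi)"
  have s: "?s > 0" by simp
  have hm: "(\<lambda>M. h (cp (Suc n) M)) \<in> borel_measurable (LM (Suc n))"
    unfolding h_def by (rule measurable_An_integrand_const)
  have gm: "(\<lambda>B. ennreal (gw (sq2 m) B)) \<in> borel_measurable (LM m)" for m
    by (intro measurable_compose[OF measurable_gw measurable_ennreal] measurable_coord)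
  have hl: "h ([:- x, 1:] * cp n B) * ennreal \<bar>poly (cp n B) x\<bar> = ennreal (\<Prod>y\<leftarrow>ys. \<bar>y - x\<bar>) *
      (if nr (cp n B) = k then ennreal (absprod (x # ys) (cp n B)) else 0)" for x B
  proof -
    have "(\<Prod>y\<leftarrow>ys. \<bar>y - x\<bar>) \<ge> 0" by (induction ys) auto
    thus ?thesis unfolding h_def nr_linear_mult[OF cp_monic(3)] absprod_linear_mult
      using absprod_nonneg[of ys "cp n B"] by (auto simp: absprod_def ennreal_mult mult_ac)
  qed
  have "of_nat (Suc k) * An (Suc n) (Suc k) ys = ennreal (1 / ?s ^ (Suc n)\<^sup>2) * (\<integral>\<^sup>+M. of_nat (Suc k) * (h (cp (Suc n) M) * ennreal (gw (sq2 (Suc n)) M)) \<partial>LM (Suc n))"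
    unfolding An_def h_def[symmetric] using hm gm by (subst nn_integral_cmult) (auto simp: mult_ac)
  \<comment> \<open>Where \<open>h\<close> does not vanish there are \<open>Suc k\<close> real
    roots, and almost everywhere \<open>Nn\<close> counts them.\<close>
  also have "(\<integral>\<^sup>+M. of_nat (Suc k) * (h (cp (Suc n) M) * ennreal (gw (sq2 (Suc n)) M)) \<partial>LM (Suc n)) =
     (\<integral>\<^sup>+M. of_nat (Nn n M) * (h (cp (Suc n) M) * ennreal (gw (sq2 (Suc n)) M)) \<partial>LM (Suc n))"
  proof (rule nn_integral_cong_AE)
    show "AE M in LM (Suc n). of_nat (Suc k) * (h (cp (Suc n) M) * ennreal (gw (sq2 (Suc n)) M)) =
      of_nat (Nn n M) * (h (cp (Suc n) M) * ennreal (gw (sq2 (Suc n)) M))"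
      using AE_Nn[of n] by eventually_elim (auto simp: h_def)
  qed
  also have "\<dots> = Kc n * (\<integral>\<^sup>+x. ennreal (exp (- x\<^sup>2 / 2)) *
      (\<integral>\<^sup>+B. h ([:- x, 1:] * cp n B) * ennreal \<bar>poly (cp n B) x\<bar> * ennreal (gw (sq2 n) B) \<partial>LM n) \<partial>lborel)"
    by (rule nn_integral_deflation[OF hm])
  also have "\<dots> = Kc n * (\<integral>\<^sup>+x. ennreal (?s ^ n\<^sup>2) * (ennreal (exp (- x\<^sup>2 / 2) * (\<Prod>y\<leftarrow>ys. \<bar>y - x\<bar>)) * An n k (x # ys)) \<partial>lborel)"
  proof (intro arg_cong[of _ _ "\<lambda>z. Kc n * z"], rule nn_integral_cong)
    fix x :: real
    have nn: "(\<Prod>y\<leftarrow>ys. \<bar>y - x\<bar>) \<ge> 0" by (induction ys) auto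
    let ?I = "\<integral>\<^sup>+B. (if nr (cp n B) = k then ennreal (absprod (x # ys) (cp n B)) else 0) * ennreal (gw (sq2 n) B) \<partial>LM n"
    have "(\<integral>\<^sup>+B. h ([:- x, 1:] * cp n B) * ennreal \<bar>poly (cp n B) x\<bar> * ennreal (gw (sq2 n) B) \<partial>LM n) =
      ennreal (\<Prod>y\<leftarrow>ys. \<bar>y - x\<bar>) * ?I"
      unfolding hl mult.assoc
    proof (rule nn_integral_cmult)
      have "(\<lambda>B. if nr (cp n B) = k then ennreal (absprod (x # ys) (cp n B)) else 0) \<in> borel_measurable (LM n)"
        by (rule measurable_An_integrand_const)
      thus "(\<lambda>B. (if nr (cp n B) = k then ennreal (absprod (x # ys) (cp n B)) else 0) * ennreal (gw (sq2 n) B)) \<in> borel_measurable (LM n)"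
        using gm by (intro borel_measurable_times_ennreal) auto
    qed
    moreover have "?I = ennreal (?s ^ n\<^sup>2) * An n k (x # ys)"
    proof -
      have "ennreal (?s ^ n\<^sup>2) * ennreal (1 / ?s ^ n\<^sup>2) = 1" using s by (subst ennreal_mult[symmetric]) auto
      thus ?thesis unfolding An_def mult.assoc[symmetric] by simp
    qed
    ultimately show "ennreal (exp (- x\<^sup>2 / 2)) * (\<integral>\<^sup>+B. h ([:- x, 1:] * cp n B) * ennreal \<bar>poly (cp n B) x\<bar> * ennreal (gw (sq2 n) B) \<partial>LM n)
      = ennreal (?s ^ n\<^sup>2) * (ennreal (exp (- x\<^sup>2 / 2) * (\<Prod>y\<leftarrow>ys. \<bar>y - x\<bar>)) * An n k (x # ys))"
      using nn by (simp add: ennreal_mult mult_ac)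
  qed
  also have "\<dots> = Kc n * (ennreal (?s ^ n\<^sup>2) * (\<integral>\<^sup>+x. ennreal (exp (- x\<^sup>2 / 2) * (\<Prod>y\<leftarrow>ys. \<bar>y - x\<bar>)) * An n k (x # ys) \<partial>lborel))"
  proof (subst nn_integral_cmult)
    have 1: "(\<lambda>x. \<Prod>y\<leftarrow>ys. \<bar>y - x\<bar>) \<in> borel_measurable borel" by (induction ys) auto
    show "(\<lambda>x. ennreal (exp (- x\<^sup>2 / 2) * (\<Prod>y\<leftarrow>ys. \<bar>y - x\<bar>)) * An n k (x # ys)) \<in> borel_measurable lborel"
      using 1 by (intro borel_measurable_times_ennreal measurable_An_Cons) measurable
  qed simp
  finally have "of_nat (Suc k) * An (Suc n) (Suc k) ys = (ennreal (1 / ?s ^ (Suc n)\<^sup>2) * Kc n * ennreal (?s ^ n\<^sup>2)) *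
      (\<integral>\<^sup>+x. ennreal (exp (- x\<^sup>2 / 2) * (\<Prod>y\<leftarrow>ys. \<bar>y - x\<bar>)) * An n k (x # ys) \<partial>lborel)" by (simp only: mult.assoc)
  also have "ennreal (1 / ?s ^ (Suc n)\<^sup>2) * Kc n * ennreal (?s ^ n\<^sup>2) = ennreal (1 / dd n)"
  proof -
    \<comment> \<open>With this identity the powers of \<open>sqrt (2 * pi)\<close> in the two
      normalisations and in \<open>Kc n\<close> cancel completely.\<close>
    have "(Suc n)\<^sup>2 = n\<^sup>2 + (2 * n + 1)" by (simp add: power2_eq_square)
    hence "1 / ?s ^ (Suc n)\<^sup>2 * (?s ^ (2 * n + 1) / dd n) * ?s ^ n\<^sup>2 = 1 / dd n"
      using dd_pos[of n] by (simp add: power_add)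
    thus ?thesis unfolding Kc_eq using dd_pos[of n] by (simp add: ennreal_mult[symmetric] less_imp_le)
  qed
  finally show ?thesis .
qed

section \<open>Iteration of the recursion\<close>

text \<open>The density of \<open>k\<close> further eigenvalues \<open>l\<close> after the points
  \<open>ys\<close> have been split off, when \<open>An m 0\<close> is replaced by the product of
  \<open>g\<close> over all points.\<close>

definition Wk :: "nat \<Rightarrow> (real \<Rightarrow> real) \<Rightarrow> real list \<Rightarrow> (nat \<Rightarrow> real) \<Rightarrow> real" where
  "Wk k g ys l = (\<Prod>i<k. exp (- (l i)\<^sup>2 / 2) * g (l i)) * (\<Prod>j<k. \<Prod>i<j. \<bar>l j - l i\<bar>) *
     (\<Prod>i<k. \<Prod>y\<leftarrow>ys. \<bar>y - l i\<bar>) * (\<Prod>y\<leftarrow>ys. g y)"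

definition Jn :: "nat \<Rightarrow> (real \<Rightarrow> real) \<Rightarrow> real list \<Rightarrow> ennreal" where
  "Jn k g ys = (\<integral>\<^sup>+l. ennreal (Wk k g ys l) \<partial>LB {..<k})"

lemma measurable_prod_list:
  fixes F :: "'b \<Rightarrow> 'a \<Rightarrow> real"
  assumes "\<And>y. y \<in> set ys \<Longrightarrow> F y \<in> borel_measurable N"
  shows "(\<lambda>z. \<Prod>y\<leftarrow>ys. F y z) \<in> borel_measurable N"
  using assms by (induction ys) auto

lemma prod_list_map_nonneg: "(\<And>y. y \<in> set ys \<Longrightarrow> f y \<ge> 0) \<Longrightarrow> (\<Prod>y\<leftarrow>ys. f y :: real) \<ge> 0"
  by (induction ys) auto

lemma measurable_Wk:
  assumes g: "g \<in> borel_measurable borel" and l: "\<And>i. i < k \<Longrightarrow> (\<lambda>z. L z i) \<in> borel_measurable N"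
    and f: "\<And>f. f \<in> set fs \<Longrightarrow> f \<in> borel_measurable N"
  shows "(\<lambda>z. Wk k g (map (\<lambda>f. f z) fs) (L z)) \<in> borel_measurable N"
proof -
  have gl: "(\<lambda>z. g (L z i)) \<in> borel_measurable N" if "i < k" for i using measurable_compose[OF l[OF that] g] .
  have gf: "(\<lambda>z. g (f z)) \<in> borel_measurable N" if "f \<in> set fs" for f using measurable_compose[OF f[OF that] g] .
  have 1: "(\<lambda>z. \<Prod>i<k. exp (- (L z i)\<^sup>2 / 2) * g (L z i)) \<in> borel_measurable N"
  proof (rule borel_measurable_prod)
    fix i assume "i \<in> {..<k}"
    hence [measurable]: "(\<lambda>z. L z i) \<in> borel_measurable N" "(\<lambda>z. g (L z i)) \<in> borel_measurable N" using l gl by auto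
    show "(\<lambda>z. exp (- (L z i)\<^sup>2 / 2) * g (L z i)) \<in> borel_measurable N" by measurable
  qed
  have 2: "(\<lambda>z. \<Prod>j<k. \<Prod>i<j. \<bar>L z j - L z i\<bar>) \<in> borel_measurable N"
    by (intro borel_measurable_prod borel_measurable_abs borel_measurable_diff l) auto
  have 3: "(\<lambda>z. \<Prod>i<k. \<Prod>f\<leftarrow>fs. \<bar>f z - L z i\<bar>) \<in> borel_measurable N"
    by (intro borel_measurable_prod measurable_prod_list borel_measurable_abs borel_measurable_diff l f) auto
  have 4: "(\<lambda>z. \<Prod>f\<leftarrow>fs. g (f z)) \<in> borel_measurable N"
    by (intro measurable_prod_list gf)
  have "Wk k g (map (\<lambda>f. f z) fs) (L z) = (\<Prod>i<k. exp (- (L z i)\<^sup>2 / 2) * g (L z i)) * (\<Prod>j<k. \<Prod>i<j. \<bar>L z j - L z i\<bar>) *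
     (\<Prod>i<k. \<Prod>f\<leftarrow>fs. \<bar>f z - L z i\<bar>) * (\<Prod>f\<leftarrow>fs. g (f z))" for z
    by (simp add: Wk_def comp_def)
  thus ?thesis using 1 2 3 4 by (simp only:) (intro borel_measurable_times)
qed

lemma map_const_apply: "map (\<lambda>f. f z) (map (\<lambda>y _. y) ys) = ys"
  by (induction ys) auto

lemma Wk_Suc:
  assumes "\<And>x. g x \<ge> 0"
  shows "Wk (Suc k) g ys (l(k := x)) = (exp (- x\<^sup>2 / 2) * (\<Prod>y\<leftarrow>ys. \<bar>y - x\<bar>)) * Wk k g (x # ys) l"
proof -
  have 1: "(\<Prod>i<Suc k. exp (- ((l(k := x)) i)\<^sup>2 / 2) * g ((l(k := x)) i)) = (\<Prod>i<k. exp (- (l i)\<^sup>2 / 2) * g (l i)) * (exp (- x\<^sup>2 / 2) * g x)"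
    by simp
  have 2: "(\<Prod>j<Suc k. \<Prod>i<j. \<bar>(l(k := x)) j - (l(k := x)) i\<bar>) = (\<Prod>j<k. \<Prod>i<j. \<bar>l j - l i\<bar>) * (\<Prod>i<k. \<bar>x - l i\<bar>)"
  proof -
    have "(\<Prod>j<k. \<Prod>i<j. \<bar>(l(k := x)) j - (l(k := x)) i\<bar>) = (\<Prod>j<k. \<Prod>i<j. \<bar>l j - l i\<bar>)"
      by (intro prod.cong refl) auto
    moreover have "(\<Prod>i<k. \<bar>(l(k := x)) k - (l(k := x)) i\<bar>) = (\<Prod>i<k. \<bar>x - l i\<bar>)"
      by (intro prod.cong refl) auto
    ultimately show ?thesis by (simp only: prod.lessThan_Suc)
  qed
  have 3: "(\<Prod>i<Suc k. \<Prod>y\<leftarrow>ys. \<bar>y - (l(k := x)) i\<bar>) = (\<Prod>i<k. \<Prod>y\<leftarrow>ys. \<bar>y - l i\<bar>) * (\<Prod>y\<leftarrow>ys. \<bar>y - x\<bar>)"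
    by simp
  have 4: "(\<Prod>i<k. \<Prod>y\<leftarrow>x # ys. \<bar>y - l i\<bar>) = (\<Prod>i<k. \<bar>x - l i\<bar>) * (\<Prod>i<k. \<Prod>y\<leftarrow>ys. \<bar>y - l i\<bar>)"
    by (simp add: prod.distrib)
  show ?thesis unfolding Wk_def 1 2 3 4 by (simp add: mult_ac)
qed

lemma Wk_nonneg: "(\<And>x. g x \<ge> 0) \<Longrightarrow> Wk k g ys l \<ge> 0"
  unfolding Wk_def by (intro mult_nonneg_nonneg prod_nonneg prod_list_map_nonneg) auto

lemma measurable_Jn_Cons:
  assumes "g \<in> borel_measurable borel"
  shows "(\<lambda>x. Jn k g (x # ys)) \<in> borel_measurable lborel"
  unfolding Jn_def
proof (rule measurable_nn_integral_snd[OF sigma_finite_LB])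
  let ?N = "lborel \<Otimes>\<^sub>M LB {..<k} :: (real \<times> _) measure"
  have c: "(\<lambda>p. snd p i) \<in> borel_measurable ?N" if "i < k" for i
    by (rule measurable_compose[OF measurable_snd measurable_coord]) (use that in simp)
  have "(\<lambda>p. Wk k g (map (\<lambda>f. f p) (fst # map (\<lambda>y _. y) ys)) (snd p)) \<in> borel_measurable ?N"
    by (rule measurable_Wk[OF assms c]) auto
  hence "(\<lambda>p. Wk k g (fst p # ys) (snd p)) \<in> borel_measurable ?N" by (simp only: list.map(2) map_const_apply)
  thus "(\<lambda>p. ennreal (Wk k g (fst p # ys) (snd p))) \<in> borel_measurable ?N" by measurable
qed simp

text \<open>The last coordinate of \<open>l\<close> passes to the list. This is the recursion of
  \<open>fact_An_Suc\<close> without its constant, so the two quantities can be compared by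
  induction.\<close>

lemma Jn_Suc:
  assumes g: "g \<in> borel_measurable borel" "\<And>x. g x \<ge> 0"
  shows "Jn (Suc k) g ys = (\<integral>\<^sup>+x. ennreal (exp (- x\<^sup>2 / 2) * (\<Prod>y\<leftarrow>ys. \<bar>y - x\<bar>)) * Jn k g (x # ys) \<partial>lborel)"
proof -
  have nn: "(\<Prod>y\<leftarrow>ys. \<bar>y - x\<bar>) \<ge> 0" for x by (rule prod_list_map_nonneg) simp
  have m: "(\<lambda>l. ennreal (Wk n g zs l)) \<in> borel_measurable (LB {..<n})" for n zs
  proof -
    have "(\<lambda>l. Wk n g (map (\<lambda>f. f l) (map (\<lambda>y _. y) zs)) l) \<in> borel_measurable (LB {..<n})"
      by (rule measurable_Wk[OF g(1)]) (auto intro: measurable_coord)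
    hence "(\<lambda>l. Wk n g zs l) \<in> borel_measurable (LB {..<n})" by (simp only: map_const_apply)
    thus ?thesis by measurable
  qed
  have "Jn (Suc k) g ys = (\<integral>\<^sup>+x. \<integral>\<^sup>+l. ennreal (Wk (Suc k) g ys (l(k := x))) \<partial>LB {..<k} \<partial>lborel)"
    unfolding Jn_def by (rule nn_LB_Suc(2)[OF m])
  also have "\<dots> = (\<integral>\<^sup>+x. ennreal (exp (- x\<^sup>2 / 2) * (\<Prod>y\<leftarrow>ys. \<bar>y - x\<bar>)) * Jn k g (x # ys) \<partial>lborel)"
  proof (rule nn_integral_cong)
    fix x :: real
    have "ennreal (Wk (Suc k) g ys (l(k := x))) = ennreal (exp (- x\<^sup>2 / 2) * (\<Prod>y\<leftarrow>ys. \<bar>y - x\<bar>)) * ennreal (Wk k g (x # ys) l)" for l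
      unfolding Wk_Suc[OF g(2)] using nn by (intro ennreal_mult mult_nonneg_nonneg Wk_nonneg g(2)) auto
    thus "(\<integral>\<^sup>+l. ennreal (Wk (Suc k) g ys (l(k := x))) \<partial>LB {..<k}) = ennreal (exp (- x\<^sup>2 / 2) * (\<Prod>y\<leftarrow>ys. \<bar>y - x\<bar>)) * Jn k g (x # ys)"
      unfolding Jn_def by (simp only: nn_integral_cmult[OF m])
  qed
  finally show ?thesis .
qed

lemma measurable_gauss_prod_list: "(\<lambda>x. ennreal (exp (- x\<^sup>2 / 2) * (\<Prod>y\<leftarrow>ys. \<bar>y - x\<bar>))) \<in> borel_measurable lborel"
proof -
  have [measurable]: "(\<lambda>x. \<Prod>y\<leftarrow>ys. \<bar>y - x\<bar>) \<in> borel_measurable borel" by (rule measurable_prod_list) measurable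
  show ?thesis by measurable
qed

text \<open>The factorial absorbs the factor \<open>Suc k\<close>, which counts the choices of the
  eigenvalue that is split off.\<close>

lemma fact_An_Suc:
  "ennreal (fact (Suc k)) * An (Suc n) (Suc k) ys = ennreal (1 / dd n) *
     (\<integral>\<^sup>+x. ennreal (exp (- x\<^sup>2 / 2) * (\<Prod>y\<leftarrow>ys. \<bar>y - x\<bar>)) * (ennreal (fact k) * An n k (x # ys)) \<partial>lborel)"
proof -
  have "ennreal (fact (Suc k)) = ennreal (fact k) * of_nat (Suc k)"
    by (simp add: ennreal_of_nat_eq_real_of_nat ennreal_mult[symmetric] mult.commute del: of_nat_Suc)
  hence "ennreal (fact (Suc k)) * An (Suc n) (Suc k) ys = ennreal (fact k) * (of_nat (Suc k) * An (Suc n) (Suc k) ys)"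
    by (simp only: mult.assoc)
  also have "\<dots> = ennreal (1 / dd n) * (ennreal (fact k) *
     (\<integral>\<^sup>+x. ennreal (exp (- x\<^sup>2 / 2) * (\<Prod>y\<leftarrow>ys. \<bar>y - x\<bar>)) * An n k (x # ys) \<partial>lborel))"
    unfolding An_recursion by (simp only: mult_ac)
  also have "ennreal (fact k) * (\<integral>\<^sup>+x. ennreal (exp (- x\<^sup>2 / 2) * (\<Prod>y\<leftarrow>ys. \<bar>y - x\<bar>)) * An n k (x # ys) \<partial>lborel) =
     (\<integral>\<^sup>+x. ennreal (fact k) * (ennreal (exp (- x\<^sup>2 / 2) * (\<Prod>y\<leftarrow>ys. \<bar>y - x\<bar>)) * An n k (x # ys)) \<partial>lborel)"
    by (rule nn_integral_cmult[symmetric]) (intro borel_measurable_times_ennreal measurable_gauss_prod_list measurable_An_Cons)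
  finally show ?thesis by (simp only: mult_ac)
qed

lemma const_Jn_Suc:
  assumes g: "g \<in> borel_measurable borel" "\<And>x. g x \<ge> 0" and C: "C \<ge> 0"
  shows "ennreal (1 / dd n) * (\<integral>\<^sup>+x. ennreal (exp (- x\<^sup>2 / 2) * (\<Prod>y\<leftarrow>ys. \<bar>y - x\<bar>)) * (ennreal C * Jn k g (x # ys)) \<partial>lborel)
    = ennreal (C / dd n) * Jn (Suc k) g ys"
proof -
  have "(\<integral>\<^sup>+x. ennreal (exp (- x\<^sup>2 / 2) * (\<Prod>y\<leftarrow>ys. \<bar>y - x\<bar>)) * (ennreal C * Jn k g (x # ys)) \<partial>lborel) =
    (\<integral>\<^sup>+x. ennreal C * (ennreal (exp (- x\<^sup>2 / 2) * (\<Prod>y\<leftarrow>ys. \<bar>y - x\<bar>)) * Jn k g (x # ys)) \<partial>lborel)"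
    by (simp only: mult_ac)
  also have "\<dots> = ennreal C * Jn (Suc k) g ys"
    unfolding Jn_Suc[OF g] by (rule nn_integral_cmult) (intro borel_measurable_times_ennreal measurable_gauss_prod_list measurable_Jn_Cons g)
  also have "ennreal (1 / dd n) * (ennreal C * Jn (Suc k) g ys) = ennreal (1 / dd n * C) * Jn (Suc k) g ys"
    using dd_pos[of n] C by (subst ennreal_mult) (auto simp: mult.assoc)
  finally show ?thesis by simp
qed

lemma Jn_0: "Jn 0 g ys = ennreal (\<Prod>y\<leftarrow>ys. g y)"
  unfolding Jn_def lessThan_0 by (subst leb.nn_integral_empty) (simp_all add: Wk_def)

text \<open>Both sides obey the same recursion with nonnegative weights, so an inequality at
  \<open>k = 0\<close> propagates. The sum \<open>length ys + k\<close> is invariant, so the base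
  bound is used only for lists of length \<open>L\<close>; the bound inserted later holds only for
  lists that are not too long.\<close>

theorem An_upper:
  assumes g: "g \<in> borel_measurable borel" "\<And>x. g x \<ge> 0" and C: "C \<ge> 0"
    and base: "\<And>ys. length ys = L \<Longrightarrow> An m 0 ys \<le> ennreal (C * (\<Prod>y\<leftarrow>ys. g y))"
    and L: "length ys + k = L"
  shows "ennreal (fact k) * An (m + k) k ys \<le> ennreal (C / (\<Prod>j<k. dd (m + j))) * Jn k g ys"
  using L
proof (induction k arbitrary: ys)
  case 0
  have "(\<Prod>y\<leftarrow>ys. g y) \<ge> 0" using g by (intro prod_list_map_nonneg) auto
  thus ?case using base[of ys] 0 C by (simp add: Jn_0 ennreal_mult)
next
  case (Suc k)
  have D: "C / (\<Prod>j<k. dd (m + j)) \<ge> 0" using C dd_pos by (intro divide_nonneg_pos prod_pos) auto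
  have "ennreal (fact (Suc k)) * An (m + Suc k) (Suc k) ys \<le> ennreal (1 / dd (m + k)) *
     (\<integral>\<^sup>+x. ennreal (exp (- x\<^sup>2 / 2) * (\<Prod>y\<leftarrow>ys. \<bar>y - x\<bar>)) * (ennreal (C / (\<Prod>j<k. dd (m + j))) * Jn k g (x # ys)) \<partial>lborel)"
    unfolding add_Suc_right fact_An_Suc using Suc.prems
    by (intro mult_left_mono nn_integral_mono Suc.IH) auto
  also have "\<dots> = ennreal (C / (\<Prod>j<k. dd (m + j)) / dd (m + k)) * Jn (Suc k) g ys"
    by (rule const_Jn_Suc[OF g D])
  finally show ?case by simp
qed

text \<open>The induction of \<open>An_upper\<close> with the inequalities reversed.\<close>

theorem An_lower:
  assumes g: "g \<in> borel_measurable borel" "\<And>x. g x \<ge> 0" and C: "C \<ge> 0"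
    and base: "\<And>ys. length ys = L \<Longrightarrow> An m 0 ys \<ge> ennreal (C * (\<Prod>y\<leftarrow>ys. g y))"
    and L: "length ys + k = L"
  shows "ennreal (fact k) * An (m + k) k ys \<ge> ennreal (C / (\<Prod>j<k. dd (m + j))) * Jn k g ys"
  using L
proof (induction k arbitrary: ys)
  case 0
  have "(\<Prod>y\<leftarrow>ys. g y) \<ge> 0" using g by (intro prod_list_map_nonneg) auto
  thus ?case using base[of ys] 0 C by (simp add: Jn_0 ennreal_mult)
next
  case (Suc k)
  have D: "C / (\<Prod>j<k. dd (m + j)) \<ge> 0" using C dd_pos by (intro divide_nonneg_pos prod_pos) auto
  have "ennreal (fact (Suc k)) * An (m + Suc k) (Suc k) ys \<ge> ennreal (1 / dd (m + k)) *
     (\<integral>\<^sup>+x. ennreal (exp (- x\<^sup>2 / 2) * (\<Prod>y\<leftarrow>ys. \<bar>y - x\<bar>)) * (ennreal (C / (\<Prod>j<k. dd (m + j))) * Jn k g (x # ys)) \<partial>lborel)"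
    unfolding add_Suc_right fact_An_Suc using Suc.prems
    by (intro mult_left_mono nn_integral_mono Suc.IH) auto
  also have "ennreal (1 / dd (m + k)) * (\<integral>\<^sup>+x. ennreal (exp (- x\<^sup>2 / 2) * (\<Prod>y\<leftarrow>ys. \<bar>y - x\<bar>)) * (ennreal (C / (\<Prod>j<k. dd (m + j))) * Jn k g (x # ys)) \<partial>lborel)
     = ennreal (C / (\<Prod>j<k. dd (m + j)) / dd (m + k)) * Jn (Suc k) g ys"
    by (rule const_Jn_Suc[OF g D])
  finally show ?case by simp
qed

section \<open>Hermite polynomials and Vandermonde integrals\<close>

text \<open>Moments of the weight \<open>exp (- x\<^sup>2)\<close>. The variables of the Vandermonde
  integral carry only the square root of this weight, which is why the Hermite polynomials are
  estimated below against \<open>exp (- x\<^sup>2 / 2)\<close>, both in mean and in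
  supremum.\<close>

fun mom :: "nat \<Rightarrow> real" where
  "mom 0 = sqrt pi"
| "mom (Suc 0) = 0"
| "mom (Suc (Suc n)) = (real n + 1) / 2 * mom n"

lemma mom_even: "mom (2 * k) = sqrt pi * (fact (2 * k) / (2 ^ (2 * k) * fact k))"
proof (induction k)
  case (Suc k)
  have f: "fact (2 * Suc k) = (2 * (real k + 1)) * ((2 * real k + 1) * fact (2 * k))" by (simp add: algebra_simps)
  have g: "2 ^ (2 * Suc k) * fact (Suc k) = (2 * (real k + 1)) * (2 * (2 ^ (2 * k) * fact k))" by (simp add: algebra_simps)
  have "fact (2 * Suc k) / (2 ^ (2 * Suc k) * fact (Suc k)) = ((2 * real k + 1) * fact (2 * k)) / (2 * (2 ^ (2 * k) * fact k))"
    unfolding f g by (rule mult_divide_mult_cancel_left) simp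
  moreover have "mom (2 * Suc k) = (2 * real k + 1) / 2 * mom (2 * k)" by simp
  ultimately show ?case using Suc by simp
qed simp

lemma mom_odd: "mom (2 * k + 1) = 0"
  by (induction k) auto

lemma has_bochner_integral_mom: "has_bochner_integral lborel (\<lambda>x. x ^ k * exp (- x\<^sup>2)) (mom k)"
proof (cases "even k")
  case True
  then obtain j where k: "k = 2 * j" by auto
  have "has_bochner_integral lborel (\<lambda>x. exp (- x\<^sup>2) * x ^ (2 * j)) (2 * (sqrt pi / 2 * (fact (2 * j) / (2 ^ (2 * j) * fact j))))"
    using has_bochner_integral_even_function[OF gaussian_moment_even_pos[of j]] by simp
  thus ?thesis unfolding k mom_even by (simp add: mult.commute)
next
  case False
  then obtain j where k: "k = 2 * j + 1" using oddE by blast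
  have "has_bochner_integral lborel (\<lambda>x :: real. exp (- x\<^sup>2) * x ^ (2 * j + 1)) 0"
    using has_bochner_integral_odd_function[OF gaussian_moment_odd_pos[of j]] by simp
  thus ?thesis unfolding k mom_odd by (simp add: mult.commute)
qed

definition GG :: "real poly \<Rightarrow> real" where
  "GG p = (\<integral>x. poly p x * exp (- x\<^sup>2) \<partial>lborel)"

lemma GG_has: "has_bochner_integral lborel (\<lambda>x. poly p x * exp (- x\<^sup>2)) (\<Sum>i\<le>degree p. coeff p i * mom i)"
proof -
  have "has_bochner_integral lborel (\<lambda>x. \<Sum>i\<le>degree p. coeff p i * (x ^ i * exp (- x\<^sup>2))) (\<Sum>i\<le>degree p. coeff p i * mom i)"
    by (intro has_bochner_integral_sum has_bochner_integral_mult_right has_bochner_integral_mom)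
  moreover have "(\<lambda>x. \<Sum>i\<le>degree p. coeff p i * (x ^ i * exp (- x\<^sup>2))) = (\<lambda>x. poly p x * exp (- x\<^sup>2))"
    by (simp add: poly_altdef sum_distrib_right mult.assoc)
  ultimately show ?thesis by simp
qed

lemma GG_integrable: "integrable lborel (\<lambda>x :: real. poly p x * exp (- x\<^sup>2))"
  using GG_has[of p] by (simp add: has_bochner_integral_iff)

lemma GG_sum: "degree p \<le> d \<Longrightarrow> GG p = (\<Sum>i\<le>d. coeff p i * mom i)"
  unfolding GG_def has_bochner_integral_integral_eq[OF GG_has]
  by (rule sum.mono_neutral_left) (auto simp: coeff_eq_0)

lemma GG_add: "GG (p + q) = GG p + GG q"
  unfolding GG_def by (subst Bochner_Integration.integral_add[symmetric]) (auto intro: GG_integrable simp: algebra_simps)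

lemma GG_diff: "GG (p - q) = GG p - GG q"
  unfolding GG_def by (subst Bochner_Integration.integral_diff[symmetric]) (auto intro: GG_integrable simp: algebra_simps)

lemma GG_const: "GG ([:c:] * p) = c * GG p"
  unfolding GG_def by (simp add: mult.assoc)

text \<open>Integration by parts against \<open>exp (- x\<^sup>2)\<close>, carried out on
  coefficients through the recurrence of \<open>mom\<close>.\<close>

lemma GG_pderiv: "GG (pderiv p) = 2 * GG ([:0, 1:] * p)"
proof -
  let ?d = "degree p"
  have "GG ([:0, 1:] * p) = (\<Sum>i\<le>Suc ?d. coeff (pCons 0 p) i * mom i)"
    by (subst GG_sum[of _ "Suc ?d"]) (auto simp: degree_pCons_eq_if)
  also have "\<dots> = (\<Sum>i\<le>?d. coeff p i * mom (Suc i))" by (simp add: sum.atMost_Suc_shift del: sum.atMost_Suc)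
  also have "\<dots> = (\<Sum>i\<le>Suc ?d. coeff p i * mom (Suc i))" by (simp add: coeff_eq_0)
  also have "\<dots> = (\<Sum>i\<le>?d. coeff p (Suc i) * mom (Suc (Suc i)))"
    by (simp add: sum.atMost_Suc_shift del: sum.atMost_Suc)
  finally have "2 * GG ([:0, 1:] * p) = (\<Sum>i\<le>?d. coeff (pderiv p) i * mom i)"
    by (simp add: sum_distrib_left coeff_pderiv mult_ac add.commute)
  also have "\<dots> = GG (pderiv p)" by (rule GG_sum[symmetric]) (simp add: degree_pderiv)
  finally show ?thesis ..
qed

text \<open>Monic Hermite polynomials for the weight \<open>exp (- x\<^sup>2)\<close>, generated by
  their raising operator.\<close>

primrec Hp :: "nat \<Rightarrow> real poly" where
  "Hp 0 = 1"
| "Hp (Suc n) = [:0, 1:] * Hp n - [:1 / 2:] * pderiv (Hp n)"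

lemma pderiv_Hp: "pderiv (Hp (Suc n)) = [:real (Suc n):] * Hp n"
proof (induction n)
  case 0
  show ?case by (simp add: pderiv_pCons one_pCons)
next
  case (Suc n)
  have "pderiv (Hp (Suc (Suc n))) = Hp (Suc n) + ([:0, 1:] * pderiv (Hp (Suc n)) - [:1 / 2:] * pderiv (pderiv (Hp (Suc n))))"
    unfolding Hp.simps(2)[of "Suc n"] pderiv_diff pderiv_mult by (simp add: pderiv_pCons)
  also have "[:0, 1:] * pderiv (Hp (Suc n)) - [:1 / 2:] * pderiv (pderiv (Hp (Suc n))) = [:real (Suc n):] * Hp (Suc n)"
  proof -
    have d: "pderiv ([:c:] * q) = [:c:] * pderiv q" for c :: real and q by (simp add: pderiv_smult)
    have "[:0, 1:] * pderiv (Hp (Suc n)) - [:1 / 2:] * pderiv (pderiv (Hp (Suc n))) =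
        [:0, 1:] * ([:real (Suc n):] * Hp n) - [:1 / 2:] * ([:real (Suc n):] * pderiv (Hp n))"
      by (simp only: Suc d)
    also have "\<dots> = [:real (Suc n):] * Hp (Suc n)"
      unfolding Hp.simps(2) by (simp only: right_diff_distrib mult.left_commute)
    finally show ?thesis .
  qed
  also have "Hp (Suc n) + [:real (Suc n):] * Hp (Suc n) = [:real (Suc (Suc n)):] * Hp (Suc n)"
  proof -
    have "[:real (Suc (Suc n)):] = 1 + [:real (Suc n):]" by (simp add: one_pCons)
    thus ?thesis by (simp only: distrib_right mult_1)
  qed
  finally show ?case .
qed

lemma Hp_monic: "degree (Hp n) = n \<and> coeff (Hp n) n = 1"
proof (induction n)
  case (Suc n)
  have 0: "Hp n \<noteq> 0" using Suc by auto
  have d: "degree ([:0, 1:] * Hp n) = Suc n" using Suc 0 by (simp add: degree_pCons_eq)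
  have e: "degree ([:1 / 2:] * pderiv (Hp n)) < Suc n" using Suc by (simp add: degree_pderiv)
  have "degree (Hp (Suc n)) = Suc n"
    unfolding Hp.simps diff_conv_add_uminus using d e by (subst degree_add_eq_left) (simp_all del: mult_pCons_left)
  moreover have "coeff (Hp (Suc n)) (Suc n) = 1"
    using Suc coeff_eq_0[OF e] by simp
  ultimately show ?case by simp
qed simp

text \<open>By parts, the raising operator is adjoint to half the derivative. Orthogonality and the
  norms follow by moving it onto the other factor.\<close>

lemma GG_Hp_Suc: "GG (f * Hp (Suc n)) = GG (pderiv f * Hp n) / 2"
proof -
  have "GG (pderiv f * Hp n) + GG (f * pderiv (Hp n)) = 2 * GG ([:0, 1:] * (f * Hp n))"
    unfolding GG_pderiv[symmetric] pderiv_mult GG_add[symmetric] by (simp add: mult.commute add.commute)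
  moreover have "f * Hp (Suc n) = [:0, 1:] * (f * Hp n) - [:1 / 2:] * (f * pderiv (Hp n))"
    unfolding Hp.simps right_diff_distrib by (simp only: mult_ac)
  ultimately show ?thesis by (simp only: GG_diff GG_const)
qed

lemma GG_Hp_orthogonal: "degree f < n \<Longrightarrow> GG (f * Hp n) = 0"
proof (induction n arbitrary: f)
  case (Suc n)
  show ?case
  proof (cases "degree f = 0")
    case True
    hence "pderiv f = 0" by (simp add: pderiv_eq_0_iff)
    thus ?thesis unfolding GG_Hp_Suc by (simp add: GG_def)
  next
    case False
    hence "degree (pderiv f) < n" using Suc.prems by (simp add: degree_pderiv)
    thus ?thesis unfolding GG_Hp_Suc using Suc.IH by simp
  qed
qed simp

definition hh :: "nat \<Rightarrow> real" where "hh n = sqrt pi * fact n / 2 ^ n"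

lemma hh_pos: "hh n > 0" by (simp add: hh_def)

lemma GG_Hp_norm: "GG (Hp n * Hp n) = hh n"
proof (induction n)
  case 0
  have "GG (Hp 0 * Hp 0) = (\<Sum>i\<le>0. coeff (1 :: real poly) i * mom i)" by (subst GG_sum[of _ 0]) auto
  thus ?case by (simp add: hh_def)
next
  case (Suc n)
  have "GG (Hp (Suc n) * Hp (Suc n)) = real (Suc n) * GG (Hp n * Hp n) / 2"
    unfolding GG_Hp_Suc[of "Hp (Suc n)"] pderiv_Hp by (simp only: mult.assoc GG_const)
  also have "\<dots> = hh (Suc n)" unfolding Suc by (simp add: hh_def field_simps)
  finally show ?case .
qed

lemma GG_Hp_delta: "i \<noteq> j \<Longrightarrow> GG (Hp i * Hp j) = 0"
  using GG_Hp_orthogonal[of "Hp i" j] GG_Hp_orthogonal[of "Hp j" i] Hp_monic[of i] Hp_monic[of j]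
  by (cases "i < j") (auto simp: mult.commute)

lemma GG_pderiv_Hp: "GG (pderiv (Hp n) * pderiv (Hp n)) = 2 * real n * hh n"
proof (cases n)
  case (Suc m)
  have "pderiv (Hp n) * pderiv (Hp n) = [:real (Suc m):] * ([:real (Suc m):] * (Hp m * Hp m))"
    unfolding Suc pderiv_Hp by (simp only: mult_ac)
  hence "GG (pderiv (Hp n) * pderiv (Hp n)) = real (Suc m) * (real (Suc m) * hh m)"
    by (simp only: GG_const GG_Hp_norm)
  thus ?thesis by (simp add: Suc hh_def field_simps)
qed (simp add: GG_def)

text \<open>Integration by parts twice; the term with the second derivative vanishes by
  orthogonality.\<close>

lemma GG_x2_Hp: "GG ([:0, 1:] * ([:0, 1:] * (Hp n * Hp n))) = (real n + 1 / 2) * hh n"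
proof -
  have 1: "2 * GG ([:0, 1:] * ([:0, 1:] * (Hp n * Hp n))) = GG (Hp n * Hp n) + 2 * GG ([:0, 1:] * (Hp n * pderiv (Hp n)))"
  proof -
    have "pderiv ([:0, 1:] * (Hp n * Hp n)) = Hp n * Hp n + [:2:] * ([:0, 1:] * (Hp n * pderiv (Hp n)))"
    proof -
      have p1: "pderiv [:0, 1 :: real:] = 1" by (simp add: pderiv_pCons one_pCons)
      have two: "[:2 :: real:] = 1 + 1" by (simp add: one_pCons)
      show ?thesis unfolding pderiv_mult p1 two by (simp only: ring_distribs mult_1 mult_1_right add_ac mult_ac)
    qed
    thus ?thesis using GG_pderiv[of "[:0, 1:] * (Hp n * Hp n)"] by (simp only: GG_add GG_const)
  qed
  have 2: "2 * GG ([:0, 1:] * (Hp n * pderiv (Hp n))) = GG (pderiv (Hp n) * pderiv (Hp n)) + GG (pderiv (pderiv (Hp n)) * Hp n)"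
    unfolding GG_pderiv[symmetric] pderiv_mult GG_add[symmetric] by (simp add: algebra_simps)
  have "GG (pderiv (pderiv (Hp n)) * Hp n) = 0"
  proof (cases "n = 0")
    case False
    thus ?thesis using Hp_monic[of n] by (intro GG_Hp_orthogonal) (simp add: degree_pderiv)
  qed (simp add: GG_def)
  thus ?thesis using 1 2 unfolding GG_Hp_norm GG_pderiv_Hp by (simp add: algebra_simps)
qed

lemma integrable_cauchy:
  "integrable lborel (\<lambda>x :: real. inverse (1 + x\<^sup>2))" "integral\<^sup>L lborel (\<lambda>x :: real. inverse (1 + x\<^sup>2)) = pi"
  using integrable_inverse_1_plus_square LBINT_inverse_1_plus_square
  by (auto simp: interval_lebesgue_integral_def set_lebesgue_integral_def set_integrable_def)

text \<open>Cauchy--Schwarz against \<open>1 / (1 + x\<^sup>2)\<close> in pointwise form. The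
  compensating weight \<open>1 + x\<^sup>2\<close> costs the second moment, which exceeds the norm
  only by a factor linear in \<open>j\<close>.\<close>

lemma Hp_L1_bound:
  "(\<integral>\<^sup>+x. ennreal (\<bar>poly (Hp j) x\<bar> * exp (- x\<^sup>2 / 2)) \<partial>lborel) \<le> ennreal (sqrt (hh j) * (real j + 4))"
proof -
  let ?h = "hh j"
  have h: "?h > 0" by (rule hh_pos)
  let ?p = "[:0, 1:] * ([:0, 1:] * (Hp j * Hp j)) + Hp j * Hp j"
  let ?F = "\<lambda>x. sqrt ?h / 2 * ((poly ?p x * exp (- x\<^sup>2)) / ?h + inverse (1 + x\<^sup>2))"
  have le: "\<bar>poly (Hp j) x\<bar> * exp (- x\<^sup>2 / 2) \<le> ?F x" for x
  proof -
    define a where "a = \<bar>poly (Hp j) x\<bar> * exp (- x\<^sup>2 / 2)"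
    have a2: "a\<^sup>2 = (poly (Hp j) x)\<^sup>2 * exp (- x\<^sup>2)"
      by (simp add: a_def power_mult_distrib flip: exp_double)
    have x1: "1 + x\<^sup>2 > 0" by (simp add: add_pos_nonneg)
    have p: "poly ?p x * exp (- x\<^sup>2) = a\<^sup>2 * (1 + x\<^sup>2)" unfolding a2 by (simp add: algebra_simps power2_eq_square)
    \<comment> \<open>Division by \<open>sqrt (hh j)\<close> balances the two squares: the integrals
      of \<open>b\<^sup>2\<close> and \<open>c\<^sup>2\<close> are \<open>j + 3 / 2\<close> and
      \<open>pi\<close>.\<close>
    define b where "b = a * sqrt (1 + x\<^sup>2) / sqrt ?h"
    define c where "c = inverse (sqrt (1 + x\<^sup>2))"
    have "2 * b * c \<le> b\<^sup>2 + c\<^sup>2" by (rule sum_squares_bound)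
    moreover have "b\<^sup>2 = a\<^sup>2 * (1 + x\<^sup>2) / ?h" using h x1 by (simp add: b_def power_divide power_mult_distrib)
    moreover have "c\<^sup>2 = inverse (1 + x\<^sup>2)" using x1 by (simp add: c_def power_inverse)
    moreover have "b * c = a / sqrt ?h" using x1 by (simp add: b_def c_def)
    ultimately have "2 * (a / sqrt ?h) \<le> a\<^sup>2 * (1 + x\<^sup>2) / ?h + inverse (1 + x\<^sup>2)" by simp
    hence "sqrt ?h / 2 * (2 * (a / sqrt ?h)) \<le> sqrt ?h / 2 * (a\<^sup>2 * (1 + x\<^sup>2) / ?h + inverse (1 + x\<^sup>2))"
      using h by (intro mult_left_mono) auto
    thus ?thesis using h unfolding p a_def[symmetric] by simp
  qed
  have int: "integrable lborel ?F" by (intro integrable_mult_right Bochner_Integration.integrable_add integrable_divide GG_integrable integrable_cauchy)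
  have "(\<integral>\<^sup>+x. ennreal (\<bar>poly (Hp j) x\<bar> * exp (- x\<^sup>2 / 2)) \<partial>lborel) \<le> (\<integral>\<^sup>+x. ennreal (?F x) \<partial>lborel)"
    by (intro nn_integral_mono ennreal_leI le)
  also have "\<dots> = ennreal (\<integral>x. ?F x \<partial>lborel)"
  proof (rule nn_integral_eq_integral[OF int])
    show "AE x in lborel. 0 \<le> ?F x" by (intro AE_I2 order_trans[OF _ le]) simp
  qed
  also have "(\<integral>x. ?F x \<partial>lborel) = sqrt ?h / 2 * (GG ?p / ?h + pi)"
    by (simp add: GG_integrable integrable_cauchy GG_def del: mult_pCons_left poly_add poly_mult poly_pCons)
  also have "GG ?p = (real j + 3 / 2) * ?h"
    unfolding GG_add GG_x2_Hp GG_Hp_norm by (simp add: algebra_simps)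
  also have "sqrt ?h / 2 * ((real j + 3 / 2) * ?h / ?h + pi) \<le> sqrt ?h * (real j + 4)"
  proof -
    have "(real j + 3 / 2 + pi) / 2 \<le> real j + 4" using pi_less_4 by simp
    hence "sqrt ?h * ((real j + 3 / 2 + pi) / 2) \<le> sqrt ?h * (real j + 4)" using h by (intro mult_left_mono) auto
    thus ?thesis using h by simp
  qed
  finally show ?thesis by (simp add: ennreal_leI)
qed

text \<open>The square \<open>f\<close> of the left-hand side has integral \<open>hh j\<close>, so
  it is at most \<open>2 * hh j\<close> somewhere in the unit interval. Its variation is at most the
  integral of \<open>g\<close>, a combination of quadratic moments of \<open>Hp j\<close> and its
  derivative, and these are \<open>hh j\<close> times linear functions of \<open>j\<close>.\<close>

lemma Hp_sup_bound: "\<bar>poly (Hp j) x\<bar> * exp (- x\<^sup>2 / 2) \<le> sqrt (hh j) * (3 * real j + 5)"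
proof -
  let ?h = "hh j"
  have h: "?h > 0" by (rule hh_pos)
  define f where "f x = poly (Hp j * Hp j) x * exp (- x\<^sup>2)" for x
  define f' where "f' x = (2 * poly (Hp j) x * poly (pderiv (Hp j)) x - 2 * x * (poly (Hp j) x)\<^sup>2) * exp (- x\<^sup>2)" for x
  \<comment> \<open>The derivative of \<open>f\<close> is at most
    \<open>H\<^sup>2 + H'\<^sup>2 + (1 + x\<^sup>2) H\<^sup>2\<close> times the weight, where
    \<open>H\<close> is \<open>Hp j\<close>: the inequality between products and squares is used
    once for \<open>H H'\<close> and once for \<open>x\<close>. This polynomial is
    \<open>?p\<close>.\<close>
  let ?p = "[:0, 1:] * ([:0, 1:] * (Hp j * Hp j)) + (Hp j * Hp j + Hp j * Hp j) + pderiv (Hp j) * pderiv (Hp j)"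
  define g where "g x = poly ?p x * exp (- x\<^sup>2)" for x
  have gint: "integrable lborel g" unfolding g_def by (rule GG_integrable)
  have gG: "(\<integral>x. g x \<partial>lborel) = (3 * real j + 5 / 2) * ?h"
  proof -
    have "(\<integral>x. g x \<partial>lborel) = GG ?p" by (simp add: g_def GG_def)
    also have "\<dots> = (3 * real j + 5 / 2) * ?h"
      unfolding GG_add GG_x2_Hp GG_Hp_norm GG_pderiv_Hp by (simp add: algebra_simps)
    finally show ?thesis .
  qed
  have d: "(f has_real_derivative f' x) (at x)" for x
    unfolding f_def f'_def by (auto intro!: derivative_eq_intros simp: power2_eq_square algebra_simps)
  have le: "\<bar>f' x\<bar> \<le> g x" for x
  proof -
    let ?a = "poly (Hp j) x" and ?b = "poly (pderiv (Hp j)) x"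
    have "\<bar>2 * ?a * ?b\<bar> \<le> ?a\<^sup>2 + ?b\<^sup>2" using sum_squares_bound[of "\<bar>?a\<bar>" "\<bar>?b\<bar>"] by (simp add: abs_mult)
    moreover have "\<bar>2 * x * ?a\<^sup>2\<bar> \<le> (1 + x\<^sup>2) * ?a\<^sup>2"
      using sum_squares_bound[of 1 "\<bar>x\<bar>"] by (auto simp: abs_mult intro!: mult_right_mono)
    ultimately have "\<bar>2 * ?a * ?b - 2 * x * ?a\<^sup>2\<bar> \<le> ?a\<^sup>2 + ?b\<^sup>2 + (1 + x\<^sup>2) * ?a\<^sup>2" by linarith
    also have "\<dots> = poly ?p x" by (simp add: algebra_simps power2_eq_square)
    finally show ?thesis unfolding f'_def g_def by (simp add: abs_mult mult_right_mono)
  qed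
  have cont: "isCont f' x" for x unfolding f'_def by (intro continuous_intros)
  have step: "\<bar>f b - f a\<bar> \<le> (3 * real j + 5 / 2) * ?h" if "a \<le> b" for a b
  proof -
    have eq: "(\<integral>x. f' x * indicator {a..b} x \<partial>lborel) = f b - f a"
      by (rule integral_FTC_Icc_real[OF that d cont])
    have "\<bar>f b - f a\<bar> \<le> (\<integral>x. \<bar>f' x * indicator {a..b} x\<bar> \<partial>lborel)"
      unfolding eq[symmetric] by (rule integral_abs_bound)
    also have "\<dots> \<le> (\<integral>x. g x \<partial>lborel)"
    proof (rule integral_mono_AE')
      show "AE x in lborel. \<bar>f' x * indicator {a..b} x\<bar> \<le> g x"
        by (intro AE_I2) (use le order_trans[OF abs_ge_zero le] in \<open>auto split: split_indicator\<close>)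
      show "AE x in lborel. 0 \<le> g x" by (intro AE_I2 order_trans[OF abs_ge_zero le])
    qed (rule gint)
    finally show ?thesis unfolding gG .
  qed
  have "\<exists>y\<in>{0..1}. f y \<le> 2 * ?h"
  proof (rule ccontr)
    assume "\<not> ?thesis"
    hence gt: "f y > 2 * ?h" if "y \<in> {0..1}" for y using that by force
    have fint: "integrable lborel f" unfolding f_def by (rule GG_integrable)
    have "(\<integral>x. 2 * ?h * indicator {0..1 :: real} x \<partial>lborel) \<le> (\<integral>x. f x \<partial>lborel)"
    proof (rule integral_mono_AE')
      show "AE x in lborel. 2 * ?h * indicator {0..1 :: real} x \<le> f x"
        using gt by (intro AE_I2) (auto split: split_indicator simp: f_def less_imp_le)
      show "AE x in lborel. 0 \<le> f x" by (simp add: f_def)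
    qed (rule fint)
    also have "(\<integral>x. f x \<partial>lborel) = ?h" unfolding f_def GG_Hp_norm[symmetric] GG_def ..
    finally show False using h by simp
  qed
  then obtain y where y: "f y \<le> 2 * ?h" by blast
  have "\<bar>f x - f y\<bar> \<le> (3 * real j + 5 / 2) * ?h"
    using step[of x y] step[of y x] by (cases "x \<le> y") (auto simp: abs_minus_commute)
  hence "f x \<le> (3 * real j + 5) * ?h" using y h by (auto simp: algebra_simps)
  also have "\<dots> \<le> (3 * real j + 5)\<^sup>2 * ?h" using h by (intro mult_right_mono) (auto simp: power2_eq_square)
  also have "\<dots> = (sqrt ?h * (3 * real j + 5))\<^sup>2" using h by (simp add: power_mult_distrib)
  also have "f x = (\<bar>poly (Hp j) x\<bar> * exp (- x\<^sup>2 / 2))\<^sup>2"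
  proof -
    have "(\<bar>poly (Hp j) x\<bar> * exp (- x\<^sup>2 / 2))\<^sup>2 = (poly (Hp j) x)\<^sup>2 * exp (- x\<^sup>2)"
      by (simp add: power_mult_distrib flip: exp_double)
    thus ?thesis by (simp add: f_def power2_eq_square)
  qed
  finally show ?thesis by (rule power2_le_imp_le) (use h in auto)
qed

section \<open>Vandermonde determinants and their integrals\<close>

definition vander :: "nat \<Rightarrow> (nat \<Rightarrow> real) \<Rightarrow> real" where
  "vander k l = (\<Prod>j<k. \<Prod>i<j. l j - l i)"

text \<open>As a function of the last point the determinant is a polynomial \<open>P\<close> of
  degree at most \<open>k\<close> that vanishes at the other points and has the smaller determinant
  as its coefficient of degree \<open>k\<close>. Any monic polynomials of the right degrees are
  admissible, so Hermite polynomials, also rescaled ones, may replace the powers.\<close>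

lemma det_monic_vander:
  fixes Q :: "nat \<Rightarrow> real poly"
  assumes Q: "\<And>j. degree (Q j) = j" "\<And>j. coeff (Q j) j = 1"
  shows "det (mat k k (\<lambda>(i, j). poly (Q j) (l i))) = vander k l"
proof (induction k)
  case 0
  show ?case by (simp add: vander_def)
next
  case (Suc k)
  define M where "M x = mat (Suc k) (Suc k) (\<lambda>(i, j). poly (Q j) (if i = k then x else l i))" for x
  have M: "M x \<in> carrier_mat (Suc k) (Suc k)" for x by (simp add: M_def)
  define c where "c j = cofactor (M 0) k j" for j
  define P where "P = (\<Sum>j<Suc k. [:c j:] * Q j)"
  have cof: "cofactor (M x) k j = c j" if "j < Suc k" for x j
    unfolding c_def cofactor_def
    by (intro arg_cong2[of _ _ _ _ "(*)"] refl arg_cong[of _ _ det] eq_matI) (auto simp: M_def mat_delete_def)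
  have detM: "det (M x) = poly P x" for x
  proof -
    have "det (M x) = (\<Sum>j<Suc k. M x $$ (k, j) * cofactor (M x) k j)"
      by (rule laplace_expansion_row[OF M]) simp
    also have "\<dots> = (\<Sum>j<Suc k. poly (Q j) x * c j)" by (intro sum.cong refl) (simp add: cof, simp add: M_def)
    also have "\<dots> = poly P x" by (simp add: P_def poly_sum mult.commute del: sum.lessThan_Suc)
    finally show ?thesis .
  qed
  have ck: "c k = vander k l"
  proof -
    have "mat_delete (M 0) k k = mat k k (\<lambda>(i, j). poly (Q j) (l i))"
      by (intro eq_matI) (auto simp: M_def mat_delete_def)
    thus ?thesis using Suc.IH by (simp add: c_def cofactor_def)
  qed
  have Ml: "M (l k) = mat (Suc k) (Suc k) (\<lambda>(i, j). poly (Q j) (l i))"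
    unfolding M_def by (intro eq_matI) auto
  have root: "poly P (l i) = 0" if "i < k" for i
  proof -
    have "row (M (l i)) i = row (M (l i)) k" using that by (intro eq_vecI) (auto simp: M_def)
    thus ?thesis unfolding detM[symmetric] using that by (intro det_identical_rows[OF M, of i k]) auto
  qed
  have V: "vander (Suc k) l = vander k l * (\<Prod>i<k. l k - l i)" by (simp add: vander_def)
  show ?case
  \<comment> \<open>Comparing the number of roots with the degree requires distinct points; if a
    point is repeated, both sides vanish.\<close>
  proof (cases "inj_on l {..<k}")
    case False
    then obtain i j where ij: "i < k" "j < k" "i \<noteq> j" "l i = l j" by (auto simp: inj_on_def)
    have "row (M (l k)) i = row (M (l k)) j" using ij by (intro eq_vecI) (auto simp: M_def)
    hence "det (M (l k)) = 0" using ij by (intro det_identical_rows[OF M, of i j]) auto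
    moreover have "vander k l = 0"
    proof -
      have "\<exists>i'\<in>{..<max i j}. l (max i j) - l i' = 0"
        using ij by (intro bexI[of _ "min i j"]) (auto simp: max_def min_def)
      hence "(\<Prod>i'<max i j. l (max i j) - l i') = 0" by (intro prod_zero) auto
      hence "\<exists>j'\<in>{..<k}. (\<Prod>i'<j'. l j' - l i') = 0" using ij by (intro bexI[of _ "max i j"]) auto
      thus ?thesis unfolding vander_def by (intro prod_zero) auto
    qed
    ultimately show ?thesis unfolding Ml[symmetric] V by simp
  next
    case True
    define R where "R = P - [:c k:] * (\<Prod>i<k. [:- l i, 1:])"
    have "coeff R n = 0" if n: "n \<ge> k" for n
    proof (cases "n = k")
      case True
      have "coeff P k = (\<Sum>j<Suc k. c j * coeff (Q j) k)" by (simp add: P_def coeff_sum del: sum.lessThan_Suc)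
      also have "\<dots> = c k" using Q coeff_eq_0[of "Q _" k] by simp
      finally have "coeff P k = c k" .
      moreover have "degree (\<Prod>i<k. [:- l i, 1:]) = k" by (subst degree_prod_eq_sum_degree) auto
      hence "coeff (\<Prod>i<k. [:- l i, 1:]) k = lead_coeff (\<Prod>i<k. [:- l i, 1:])" by simp
      hence "coeff (\<Prod>i<k. [:- l i, 1:]) k = 1" by (simp add: lead_coeff_prod)
      ultimately show ?thesis using True by (simp add: R_def)
    next
      case False
      hence n: "n > k" using n by simp
      have "coeff P n = (\<Sum>j<Suc k. c j * coeff (Q j) n)" by (simp add: P_def coeff_sum del: sum.lessThan_Suc)
      also have "\<dots> = 0" using Q n by (intro sum.neutral) (auto simp: coeff_eq_0)
      finally have "coeff P n = 0" .
      moreover have "degree (\<Prod>i<k. [:- l i, 1:]) = k" by (subst degree_prod_eq_sum_degree) auto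
      hence "coeff (\<Prod>i<k. [:- l i, 1:]) n = 0" using n by (intro coeff_eq_0) simp
      ultimately show ?thesis by (simp add: R_def)
    qed
    hence deg: "R = 0 \<or> degree R < k" by (metis leading_coeff_0_iff not_le)
    have "R = 0"
    proof (rule ccontr)
      assume R: "R \<noteq> 0"
      have "l ` {..<k} \<subseteq> {x. poly R x = 0}" using root by (auto simp: R_def poly_prod)
      hence "card (l ` {..<k}) \<le> card {x. poly R x = 0}" using R by (intro card_mono poly_roots_finite)
      also have "\<dots> \<le> degree R" by (rule card_poly_roots_bound[OF R])
      finally have "k \<le> degree R" using True by (simp add: card_image)
      thus False using deg R by simp
    qed
    hence "P = [:c k:] * (\<Prod>i<k. [:- l i, 1:])" by (simp add: R_def)
    hence "poly P (l k) = c k * (\<Prod>i<k. l k - l i)" by (simp add: poly_prod algebra_simps)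
    thus ?thesis unfolding Ml[symmetric] V detM ck .
  qed
qed

lemma vander_leibniz:
  fixes Q :: "nat \<Rightarrow> real poly"
  assumes Q: "\<And>j. degree (Q j) = j" "\<And>j. coeff (Q j) j = 1"
  shows "vander k l = (\<Sum>p | p permutes {..<k}. signof p * (\<Prod>i<k. poly (Q (p i)) (l i)))"
proof -
  have "vander k l = det (mat k k (\<lambda>(i, j). poly (Q j) (l i)))" using det_monic_vander[of Q] Q by simp
  also have "\<dots> = (\<Sum>p | p permutes {0..<k}. signof p * (\<Prod>i = 0..<k. mat k k (\<lambda>(i, j). poly (Q j) (l i)) $$ (i, p i)))"
    by (rule det_def') simp
  also have "\<dots> = (\<Sum>p | p permutes {0..<k}. signof p * (\<Prod>i = 0..<k. poly (Q (p i)) (l i)))"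
    by (intro sum.cong refl arg_cong2[of _ _ _ _ "(*)"] prod.cong) (auto dest: permutes_in_image[of _ "{0..<k}"])
  finally show ?thesis by (simp add: lessThan_atLeast0)
qed

lemma abs_vander: "\<bar>vander k l\<bar> = (\<Prod>j<k. \<Prod>i<j. \<bar>l j - l i\<bar>)"
  by (simp add: vander_def abs_prod)

text \<open>In the Leibniz expansion with the polynomials \<open>Q\<close> every permutation gives,
  after taking absolute values, a product integral. The factorial cancels later against the one in
  \<open>An_upper\<close>.\<close>

lemma vander_integral_upper:
  fixes Q :: "nat \<Rightarrow> real poly" and \<omega> \<alpha> :: "_ \<Rightarrow> real"
  assumes Q: "\<And>j. degree (Q j) = j" "\<And>j. coeff (Q j) j = 1"
    and \<omega>: "\<omega> \<in> borel_measurable borel" "\<And>x. \<omega> x \<ge> 0" and \<alpha>: "\<And>j. \<alpha> j \<ge> 0"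
    and bound: "\<And>j. (\<integral>\<^sup>+x. ennreal (\<bar>poly (Q j) x\<bar> * \<omega> x) \<partial>lborel) \<le> ennreal (\<alpha> j)"
  shows "(\<integral>\<^sup>+l. ennreal ((\<Prod>i<k. \<omega> (l i)) * (\<Prod>j<k. \<Prod>i<j. \<bar>l j - l i\<bar>)) \<partial>LB {..<k}) \<le> ennreal (fact k * (\<Prod>j<k. \<alpha> j))"
proof -
  let ?P = "{p. p permutes {..<k}}"
  have fin: "finite ?P" by (simp add: finite_permutations)
  have le: "ennreal ((\<Prod>i<k. \<omega> (l i)) * (\<Prod>j<k. \<Prod>i<j. \<bar>l j - l i\<bar>)) \<le> (\<Sum>p\<in>?P. \<Prod>i<k. ennreal (\<bar>poly (Q (p i)) (l i)\<bar> * \<omega> (l i)))" for l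
  proof -
    have "\<bar>vander k l\<bar> \<le> (\<Sum>p\<in>?P. \<bar>signof p * (\<Prod>i<k. poly (Q (p i)) (l i))\<bar>)"
      unfolding vander_leibniz[OF Q] by (rule sum_abs)
    also have "\<dots> = (\<Sum>p\<in>?P. \<Prod>i<k. \<bar>poly (Q (p i)) (l i)\<bar>)"
      by (intro sum.cong refl) (simp add: abs_mult abs_prod sign_def)
    finally have "(\<Prod>i<k. \<omega> (l i)) * \<bar>vander k l\<bar> \<le> (\<Prod>i<k. \<omega> (l i)) * (\<Sum>p\<in>?P. \<Prod>i<k. \<bar>poly (Q (p i)) (l i)\<bar>)"
      by (intro mult_left_mono prod_nonneg) (auto simp: \<omega>)
    also have "\<dots> = (\<Sum>p\<in>?P. \<Prod>i<k. \<bar>poly (Q (p i)) (l i)\<bar> * \<omega> (l i))"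
      by (simp add: sum_distrib_left prod.distrib mult.commute)
    finally have "ennreal ((\<Prod>i<k. \<omega> (l i)) * \<bar>vander k l\<bar>) \<le> ennreal (\<Sum>p\<in>?P. \<Prod>i<k. \<bar>poly (Q (p i)) (l i)\<bar> * \<omega> (l i))"
      by (rule ennreal_leI)
    also have "\<dots> = (\<Sum>p\<in>?P. \<Prod>i<k. ennreal (\<bar>poly (Q (p i)) (l i)\<bar> * \<omega> (l i)))"
      using \<omega> by (subst sum_ennreal[symmetric]) (auto intro!: prod_nonneg sum.cong simp: prod_ennreal)
    finally show ?thesis by (simp add: abs_vander)
  qed
  have m: "(\<lambda>x. ennreal (\<bar>poly (Q j) x\<bar> * \<omega> x)) \<in> borel_measurable borel" for j
  proof -
    have [measurable]: "poly (Q j) \<in> borel_measurable borel" by (intro borel_measurable_continuous_onI continuous_intros)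
    show ?thesis using \<omega>(1) by measurable
  qed
  have "(\<integral>\<^sup>+l. ennreal ((\<Prod>i<k. \<omega> (l i)) * (\<Prod>j<k. \<Prod>i<j. \<bar>l j - l i\<bar>)) \<partial>LB {..<k})
     \<le> (\<integral>\<^sup>+l. (\<Sum>p\<in>?P. \<Prod>i<k. ennreal (\<bar>poly (Q (p i)) (l i)\<bar> * \<omega> (l i))) \<partial>LB {..<k})"
    by (rule nn_integral_mono) (rule le)
  also have "\<dots> = (\<Sum>p\<in>?P. \<integral>\<^sup>+l. (\<Prod>i<k. ennreal (\<bar>poly (Q (p i)) (l i)\<bar> * \<omega> (l i))) \<partial>LB {..<k})"
    by (rule nn_integral_sum) (intro borel_measurable_prod_ennreal measurable_compose[OF measurable_coord m])
  also have "\<dots> = (\<Sum>p\<in>?P. \<Prod>i<k. \<integral>\<^sup>+x. ennreal (\<bar>poly (Q (p i)) x\<bar> * \<omega> x) \<partial>lborel)"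
    by (intro sum.cong refl leb.product_nn_integral_prod[where f = "\<lambda>i x. ennreal (\<bar>poly (Q (_ i)) x\<bar> * \<omega> x)"]) (use m in auto)
  also have "\<dots> \<le> (\<Sum>p\<in>?P. \<Prod>i<k. ennreal (\<alpha> (p i)))"
    by (intro sum_mono prod_mono_ennreal bound)
  also have "\<dots> = (\<Sum>p\<in>?P. ennreal (\<Prod>j<k. \<alpha> j))"
  proof (intro sum.cong refl)
    fix p assume "p \<in> ?P"
    hence "(\<Prod>i<k. \<alpha> (p i)) = (\<Prod>j<k. \<alpha> j)" by (simp add: prod.permute[of p "{..<k}" \<alpha>] comp_def)
    thus "(\<Prod>i<k. ennreal (\<alpha> (p i))) = ennreal (\<Prod>j<k. \<alpha> j)" using \<alpha> by (simp add: prod_ennreal)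
  qed
  also have "\<dots> = ennreal (fact k * (\<Prod>j<k. \<alpha> j))"
    using \<alpha> by (simp add: card_permutations[OF refl] ennreal_mult prod_nonneg ennreal_of_nat_eq_real_of_nat)
  finally show ?thesis .
qed

text \<open>The determinant is tested against the product of the \<open>Hp i\<close> at
  \<open>l i\<close> with the full weight. By orthogonality only the identity permutation survives
  and gives the product of the norms; the supremum bound removes the test function together with
  half of the Gaussian exponent.\<close>

lemma vander_integral_lower:
  "ennreal (\<Prod>j<k. hh j) \<le> ennreal (\<Prod>j<k. sqrt (hh j) * (3 * real j + 5)) *
     (\<integral>\<^sup>+l. ennreal ((\<Prod>i<k. exp (- (l i)\<^sup>2 / 2)) * (\<Prod>j<k. \<Prod>i<j. \<bar>l j - l i\<bar>)) \<partial>LB {..<k})"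
proof -
  let ?P = "{p. p permutes {..<k}}"
  define F where "F p l = signof p * (\<Prod>i<k. poly (Hp (p i) * Hp i) (l i) * exp (- (l i)\<^sup>2))" for p and l :: "nat \<Rightarrow> real"
  have fin: "finite ?P" by (simp add: finite_permutations)
  have int: "integrable (LB {..<k}) (F p)" for p
    unfolding F_def by (intro integrable_mult_right leb.product_integrable_prod) (auto simp: GG_integrable simp del: poly_mult)
  have val: "integral\<^sup>L (LB {..<k}) (F p) = (if p = id then \<Prod>j<k. hh j else 0)" if p: "p \<in> ?P" for p
  proof -
    have "integral\<^sup>L (LB {..<k}) (F p) = signof p * (\<Prod>i<k. GG (Hp (p i) * Hp i))"
      unfolding F_def GG_def
      by (simp only: integral_mult_right_zero) (subst leb.product_integral_prod, auto simp: GG_integrable simp del: poly_mult)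
    also have "\<dots> = (if p = id then \<Prod>j<k. hh j else 0)"
    proof (cases "p = id")
      case True
      thus ?thesis by (simp add: GG_Hp_norm)
    next
      case False
      then obtain i where "p i \<noteq> i" by (metis id_apply ext)
      hence "i < k" using p permutes_not_in by fastforce
      hence "(\<Prod>i<k. GG (Hp (p i) * Hp i)) = 0" using GG_Hp_delta[OF \<open>p i \<noteq> i\<close>] by (intro prod_zero) auto
      thus ?thesis using False by simp
    qed
    finally show ?thesis .
  qed
  have "(\<Sum>p\<in>?P. integral\<^sup>L (LB {..<k}) (F p)) = (\<Prod>j<k. hh j)"
  proof -
    have "(\<Sum>p\<in>?P. integral\<^sup>L (LB {..<k}) (F p)) = (\<Sum>p\<in>?P. if p = id then \<Prod>j<k. hh j else 0)"
      by (intro sum.cong refl val)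
    also have "\<dots> = (\<Prod>j<k. hh j)" using fin by (simp add: permutes_id)
    finally show ?thesis .
  qed
  hence eq: "(\<integral>l. (\<Sum>p\<in>?P. F p l) \<partial>LB {..<k}) = (\<Prod>j<k. hh j)"
    by (subst Bochner_Integration.integral_sum) (use int in auto)
  have sumF: "(\<Sum>p\<in>?P. F p l) = vander k l * (\<Prod>i<k. poly (Hp i) (l i) * exp (- (l i)\<^sup>2))" for l
    unfolding F_def vander_leibniz[of Hp k l, OF conjunct1[OF Hp_monic] conjunct2[OF Hp_monic]] sum_distrib_right
    by (intro sum.cong refl) (simp add: prod.distrib mult_ac)
  have "ennreal (\<Prod>j<k. hh j) = ennreal (norm (\<integral>l. (\<Sum>p\<in>?P. F p l) \<partial>LB {..<k}))"
    unfolding eq using hh_pos by (simp add: prod_nonneg less_imp_le)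
  also have "\<dots> \<le> (\<integral>\<^sup>+l. ennreal (norm (\<Sum>p\<in>?P. F p l)) \<partial>LB {..<k})"
    by (rule integral_norm_bound_ennreal) (use int in auto)
  also have "\<dots> \<le> (\<integral>\<^sup>+l. ennreal (\<Prod>j<k. sqrt (hh j) * (3 * real j + 5)) * ennreal ((\<Prod>i<k. exp (- (l i)\<^sup>2 / 2)) * (\<Prod>j<k. \<Prod>i<j. \<bar>l j - l i\<bar>)) \<partial>LB {..<k})"
  proof (rule nn_integral_mono)
    fix l :: "nat \<Rightarrow> real"
    have "norm (\<Sum>p\<in>?P. F p l) = \<bar>vander k l\<bar> * (\<Prod>i<k. (\<bar>poly (Hp i) (l i)\<bar> * exp (- (l i)\<^sup>2 / 2)) * exp (- (l i)\<^sup>2 / 2))"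
      unfolding sumF real_norm_def abs_mult[of "vander k l"] abs_prod[of _ "{..<k}"]
      by (intro arg_cong2[of _ _ _ _ "(*)"] refl prod.cong) (simp only: abs_mult abs_exp_cancel mult.assoc exp_add[symmetric], simp)
    also have "\<dots> \<le> \<bar>vander k l\<bar> * (\<Prod>i<k. (sqrt (hh i) * (3 * real i + 5)) * exp (- (l i)\<^sup>2 / 2))"
      by (intro mult_left_mono prod_mono conjI mult_right_mono Hp_sup_bound mult_nonneg_nonneg) auto
    also have "\<dots> = (\<Prod>j<k. sqrt (hh j) * (3 * real j + 5)) * ((\<Prod>i<k. exp (- (l i)\<^sup>2 / 2)) * (\<Prod>j<k. \<Prod>i<j. \<bar>l j - l i\<bar>))"
      by (simp only: prod.distrib abs_vander mult_ac)
    finally have "ennreal (norm (\<Sum>p\<in>?P. F p l)) \<le> ennreal ((\<Prod>j<k. sqrt (hh j) * (3 * real j + 5)) * ((\<Prod>i<k. exp (- (l i)\<^sup>2 / 2)) * (\<Prod>j<k. \<Prod>i<j. \<bar>l j - l i\<bar>)))"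
      by (rule ennreal_leI)
    thus "ennreal (norm (\<Sum>p\<in>?P. F p l)) \<le> ennreal (\<Prod>j<k. sqrt (hh j) * (3 * real j + 5)) * ennreal ((\<Prod>i<k. exp (- (l i)\<^sup>2 / 2)) * (\<Prod>j<k. \<Prod>i<j. \<bar>l j - l i\<bar>))"
      by (subst ennreal_mult[symmetric]) (auto intro!: prod_nonneg mult_nonneg_nonneg simp: hh_pos less_imp_le)
  qed
  also have "\<dots> = ennreal (\<Prod>j<k. sqrt (hh j) * (3 * real j + 5)) *
     (\<integral>\<^sup>+l. ennreal ((\<Prod>i<k. exp (- (l i)\<^sup>2 / 2)) * (\<Prod>j<k. \<Prod>i<j. \<bar>l j - l i\<bar>)) \<partial>LB {..<k})"
  proof (rule nn_integral_cmult)
    have c: "(\<lambda>l. l i) \<in> borel_measurable (LB {..<k})" if "i < k" for i using that by (intro measurable_coord) simp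
    have e: "(\<lambda>l. exp (- (l i)\<^sup>2 / 2)) \<in> borel_measurable (LB {..<k})" if "i < k" for i using c[OF that] by measurable
    show "(\<lambda>l. ennreal ((\<Prod>i<k. exp (- (l i)\<^sup>2 / 2)) * (\<Prod>j<k. \<Prod>i<j. \<bar>l j - l i\<bar>))) \<in> borel_measurable (LB {..<k})"
      by (intro measurable_compose[OF _ measurable_ennreal] borel_measurable_times borel_measurable_prod borel_measurable_abs borel_measurable_diff c e) auto
  qed
  finally show ?thesis .
qed

section \<open>Characteristic polynomials without real roots: upper bound\<close>

text \<open>The determinant is a product of pivots. Each pivot satisfies
  \<open>a \<le> exp (a - 1)\<close>, and passing to the Schur complement can only lower the
  remaining diagonal entries, so the sum of the pivots is at most the trace.\<close>

lemma det_psd_le_exp_trace: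
  fixes G :: "real mat"
  assumes "G \<in> carrier_mat n n" "\<And>i j. i < n \<Longrightarrow> j < n \<Longrightarrow> G $$ (i, j) = G $$ (j, i)"
    and "\<And>v. (\<Sum>i<n. \<Sum>j<n. v i * G $$ (i, j) * v j) \<ge> 0"
  shows "0 \<le> det G \<and> det G \<le> exp ((\<Sum>i<n. G $$ (i, i)) - real n)"
  using assms
proof (induction n arbitrary: G)
  case 0
  have "det G = 1" using 0(1) by (intro det_dim_zero) auto
  thus ?case by simp
next
  case (Suc n G)
  note G = Suc.prems(1) and sym = Suc.prems(2)
  define a where "a = G $$ (n, n)"
  have q: "(\<Sum>i<n. \<Sum>j<n. v i * G $$ (i, j) * v j) + 2 * t * (\<Sum>i<n. v i * G $$ (i, n)) + a * t\<^sup>2 \<ge> 0" for v t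
  proof -
    let ?v = "v(n := t)"
    have "0 \<le> (\<Sum>i<Suc n. \<Sum>j<Suc n. ?v i * G $$ (i, j) * ?v j)" by (rule Suc.prems(3))
    also have "\<dots> = (\<Sum>i<n. \<Sum>j<n. v i * G $$ (i, j) * v j) + (\<Sum>i<n. v i * G $$ (i, n) * t) + (\<Sum>j<n. t * G $$ (n, j) * v j) + a * t\<^sup>2"
      by (simp add: sum.distrib a_def power2_eq_square)
    also have "(\<Sum>j<n. t * G $$ (n, j) * v j) = t * (\<Sum>i<n. v i * G $$ (i, n))"
      unfolding sum_distrib_left by (intro sum.cong refl) (use sym[of n] in simp)
    also have "(\<Sum>i<n. v i * G $$ (i, n) * t) = t * (\<Sum>i<n. v i * G $$ (i, n))"
      unfolding sum_distrib_left by (intro sum.cong refl) simp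
    finally show ?thesis by simp
  qed
  from q[of "\<lambda>_. 0" 1] have a: "a \<ge> 0" by simp
  show ?case
  proof (cases "a = 0")
    case True
    have "G $$ (i, n) = 0" if i: "i < n" for i
    proof (rule ccontr)
      assume ne: "G $$ (i, n) \<noteq> 0"
      \<comment> \<open>On the vector with entry 1 at \<open>i\<close> and \<open>s\<close> at
        \<open>n\<close> the form would be \<open>G $$ (i, i) - \<bar>G $$ (i, i)\<bar> - 1\<close>,
        which is negative.\<close>
      define s where "s = - (\<bar>G $$ (i, i)\<bar> + 1) / (2 * G $$ (i, n))"
      have "(\<Sum>j<n. \<Sum>l<n. (if j = i then 1 else 0) * G $$ (j, l) * (if l = i then 1 else 0)) = G $$ (i, i)"
      proof -
        have "(\<Sum>j<n. \<Sum>l<n. (if j = i then 1 else 0) * G $$ (j, l) * (if l = i then 1 else 0)) = (\<Sum>j<n. \<Sum>l<n. if j = i then (if l = i then G $$ (j, l) else 0) else 0)"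
          by (intro sum.cong refl) auto
        also have "\<dots> = (\<Sum>j<n. if j = i then G $$ (j, i) else 0)" by (intro sum.cong refl) (use i in auto)
        finally show ?thesis using i by simp
      qed
      moreover have "(\<Sum>j<n. (if j = i then 1 else 0) * G $$ (j, n)) = G $$ (i, n)"
        using i by (simp add: if_distrib[of "\<lambda>x. x * _"] cong: if_cong)
      ultimately have "G $$ (i, i) + 2 * s * G $$ (i, n) \<ge> 0"
        using q[of "\<lambda>j. if j = i then 1 else 0" s] True by simp
      moreover have "2 * s * G $$ (i, n) = - (\<bar>G $$ (i, i)\<bar> + 1)" using ne by (simp add: s_def field_simps)
      ultimately show False by linarith
    qed
    hence "G $$ (i, n) = 0" if "i < Suc n" for i using that True by (cases "i = n") (auto simp: a_def)
    hence "det G = 0" using laplace_expansion_column[OF G, of n] by (simp del: sum.lessThan_Suc)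
    thus ?thesis by simp
  next
    case False
    hence a: "a > 0" using a by simp
    define S where "S = mat n n (\<lambda>(i, j). G $$ (i, j) - G $$ (i, n) * G $$ (n, j) / G $$ (n, n))"
    have S: "S \<in> carrier_mat n n" by (simp add: S_def)
    have dS: "det G = a * det S" unfolding a_def S_def by (rule det_schur_corner[OF G]) (use a in \<open>simp add: a_def\<close>)
    have Sij: "S $$ (i, j) = G $$ (i, j) - G $$ (i, n) * G $$ (j, n) / a" if "i < n" "j < n" for i j
      using that sym[of n j] by (simp add: S_def a_def)
    have "0 \<le> det S \<and> det S \<le> exp ((\<Sum>i<n. S $$ (i, i)) - real n)"
    proof (rule Suc.IH[OF S])
      show "S $$ (i, j) = S $$ (j, i)" if "i < n" "j < n" for i j using that sym[of i j] by (simp add: Sij)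
      fix v :: "nat \<Rightarrow> real"
      define b where "b = (\<Sum>i<n. v i * G $$ (i, n))"
      have "(\<Sum>i<n. \<Sum>j<n. v i * S $$ (i, j) * v j) = (\<Sum>i<n. \<Sum>j<n. v i * G $$ (i, j) * v j - (v i * G $$ (i, n)) * (v j * G $$ (j, n)) / a)"
        by (intro sum.cong refl) (simp add: Sij field_simps)
      also have "\<dots> = (\<Sum>i<n. \<Sum>j<n. v i * G $$ (i, j) * v j) - b * b / a"
        by (simp add: sum_subtractf b_def sum_product sum_divide_distrib)
      \<comment> \<open>The value \<open>- b / a\<close> minimises the form over the last
        coordinate; the form of the Schur complement is this minimum.\<close>
      also have "\<dots> = (\<Sum>i<n. \<Sum>j<n. v i * G $$ (i, j) * v j) + 2 * (- b / a) * b + a * (- b / a)\<^sup>2"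
        using a by (simp add: field_simps power2_eq_square)
      finally show "(\<Sum>i<n. \<Sum>j<n. v i * S $$ (i, j) * v j) \<ge> 0" using q[of v "- b / a"] by (simp add: b_def)
    qed
    moreover have "a \<le> exp (a - 1)" using exp_ge_add_one_self[of "a - 1"] by simp
    moreover have "(\<Sum>i<n. S $$ (i, i)) \<le> (\<Sum>i<n. G $$ (i, i))"
      using a by (intro sum_mono) (simp add: Sij flip: power2_eq_square)
    ultimately have "0 \<le> det S" "det S \<le> exp ((\<Sum>i<n. G $$ (i, i)) - real n)" "a \<le> exp (a - 1)"
      by (auto elim!: order_trans)
    hence "0 \<le> det G" "det G \<le> exp (a - 1) * exp ((\<Sum>i<n. G $$ (i, i)) - real n)"
      unfolding dS using a by (auto intro!: mult_mono)
    thus ?thesis by (simp add: exp_add[symmetric] a_def algebra_simps)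
  qed
qed

text \<open>The Gram matrix \<open>G\<close> is positive semidefinite, its determinant is the square
  of \<open>det A\<close>, and its trace is the squared Frobenius norm of \<open>A\<close>.\<close>

lemma det_sq_le_exp:
  fixes A :: "real mat"
  assumes A: "A \<in> carrier_mat n n"
  shows "(det A)\<^sup>2 \<le> exp ((\<Sum>i<n. \<Sum>j<n. (A $$ (i, j))\<^sup>2) - real n)"
proof -
  define G where "G = transpose_mat A * A"
  have Gij: "G $$ (i, j) = (\<Sum>l<n. A $$ (l, i) * A $$ (l, j))" if "i < n" "j < n" for i j
    using that A by (auto simp: G_def scalar_prod_def lessThan_atLeast0 intro!: sum.cong)
  have "det G \<le> exp ((\<Sum>i<n. G $$ (i, i)) - real n)"
  proof (rule conjunct2[OF det_psd_le_exp_trace])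
    show "G \<in> carrier_mat n n" using A by (auto simp: G_def)
    show "G $$ (i, j) = G $$ (j, i)" if "i < n" "j < n" for i j using that by (simp add: Gij mult.commute)
    fix v :: "nat \<Rightarrow> real"
    have "(\<Sum>i<n. \<Sum>j<n. v i * G $$ (i, j) * v j) = (\<Sum>i<n. \<Sum>j<n. \<Sum>l<n. (v i * A $$ (l, i)) * (v j * A $$ (l, j)))"
      by (intro sum.cong refl) (simp add: Gij sum_distrib_left sum_distrib_right mult_ac)
    also have "\<dots> = (\<Sum>i<n. \<Sum>l<n. \<Sum>j<n. (v i * A $$ (l, i)) * (v j * A $$ (l, j)))"
      by (rule sum.cong[OF refl]) (rule sum.swap)
    also have "\<dots> = (\<Sum>l<n. \<Sum>i<n. \<Sum>j<n. (v i * A $$ (l, i)) * (v j * A $$ (l, j)))" by (rule sum.swap)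
    also have "\<dots> = (\<Sum>l<n. (\<Sum>i<n. v i * A $$ (l, i))\<^sup>2)" by (simp only: sum_product power2_eq_square)
    finally show "(\<Sum>i<n. \<Sum>j<n. v i * G $$ (i, j) * v j) \<ge> 0" by (simp add: sum_nonneg)
  qed
  also have "(\<Sum>i<n. G $$ (i, i)) = (\<Sum>i<n. \<Sum>l<n. (A $$ (l, i))\<^sup>2)"
    by (intro sum.cong refl) (simp add: Gij power2_eq_square)
  also have "\<dots> = (\<Sum>i<n. \<Sum>j<n. (A $$ (i, j))\<^sup>2)" by (rule sum.swap)
  also have "det G = (det A)\<^sup>2"
    using A det_transpose[OF A] by (simp add: G_def det_mult[of _ n] power2_eq_square)
  finally show ?thesis .
qed

text \<open>The determinant bound is applied to \<open>E / sqrt c\<close>. A large \<open>c\<close>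
  trades the factor \<open>sqrt c ^ m\<close> for a small exponent, so that many such factors can be
  multiplied and still be integrated against the Gaussian weight.\<close>

lemma abs_poly_cp_le:
  assumes c: "c > 0"
  shows "\<bar>poly (cp m B) y\<bar> \<le> (sqrt c ^ m * exp (real m * y\<^sup>2 / c)) * exp (sqn (sq2 m) B / c)"
proof -
  define E where "E = mat m m (\<lambda>(i, j). (if i = j then y else 0) - B (i, j))"
  have E: "E \<in> carrier_mat m m" by (simp add: E_def)
  define E' where "E' = (1 / sqrt c) \<cdot>\<^sub>m E"
  have E': "E' \<in> carrier_mat m m" using E by (simp add: E'_def)
  have ss: "sqrt c * sqrt c = c" using c by simp
  have "(\<Sum>i<m. \<Sum>j<m. (E' $$ (i, j))\<^sup>2) \<le> (\<Sum>i<m. \<Sum>j<m. (if i = j then 2 * y\<^sup>2 / c else 0) + 2 * (B (i, j))\<^sup>2 / c)"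
  proof (intro sum_mono)
    fix i j assume ij: "i \<in> {..<m}" "j \<in> {..<m}"
    have *: "(a - b)\<^sup>2 / c \<le> 2 * a\<^sup>2 / c + 2 * b\<^sup>2 / c" for a b :: real
    proof -
      have "(a - b)\<^sup>2 \<le> 2 * a\<^sup>2 + 2 * b\<^sup>2" using zero_le_power2[of "a + b"] by (simp add: power2_eq_square algebra_simps)
      thus ?thesis using c by (simp add: divide_right_mono flip: add_divide_distrib)
    qed
    have "(E' $$ (i, j))\<^sup>2 = ((if i = j then y else 0) - B (i, j))\<^sup>2 / c"
      using ij c by (simp add: E'_def E_def power_divide power_mult_distrib)
    also have "\<dots> \<le> (if i = j then 2 * y\<^sup>2 / c else 0) + 2 * (B (i, j))\<^sup>2 / c"
      using *[of "if i = j then y else 0" "B (i, j)"] by (auto split: if_splits)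
    finally show "(E' $$ (i, j))\<^sup>2 \<le> (if i = j then 2 * y\<^sup>2 / c else 0) + 2 * (B (i, j))\<^sup>2 / c" .
  qed
  also have "\<dots> = 2 * (real m * y\<^sup>2 / c + sqn (sq2 m) B / c)"
    by (simp add: sum.distrib sqn_def sum_sq2 sum_distrib_left sum_divide_distrib)
  finally have "(det E')\<^sup>2 \<le> exp (2 * (real m * y\<^sup>2 / c + sqn (sq2 m) B / c))"
    using det_sq_le_exp[OF E'] by (elim order_trans) simp
  also have "\<dots> = (exp (real m * y\<^sup>2 / c + sqn (sq2 m) B / c))\<^sup>2" by (simp flip: exp_double)
  finally have "\<bar>det E'\<bar> \<le> exp (real m * y\<^sup>2 / c + sqn (sq2 m) B / c)" by (rule power2_le_imp_le[OF _ exp_ge_zero, THEN order_trans[rotated], of "\<bar>det E'\<bar>", simplified]) simp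
  hence "sqrt c ^ m * \<bar>det E'\<bar> \<le> sqrt c ^ m * exp (real m * y\<^sup>2 / c + sqn (sq2 m) B / c)"
    using c by (intro mult_left_mono) auto
  also have "sqrt c ^ m * \<bar>det E'\<bar> = \<bar>det E\<bar>"
    using c E by (simp add: E'_def det_smult abs_mult power_divide)
  also have "det E = poly (cp m B) y" by (simp add: poly_cp E_def)
  finally show ?thesis by (simp add: exp_add mult_ac)
qed

lemma absprod_cp_le:
  assumes "c > 0"
  shows "absprod ys (cp m B) \<le> (\<Prod>y\<leftarrow>ys. sqrt c ^ m * exp (real m * y\<^sup>2 / c)) * exp (real (length ys) * sqn (sq2 m) B / c)"
proof (induction ys)
  case Nil
  show ?case by (simp add: absprod_def)
next
  case (Cons y ys)
  have "absprod (y # ys) (cp m B) = \<bar>poly (cp m B) y\<bar> * absprod ys (cp m B)" by (simp add: absprod_def)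
  also have "\<dots> \<le> ((sqrt c ^ m * exp (real m * y\<^sup>2 / c)) * exp (sqn (sq2 m) B / c)) *
     ((\<Prod>y\<leftarrow>ys. sqrt c ^ m * exp (real m * y\<^sup>2 / c)) * exp (real (length ys) * sqn (sq2 m) B / c))"
    using assms by (intro mult_mono abs_poly_cp_le Cons.IH absprod_nonneg) auto
  also have "\<dots> = (\<Prod>y\<leftarrow>y # ys. sqrt c ^ m * exp (real m * y\<^sup>2 / c)) * exp (sqn (sq2 m) B / c + real (length ys) * sqn (sq2 m) B / c)"
    by (simp add: exp_add mult_ac)
  finally show ?case by (simp add: algebra_simps add_divide_distrib)
qed

lemma nn_integral_gauss_half: "(\<integral>\<^sup>+x. ennreal (exp (- x\<^sup>2 / 4)) \<partial>lborel) = ennreal (sqrt 2 * sqrt (2 * pi))"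
proof -
  have "(\<integral>\<^sup>+x. ennreal (exp (- x\<^sup>2 / 2)) \<partial>lborel) = ennreal \<bar>1 / sqrt 2\<bar> * (\<integral>\<^sup>+x. ennreal (exp (- (0 + 1 / sqrt 2 * x)\<^sup>2 / 2)) \<partial>lborel)"
    by (rule nn_integral_real_affine) auto
  also have "(\<lambda>x. ennreal (exp (- (0 + 1 / sqrt 2 * x)\<^sup>2 / 2))) = (\<lambda>x. ennreal (exp (- x\<^sup>2 / 4)))"
    by (simp add: power_mult_distrib power_divide)
  finally have *: "ennreal (1 / sqrt 2) * (\<integral>\<^sup>+x. ennreal (exp (- x\<^sup>2 / 4)) \<partial>lborel) = ennreal (sqrt (2 * pi))"
    unfolding nn_integral_gauss_1 by simp
  have "ennreal (sqrt 2) * (ennreal (1 / sqrt 2) * (\<integral>\<^sup>+x. ennreal (exp (- x\<^sup>2 / 4)) \<partial>lborel)) = (\<integral>\<^sup>+x. ennreal (exp (- x\<^sup>2 / 4)) \<partial>lborel)"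
    by (subst mult.assoc[symmetric], subst ennreal_mult[symmetric]) auto
  thus ?thesis unfolding * by (simp add: ennreal_mult)
qed

text \<open>For \<open>c = 4 n\<close> the at most \<open>n\<close> factors together cost half of
  the Gaussian exponent. The weight that is left has variance 2 in each entry, which accounts for
  \<open>sqrt 2 ^ m\<^sup>2\<close>.\<close>

theorem An_0_upper:
  assumes n: "n \<ge> 1" and len: "length ys \<le> n"
  shows "An m 0 ys \<le> ennreal (sqrt 2 ^ m\<^sup>2 * (\<Prod>y\<leftarrow>ys. sqrt (4 * real n) ^ m * exp (real m * y\<^sup>2 / (4 * real n))))"
proof -
  define R where "R = (\<Prod>y\<leftarrow>ys. sqrt (4 * real n) ^ m * exp (real m * y\<^sup>2 / (4 * real n)))"
  have R: "R \<ge> 0" unfolding R_def by (rule prod_list_map_nonneg) auto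
  have le: "(if nr (cp m B) = 0 then ennreal (absprod ys (cp m B)) else 0) * ennreal (gw (sq2 m) B)
      \<le> ennreal R * (\<Prod>p\<in>sq2 m. ennreal (exp (- (B p)\<^sup>2 / 4)))" for B
  proof -
    have "real (length ys) * sqn (sq2 m) B \<le> real n * sqn (sq2 m) B"
      using len by (intro mult_right_mono) (auto simp: sqn_def sum_nonneg)
    hence "real (length ys) * sqn (sq2 m) B / (4 * real n) \<le> sqn (sq2 m) B / 4" using n by (simp add: field_simps)
    hence "absprod ys (cp m B) \<le> R * exp (sqn (sq2 m) B / 4)"
      using absprod_cp_le[of "4 * real n" ys m B] n R unfolding R_def[symmetric]
      by (auto elim!: order_trans intro!: mult_left_mono)
    hence "absprod ys (cp m B) * gw (sq2 m) B \<le> R * exp (sqn (sq2 m) B / 4) * gw (sq2 m) B"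
      by (intro mult_right_mono) (auto simp: gw_def)
    also have "\<dots> = R * exp (- sqn (sq2 m) B / 4)" by (simp add: gw_def mult.assoc flip: exp_add)
    also have "exp (- sqn (sq2 m) B / 4) = (\<Prod>p\<in>sq2 m. exp (- (B p)\<^sup>2 / 4))"
      by (simp add: sqn_def sum_negf[symmetric] sum_divide_distrib exp_sum del: sum_negf)
    finally have "ennreal (absprod ys (cp m B) * gw (sq2 m) B) \<le> ennreal (R * (\<Prod>p\<in>sq2 m. exp (- (B p)\<^sup>2 / 4)))" by (rule ennreal_leI)
    also have "\<dots> = ennreal R * (\<Prod>p\<in>sq2 m. ennreal (exp (- (B p)\<^sup>2 / 4)))" using R by (simp add: ennreal_mult prod_nonneg prod_ennreal)
    finally show ?thesis by (auto simp: ennreal_mult absprod_nonneg gw_def)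
  qed
  have "(\<integral>\<^sup>+B. (if nr (cp m B) = 0 then ennreal (absprod ys (cp m B)) else 0) * ennreal (gw (sq2 m) B) \<partial>LM m)
     \<le> (\<integral>\<^sup>+B. ennreal R * (\<Prod>p\<in>sq2 m. ennreal (exp (- (B p)\<^sup>2 / 4))) \<partial>LM m)" by (rule nn_integral_mono) (rule le)
  also have "\<dots> = ennreal R * (\<integral>\<^sup>+B. (\<Prod>p\<in>sq2 m. ennreal (exp (- (B p)\<^sup>2 / 4))) \<partial>LM m)"
    by (rule nn_integral_cmult) measurable
  also have "(\<integral>\<^sup>+B. (\<Prod>p\<in>sq2 m. ennreal (exp (- (B p)\<^sup>2 / 4))) \<partial>LM m) = (\<Prod>p\<in>sq2 m. \<integral>\<^sup>+x. ennreal (exp (- x\<^sup>2 / 4)) \<partial>lborel)"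
    by (rule leb.product_nn_integral_prod[where f = "\<lambda>_ x. ennreal (exp (- x\<^sup>2 / 4))"]) auto
  also have "\<dots> = ennreal ((sqrt 2 * sqrt (2 * pi)) ^ m\<^sup>2)"
    by (simp only: nn_integral_gauss_half) (simp add: ennreal_power card_cartesian_product power2_eq_square)
  finally have "An m 0 ys \<le> ennreal (1 / sqrt (2 * pi) ^ m\<^sup>2) * (ennreal R * ennreal ((sqrt 2 * sqrt (2 * pi)) ^ m\<^sup>2))"
    unfolding An_def by (intro mult_left_mono) auto
  also have "\<dots> = ennreal (1 / sqrt (2 * pi) ^ m\<^sup>2 * (R * (sqrt 2 * sqrt (2 * pi)) ^ m\<^sup>2))"
    using R by (subst ennreal_mult[symmetric], simp, simp, subst ennreal_mult[symmetric]) auto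
  also have "1 / sqrt (2 * pi) ^ m\<^sup>2 * (R * (sqrt 2 * sqrt (2 * pi)) ^ m\<^sup>2) = sqrt 2 ^ m\<^sup>2 * R"
    by (simp only: power_mult_distrib[of "sqrt 2"]) simp
  finally show ?thesis unfolding R_def .
qed

section \<open>Characteristic polynomials without real roots: lower bound\<close>

lemma nn_integral_gw_linear:
  assumes I: "finite I"
  shows "(\<integral>\<^sup>+x. ennreal (exp (\<Sum>i\<in>I. a i * x i) * gw I x) \<partial>LB I) = ennreal (exp (sqn I a / 2) * sqrt (2 * pi) ^ card I)"
proof -
  have m: "(\<lambda>x. ennreal (gw I x)) \<in> borel_measurable (LB I)"
    by (intro measurable_compose[OF measurable_gw measurable_ennreal] measurable_coord)
  have "ennreal (exp (\<Sum>i\<in>I. a i * x i) * gw I x) = ennreal (exp (sqn I a / 2)) * ennreal (gw I (\<lambda>i\<in>I. x i + - a i))" for x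
  proof -
    have "sqn I (\<lambda>i\<in>I. x i + - a i) = sqn I x - 2 * (\<Sum>i\<in>I. a i * x i) + sqn I a"
      unfolding sqn_def sum_distrib_left sum_subtractf[symmetric] sum.distrib[symmetric]
      by (intro sum.cong refl) (simp add: power2_eq_square algebra_simps)
    hence "exp (\<Sum>i\<in>I. a i * x i) * gw I x = exp (sqn I a / 2) * gw I (\<lambda>i\<in>I. x i + - a i)"
      by (simp add: gw_def exp_add[symmetric] field_simps)
    thus ?thesis by (simp add: ennreal_mult gw_def)
  qed
  hence "(\<integral>\<^sup>+x. ennreal (exp (\<Sum>i\<in>I. a i * x i) * gw I x) \<partial>LB I)
      = (\<integral>\<^sup>+x. ennreal (exp (sqn I a / 2)) * ennreal (gw I (\<lambda>i\<in>I. x i + - a i)) \<partial>LB I)" by simp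
  also have "\<dots> = ennreal (exp (sqn I a / 2)) * (\<integral>\<^sup>+x. ennreal (gw I (\<lambda>i\<in>I. x i + - a i)) \<partial>LB I)"
    by (intro nn_integral_cmult measurable_compose[OF _ m] restrict_measurable_LB) measurable
  also have "(\<integral>\<^sup>+x. ennreal (gw I (\<lambda>i\<in>I. x i + - a i)) \<partial>LB I) = (\<integral>\<^sup>+x. ennreal (gw I x) \<partial>LB I)"
    by (rule nn_LB_translate[OF I m])
  also have "\<dots> = ennreal (sqrt (2 * pi) ^ card I)" by (rule nn_integral_gw[OF I])
  finally show ?thesis by (simp add: ennreal_mult)
qed

text \<open>A Gaussian integral replaces singular values: substituting \<open>A\<close> and
  \<open>t\<close> times the identity into the same integral, the pointwise comparison of the
  integrands turns into a comparison of the Jacobians.\<close>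

lemma det_ge_of_expanding:
  fixes A :: "real mat"
  assumes A: "A \<in> carrier_mat n n" and t: "t > 0"
    and ex: "\<And>y. t\<^sup>2 * (\<Sum>i<n. (y i)\<^sup>2) \<le> (\<Sum>i<n. (mv n A y i)\<^sup>2)"
  shows "det A \<noteq> 0" "t ^ n \<le> \<bar>det A\<bar>"
proof -
  show d: "det A \<noteq> 0"
  proof
    assume "det A = 0"
    then obtain v where v: "v \<in> carrier_vec n" "v \<noteq> 0\<^sub>v n" "A *\<^sub>v v = 0\<^sub>v n"
      using det_0_iff_vec_prod_zero_field[OF A] by blast
    have "mv n A (vec_index v) i = (A *\<^sub>v v) $ i" if "i < n" for i
      using that A v(1) by (simp add: mv_def scalar_prod_def lessThan_atLeast0)
    hence "(\<Sum>i<n. (mv n A (vec_index v) i)\<^sup>2) = 0" using v(3) by simp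
    hence "t\<^sup>2 * (\<Sum>i<n. (v $ i)\<^sup>2) \<le> 0" using ex[of "vec_index v"] by simp
    hence "(\<Sum>i<n. (v $ i)\<^sup>2) \<le> 0" using t by (simp add: mult_le_0_iff)
    hence "(\<Sum>i<n. (v $ i)\<^sup>2) = 0" by (intro antisym sum_nonneg) auto
    hence "v $ i = 0" if "i < n" for i using that by (subst (asm) sum_nonneg_eq_0_iff) auto
    hence "v = 0\<^sub>v n" using v(1) by (intro eq_vecI) auto
    thus False using v(2) by simp
  qed
  define T where "T = t \<cdot>\<^sub>m (1\<^sub>m n :: real mat)"
  have T: "T \<in> carrier_mat n n" "det T = t ^ n" by (simp_all add: T_def det_smult)
  have mvT: "mv n T y i = t * y i" if "i < n" for y i
  proof -
    have "mv n T y i = (\<Sum>j<n. if j = i then t * y j else 0)"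
      using that by (simp add: mv_def T_def mult.commute[of _ "if _ then _ else _"] if_distrib[of "\<lambda>x. x * _"] if_distrib[of "\<lambda>x. _ * x"] eq_commute[of i] cong: if_cong)
    thus ?thesis using that by simp
  qed
  have m: "(\<lambda>x. ennreal (gw {..<n} x)) \<in> borel_measurable (LB {..<n})"
    by (intro measurable_compose[OF measurable_gw measurable_ennreal] measurable_coord)
  define J where "J = (\<integral>\<^sup>+x. ennreal (gw {..<n} (mv n T x)) \<partial>LB {..<n})"
  have g: "(\<integral>\<^sup>+x. ennreal (gw {..<n} x) \<partial>LB {..<n}) = ennreal (sqrt (2 * pi) ^ n)"
    using nn_integral_gw[of "{..<n}"] by simp
  have 1: "ennreal (sqrt (2 * pi) ^ n) = ennreal (t ^ n) * J"
    using nn_LB_linear[OF T(1) _ m] t T(2) unfolding g J_def by simp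
  have "ennreal (sqrt (2 * pi) ^ n) = ennreal \<bar>det A\<bar> * (\<integral>\<^sup>+x. ennreal (gw {..<n} (mv n A x)) \<partial>LB {..<n})"
    using nn_LB_linear[OF A d m] unfolding g .
  also have "\<dots> \<le> ennreal \<bar>det A\<bar> * J"
    unfolding J_def
  proof (rule mult_left_mono[OF nn_integral_mono])
    fix x :: "nat \<Rightarrow> real"
    have "(\<Sum>i<n. (mv n T x i)\<^sup>2) = t\<^sup>2 * (\<Sum>i<n. (x i)\<^sup>2)"
      unfolding sum_distrib_left by (intro sum.cong refl) (simp add: mvT power_mult_distrib)
    thus "ennreal (gw {..<n} (mv n A x)) \<le> ennreal (gw {..<n} (mv n T x))"
      using ex[of x] by (intro ennreal_leI) (simp add: gw_def sqn_def)
  qed simp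
  finally have 2: "ennreal (t ^ n) * J \<le> ennreal \<bar>det A\<bar> * J" unfolding 1 .
  have "J \<noteq> \<top>"
  proof
    assume "J = \<top>"
    hence "ennreal (sqrt (2 * pi) ^ n) = \<top>" using 1 t by (simp add: ennreal_mult_eq_top_iff)
    thus False by simp
  qed
  then obtain r where r: "J = ennreal r" "r \<ge> 0" by (cases J) auto
  have "sqrt (2 * pi) ^ n > 0" by simp
  hence "J \<noteq> 0" unfolding 1[symmetric] using 1 by (metis ennreal_eq_0_iff mult_zero_right not_le)
  hence "r \<noteq> 0" using r by auto
  thus "t ^ n \<le> \<bar>det A\<bar>" using 2 r t by (simp add: ennreal_mult[symmetric] mult_le_cancel_right)
qed

text \<open>The complex structure \<open>J\<close> exchanges the coordinates \<open>2 i\<close> and \<open>2 i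
  + 1\<close>; \<open>qf m G z\<close> is the inner product of \<open>J z\<close> and \<open>G z\<close>,
  which controls how far \<open>J\<close> may be perturbed by \<open>G\<close> without creating real
  eigenvalues.\<close>

definition pr :: "nat \<Rightarrow> nat" where "pr i = (if even i then Suc i else i - 1)"
definition sg :: "nat \<Rightarrow> real" where "sg i = (if even i then - 1 else 1)"
definition Jv :: "(nat \<Rightarrow> real) \<Rightarrow> nat \<Rightarrow> real" where "Jv z i = sg i * z (pr i)"
definition qf :: "nat \<Rightarrow> (nat \<times> nat \<Rightarrow> real) \<Rightarrow> (nat \<Rightarrow> real) \<Rightarrow> real" where
  "qf m G z = (\<Sum>i<m. Jv z i * (\<Sum>j<m. G (i, j) * z j))"

lemma pr_pr [simp]: "pr (pr i) = i" by (auto simp: pr_def elim: oddE)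

lemma sg_pr: "sg (pr i) = - sg i" by (auto simp: pr_def sg_def elim: oddE)

lemma sg_sq [simp]: "sg i * sg i = 1" by (simp add: sg_def)

lemma pr_less:
  assumes "even m" "i < m"
  shows "pr i < m"
proof (cases "even i")
  case True
  hence "Suc i \<noteq> m" using assms(1) by auto
  thus ?thesis using True assms(2) by (simp add: pr_def)
qed (use assms in \<open>simp add: pr_def\<close>)

lemma sum_pr:
  assumes "even m"
  shows "(\<Sum>i<m. f (pr i)) = (\<Sum>i<m. f i)"
  by (rule sum.reindex_bij_witness[of _ pr pr]) (use pr_less[OF assms] in auto)

lemma Jv_sq: "even m \<Longrightarrow> (\<Sum>i<m. (Jv z i)\<^sup>2) = (\<Sum>i<m. (z i)\<^sup>2)"
  using sum_pr[of m "\<lambda>i. (z i)\<^sup>2"] by (simp add: Jv_def power_mult_distrib power2_eq_square[of "sg _"])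

lemma Jv_orth:
  assumes "even m"
  shows "(\<Sum>i<m. Jv z i * z i) = 0"
proof -
  have "(\<Sum>i<m. Jv z i * z i) = (\<Sum>i<m. Jv z (pr i) * z (pr i))" by (rule sum_pr[OF assms, symmetric])
  also have "\<dots> = - (\<Sum>i<m. Jv z i * z i)"
    unfolding sum_negf[symmetric] by (intro sum.cong refl) (simp add: Jv_def sg_pr)
  finally show ?thesis by simp
qed

lemma qf_eq_sum: "qf m G z = (\<Sum>p\<in>sq2 m. (Jv z (fst p) * z (snd p)) * G p)"
  by (simp add: qf_def sum_sq2 sum_distrib_left mult_ac)

text \<open>Quadratic expansion, used as homogeneity when \<open>b\<close> is 0 and as polarisation
  with the two signs of \<open>b\<close>.\<close>

lemma qf_add:
  "qf m G (\<lambda>i. a * y i + b * h i) = a\<^sup>2 * qf m G y + b\<^sup>2 * qf m G h +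
     a * b * (\<Sum>i<m. Jv y i * (\<Sum>j<m. G (i, j) * h j) + Jv h i * (\<Sum>j<m. G (i, j) * y j))"
proof -
  have "(\<Sum>j<m. G (i, j) * (a * y j + b * h j)) = a * (\<Sum>j<m. G (i, j) * y j) + b * (\<Sum>j<m. G (i, j) * h j)" for i
    by (simp add: sum_distrib_left sum.distrib algebra_simps)
  moreover have "Jv (\<lambda>i. a * y i + b * h i) i = a * Jv y i + b * Jv h i" for i by (simp add: Jv_def algebra_simps)
  ultimately show ?thesis
    unfolding qf_def sum_distrib_left sum.distrib[symmetric]
    by (intro sum.cong refl) (simp only:, simp add: power2_eq_square algebra_simps)
qed

text \<open>The bound may be arbitrarily bad, since the iteration in \<open>qf_le_of_net\<close>
  halves the excess at every step.\<close>

lemma abs_qf_le: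
  assumes m: "even m"
  shows "\<bar>qf m G y\<bar> \<le> (\<Sum>p\<in>sq2 m. \<bar>G p\<bar>) * (\<Sum>i<m. (y i)\<^sup>2)"
proof -
  have sq: "(y i)\<^sup>2 \<le> (\<Sum>i<m. (y i)\<^sup>2)" if "i < m" for i using that by (intro member_le_sum) auto
  have "\<bar>qf m G y\<bar> \<le> (\<Sum>p\<in>sq2 m. \<bar>(Jv y (fst p) * y (snd p)) * G p\<bar>)" unfolding qf_eq_sum by (rule sum_abs)
  also have "\<dots> \<le> (\<Sum>p\<in>sq2 m. \<bar>G p\<bar> * (\<Sum>i<m. (y i)\<^sup>2))"
  proof (intro sum_mono)
    fix p assume p: "p \<in> sq2 m"
    have "2 * \<bar>Jv y (fst p) * y (snd p)\<bar> \<le> (Jv y (fst p))\<^sup>2 + (y (snd p))\<^sup>2"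
      using sum_squares_bound[of "\<bar>Jv y (fst p)\<bar>" "\<bar>y (snd p)\<bar>"] by (simp add: abs_mult)
    also have "(Jv y (fst p))\<^sup>2 = (y (pr (fst p)))\<^sup>2" by (simp add: Jv_def power_mult_distrib power2_eq_square[of "sg _"])
    also have "\<dots> + (y (snd p))\<^sup>2 \<le> 2 * (\<Sum>i<m. (y i)\<^sup>2)"
      using sq[of "pr (fst p)"] sq[of "snd p"] p pr_less[OF m] by auto
    finally have "\<bar>Jv y (fst p) * y (snd p)\<bar> \<le> (\<Sum>i<m. (y i)\<^sup>2)" by simp
    thus "\<bar>(Jv y (fst p) * y (snd p)) * G p\<bar> \<le> \<bar>G p\<bar> * (\<Sum>i<m. (y i)\<^sup>2)"
      by (simp add: abs_mult mult.commute[of "\<bar>G p\<bar>"] mult_right_mono)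
  qed
  finally show ?thesis by (simp add: sum_distrib_right)
qed

text \<open>Lattice points of norm squared at most \<open>21 m\<close>, scaled by \<open>1 / (4 sqrt
  m)\<close>, approximate the unit sphere up to \<open>1 / 8\<close>.\<close>

definition net :: "nat \<Rightarrow> (nat \<Rightarrow> int) set" where
  "net m = {k \<in> PiE {..<m} (\<lambda>_. {- int (21 * m)..int (21 * m)}). (\<Sum>i<m. (k i)\<^sup>2) \<le> 21 * int m}"

definition netpt :: "nat \<Rightarrow> (nat \<Rightarrow> int) \<Rightarrow> nat \<Rightarrow> real" where
  "netpt m k i = of_int (k i) / (4 * sqrt (real m))"

lemma finite_net: "finite (net m)"
  unfolding net_def by (intro finite_subset[OF Collect_restrict] finite_PiE) auto

text \<open>Rounding the multiple of \<open>y\<close> by \<open>4 * sqrt (real m)\<close> to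
  integers changes every coordinate of \<open>y\<close> by at most
  \<open>1 / (8 * sqrt (real m))\<close>, so the squared error is at most
  \<open>1 / 64\<close>.\<close>

lemma net_approx:
  assumes y: "(\<Sum>i<m. (y i)\<^sup>2) = 1"
  shows "\<exists>k\<in>net m. (\<Sum>i<m. (netpt m k i - y i)\<^sup>2) \<le> 1 / 64"
proof -
  have m: "m > 0" using y by (cases m) auto
  define s where "s = 4 * sqrt (real m)"
  have s: "s > 0" "s\<^sup>2 = 16 * real m" using m by (simp_all add: s_def power_mult_distrib)
  define k where "k = (\<lambda>i\<in>{..<m}. round (s * y i))"
  define z where "z i = of_int (round (s * y i)) / s" for i
  have zk: "z i = netpt m k i" if "i < m" for i using that by (simp add: z_def netpt_def k_def s_def)
  have zy: "(z i - y i)\<^sup>2 \<le> 1 / (64 * real m)" for i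
  proof -
    have "\<bar>s * (z i - y i)\<bar> \<le> 1 / 2" using of_int_round_abs_le[of "s * y i"] s by (simp add: z_def right_diff_distrib)
    hence "(s * (z i - y i))\<^sup>2 \<le> (1 / 2)\<^sup>2" by (metis abs_ge_zero power2_abs power_mono)
    hence "16 * real m * (z i - y i)\<^sup>2 \<le> 1 / 4" by (simp only: power_mult_distrib s) (simp add: power2_eq_square)
    thus ?thesis using m by (simp add: field_simps)
  qed
  have sz: "(\<Sum>i<m. (z i - y i)\<^sup>2) \<le> 1 / 64"
  proof -
    have "(\<Sum>i<m. (z i - y i)\<^sup>2) \<le> (\<Sum>i<m. 1 / (64 * real m))" by (intro sum_mono zy)
    thus ?thesis using m by simp
  qed
  \<comment> \<open>The weights \<open>9 / 8\<close> and \<open>9\<close> come from completing a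
    square. They give \<open>9 / 8 + 9 / 64 \<le> 21 / 16\<close>, which the scaling
    \<open>s\<^sup>2 = 16 * real m\<close> turns into the bound \<open>21 m\<close> of
    \<open>net\<close>.\<close>
  have "(\<Sum>i<m. (z i)\<^sup>2) \<le> (\<Sum>i<m. 9 / 8 * (y i)\<^sup>2 + 9 * (z i - y i)\<^sup>2)"
  proof (intro sum_mono)
    fix i
    have "0 \<le> (y i - 8 * (z i - y i))\<^sup>2" by simp
    thus "(z i)\<^sup>2 \<le> 9 / 8 * (y i)\<^sup>2 + 9 * (z i - y i)\<^sup>2" by (simp add: power2_eq_square algebra_simps)
  qed
  also have "\<dots> = 9 / 8 + 9 * (\<Sum>i<m. (z i - y i)\<^sup>2)" by (simp only: sum.distrib sum_distrib_left[symmetric] y)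
  also have "\<dots> \<le> 21 / 16" using sz by simp
  finally have "s\<^sup>2 * (\<Sum>i<m. (z i)\<^sup>2) \<le> s\<^sup>2 * (21 / 16)" by (intro mult_left_mono) auto
  also have "s\<^sup>2 * (\<Sum>i<m. (z i)\<^sup>2) = (\<Sum>i<m. (of_int (k i))\<^sup>2)"
    unfolding sum_distrib_left by (intro sum.cong refl) (use s(1) in \<open>simp add: z_def k_def power_divide\<close>)
  also have "s\<^sup>2 * (21 / 16) = of_int (21 * int m)" by (simp add: s)
  finally have le: "(\<Sum>i<m. (k i)\<^sup>2) \<le> 21 * int m"
    by (simp only: of_int_power[symmetric] of_int_sum[symmetric] of_int_le_iff)
  have "k i \<in> {- int (21 * m)..int (21 * m)}" if i: "i < m" for i
  proof -
    have "int (nat \<bar>k i\<bar>) \<le> (int (nat \<bar>k i\<bar>))\<^sup>2" by (cases "nat \<bar>k i\<bar>") (auto simp: power2_eq_square)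
    hence "\<bar>k i\<bar> \<le> (k i)\<^sup>2" by simp
    also have "\<dots> \<le> (\<Sum>i<m. (k i)\<^sup>2)" using i by (intro member_le_sum) auto
    finally show ?thesis using le by auto
  qed
  hence "k \<in> net m" using le by (auto simp: net_def k_def)
  moreover have "(\<Sum>i<m. (netpt m k i - y i)\<^sup>2) \<le> 1 / 64" using sz zk by simp
  ultimately show ?thesis by blast
qed

text \<open>Rounding to the net improves a bound \<open>Q\<close> on the unit sphere to \<open>\<tau> + Q /
  2\<close>; iterate, starting from a crude bound.\<close>

lemma qf_le_of_net:
  assumes m: "even m" and net: "\<And>k. k \<in> net m \<Longrightarrow> \<bar>qf m G (netpt m k)\<bar> \<le> \<tau>"
  shows "\<bar>qf m G y\<bar> \<le> 2 * \<tau> * (\<Sum>i<m. (y i)\<^sup>2)"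
proof -
  define Q0 where "Q0 = (\<Sum>p\<in>sq2 m. \<bar>G p\<bar>)"
  have it: "\<bar>qf m G y\<bar> \<le> (2 * \<tau> + (Q0 - 2 * \<tau>) / 2 ^ n) * (\<Sum>i<m. (y i)\<^sup>2)" for n y
  proof (induction n arbitrary: y)
    case 0
    show ?case using abs_qf_le[OF m] by (simp add: Q0_def)
  next
    case (Suc n)
    define Q where "Q = 2 * \<tau> + (Q0 - 2 * \<tau>) / 2 ^ n"
    have IH: "\<bar>qf m G y\<bar> \<le> Q * (\<Sum>i<m. (y i)\<^sup>2)" for y using Suc.IH by (simp add: Q_def)
    have unit: "\<bar>qf m G y\<bar> \<le> \<tau> + Q / 2" if y: "(\<Sum>i<m. (y i)\<^sup>2) = 1" for y
    proof -
      obtain k where k: "k \<in> net m" "(\<Sum>i<m. (netpt m k i - y i)\<^sup>2) \<le> 1 / 64" using net_approx[OF y] by blast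
      define h where "h i = netpt m k i - y i" for i
      define c where "c = (\<Sum>i<m. Jv y i * (\<Sum>j<m. G (i, j) * h j) + Jv h i * (\<Sum>j<m. G (i, j) * y j))"
      define H where "H = (\<Sum>i<m. (h i)\<^sup>2)"
      have H: "H \<le> 1 / 64" "H \<ge> 0" using k(2) by (simp_all add: H_def h_def sum_nonneg)
      have Q: "Q \<ge> 0" using IH[of y] y by simp
      have "qf m G (netpt m k) = qf m G y + qf m G h + c"
        using qf_add[of m G 1 y 1 h] by (simp add: c_def h_def)
      hence 1: "\<bar>qf m G y\<bar> \<le> \<tau> + \<bar>qf m G h\<bar> + \<bar>c\<bar>" using net[OF k(1)] by linarith
      have 2: "\<bar>qf m G h\<bar> \<le> Q * H" using IH[of h] by (simp add: H_def)
      \<comment> \<open>Polarisation with the weights \<open>1 / 4\<close> and 4 reflects that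
        \<open>h\<close> is short: with \<open>H \<le> 1 / 64\<close> the terms of \<open>h\<close>
        and \<open>c\<close> add up to at most \<open>Q * (1 / 16 + 17 * H)\<close>, which is below
        \<open>Q / 2\<close>.\<close>
      have cc: "2 * c = qf m G (\<lambda>i. 1 / 4 * y i + 4 * h i) - qf m G (\<lambda>i. 1 / 4 * y i + - 4 * h i)"
        unfolding qf_add[of m G "1 / 4" y 4 h] qf_add[of m G "1 / 4" y "- 4" h] c_def[symmetric] by simp
      have "\<bar>2 * c\<bar> \<le> Q * (\<Sum>i<m. (1 / 4 * y i + 4 * h i)\<^sup>2) + Q * (\<Sum>i<m. (1 / 4 * y i + - 4 * h i)\<^sup>2)"
        unfolding cc by (rule order_trans[OF abs_triangle_ineq4 add_mono[OF IH IH]])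
      also have "\<dots> = Q * (\<Sum>i<m. 1 / 8 * (y i)\<^sup>2 + 32 * (h i)\<^sup>2)"
      proof -
        have e: "(1 / 4 * a + 4 * b)\<^sup>2 + (1 / 4 * a + - 4 * b)\<^sup>2 = 1 / 8 * a\<^sup>2 + 32 * b\<^sup>2" for a b :: real
          by (simp add: power2_eq_square algebra_simps)
        show ?thesis by (simp only: e distrib_left[symmetric] sum.distrib[symmetric])
      qed
      also have "(\<Sum>i<m. 1 / 8 * (y i)\<^sup>2 + 32 * (h i)\<^sup>2) = 1 / 8 + 32 * H"
        by (simp only: sum.distrib sum_distrib_left[symmetric] y H_def)
      finally have 3: "2 * \<bar>c\<bar> \<le> Q * (1 / 8 + 32 * H)" by simp
      have "Q * H + Q * (1 / 8 + 32 * H) / 2 = Q * (1 / 16 + 17 * H)" by (simp add: algebra_simps)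
      also have "\<dots> \<le> Q * (1 / 2)" using H Q by (intro mult_left_mono) auto
      finally have 4: "Q * H + Q * (1 / 8 + 32 * H) / 2 \<le> Q * (1 / 2)" .
      have gen: "\<And>a b c t u w Q :: real. a \<le> t + b + c \<Longrightarrow> b \<le> u \<Longrightarrow> 2 * c \<le> w \<Longrightarrow> u + w / 2 \<le> Q * (1 / 2) \<Longrightarrow> a \<le> t + Q / 2"
        by linarith
      show ?thesis by (rule gen[OF 1 2 3 4])
    qed
    have "\<bar>qf m G y\<bar> \<le> (\<tau> + Q / 2) * (\<Sum>i<m. (y i)\<^sup>2)"
    proof (cases "(\<Sum>i<m. (y i)\<^sup>2) = 0")
      case True
      thus ?thesis using IH[of y] by simp
    next
      case False
      define s where "s = (\<Sum>i<m. (y i)\<^sup>2)"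
      have s: "s > 0" using False sum_nonneg[of "{..<m}" "\<lambda>i. (y i)\<^sup>2"] by (simp add: s_def)
      \<comment> \<open>The summand with coefficient 0 brings the normalisation of \<open>y\<close>
        into the form of \<open>qf_add\<close>.\<close>
      define u where "u i = 1 / sqrt s * y i + 0 * y i" for i
      have "(\<Sum>i<m. (u i)\<^sup>2) = (\<Sum>i<m. (y i)\<^sup>2 / s)" using s by (simp add: u_def power_divide)
      hence "(\<Sum>i<m. (u i)\<^sup>2) = 1" using s by (simp add: sum_divide_distrib[symmetric] s_def[symmetric])
      hence "\<bar>qf m G u\<bar> \<le> \<tau> + Q / 2" by (rule unit)
      moreover have "qf m G u = qf m G y / s" unfolding u_def qf_add using s by (simp add: power_divide)
      ultimately show ?thesis using s by (simp add: s_def[symmetric] field_simps)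
    qed
    also have "\<tau> + Q / 2 = 2 * \<tau> + (Q0 - 2 * \<tau>) / 2 ^ Suc n" by (simp add: Q_def field_simps)
    finally show ?case .
  qed
  have "(\<lambda>n. (2 * \<tau> + (Q0 - 2 * \<tau>) * (1 / 2) ^ n) * (\<Sum>i<m. (y i)\<^sup>2)) \<longlonglongrightarrow> (2 * \<tau> + (Q0 - 2 * \<tau>) * 0) * (\<Sum>i<m. (y i)\<^sup>2)"
    by (intro tendsto_intros LIMSEQ_realpow_zero) auto
  hence "\<bar>qf m G y\<bar> \<le> (2 * \<tau> + (Q0 - 2 * \<tau>) * 0) * (\<Sum>i<m. (y i)\<^sup>2)"
    by (rule LIMSEQ_le_const) (use it in \<open>auto simp: power_one_over field_simps\<close>)
  thus ?thesis by simp
qed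

text \<open>Exponential counting: on the net, 1 is at most \<open>exp (21 * real m)\<close> times
  the product of \<open>exp (- (real_of_int (k i))\<^sup>2)\<close>. The sum over the whole box
  factorises, with each factor at most \<open>exp 2\<close>.\<close>

lemma card_net_le: "real (card (net m)) \<le> exp (23 * real m)"
proof -
  define L where "L = 21 * m"
  have half: "exp (- (real_of_int j)\<^sup>2) \<le> (1 / 2) ^ nat \<bar>j\<bar>" for j
  proof -
    have "real (nat \<bar>j\<bar>) \<le> (real (nat \<bar>j\<bar>))\<^sup>2" by (cases "nat \<bar>j\<bar>") (auto simp: power2_eq_square)
    also have "\<dots> = (real_of_int j)\<^sup>2" by simp
    finally have "exp (- (real_of_int j)\<^sup>2) \<le> exp (- 1) ^ nat \<bar>j\<bar>" by (simp flip: exp_of_nat_mult)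
    also have "\<dots> \<le> (1 / 2) ^ nat \<bar>j\<bar>"
    proof (rule power_mono)
      have "2 \<le> exp (1::real)" using exp_ge_add_one_self[of 1] by simp
      thus "exp (- 1) \<le> (1 / 2 :: real)" by (simp add: exp_minus field_simps)
    qed simp
    finally show ?thesis .
  qed
  have three: "(\<Sum>j\<in>{- int L..int L}. (1 / 2) ^ nat \<bar>j\<bar>) \<le> 3 - 2 * (1 / 2 :: real) ^ L" for L
  proof (induction L)
    case (Suc L)
    have "{- int (Suc L)..int (Suc L)} = insert (- int (Suc L)) (insert (int (Suc L)) {- int L..int L})" by auto
    moreover have "- int (Suc L) \<notin> insert (int (Suc L)) {- int L..int L}" "int (Suc L) \<notin> {- int L..int L}" by auto
    moreover have "nat \<bar>- int (Suc L)\<bar> = Suc L" "nat \<bar>int (Suc L)\<bar> = Suc L" by auto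
    ultimately have "(\<Sum>j\<in>{- int (Suc L)..int (Suc L)}. (1 / 2) ^ nat \<bar>j\<bar>) = (1 / 2 :: real) ^ Suc L + ((1 / 2) ^ Suc L + (\<Sum>j\<in>{- int L..int L}. (1 / 2) ^ nat \<bar>j\<bar>))"
      by (simp only: sum.insert finite_insert finite_atLeastAtMost_int not_False_eq_True)
    also have "\<dots> \<le> 3 - 2 * (1 / 2 :: real) ^ Suc L" using Suc by simp
    finally show ?case .
  qed simp
  have three': "(\<Sum>j\<in>{- int L..int L}. exp (- (real_of_int j)\<^sup>2)) \<le> exp 2"
  proof -
    have "(\<Sum>j\<in>{- int L..int L}. exp (- (real_of_int j)\<^sup>2)) \<le> (\<Sum>j\<in>{- int L..int L}. (1 / 2) ^ nat \<bar>j\<bar>)"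
      by (intro sum_mono half)
    also have "\<dots> \<le> 3" using three[of L] zero_le_power[of "1/2::real" L] by linarith
    also have "\<dots> \<le> exp 2" using exp_ge_add_one_self[of 2] by simp
    finally show ?thesis .
  qed
  have "real (card (net m)) = (\<Sum>k\<in>net m. 1)" by simp
  also have "\<dots> \<le> (\<Sum>k\<in>net m. exp (21 * real m) * (\<Prod>i<m. exp (- (real_of_int (k i))\<^sup>2)))"
  proof (intro sum_mono)
    fix k assume "k \<in> net m"
    hence "(\<Sum>i<m. (k i)\<^sup>2) \<le> 21 * int m" by (simp add: net_def)
    hence "real_of_int (\<Sum>i<m. (k i)\<^sup>2) \<le> 21 * real m" by linarith
    hence "1 \<le> exp (21 * real m + (\<Sum>i<m. - (real_of_int (k i))\<^sup>2))" by (simp add: sum_negf)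
    also have "\<dots> = exp (21 * real m) * (\<Prod>i<m. exp (- (real_of_int (k i))\<^sup>2))" by (simp only: exp_add exp_sum finite_lessThan)
    finally show "1 \<le> exp (21 * real m) * (\<Prod>i<m. exp (- (real_of_int (k i))\<^sup>2))" .
  qed
  also have "\<dots> \<le> (\<Sum>k\<in>PiE {..<m} (\<lambda>_. {- int L..int L}). exp (21 * real m) * (\<Prod>i<m. exp (- (real_of_int (k i))\<^sup>2)))"
    by (rule sum_mono2) (auto simp: net_def L_def finite_PiE prod_nonneg)
  also have "\<dots> = exp (21 * real m) * (\<Prod>i<m. \<Sum>j\<in>{- int L..int L}. exp (- (real_of_int j)\<^sup>2))"
    by (subst prod_sum_PiE) (auto simp: sum_distrib_left)
  also have "\<dots> \<le> exp (21 * real m) * (\<Prod>i<m. exp 2)"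
    by (intro mult_left_mono prod_mono conjI sum_nonneg three') auto
  also have "\<dots> = exp (23 * real m)"
    by (simp only: prod_constant card_lessThan exp_of_nat_mult[symmetric] exp_add[symmetric]) simp
  finally show ?thesis .
qed

section \<open>Gaussian matrices translated by the complex structure\<close>

definition JM :: "nat \<times> nat \<Rightarrow> real" where
  "JM p = (if snd p = pr (fst p) then sg (fst p) else 0)"

lemma sum_JM:
  assumes "even m" "i < m"
  shows "(\<Sum>j<m. JM (i, j) * f j) = sg i * f (pr i)"
proof -
  have "(\<Sum>j<m. JM (i, j) * f j) = (\<Sum>j<m. if j = pr i then sg i * f j else 0)"
    by (intro sum.cong refl) (auto simp: JM_def)
  thus ?thesis using pr_less[OF assms] by simp
qed

text \<open>Union bound over the net. At a net point \<open>qf\<close> is a Gaussian linear form of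
  variance at most \<open>(21 / 16)\<^sup>2 \<le> 2\<close>, and the exponential Markov inequality
  with parameter \<open>sqrt n\<close> bounds each tail by \<open>exp (n - 26 n)\<close>. Two signs
  and at most \<open>exp (23 n)\<close> points leave
  \<open>2 exp (- 2 n) \<le> 1 / 2\<close>.\<close>

lemma gauss_qf_small:
  assumes m: "even m" "m \<le> n" and n: "n \<ge> 1"
  defines "G0 \<equiv> {G. \<forall>k\<in>net m. \<bar>qf m G (netpt m k)\<bar> \<le> 26 * sqrt (real n)}"
  shows "ennreal (sqrt (2 * pi) ^ m\<^sup>2 / 2) \<le> (\<integral>\<^sup>+G. ennreal (gw (sq2 m) G) * indicator G0 G \<partial>LM m)"
proof -
  define th where "th = sqrt (real n)"
  have th: "th > 0" "th * th = real n" using n by (simp_all add: th_def)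
  define c where "c = exp (- 26 * real n)"
  define a where "a k e p = e * (Jv (netpt m k) (fst p) * netpt m k (snd p))" for k e and p :: "nat \<times> nat"
  define T where "T = sqrt (2 * pi) ^ m\<^sup>2"
  have T: "T > 0" by (simp add: T_def)
  have ga: "(\<lambda>G. ennreal (gw (sq2 m) G)) \<in> borel_measurable (LM m)"
    by (intro measurable_compose[OF measurable_gw measurable_ennreal] measurable_coord)
  have mq: "(\<lambda>G. qf m G z) \<in> borel_measurable (LM m)" for z
    unfolding qf_eq_sum by (intro borel_measurable_sum borel_measurable_times measurable_coord) auto
  have mG0: "G0 \<inter> space (LM m) \<in> sets (LM m)"
  proof -
    have "{G \<in> space (LM m). \<forall>k\<in>net m. \<bar>qf m G (netpt m k)\<bar> \<le> 26 * sqrt (real n)} \<in> sets (LM m)"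
      using finite_net mq by measurable
    thus ?thesis by (simp add: G0_def Int_def conj_commute)
  qed
  hence mi: "(\<lambda>G. indicator G0 G :: ennreal) \<in> borel_measurable (LM m)" by (simp add: borel_measurable_indicator_iff)
  have ma: "(\<lambda>G. ennreal (exp (\<Sum>p\<in>sq2 m. a k e p * G p) * gw (sq2 m) G)) \<in> borel_measurable (LM m)" for k e
    by (intro measurable_compose[OF _ measurable_ennreal] borel_measurable_times measurable_gw measurable_coord
        measurable_compose[OF _ borel_measurable_exp] borel_measurable_sum borel_measurable_const) auto
  have q: "(\<Sum>p\<in>sq2 m. a k e p * G p) = e * qf m G (netpt m k)" for k e G
    by (simp add: qf_eq_sum a_def sum_distrib_left mult_ac)
  have sqa: "sqn (sq2 m) (a k e) / 2 \<le> real n" if k: "k \<in> net m" and e: "e\<^sup>2 = real n" for k e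
  proof (cases "m = 0")
    case True thus ?thesis using n by (simp add: sqn_def)
  next
    case False
    define s where "s = (\<Sum>i<m. (netpt m k i)\<^sup>2)"
    have "s = of_int (\<Sum>i<m. (k i)\<^sup>2) / (16 * real m)"
      unfolding s_def netpt_def by (simp add: power_divide power_mult_distrib sum_divide_distrib)
    also have "\<dots> \<le> (21 * real m) / (16 * real m)"
    proof (rule divide_right_mono)
      have "(\<Sum>i<m. (k i)\<^sup>2) \<le> 21 * int m" using k by (simp add: net_def)
      thus "real_of_int (\<Sum>i<m. (k i)\<^sup>2) \<le> 21 * real m" by linarith
    qed simp
    also have "\<dots> = 21 / 16" using False by simp
    finally have "s * s \<le> (21 / 16) * (21 / 16)" by (intro mult_mono) (auto simp: s_def sum_nonneg)
    hence s: "s * s \<le> 2" by simp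
    have "sqn (sq2 m) (a k e) = real n * ((\<Sum>i<m. (Jv (netpt m k) i)\<^sup>2) * s)"
      unfolding sqn_def sum_sq2 a_def s_def sum_product
      by (simp add: power_mult_distrib e sum_distrib_left)
    also have "\<dots> = real n * (s * s)" using Jv_sq[OF m(1)] by (simp add: s_def)
    also have "\<dots> \<le> real n * 2" using s by (intro mult_left_mono) auto
    finally show ?thesis by simp
  qed
  \<comment> \<open>Outside \<open>G0\<close> there is a net point at which, for the sign
    \<open>e\<close> that agrees with \<open>qf\<close>, one exponential term alone is at least
    1.\<close>
  have bad: "1 \<le> (indicator G0 G :: ennreal) + (\<Sum>k\<in>net m. \<Sum>e\<in>{th, - th}. ennreal (c * exp (\<Sum>p\<in>sq2 m. a k e p * G p)))" for G
  proof (cases "G \<in> G0")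
    case False
    then obtain k where k: "k \<in> net m" "26 * th < \<bar>qf m G (netpt m k)\<bar>" by (auto simp: G0_def th_def not_le)
    define e where "e = (if qf m G (netpt m k) \<ge> 0 then th else - th)"
    have "th * (26 * th) \<le> th * \<bar>qf m G (netpt m k)\<bar>" using k th by (intro mult_left_mono) auto
    also have "\<dots> = e * qf m G (netpt m k)" by (auto simp: e_def)
    finally have "26 * real n \<le> e * qf m G (netpt m k)" using th by simp
    hence "1 \<le> c * exp (\<Sum>p\<in>sq2 m. a k e p * G p)" by (simp add: c_def q flip: exp_add)
    hence "1 \<le> ennreal (c * exp (\<Sum>p\<in>sq2 m. a k e p * G p))" by simp
    also have "\<dots> \<le> (\<Sum>e\<in>{th, - th}. ennreal (c * exp (\<Sum>p\<in>sq2 m. a k e p * G p)))"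
      by (rule member_le_sum) (auto simp: e_def)
    also have "\<dots> \<le> (\<Sum>k\<in>net m. \<Sum>e\<in>{th, - th}. ennreal (c * exp (\<Sum>p\<in>sq2 m. a k e p * G p)))"
      by (rule member_le_sum[OF k(1)]) (auto simp: finite_net)
    finally show ?thesis by (simp add: add_increasing)
  qed simp
  have "ennreal T = (\<integral>\<^sup>+G. ennreal (gw (sq2 m) G) \<partial>LM m)"
    by (simp add: nn_integral_gw T_def card_cartesian_product power2_eq_square)
  also have "\<dots> \<le> (\<integral>\<^sup>+G. ennreal (gw (sq2 m) G) * indicator G0 G +
      (\<Sum>k\<in>net m. \<Sum>e\<in>{th, - th}. ennreal c * ennreal (exp (\<Sum>p\<in>sq2 m. a k e p * G p) * gw (sq2 m) G)) \<partial>LM m)"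
  proof (rule nn_integral_mono)
    fix G
    have "ennreal (gw (sq2 m) G) * 1 \<le> ennreal (gw (sq2 m) G) * (indicator G0 G + (\<Sum>k\<in>net m. \<Sum>e\<in>{th, - th}. ennreal (c * exp (\<Sum>p\<in>sq2 m. a k e p * G p))))"
      by (intro mult_left_mono bad) simp
    also have "\<dots> = ennreal (gw (sq2 m) G) * indicator G0 G +
      (\<Sum>k\<in>net m. \<Sum>e\<in>{th, - th}. ennreal c * ennreal (exp (\<Sum>p\<in>sq2 m. a k e p * G p) * gw (sq2 m) G))"
      unfolding distrib_left sum_distrib_left
      by (intro arg_cong2[of _ _ _ _ "(+)"] refl sum.cong) (simp add: c_def gw_def ennreal_mult mult_ac)
    finally show "ennreal (gw (sq2 m) G) \<le> ennreal (gw (sq2 m) G) * indicator G0 G +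
      (\<Sum>k\<in>net m. \<Sum>e\<in>{th, - th}. ennreal c * ennreal (exp (\<Sum>p\<in>sq2 m. a k e p * G p) * gw (sq2 m) G))" by simp
  qed
  also have "\<dots> = (\<integral>\<^sup>+G. ennreal (gw (sq2 m) G) * indicator G0 G \<partial>LM m) +
      (\<Sum>k\<in>net m. \<Sum>e\<in>{th, - th}. ennreal c * (\<integral>\<^sup>+G. ennreal (exp (\<Sum>p\<in>sq2 m. a k e p * G p) * gw (sq2 m) G) \<partial>LM m))"
    using ga mi ma
    by (simp add: nn_integral_add nn_integral_sum nn_integral_cmult)
  also have "(\<Sum>k\<in>net m. \<Sum>e\<in>{th, - th}. ennreal c * (\<integral>\<^sup>+G. ennreal (exp (\<Sum>p\<in>sq2 m. a k e p * G p) * gw (sq2 m) G) \<partial>LM m))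
     \<le> (\<Sum>k\<in>net m. \<Sum>e\<in>{th, - th}. ennreal c * ennreal (exp (real n) * T))"
  proof (rule sum_mono, rule sum_mono, rule mult_left_mono)
    fix k e assume k: "k \<in> net m" and e: "e \<in> {th, - th}"
    have "e\<^sup>2 = real n" using e th by (auto simp: power2_eq_square)
    hence "exp (sqn (sq2 m) (a k e) / 2) * T \<le> exp (real n) * T"
      using sqa[OF k] T by (intro mult_right_mono) auto
    thus "(\<integral>\<^sup>+G. ennreal (exp (\<Sum>p\<in>sq2 m. a k e p * G p) * gw (sq2 m) G) \<partial>LM m) \<le> ennreal (exp (real n) * T)"
      by (subst nn_integral_gw_linear) (auto intro!: ennreal_leI simp: T_def card_cartesian_product power2_eq_square)
  qed simp
  also have "\<dots> \<le> ennreal (T / 2)"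
  proof -
    have "(\<Sum>k\<in>net m. \<Sum>e\<in>{th, - th}. ennreal c * ennreal (exp (real n) * T)) = ennreal (real (card (net m)) * (2 * (c * (exp (real n) * T))))"
      using th T by (simp add: ennreal_mult c_def ennreal_of_nat_eq_real_of_nat mult_ac)
    also have "real (card (net m)) * (2 * (c * (exp (real n) * T))) \<le> exp (23 * real n) * (2 * (c * (exp (real n) * T)))"
    proof (rule mult_right_mono)
      show "real (card (net m)) \<le> exp (23 * real n)" using card_net_le[of m] m(2) by (elim order_trans) simp
    qed (use T in \<open>simp add: c_def\<close>)
    also have "\<dots> = 2 * T * (exp (23 * real n) * exp (real n) * exp (- 26 * real n))" by (simp add: c_def mult_ac)
    also have "exp (23 * real n) * exp (real n) * exp (- 26 * real n) = exp (- 2 * real n)"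
      by (simp only: exp_add[symmetric]) simp
    also have "exp (- 2 * real n) \<le> exp (- 1) * exp (- 1)" using n by (simp only: exp_add[symmetric]) simp
    also have "\<dots> \<le> 1 / 2 * (1 / 2)"
    proof -
      have "2 \<le> exp (1::real)" using exp_ge_add_one_self[of 1] by simp
      hence "exp (- 1) \<le> (1 / 2 :: real)" by (simp add: exp_minus field_simps)
      thus ?thesis by (intro mult_mono) auto
    qed
    finally show ?thesis using T by (simp add: ennreal_leI)
  qed
  finally have *: "ennreal T \<le> (\<integral>\<^sup>+G. ennreal (gw (sq2 m) G) * indicator G0 G \<partial>LM m) + ennreal (T / 2)" by (simp add: add_left_mono)
  show ?thesis
  proof (cases "\<integral>\<^sup>+G. ennreal (gw (sq2 m) G) * indicator G0 G \<partial>LM m")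
    case (real r)
    hence "ennreal T \<le> ennreal (r + T / 2)" using * T by (simp add: ennreal_plus)
    hence "T \<le> r + T / 2" using real T by (subst (asm) ennreal_le_iff) auto
    thus ?thesis unfolding real(2) using T by (intro ennreal_leI) (simp add: T_def)
  qed simp
qed

text \<open>Paired with \<open>J y\<close>, the vector \<open>(x - B) y\<close> loses its dependence
  on the real number \<open>x\<close>, because \<open>J y\<close> is orthogonal to \<open>y\<close>,
  while the shift contributes \<open>- 2 t\<close> times the squared length of \<open>y\<close>. At
  least half of this survives the perturbation by \<open>G\<close>, and Cauchy--Schwarz turns it
  into expansion by \<open>t\<close>.\<close>

lemma shifted_matrix_expanding:
  assumes m: "even m" and t: "t > 0" and q: "\<And>y. \<bar>qf m G y\<bar> \<le> t * (\<Sum>i<m. (y i)\<^sup>2)"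
    and B: "\<And>i j. i < m \<Longrightarrow> j < m \<Longrightarrow> B (i, j) = G (i, j) + 2 * t * JM (i, j)"
  shows "poly (cp m B) x \<noteq> 0" "t ^ m \<le> \<bar>poly (cp m B) x\<bar>"
proof -
  define A where "A = mat m m (\<lambda>(i, j). (if i = j then x else 0) - B (i, j))"
  have A: "A \<in> carrier_mat m m" by (simp add: A_def)
  have ex: "t\<^sup>2 * (\<Sum>i<m. (y i)\<^sup>2) \<le> (\<Sum>i<m. (mv m A y i)\<^sup>2)" for y
  proof -
    define s where "s = (\<Sum>i<m. (y i)\<^sup>2)"
    have s: "s \<ge> 0" by (simp add: s_def sum_nonneg)
    have mvA: "mv m A y i = x * y i - (\<Sum>j<m. G (i, j) * y j) - 2 * t * Jv y i" if i: "i < m" for i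
    proof -
      have "mv m A y i = (\<Sum>j<m. (if j = i then x * y j else 0) - G (i, j) * y j - 2 * t * (JM (i, j) * y j))"
        using i by (simp add: mv_def A_def) (intro sum.cong refl, auto simp: B algebra_simps)
      also have "\<dots> = x * y i - (\<Sum>j<m. G (i, j) * y j) - 2 * t * Jv y i"
        using i sum_JM[OF m i, of y] by (simp add: sum_subtractf sum_distrib_left[symmetric] Jv_def)
      finally show ?thesis .
    qed
    have "(\<Sum>i<m. Jv y i * mv m A y i) = (\<Sum>i<m. x * (Jv y i * y i) - Jv y i * (\<Sum>j<m. G (i, j) * y j) - 2 * t * (Jv y i)\<^sup>2)"
      by (intro sum.cong refl) (simp add: mvA power2_eq_square algebra_simps)
    also have "\<dots> = - (qf m G y + 2 * t * s)"
      using Jv_orth[OF m, of y] Jv_sq[OF m, of y] by (simp add: sum_subtractf sum_distrib_left[symmetric] qf_def s_def)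
    finally have eq: "(\<Sum>i<m. Jv y i * mv m A y i) = - (qf m G y + 2 * t * s)" .
    have "t * s \<le> qf m G y + 2 * t * s" using q[of y] by (simp add: s_def)
    hence "(t * s)\<^sup>2 \<le> (qf m G y + 2 * t * s)\<^sup>2" using s t by (intro power_mono) auto
    also have "\<dots> = (\<Sum>i<m. Jv y i * mv m A y i)\<^sup>2" unfolding eq power2_minus ..
    also have "\<dots> \<le> (\<Sum>i<m. (Jv y i)\<^sup>2) * (\<Sum>i<m. (mv m A y i)\<^sup>2)" by (rule Cauchy_Schwarz_ineq_sum)
    also have "(\<Sum>i<m. (Jv y i)\<^sup>2) = s" using Jv_sq[OF m] by (simp add: s_def)
    finally have "s * (t\<^sup>2 * s) \<le> s * (\<Sum>i<m. (mv m A y i)\<^sup>2)" by (simp add: power2_eq_square mult_ac)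
    thus ?thesis unfolding s_def[symmetric] using s by (cases "s = 0") (auto simp: sum_nonneg)
  qed
  have "det A = poly (cp m B) x" by (simp add: poly_cp A_def)
  thus "poly (cp m B) x \<noteq> 0" "t ^ m \<le> \<bar>poly (cp m B) x\<bar>" using det_ge_of_expanding[OF A t ex] by simp_all
qed

text \<open>The cross term of the translation involves only the entries of \<open>G\<close> where
  \<open>JM\<close> is nonzero. Each, with its sign, is the value of \<open>qf\<close> at a unit
  vector, so the hypothesis \<open>q\<close> bounds it and the loss in the exponent is at most
  \<open>4 m t\<^sup>2\<close>.\<close>

lemma gw_shift_ge:
  assumes m: "even m" and t: "t > 0" and q: "\<And>y. \<bar>qf m G y\<bar> \<le> t * (\<Sum>i<m. (y i)\<^sup>2)"
    and B: "\<And>i j. i < m \<Longrightarrow> j < m \<Longrightarrow> B (i, j) = G (i, j) + 2 * t * JM (i, j)"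
  shows "gw (sq2 m) B \<ge> exp (- 4 * real m * t\<^sup>2) * gw (sq2 m) G"
proof -
  have e: "sg i * G (i, pr i) \<le> t" if i: "i < m" for i
  proof -
    define y where "y = (\<lambda>j. if j = pr i then 1 else 0 :: real)"
    have pi: "pr i < m" by (rule pr_less[OF m i])
    have "Jv y l = (if l = i then sg i else 0)" for l by (metis Jv_def y_def pr_pr mult.right_neutral mult_zero_right)
    moreover have "(\<Sum>j<m. G (l, j) * y j) = G (l, pr i)" for l
      using pi by (simp add: y_def if_distrib[of "\<lambda>x. _ * x"] cong: if_cong)
    ultimately have "qf m G y = sg i * G (i, pr i)"
      using i by (simp add: qf_def if_distrib[of "\<lambda>x. x * _"] cong: if_cong)
    moreover have "(\<Sum>i<m. (y i)\<^sup>2) = 1" using pi by (simp add: y_def if_distrib[of "\<lambda>x. x ^ _"] cong: if_cong)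
    ultimately show ?thesis using q[of y] by simp
  qed
  have "sqn (sq2 m) B = (\<Sum>i<m. \<Sum>j<m. (G (i, j))\<^sup>2 + (4 * t * (JM (i, j) * G (i, j)) + 4 * t\<^sup>2 * (JM (i, j) * JM (i, j))))"
    unfolding sqn_def sum_sq2 by (intro sum.cong refl) (simp add: B power2_eq_square algebra_simps)
  also have "\<dots> = sqn (sq2 m) G + (\<Sum>i<m. 4 * t * (sg i * G (i, pr i)) + 4 * t\<^sup>2 * (sg i * JM (i, pr i)))"
    by (simp add: sum.distrib sqn_def sum_sq2 sum_distrib_left[symmetric] sum_JM[OF m, where f = "\<lambda>j. G (_, j)"] sum_JM[OF m, where f = "\<lambda>j. JM (_, j)"])
  also have "\<dots> \<le> sqn (sq2 m) G + (\<Sum>i<m. 8 * t\<^sup>2)"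
  proof (intro add_left_mono sum_mono)
    fix i assume "i \<in> {..<m}"
    hence "t * (sg i * G (i, pr i)) \<le> t * t" using e t by (intro mult_left_mono) auto
    thus "4 * t * (sg i * G (i, pr i)) + 4 * t\<^sup>2 * (sg i * JM (i, pr i)) \<le> 8 * t\<^sup>2"
      by (simp add: JM_def power2_eq_square)
  qed
  finally have "- 4 * real m * t\<^sup>2 - sqn (sq2 m) G / 2 \<le> - sqn (sq2 m) B / 2" by simp
  thus ?thesis by (simp add: gw_def flip: exp_add)
qed

theorem An_0_lower:
  assumes m: "even m" "m \<le> n" and n: "n \<ge> 1"
  shows "An m 0 ys \<ge> ennreal (1 / 2 * exp (- 10816 * real m * real n) * (\<Prod>y\<leftarrow>ys. (52 * sqrt (real n)) ^ m))"
proof -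
  \<comment> \<open>The passage from the net to all vectors doubles
    \<open>26 * sqrt (real n)\<close>. The exponent \<open>4 m t\<^sup>2\<close> of the translation
    is then \<open>10816 m n\<close>.\<close>
  define t where "t = 52 * sqrt (real n)"
  have t: "t > 0" using n by (simp add: t_def)
  define G0 where "G0 = {G. \<forall>k\<in>net m. \<bar>qf m G (netpt m k)\<bar> \<le> 26 * sqrt (real n)}"
  define F where "F B = (if nr (cp m B) = 0 then ennreal (absprod ys (cp m B)) else 0) * ennreal (gw (sq2 m) B)" for B
  define K where "K = exp (- 4 * real m * t\<^sup>2) * (\<Prod>y\<leftarrow>ys. t ^ m)"
  have P: "(\<Prod>y\<leftarrow>ys. t ^ m) \<ge> 0" by (rule prod_list_map_nonneg) (use t in auto)
  hence K: "K \<ge> 0" by (simp add: K_def)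
  have ga: "(\<lambda>G. ennreal (gw (sq2 m) G)) \<in> borel_measurable (LM m)"
    by (intro measurable_compose[OF measurable_gw measurable_ennreal] measurable_coord)
  have Fm: "F \<in> borel_measurable (LM m)"
    unfolding F_def using measurable_An_integrand_const ga by (intro borel_measurable_times_ennreal)
  have le: "ennreal K * (ennreal (gw (sq2 m) G) * indicator G0 G) \<le> F (\<lambda>p\<in>sq2 m. G p + 2 * t * JM p)" for G
  proof (cases "G \<in> G0")
    case True
    define B where "B = (\<lambda>p\<in>sq2 m. G p + 2 * t * JM p)"
    have B: "B (i, j) = G (i, j) + 2 * t * JM (i, j)" if "i < m" "j < m" for i j using that by (simp add: B_def)
    have q: "\<bar>qf m G y\<bar> \<le> t * (\<Sum>i<m. (y i)\<^sup>2)" for y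
      using qf_le_of_net[OF m(1), of G "26 * sqrt (real n)" y] True by (simp add: G0_def t_def)
    note sh = shifted_matrix_expanding[OF m(1) t q B]
    have "nr (cp m B) = 0" using sh(1) by (simp add: nr_def)
    moreover have "(\<Prod>y\<leftarrow>ys. t ^ m) \<le> absprod ys (cp m B)"
      unfolding absprod_def
    proof (induction ys)
      case (Cons y ys)
      have "t ^ m * (\<Prod>y\<leftarrow>ys. t ^ m) \<le> \<bar>poly (cp m B) y\<bar> * (\<Prod>y\<leftarrow>ys. \<bar>poly (cp m B) y\<bar>)"
        by (intro mult_mono sh(2) Cons.IH prod_list_map_nonneg) (use t in auto)
      thus ?case by simp
    qed simp
    hence "(\<Prod>y\<leftarrow>ys. t ^ m) * (exp (- 4 * real m * t\<^sup>2) * gw (sq2 m) G) \<le> absprod ys (cp m B) * gw (sq2 m) B"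
      by (intro mult_mono gw_shift_ge[OF m(1) t q B] absprod_nonneg) (auto simp: gw_def)
    hence "K * gw (sq2 m) G \<le> absprod ys (cp m B) * gw (sq2 m) B" by (simp add: K_def mult_ac)
    ultimately show ?thesis using True K
      by (simp add: F_def B_def[symmetric] ennreal_mult[symmetric] gw_def absprod_nonneg ennreal_leI)
  qed simp
  have mG: "(\<lambda>G. ennreal (gw (sq2 m) G) * indicator G0 G) \<in> borel_measurable (LM m)"
  proof -
    have mq: "(\<lambda>G. qf m G z) \<in> borel_measurable (LM m)" for z
      unfolding qf_eq_sum by (intro borel_measurable_sum borel_measurable_times measurable_coord) auto
    have "{G \<in> space (LM m). \<forall>k\<in>net m. \<bar>qf m G (netpt m k)\<bar> \<le> 26 * sqrt (real n)} \<in> sets (LM m)"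
      using finite_net mq by measurable
    hence "G0 \<inter> space (LM m) \<in> sets (LM m)" by (simp add: G0_def Int_def conj_commute)
    hence "(\<lambda>G. indicator G0 G :: ennreal) \<in> borel_measurable (LM m)" by (simp add: borel_measurable_indicator_iff)
    thus ?thesis using ga by (intro borel_measurable_times_ennreal)
  qed
  have "ennreal (K * (sqrt (2 * pi) ^ m\<^sup>2 / 2)) = ennreal K * ennreal (sqrt (2 * pi) ^ m\<^sup>2 / 2)" using K by (intro ennreal_mult) auto
  also have "\<dots> \<le> ennreal K * (\<integral>\<^sup>+G. ennreal (gw (sq2 m) G) * indicator G0 G \<partial>LM m)"
    unfolding G0_def by (intro mult_left_mono gauss_qf_small m n) auto
  also have "\<dots> = (\<integral>\<^sup>+G. ennreal K * (ennreal (gw (sq2 m) G) * indicator G0 G) \<partial>LM m)"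
    by (rule nn_integral_cmult[symmetric]) (rule mG)
  also have "\<dots> \<le> (\<integral>\<^sup>+G. F (\<lambda>p\<in>sq2 m. G p + 2 * t * JM p) \<partial>LM m)"
    by (rule nn_integral_mono) (rule le)
  also have "\<dots> = (\<integral>\<^sup>+B. F B \<partial>LM m)" by (rule nn_LB_translate[OF _ Fm]) auto
  finally have "ennreal (1 / sqrt (2 * pi) ^ m\<^sup>2) * ennreal (K * (sqrt (2 * pi) ^ m\<^sup>2 / 2)) \<le> An m 0 ys"
    unfolding An_def F_def by (intro mult_left_mono) auto
  also have "ennreal (1 / sqrt (2 * pi) ^ m\<^sup>2) * ennreal (K * (sqrt (2 * pi) ^ m\<^sup>2 / 2)) = ennreal (K / 2)"
    using K by (subst ennreal_mult[symmetric]) auto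
  also have "K / 2 = 1 / 2 * exp (- 10816 * real m * real n) * (\<Prod>y\<leftarrow>ys. t ^ m)"
    by (simp add: K_def t_def power_mult_distrib)
  finally show ?thesis by (simp add: t_def)
qed

section \<open>Explicit bounds and asymptotics\<close>

text \<open>The moments follow \<open>sqrt (fact n)\<close> up to a factor linear in
  \<open>n\<close>, which amounts to \<open>O(ln n)\<close> per eigenvalue after taking
  logarithms.\<close>

lemma dd_bounds: "sqrt (fact n) / (real n + 1) \<le> dd n \<and> dd n \<le> 3 * sqrt (fact n)"
proof (induction n rule: dd.induct)
  case 1
  have "sqrt (2 * pi) \<le> sqrt (3 * 3)" using pi_less_4 by (intro real_sqrt_le_mono) simp
  moreover have "sqrt (2 * pi) \<ge> sqrt (1 * 1)" using pi_gt3 by (intro real_sqrt_le_mono) simp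
  ultimately show ?case by (simp del: real_sqrt_le_iff real_sqrt_ge_1_iff add: real_sqrt_mult_self)
next
  case 2
  show ?case by simp
next
  case (3 n)
  have s: "sqrt (fact (Suc (Suc n))) = sqrt ((real n + 1) * (real n + 2)) * sqrt (fact n)"
  proof -
    have "fact (Suc (Suc n)) = (real n + 1) * (real n + 2) * fact n" by (simp add: algebra_simps)
    thus ?thesis by (simp only: real_sqrt_mult)
  qed
  have u: "sqrt ((real n + 1) * (real n + 2)) \<le> real n + 3" by (rule real_le_lsqrt) (auto simp: power2_eq_square algebra_simps)
  have l: "real n + 1 \<le> sqrt ((real n + 1) * (real n + 2))" by (rule real_le_rsqrt) (auto simp: power2_eq_square algebra_simps)
  have "sqrt (fact (Suc (Suc n))) / (real n + 3) \<le> sqrt (fact n)"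
    unfolding s using u mult_right_mono[OF u, of "sqrt (fact n)"] by (simp add: field_simps)
  also have "\<dots> = (real n + 1) * (sqrt (fact n) / (real n + 1))" by simp
  also have "\<dots> \<le> (real n + 1) * dd n" using 3 by (intro mult_left_mono) auto
  finally have 1: "sqrt (fact (Suc (Suc n))) / (real n + 3) \<le> (real n + 1) * dd n" .
  have "(real n + 1) * dd n \<le> (real n + 1) * (3 * sqrt (fact n))" using 3 by (intro mult_left_mono) auto
  also have "\<dots> \<le> sqrt ((real n + 1) * (real n + 2)) * (3 * sqrt (fact n))" using l by (intro mult_right_mono) auto
  also have "\<dots> = 3 * sqrt (fact (Suc (Suc n)))" by (simp only: s mult_ac)
  finally show ?case using 1 by (simp add: add.commute)
qed

text \<open>The growth of \<open>g\<close> weakens the weight to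
  \<open>exp (- s * x\<^sup>2 / 2)\<close>. Hermite polynomials with argument scaled by
  \<open>sqrt s\<close>, made monic again, are adapted to it; the rescaling produces the powers of
  \<open>1 / sqrt s\<close>.\<close>

lemma Jn_gauss_upper:
  assumes s: "s > 0"
    and g: "\<And>x. g x = \<gamma> * exp ((1 - s) * x\<^sup>2 / 2)" and \<gamma>: "\<gamma> \<ge> 0"
  shows "Jn k g [] \<le> ennreal (\<gamma> ^ k * (fact k * (\<Prod>j<k. (1 / sqrt s) ^ Suc j * (sqrt (hh j) * (real j + 4)))))"
proof -
  define r where "r = sqrt s"
  have r: "r > 0" "r * r = s" using s by (simp_all add: r_def)
  define \<omega> where "\<omega> x = exp (- s * x\<^sup>2 / 2)" for x :: real
  define Q where "Q j = Polynomial.smult ((1 / r) ^ j) (pcompose (Hp j) [:0, r:])" for j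
  define \<alpha> where "\<alpha> j = (1 / r) ^ Suc j * (sqrt (hh j) * (real j + 4))" for j
  have \<alpha>: "\<alpha> j \<ge> 0" for j using r hh_pos[of j] by (simp add: \<alpha>_def)
  have dQ: "degree (Q j) = j" for j using r Hp_monic[of j] by (simp add: Q_def degree_pcompose)
  have cQ: "coeff (Q j) j = 1" for j
  proof -
    have dP: "degree (pcompose (Hp j) [:0, r:]) = j" using r Hp_monic[of j] by (simp add: degree_pcompose)
    have "lead_coeff (pcompose (Hp j) [:0, r:]) = lead_coeff (Hp j) * r ^ degree (Hp j)"
      using r by (subst lead_coeff_comp) auto
    hence "coeff (pcompose (Hp j) [:0, r:]) j = r ^ j" unfolding dP using Hp_monic[of j] by simp
    thus ?thesis using r by (simp add: Q_def power_divide)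
  qed
  have bound: "(\<integral>\<^sup>+x. ennreal (\<bar>poly (Q j) x\<bar> * \<omega> x) \<partial>lborel) \<le> ennreal (\<alpha> j)" for j
  proof -
    have m: "(\<lambda>x. ennreal (\<bar>poly (Hp j) x\<bar> * exp (- x\<^sup>2 / 2))) \<in> borel_measurable borel"
    proof -
      have [measurable]: "poly (Hp j) \<in> borel_measurable borel" by (intro borel_measurable_continuous_onI continuous_intros)
      show ?thesis by measurable
    qed
    have "ennreal (\<bar>poly (Q j) x\<bar> * \<omega> x) = ennreal ((1 / r) ^ j) * ennreal (\<bar>poly (Hp j) (0 + r * x)\<bar> * exp (- (0 + r * x)\<^sup>2 / 2))" for x
      using r by (subst ennreal_mult[symmetric]) (auto simp: Q_def \<omega>_def poly_pcompose abs_mult power_mult_distrib power2_eq_square[of r] mult_ac)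
    hence "(\<integral>\<^sup>+x. ennreal (\<bar>poly (Q j) x\<bar> * \<omega> x) \<partial>lborel)
       = ennreal ((1 / r) ^ j) * (\<integral>\<^sup>+x. ennreal (\<bar>poly (Hp j) (0 + r * x)\<bar> * exp (- (0 + r * x)\<^sup>2 / 2)) \<partial>lborel)"
      using m by (subst nn_integral_cmult[symmetric]) (auto intro!: measurable_compose[OF _ m])
    also have "(\<integral>\<^sup>+x. ennreal (\<bar>poly (Hp j) (0 + r * x)\<bar> * exp (- (0 + r * x)\<^sup>2 / 2)) \<partial>lborel)
       = ennreal (1 / r) * (ennreal \<bar>r\<bar> * (\<integral>\<^sup>+x. ennreal (\<bar>poly (Hp j) (0 + r * x)\<bar> * exp (- (0 + r * x)\<^sup>2 / 2)) \<partial>lborel))"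
      using r by (subst mult.assoc[symmetric], subst ennreal_mult[symmetric]) auto
    also have "ennreal \<bar>r\<bar> * (\<integral>\<^sup>+x. ennreal (\<bar>poly (Hp j) (0 + r * x)\<bar> * exp (- (0 + r * x)\<^sup>2 / 2)) \<partial>lborel)
       = (\<integral>\<^sup>+x. ennreal (\<bar>poly (Hp j) x\<bar> * exp (- x\<^sup>2 / 2)) \<partial>lborel)"
      using r m by (intro nn_integral_real_affine[symmetric]) auto
    also have "ennreal ((1 / r) ^ j) * (ennreal (1 / r) * (\<integral>\<^sup>+x. ennreal (\<bar>poly (Hp j) x\<bar> * exp (- x\<^sup>2 / 2)) \<partial>lborel))
       \<le> ennreal ((1 / r) ^ j) * (ennreal (1 / r) * ennreal (sqrt (hh j) * (real j + 4)))"
      by (intro mult_left_mono Hp_L1_bound) auto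
    also have "\<dots> = ennreal (\<alpha> j)"
      using r hh_pos[of j] unfolding \<alpha>_def by (simp add: ennreal_mult[symmetric] less_imp_le mult_ac)
    finally show ?thesis .
  qed
  have W: "ennreal (Wk k g [] l) = ennreal (\<gamma> ^ k) * ennreal ((\<Prod>i<k. \<omega> (l i)) * (\<Prod>j<k. \<Prod>i<j. \<bar>l j - l i\<bar>))" for l
  proof -
    have "exp (- (l i)\<^sup>2 / 2) * g (l i) = \<gamma> * \<omega> (l i)" for i
      by (simp add: g \<omega>_def exp_add[symmetric] field_simps)
    hence "Wk k g [] l = \<gamma> ^ k * ((\<Prod>i<k. \<omega> (l i)) * (\<Prod>j<k. \<Prod>i<j. \<bar>l j - l i\<bar>))"
      by (simp add: Wk_def prod.distrib)
    thus ?thesis using \<gamma> by (simp add: ennreal_mult \<omega>_def prod_nonneg)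
  qed
  have mV: "(\<lambda>l. ennreal ((\<Prod>i<k. \<omega> (l i)) * (\<Prod>j<k. \<Prod>i<j. \<bar>l j - l i\<bar>))) \<in> borel_measurable (LB {..<k})"
  proof -
    have w: "\<omega> \<in> borel_measurable borel" unfolding \<omega>_def by measurable
    show ?thesis
      by (intro measurable_compose[OF _ measurable_ennreal] borel_measurable_times borel_measurable_prod
          measurable_compose[OF measurable_coord w] borel_measurable_abs borel_measurable_diff measurable_coord) auto
  qed
  have "Jn k g [] = ennreal (\<gamma> ^ k) * (\<integral>\<^sup>+l. ennreal ((\<Prod>i<k. \<omega> (l i)) * (\<Prod>j<k. \<Prod>i<j. \<bar>l j - l i\<bar>)) \<partial>LB {..<k})"
    unfolding Jn_def W by (rule nn_integral_cmult[OF mV])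
  also have "\<dots> \<le> ennreal (\<gamma> ^ k) * ennreal (fact k * (\<Prod>j<k. \<alpha> j))"
    by (intro mult_left_mono vander_integral_upper[where Q = Q] dQ cQ bound \<alpha>) (auto simp: \<omega>_def)
  also have "\<dots> = ennreal (\<gamma> ^ k * (fact k * (\<Prod>j<k. \<alpha> j)))"
    using \<gamma> \<alpha> by (simp add: ennreal_mult[symmetric] prod_nonneg)
  finally show ?thesis by (simp add: \<alpha>_def r_def)
qed

lemma Jn_const_lower:
  assumes \<gamma>: "\<gamma> \<ge> 0"
  shows "Jn k (\<lambda>_. \<gamma>) [] \<ge> ennreal (\<gamma> ^ k * (\<Prod>j<k. sqrt (hh j) / (3 * real j + 5)))"
proof -
  define I where "I = (\<integral>\<^sup>+l. ennreal ((\<Prod>i<k. exp (- (l i)\<^sup>2 / 2)) * (\<Prod>j<k. \<Prod>i<j. \<bar>l j - l i\<bar>)) \<partial>LB {..<k})"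
  define c where "c = (\<Prod>j<k. sqrt (hh j) * (3 * real j + 5))"
  have c: "c > 0" unfolding c_def by (intro prod_pos) (auto simp: hh_pos)
  have mV: "(\<lambda>l. ennreal ((\<Prod>i<k. exp (- (l i)\<^sup>2 / 2)) * (\<Prod>j<k. \<Prod>i<j. \<bar>l j - l i\<bar>))) \<in> borel_measurable (LB {..<k})"
  proof -
    have w: "(\<lambda>x :: real. exp (- x\<^sup>2 / 2)) \<in> borel_measurable borel" by measurable
    show ?thesis
      by (intro measurable_compose[OF _ measurable_ennreal] borel_measurable_times borel_measurable_prod
          measurable_compose[OF measurable_coord w] borel_measurable_abs borel_measurable_diff measurable_coord) auto
  qed
  have "ennreal (1 / c) * ennreal (\<Prod>j<k. hh j) \<le> ennreal (1 / c) * (ennreal c * I)"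
    unfolding c_def I_def by (intro mult_left_mono vander_integral_lower) auto
  also have "\<dots> = I" using c by (simp add: mult.assoc[symmetric] ennreal_mult[symmetric])
  finally have "ennreal (\<gamma> ^ k) * (ennreal (1 / c) * ennreal (\<Prod>j<k. hh j)) \<le> ennreal (\<gamma> ^ k) * I" by (intro mult_left_mono) auto
  also have "ennreal (\<gamma> ^ k) * I = Jn k (\<lambda>_. \<gamma>) []"
  proof -
    have W: "ennreal (Wk k (\<lambda>_. \<gamma>) [] l) = ennreal (\<gamma> ^ k) * ennreal ((\<Prod>i<k. exp (- (l i)\<^sup>2 / 2)) * (\<Prod>j<k. \<Prod>i<j. \<bar>l j - l i\<bar>))" for l
      using \<gamma> by (subst ennreal_mult[symmetric]) (auto simp: Wk_def prod.distrib prod_nonneg mult_ac)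
    show ?thesis unfolding Jn_def I_def W by (rule nn_integral_cmult[OF mV, symmetric])
  qed
  also have "ennreal (\<gamma> ^ k) * (ennreal (1 / c) * ennreal (\<Prod>j<k. hh j)) = ennreal (\<gamma> ^ k * ((1 / c) * (\<Prod>j<k. hh j)))"
    using \<gamma> c hh_pos by (subst ennreal_mult[symmetric], simp, simp add: prod_nonneg less_imp_le, subst ennreal_mult[symmetric]) (auto simp: prod_nonneg less_imp_le)
  also have "(1 / c) * (\<Prod>j<k. hh j) = (\<Prod>j<k. sqrt (hh j) / (3 * real j + 5))"
  proof -
    have "sqrt (hh j) / (3 * real j + 5) = hh j / (sqrt (hh j) * (3 * real j + 5))" for j
    proof -
      have "sqrt (hh j) / (3 * real j + 5) = (sqrt (hh j) * sqrt (hh j)) / (sqrt (hh j) * (3 * real j + 5))"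
        using hh_pos[of j] by (intro mult_divide_mult_cancel_left[symmetric]) simp
      thus ?thesis using hh_pos[of j] by simp
    qed
    thus ?thesis by (simp add: c_def prod_dividef)
  qed
  finally show ?thesis .
qed

text \<open>The value of \<open>s\<close> is read off from
  \<open>exp (m y\<^sup>2 / (4 n)) = exp ((1 - s) y\<^sup>2 / 2)\<close>, where the left-hand side
  is the growth in \<open>y\<close> of the determinant bound.\<close>

theorem An_upper_explicit:
  assumes n: "n \<ge> 1" "n = m + k"
  defines "s \<equiv> 1 - real m / (2 * real n)"
  shows "An n k [] \<le> ennreal (sqrt 2 ^ m\<^sup>2 * sqrt (4 * real n) ^ (m * k) *
     (\<Prod>j<k. (1 / sqrt s) ^ Suc j * (sqrt (hh j) * (real j + 4)) / dd (m + j)))"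
proof -
  define \<gamma> where "\<gamma> = sqrt (4 * real n) ^ m"
  define g where "g y = \<gamma> * exp (real m * y\<^sup>2 / (4 * real n))" for y :: real
  define \<beta> where "\<beta> j = (1 / sqrt s) ^ Suc j * (sqrt (hh j) * (real j + 4))" for j
  have s: "s > 0" using n by (simp add: s_def field_simps)
  have \<gamma>: "\<gamma> \<ge> 0" by (simp add: \<gamma>_def)
  have \<beta>: "\<beta> j \<ge> 0" for j using s hh_pos[of j] by (simp add: \<beta>_def)
  have g': "g x = \<gamma> * exp ((1 - s) * x\<^sup>2 / 2)" for x by (simp add: g_def s_def)
  have D: "(\<Prod>j<k. dd (m + j)) > 0" by (intro prod_pos) (simp add: dd_pos)
  have "ennreal (fact k) * An (m + k) k [] \<le> ennreal (sqrt 2 ^ m\<^sup>2 / (\<Prod>j<k. dd (m + j))) * Jn k g []"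
  proof (rule An_upper[where L = k])
    show "g \<in> borel_measurable borel" unfolding g_def by measurable
    show "An m 0 ys \<le> ennreal (sqrt 2 ^ m\<^sup>2 * (\<Prod>y\<leftarrow>ys. g y))" if "length ys = k" for ys
      using An_0_upper[of n ys m] n that by (simp add: g_def \<gamma>_def)
  qed (auto simp: g_def \<gamma>_def)
  also have "\<dots> \<le> ennreal (sqrt 2 ^ m\<^sup>2 / (\<Prod>j<k. dd (m + j))) * ennreal (\<gamma> ^ k * (fact k * (\<Prod>j<k. \<beta> j)))"
    unfolding \<beta>_def by (intro mult_left_mono Jn_gauss_upper[OF s g' \<gamma>]) simp
  also have "\<dots> = ennreal (fact k) * ennreal (sqrt 2 ^ m\<^sup>2 * \<gamma> ^ k * ((\<Prod>j<k. \<beta> j) / (\<Prod>j<k. dd (m + j))))"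
    using D \<gamma> \<beta> by (subst (1 2) ennreal_mult[symmetric]) (auto intro!: mult_nonneg_nonneg divide_nonneg_pos prod_nonneg simp: mult_ac)
  finally have "An n k [] \<le> ennreal (sqrt 2 ^ m\<^sup>2 * \<gamma> ^ k * ((\<Prod>j<k. \<beta> j) / (\<Prod>j<k. dd (m + j))))"
    using n(2) by (simp add: ennreal_mult_le_mult_iff)
  thus ?thesis unfolding \<gamma>_def power_mult[symmetric] prod_dividef[symmetric] \<beta>_def .
qed

text \<open>The lower bound for \<open>An m 0 ys\<close> is uniform in the points, so
  \<open>g\<close> is constant and the weight stays standard. Only one permutation survived in the
  Vandermonde integral, hence the factor \<open>1 / fact k\<close>, whose logarithm is
  \<open>O(n ln n)\<close>.\<close>

theorem An_lower_explicit:
  assumes n: "n \<ge> 1" "n = m + k" and m: "even m"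
  shows "An n k [] \<ge> ennreal (1 / 2 * exp (- 10816 * real m * real n) / fact k * (52 * sqrt (real n)) ^ (m * k) *
     (\<Prod>j<k. sqrt (hh j) / (3 * real j + 5) / dd (m + j)))"
proof -
  define \<gamma> where "\<gamma> = (52 * sqrt (real n)) ^ m"
  define C where "C = 1 / 2 * exp (- 10816 * real m * real n)"
  define \<beta> where "\<beta> j = sqrt (hh j) / (3 * real j + 5)" for j
  have \<gamma>: "\<gamma> \<ge> 0" by (simp add: \<gamma>_def)
  have C: "C \<ge> 0" by (simp add: C_def)
  have \<beta>: "\<beta> j \<ge> 0" for j using hh_pos[of j] by (simp add: \<beta>_def)
  have D: "(\<Prod>j<k. dd (m + j)) > 0" by (intro prod_pos) (simp add: dd_pos)
  have "ennreal (fact k) * An (m + k) k [] \<ge> ennreal (C / (\<Prod>j<k. dd (m + j))) * Jn k (\<lambda>_. \<gamma>) []"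
  proof (rule An_lower[where L = k])
    show "An m 0 ys \<ge> ennreal (C * (\<Prod>y\<leftarrow>ys. \<gamma>))" if "length ys = k" for ys
      using An_0_lower[of m n ys] n m by (simp add: C_def \<gamma>_def)
  qed (auto simp: \<gamma> C)
  moreover have "ennreal (C / (\<Prod>j<k. dd (m + j))) * Jn k (\<lambda>_. \<gamma>) [] \<ge> ennreal (C / (\<Prod>j<k. dd (m + j))) * ennreal (\<gamma> ^ k * (\<Prod>j<k. \<beta> j))"
    unfolding \<beta>_def by (intro mult_left_mono Jn_const_lower \<gamma>) simp
  moreover have "ennreal (C / (\<Prod>j<k. dd (m + j))) * ennreal (\<gamma> ^ k * (\<Prod>j<k. \<beta> j))
     = ennreal (fact k) * ennreal (C / fact k * \<gamma> ^ k * ((\<Prod>j<k. \<beta> j) / (\<Prod>j<k. dd (m + j))))"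
    using D \<gamma> \<beta> C by (subst (1 2) ennreal_mult[symmetric]) (auto intro!: mult_nonneg_nonneg divide_nonneg_pos prod_nonneg simp: mult_ac)
  ultimately have "ennreal (fact k) * ennreal (C / fact k * \<gamma> ^ k * ((\<Prod>j<k. \<beta> j) / (\<Prod>j<k. dd (m + j)))) \<le> ennreal (fact k) * An n k []"
    using n(2) by auto
  hence "ennreal (C / fact k * \<gamma> ^ k * ((\<Prod>j<k. \<beta> j) / (\<Prod>j<k. dd (m + j)))) \<le> An n k []"
    by (simp add: ennreal_mult_le_mult_iff)
  thus ?thesis unfolding \<gamma>_def C_def power_mult[symmetric] prod_dividef[symmetric] \<beta>_def .
qed

section \<open>Logarithms of the explicit bounds\<close>

text \<open>The quotient of \<open>real n ^ k\<close> and \<open>fact k\<close> is a single term of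
  the exponential series at \<open>n\<close>.\<close>

lemma ln_fact_ge:
  assumes "n \<ge> 1"
  shows "real k * ln (real n) - real n \<le> ln (fact k)"
proof -
  have "real n ^ k / fact k \<le> exp (real n)"
  proof -
    have "(\<Sum>i\<in>{k}. real n ^ i / fact i) \<le> (\<Sum>i. real n ^ i / fact i)"
      by (rule sum_le_suminf) (use summable_exp_generic[of "real n"] in \<open>auto simp: divide_inverse mult.commute\<close>)
    thus ?thesis by (simp add: exp_def divide_inverse mult.commute)
  qed
  hence "real n ^ k \<le> exp (real n) * fact k" by (simp add: field_simps)
  hence "ln (real n ^ k) \<le> ln (exp (real n) * fact k)" using assms by (subst ln_le_cancel_iff) auto
  thus ?thesis using assms by (simp add: ln_mult ln_realpow)
qed

lemma fact_add_bounds: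
  assumes "m + j \<le> n"
  shows "real (Suc j) ^ m * fact j \<le> fact (m + j)" "fact (m + j) \<le> real n ^ m * fact j"
  using assms
proof (induction m)
  case (Suc m)
  { case 1
    have "real (Suc j) * (real (Suc j) ^ m * fact j) \<le> real (Suc m + j) * fact (m + j)"
      using Suc 1 by (intro mult_mono) auto
    thus ?case by (simp add: mult.assoc)
  next
    case 2
    have "real (Suc m + j) * fact (m + j) \<le> real n * (real n ^ m * fact j)"
      using Suc 2 by (intro mult_mono) auto
    thus ?case by (simp add: mult.assoc)
  }
qed simp_all

text \<open>\<open>D\<close> compares the factorials behind \<open>dd (m + j)\<close> with those in
  \<open>hh j\<close>. It is \<open>m k ln n\<close> up to \<open>m n\<close>, the precision needed
  to cancel the powers of \<open>sqrt n\<close> that come from the determinants.\<close>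

lemma sum_ln_fact_bounds:
  assumes "n = m + k" "n \<ge> 1"
  defines "D \<equiv> (\<Sum>j<k. ln (fact (m + j)) - ln (fact j))"
  shows "D \<le> real m * real k * ln (real n)" "real m * (real k * ln (real n) - real n) \<le> D"
proof -
  have "D \<le> (\<Sum>j<k. real m * ln (real n))"
    unfolding D_def
  proof (rule sum_mono)
    fix j assume "j \<in> {..<k}"
    hence "fact (m + j) \<le> real n ^ m * fact j" using fact_add_bounds(2)[of m j n] assms by simp
    hence "ln (fact (m + j)) \<le> ln (real n ^ m * fact j)" using assms by (subst ln_le_cancel_iff) auto
    thus "ln (fact (m + j)) - ln (fact j) \<le> real m * ln (real n)" using assms by (simp add: ln_mult ln_realpow)
  qed
  thus "D \<le> real m * real k * ln (real n)" by (simp add: mult_ac)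
  have "ln (fact k) = (\<Sum>j<k. ln (real (Suc j)))"
    by (induction k) (simp_all add: ln_mult)
  hence "real m * (real k * ln (real n) - real n) \<le> real m * (\<Sum>j<k. ln (real (Suc j)))"
    using ln_fact_ge[OF assms(2), of k] by (intro mult_left_mono) auto
  also have "\<dots> = (\<Sum>j<k. real m * ln (real (Suc j)))" by (rule sum_distrib_left)
  also have "\<dots> \<le> D" unfolding D_def
  proof (rule sum_mono)
    fix j assume "j \<in> {..<k}"
    hence "real (Suc j) ^ m * fact j \<le> fact (m + j)" using fact_add_bounds(1)[of m j n] assms by simp
    hence "ln (real (Suc j) ^ m * fact j) \<le> ln (fact (m + j))" by (subst ln_le_cancel_iff) auto
    moreover have "ln (real (Suc j) ^ m * fact j) = real m * ln (real (Suc j)) + ln (fact j)"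
      by (simp add: ln_mult ln_realpow del: of_nat_Suc)
    ultimately show "real m * ln (real (Suc j)) \<le> ln (fact (m + j)) - ln (fact j)" by linarith
  qed
  finally show "real m * (real k * ln (real n) - real n) \<le> D" .
qed

lemma ln_sqrt_hh: "ln (sqrt (hh j)) = ln pi / 4 + ln (fact j) / 2 - real j / 2 * ln 2"
  by (simp add: hh_def ln_sqrt ln_mult ln_div ln_realpow)

text \<open>The main term arises here: the sum of \<open>j / 2\<close> over \<open>j < k\<close> is
  \<open>k\<^sup>2 / 4 - k / 4\<close>.\<close>

lemma sum_ln_sqrt_hh: "(\<Sum>j<k. ln (sqrt (hh j))) = - ((real k)\<^sup>2 / 4) * ln 2 + real k / 4 * (ln 2 + ln pi) + (\<Sum>j<k. ln (fact j)) / 2"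
proof -
  have S: "(\<Sum>j<k. real j) = (real k)\<^sup>2 / 2 - real k / 2" by (induction k) (simp_all add: power2_eq_square algebra_simps add_divide_distrib)
  have "(\<Sum>j<k. real j / 2 * ln 2) = (\<Sum>j<k. real j) * (ln 2 / 2)" by (simp add: sum_distrib_right)
  hence *: "(\<Sum>j<k. real j / 2 * ln 2) = ((real k)\<^sup>2 / 4 - real k / 4) * ln 2" unfolding S by (simp add: algebra_simps)
  show ?thesis unfolding ln_sqrt_hh sum_subtractf sum.distrib *
    by (simp add: sum_divide_distrib[symmetric] algebra_simps)
qed

lemma ln_dd: "ln (fact n) / 2 - ln (real n + 1) \<le> ln (dd n)" "ln (dd n) \<le> ln (fact n) / 2 + ln 3"
proof -
  have "ln (sqrt (fact n) / (real n + 1)) \<le> ln (dd n)" using dd_bounds[of n] dd_pos[of n] by (subst ln_le_cancel_iff) auto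
  thus "ln (fact n) / 2 - ln (real n + 1) \<le> ln (dd n)" by (simp add: ln_div ln_sqrt)
  have "ln (dd n) \<le> ln (3 * sqrt (fact n))" using dd_bounds[of n] dd_pos[of n] by (subst ln_le_cancel_iff) auto
  thus "ln (dd n) \<le> ln (fact n) / 2 + ln 3" by (simp add: ln_mult ln_sqrt)
qed

lemma ln_num_bounds: "ln 3 \<le> (2::real)" "ln pi \<le> (2::real)" "ln 2 \<le> (1::real)" "0 \<le> ln pi"
  using ln_le_minus_one[of 3] ln_le_minus_one[of 2] pi_gt3 pi_less_4 ln_2_less_1
proof -
  have "ln pi \<le> ln 4" using pi_less_4 pi_gt3 by (subst ln_le_cancel_iff) auto
  also have "\<dots> = 2 * ln (2::real)" using ln_realpow[of 2 2] by simp
  finally show "ln pi \<le> (2::real)" using ln_2_less_1 by simp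
qed auto

lemma ln_mult_div: "a > 0 \<Longrightarrow> b > 0 \<Longrightarrow> c > 0 \<Longrightarrow> ln (a * b / c) = ln a + ln b - ln (c :: real)"
  by (simp add: ln_div ln_mult)

lemma ln_mult3: "a > 0 \<Longrightarrow> b > 0 \<Longrightarrow> c > 0 \<Longrightarrow> ln (a * b * c) = ln a + ln b + ln (c :: real)"
  by (simp add: ln_mult)

text \<open>Both logarithms are expanded into the main term of \<open>sum_ln_sqrt_hh\<close>, the
  quantity \<open>D\<close> and terms of order \<open>m n + n ln n\<close>. Evenness of
  \<open>m\<close> provides the complex structure for the lower bound.\<close>

theorem ln_An_bounds:
  assumes n: "n \<ge> 1" "n = m + k" and m: "even m"
  shows "\<exists>p>0. An n k [] = ennreal p \<and>
     \<bar>ln p + (real k)\<^sup>2 / 4 * ln 2\<bar> \<le> 10816 * real m * real n + 2 * real n * ln (real n + 4) + 5 * real n"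
proof -
  define s where "s = 1 - real m / (2 * real n)"
  define D where "D = (\<Sum>j<k. ln (fact (m + j)) - ln (fact j) :: real)"
  define u where "u = sqrt 2 ^ m\<^sup>2 * sqrt (4 * real n) ^ (m * k) *
     (\<Prod>j<k. (1 / sqrt s) ^ Suc j * (sqrt (hh j) * (real j + 4)) / dd (m + j))"
  define l where "l = 1 / 2 * exp (- 10816 * real m * real n) / fact k * (52 * sqrt (real n)) ^ (m * k) *
     (\<Prod>j<k. sqrt (hh j) / (3 * real j + 5) / dd (m + j))"
  have up: "An n k [] \<le> ennreal u" using An_upper_explicit[OF n] by (simp add: u_def s_def)
  have lo: "ennreal l \<le> An n k []" using An_lower_explicit[OF n m] by (simp add: l_def)
  have rn: "real n \<ge> 1" using n by simp
  have s: "s \<ge> 1 / 2" using n by (simp add: s_def field_simps)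
  have lpos: "0 < (\<Prod>j<k. sqrt (hh j) / (3 * real j + 5) / dd (m + j))"
    by (intro prod_pos) (simp add: hh_pos dd_pos)
  hence l: "l > 0" using rn by (simp add: l_def)
  have upos: "0 < (\<Prod>j<k. (1 / sqrt s) ^ Suc j * (sqrt (hh j) * (real j + 4)) / dd (m + j))"
    using s hh_pos dd_pos by (intro prod_pos ballI divide_pos_pos mult_pos_pos zero_less_power) auto
  hence u: "u > 0" using rn by (simp add: u_def)
  from up obtain p where p: "An n k [] = ennreal p" "p \<ge> 0" by (cases "An n k []") (auto simp: top_unique)
  have lp: "l \<le> p" "p \<le> u" using up lo p u by (auto simp: ennreal_le_iff)
  have p0: "p > 0" using l lp by simp
  have D: "D \<le> real m * real k * ln (real n)" "real m * (real k * ln (real n) - real n) \<le> D"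
    using sum_ln_fact_bounds[OF n(2,1)] by (simp_all add: D_def)
  have D': "(\<Sum>j<k. ln (fact (m + j))) = D + (\<Sum>j<k. ln (fact j) :: real)" by (simp add: D_def sum_subtractf)
  define L where "L = ln (real n + 4)"
  have L: "L \<ge> 0" using rn by (simp add: L_def)
  have kn: "real k \<le> real n" "real m + real k = real n" using n by auto
  have kL: "real k * L \<le> real n * L" using L kn by (intro mult_right_mono) auto

  have "ln p \<le> ln u" using lp p0 u by (subst ln_le_cancel_iff) auto
  also have "ln u = (real m)\<^sup>2 / 2 * ln 2 + real m * real k / 2 * (2 * ln 2 + ln (real n)) +
     (\<Sum>j<k. real (Suc j) * (- ln s / 2) + (ln (sqrt (hh j)) + ln (real j + 4)) - ln (dd (m + j)))"
  proof -
    have "ln (\<Prod>j<k. (1 / sqrt s) ^ Suc j * (sqrt (hh j) * (real j + 4)) / dd (m + j)) =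
      (\<Sum>j<k. ln ((1 / sqrt s) ^ Suc j * (sqrt (hh j) * (real j + 4)) / dd (m + j)))"
      using s by (intro ln_prod divide_pos_pos mult_pos_pos zero_less_power)
        (auto simp: hh_pos dd_pos less_imp_neq[OF hh_pos, symmetric] less_imp_neq[OF dd_pos, symmetric])
    also have "\<dots> = (\<Sum>j<k. real (Suc j) * (- ln s / 2) + (ln (sqrt (hh j)) + ln (real j + 4)) - ln (dd (m + j)))"
    proof (rule sum.cong[OF refl])
      fix j
      have "ln ((1 / sqrt s) ^ Suc j) = real (Suc j) * (- ln s / 2)"
        using s by (subst ln_realpow) (auto simp: ln_div ln_sqrt)
      moreover have "ln (sqrt (hh j) * (real j + 4)) = ln (sqrt (hh j)) + ln (real j + 4)"
        using hh_pos[of j] by (subst ln_mult) auto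
      ultimately show "ln ((1 / sqrt s) ^ Suc j * (sqrt (hh j) * (real j + 4)) / dd (m + j)) =
         real (Suc j) * (- ln s / 2) + (ln (sqrt (hh j)) + ln (real j + 4)) - ln (dd (m + j))"
        using s hh_pos[of j] dd_pos[of "m + j"] ln_mult_div[of "(1 / sqrt s) ^ Suc j" "sqrt (hh j) * (real j + 4)" "dd (m + j)"]
        by (simp del: power_Suc of_nat_Suc)
    qed
    moreover have "ln (sqrt 2 ^ m\<^sup>2) = (real m)\<^sup>2 / 2 * ln 2" by (simp add: ln_realpow ln_sqrt)
    moreover have "ln (sqrt (4 * real n) ^ (m * k)) = real m * real k / 2 * (2 * ln 2 + ln (real n))"
      using rn ln_realpow[of 2 2] by (simp add: ln_realpow ln_sqrt ln_mult)
    ultimately show ?thesis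
      unfolding u_def using ln_mult3[OF _ _ upos, of "sqrt 2 ^ m\<^sup>2" "sqrt (4 * real n) ^ (m * k)"] rn by simp
  qed
  also have "(\<Sum>j<k. real (Suc j) * (- ln s / 2) + (ln (sqrt (hh j)) + ln (real j + 4)) - ln (dd (m + j)))
     \<le> (\<Sum>j<k. real n * (real m / real n / 2) + (ln (sqrt (hh j)) + L) - (ln (fact (m + j)) / 2 - L))"
  proof (rule sum_mono)
    fix j assume j: "j \<in> {..<k}"
    \<comment> \<open>As \<open>s\<close> is at least \<open>1 / 2\<close>, the power of
      \<open>1 / sqrt s\<close> costs at most \<open>m / 2\<close> for each of the \<open>k\<close>
      eigenvalues.\<close>
    have "- ln s \<le> real m / real n"
    proof -
      have "ln (1 / s) \<le> 1 / s - 1" using s by (intro ln_le_minus_one) auto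
      hence "- ln s \<le> (1 - s) / s" using s by (simp add: ln_div diff_divide_distrib)
      also have "\<dots> \<le> (1 - s) / (1 / 2)" using s by (intro divide_left_mono) (auto simp: s_def)
      also have "\<dots> = real m / real n" by (simp add: s_def)
      finally show ?thesis .
    qed
    hence "real (Suc j) * (- ln s / 2) \<le> real (Suc j) * (real m / real n / 2)" by (intro mult_left_mono) auto
    also have "\<dots> \<le> real n * (real m / real n / 2)" using j n by (intro mult_right_mono) auto
    finally have 1: "real (Suc j) * (- ln s / 2) \<le> real n * (real m / real n / 2)" .
    have 2: "ln (real j + 4) \<le> L" unfolding L_def using j n by (subst ln_le_cancel_iff) auto
    have "ln (real (m + j) + 1) \<le> L" unfolding L_def using j n by (subst ln_le_cancel_iff) auto
    hence 3: "ln (fact (m + j)) / 2 - L \<le> ln (dd (m + j))" using ln_dd(1)[of "m + j"] by linarith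
    show "real (Suc j) * (- ln s / 2) + (ln (sqrt (hh j)) + ln (real j + 4)) - ln (dd (m + j))
      \<le> real n * (real m / real n / 2) + (ln (sqrt (hh j)) + L) - (ln (fact (m + j)) / 2 - L)"
      using 1 2 3 by linarith
  qed
  also have "\<dots> = real k * real m / 2 + 2 * (real k * L) + (- ((real k)\<^sup>2 / 4) * ln 2 + real k / 4 * (ln 2 + ln pi)) - D / 2"
    unfolding sum.distrib sum_subtractf sum_ln_sqrt_hh sum_divide_distrib[symmetric] D' using rn
    by (simp add: algebra_simps add_divide_distrib)
  finally have A: "ln p \<le> (real m)\<^sup>2 / 2 * ln 2 + real m * real k / 2 * (2 * ln 2 + ln (real n)) +
    (real k * real m / 2 + 2 * (real k * L) + (- ((real k)\<^sup>2 / 4) * ln 2 + real k / 4 * (ln 2 + ln pi)) - D / 2)" by simp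
  have "(real m)\<^sup>2 / 2 * ln 2 + real m * real k * ln 2 \<le> (real m)\<^sup>2 / 2 * 1 + real m * real k * 1"
    using ln_num_bounds(3) by (intro add_mono mult_left_mono) auto
  also have "\<dots> \<le> real m * (real m + real k)" by (simp add: power2_eq_square algebra_simps)
  finally have a1: "(real m)\<^sup>2 / 2 * ln 2 + real m * real k * ln 2 \<le> real m * real n" unfolding kn(2) .
  have a2: "real k / 4 * (ln 2 + ln pi) \<le> real n"
  proof -
    have "real k / 4 * (ln 2 + ln pi) \<le> real k / 4 * 4" using ln_num_bounds by (intro mult_left_mono) auto
    thus ?thesis using kn by simp
  qed
  have a3: "real k * real m \<le> real m * real n" using mult_left_mono[OF kn(1), of "real m"] by (simp add: mult.commute)
  have a4: "real m * real n \<ge> 0" by simp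
  have "ln p \<le> ((real m)\<^sup>2 / 2 * ln 2 + real m * real k * ln 2) + real m * real k * ln (real n) / 2 +
    real k * real m / 2 + 2 * (real k * L) - (real k)\<^sup>2 / 4 * ln 2 + real k / 4 * (ln 2 + ln pi) - D / 2"
    using A by (simp add: algebra_simps add_divide_distrib)
  \<comment> \<open>Here the powers of \<open>n\<close> cancel: half of \<open>m k ln n\<close> from
    the determinants is met by \<open>D / 2\<close>, and only half of \<open>m n\<close>
    remains.\<close>
  moreover have "real m * real k * ln (real n) - real m * real n \<le> D" using D(2) by (simp add: algebra_simps)
  ultimately have U: "ln p + (real k)\<^sup>2 / 4 * ln 2 \<le> 10816 * (real m * real n) + 2 * (real n * L) + 5 * real n"
    using a1 a2 a3 a4 kL rn by linarith

  have "ln l \<le> ln p" using lp l by (subst ln_le_cancel_iff) auto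
  moreover have "ln l = - ln 2 - 10816 * real m * real n - ln (fact k) + real m * real k * (ln 52 + ln (real n) / 2) +
     (\<Sum>j<k. ln (sqrt (hh j)) - ln (3 * real j + 5) - ln (dd (m + j)))"
  proof -
    have "ln (\<Prod>j<k. sqrt (hh j) / (3 * real j + 5) / dd (m + j)) = (\<Sum>j<k. ln (sqrt (hh j) / (3 * real j + 5) / dd (m + j)))"
      by (intro ln_prod) (auto simp: hh_pos dd_pos less_imp_neq[OF hh_pos, symmetric] less_imp_neq[OF dd_pos, symmetric])
    also have "\<dots> = (\<Sum>j<k. ln (sqrt (hh j)) - ln (3 * real j + 5) - ln (dd (m + j)))"
    proof (rule sum.cong[OF refl])
      fix j
      show "ln (sqrt (hh j) / (3 * real j + 5) / dd (m + j)) = ln (sqrt (hh j)) - ln (3 * real j + 5) - ln (dd (m + j))"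
        using hh_pos[of j] dd_pos[of "m + j"] by (subst ln_div, simp, simp, subst ln_div) auto
    qed
    moreover have "ln ((52 * sqrt (real n)) ^ (m * k)) = real m * real k * (ln 52 + ln (real n) / 2)"
      using rn by (subst ln_realpow) (auto simp: ln_mult ln_sqrt)
    moreover have "ln (1 / 2 * exp (- 10816 * real m * real n) / fact k) = - ln 2 - 10816 * real m * real n - ln (fact k)"
      by (simp add: ln_div ln_mult)
    ultimately show ?thesis
      unfolding l_def using ln_mult3[OF _ _ lpos, of "1 / 2 * exp (- 10816 * real m * real n) / fact k" "(52 * sqrt (real n)) ^ (m * k)"] rn
      by (simp only:) simp
  qed
  moreover have "(\<Sum>j<k. ln (sqrt (hh j)) - ln (3 * real j + 5) - ln (dd (m + j)))
     \<ge> (\<Sum>j<k. ln (sqrt (hh j)) - (2 + L) - (ln (fact (m + j)) / 2 + 2))"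
  proof (rule sum_mono)
    fix j assume j: "j \<in> {..<k}"
    have "ln (3 * real j + 5) \<le> ln (3 * (real n + 4))" using j n by (subst ln_le_cancel_iff) auto
    also have "\<dots> = ln 3 + L" unfolding L_def using rn by (intro ln_mult_pos) auto
    finally have "ln (3 * real j + 5) \<le> 2 + L" using ln_num_bounds(1) by linarith
    thus "ln (sqrt (hh j)) - (2 + L) - (ln (fact (m + j)) / 2 + 2) \<le> ln (sqrt (hh j)) - ln (3 * real j + 5) - ln (dd (m + j))"
      using ln_dd(2)[of "m + j"] ln_num_bounds(1) by linarith
  qed
  moreover have "(\<Sum>j<k. ln (sqrt (hh j)) - (2 + L) - (ln (fact (m + j)) / 2 + 2))
     = - 4 * real k - real k * L + (- ((real k)\<^sup>2 / 4) * ln 2 + real k / 4 * (ln 2 + ln pi)) - D / 2"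
    unfolding sum.distrib sum_subtractf sum_ln_sqrt_hh sum_divide_distrib[symmetric] D'
    by (simp add: algebra_simps add_divide_distrib)
  ultimately have B: "ln p \<ge> - ln 2 - 10816 * real m * real n - ln (fact k) + real m * real k * (ln 52 + ln (real n) / 2) +
     (- 4 * real k - real k * L + (- ((real k)\<^sup>2 / 4) * ln 2 + real k / 4 * (ln 2 + ln pi)) - D / 2)" by linarith
  have b1: "ln (fact k) \<le> real n * L"
  proof -
    have "fact k \<le> real n ^ k * fact 0" using fact_add_bounds(2)[of k 0 n] n by simp
    hence "ln (fact k) \<le> ln (real n ^ k)" using rn by (subst ln_le_cancel_iff) auto
    also have "\<dots> = real k * ln (real n)" using rn by (simp add: ln_realpow)
    also have "\<dots> \<le> real n * L"
      unfolding L_def using rn kn by (intro mult_mono) auto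
    finally show ?thesis .
  qed
  have b2: "0 \<le> real k / 4 * (ln 2 + ln pi)" using ln_num_bounds by simp
  have b3: "0 \<le> real m * real k * ln 52" by simp
  have "ln p \<ge> - ln 2 - 10816 * (real m * real n) - ln (fact k) + real m * real k * ln 52 + real m * real k * ln (real n) / 2
     - 4 * real k - real k * L - (real k)\<^sup>2 / 4 * ln 2 + real k / 4 * (ln 2 + ln pi) - D / 2"
    using B by (simp add: algebra_simps add_divide_distrib)
  hence Lo: "ln p + (real k)\<^sup>2 / 4 * ln 2 \<ge> - (10816 * (real m * real n) + 2 * (real n * L) + 5 * real n)"
    using D(1) b1 b2 b3 kL rn kn(1) ln_num_bounds(3) by linarith
  show ?thesis using p p0 U Lo unfolding L_def by (intro exI[of _ p]) (simp add: abs_le_iff mult.assoc)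
qed

section \<open>Transfer to the Ginibre ensemble\<close>

text \<open>The maximal power of the linear factor at \<open>c * x\<close> becomes, up to a
  constant, the same power of the linear factor at \<open>x\<close>, and the cofactor stays nonzero
  there.\<close>

lemma order_pcompose_scale:
  fixes p :: "real poly"
  assumes c: "c \<noteq> 0" and p: "p \<noteq> 0"
  shows "order x (pcompose p [:0, c:]) = order (c * x) p"
proof -
  define l where "l = order (c * x) p"
  obtain q where q: "p = [:- (c * x), 1:] ^ l * q" "\<not> [:- (c * x), 1:] dvd q"
    using order_decomp[OF p, of "c * x"] by (auto simp: l_def)
  define q' where "q' = pcompose q [:0, c:]"
  have q': "poly q' x \<noteq> 0" using q(2) by (simp add: q'_def poly_pcompose poly_eq_0_iff_dvd mult.commute)
  have pow: "pcompose (r ^ i) [:0, c:] = (pcompose r [:0, c:]) ^ i" for r :: "real poly" and i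
    by (induction i) (simp_all add: pcompose_mult pcompose_1)
  have "pcompose [:- (c * x), 1:] [:0, c:] = Polynomial.smult c [:- x, 1:]" by (simp add: pcompose_pCons)
  hence "pcompose p [:0, c:] = Polynomial.smult (c ^ l) ([:- x, 1:] ^ l * q')"
    by (simp only: q(1) pcompose_mult pow smult_power q'_def mult_smult_left)
  hence "order x (pcompose p [:0, c:]) = order x ([:- x, 1:] ^ l * q')" using c by (simp add: order_smult del: mult_pCons_left)
  also have "\<dots> = l" using q' by (subst order_mult) (auto simp: order_power_n_n order_0I)
  finally show ?thesis by (simp add: l_def)
qed

text \<open>Scaling a matrix scales its eigenvalues and keeps their multiplicities, so variance
  \<open>1 / n\<close> may be exchanged for variance 1.\<close>

lemma nr_cp_scale:
  assumes c: "c > 0"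
  shows "nr (cp n (\<lambda>p. c * B p)) = nr (cp n B)"
proof -
  define p where "p = cp n (\<lambda>p. c * B p)"
  have p: "p \<noteq> 0" by (simp add: p_def cp_monic)
  have pc: "poly p (c * x) = c ^ n * poly (cp n B) x" for x
  proof -
    have "mat n n (\<lambda>(i, j). (if i = j then c * x else 0) - c * B (i, j)) = c \<cdot>\<^sub>m mat n n (\<lambda>(i, j). (if i = j then x else 0) - B (i, j))"
      by (intro eq_matI) (auto simp: algebra_simps)
    thus ?thesis by (simp add: p_def poly_cp det_smult)
  qed
  have "pcompose p [:0, c:] = Polynomial.smult (c ^ n) (cp n B)"
    by (subst poly_eq_poly_eq_iff[symmetric]) (simp add: fun_eq_iff poly_pcompose pc mult.commute[of _ c])
  hence ord: "order x (cp n B) = order (c * x) p" for x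
    using order_pcompose_scale[OF _ p, of c x] c by (simp add: order_smult)
  have "nr p = (\<Sum>x | poly (cp n B) x = 0. order (c * x) p)"
    unfolding nr_def
    by (rule sum.reindex_bij_witness[of _ "\<lambda>x. c * x" "\<lambda>y. y / c"]) (use c pc[of "_ / c"] pc in auto)
  thus ?thesis by (simp add: nr_def ord p_def)
qed

lemma PiM_density_lborel:
  fixes f :: "real \<Rightarrow> real"
  assumes I: "finite I" and f: "f \<in> borel_measurable borel" and pr: "prob_space (density lborel (\<lambda>x. ennreal (f x)))"
  shows "PiM I (\<lambda>_. density lborel (\<lambda>x. ennreal (f x))) = density (LB I) (\<lambda>x. \<Prod>i\<in>I. ennreal (f (x i)))"
proof -
  let ?N = "density lborel (\<lambda>x. ennreal (f x))"
  have mf: "(\<lambda>x. ennreal (f x)) \<in> borel_measurable lborel" using f by simp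
  interpret N: prob_space ?N by (rule pr)
  interpret N: product_sigma_finite "\<lambda>_. ?N" by standard
  have mI: "(\<lambda>x. \<Prod>i\<in>I. ennreal (f (x i))) \<in> borel_measurable (LB I)"
    using f by (intro borel_measurable_prod_ennreal measurable_compose[OF measurable_coord] measurable_compose[OF _ measurable_ennreal])
  show ?thesis
  proof (rule N.PiM_eqI[OF I, symmetric])
    show "sets (density (LB I) (\<lambda>x. \<Prod>i\<in>I. ennreal (f (x i)))) = sets (PiM I (\<lambda>_. ?N))"
      by (simp cong: sets_PiM_cong)
    fix A :: "_ \<Rightarrow> real set" assume "\<And>i. i \<in> I \<Longrightarrow> A i \<in> sets ?N"
    hence A: "\<And>i. i \<in> I \<Longrightarrow> A i \<in> sets lborel" by simp
    have "emeasure (density (LB I) (\<lambda>x. \<Prod>i\<in>I. ennreal (f (x i)))) (Pi\<^sub>E I A)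
       = (\<integral>\<^sup>+x. (\<Prod>i\<in>I. ennreal (f (x i))) * indicator (Pi\<^sub>E I A) x \<partial>LB I)"
      by (rule emeasure_density[OF mI]) (intro sets_PiM_I_finite I A)
    also have "\<dots> = (\<integral>\<^sup>+x. (\<Prod>i\<in>I. ennreal (f (x i)) * indicator (A i) (x i)) \<partial>LB I)"
    proof (rule nn_integral_cong)
      fix x assume "x \<in> space (LB I)"
      hence "x \<in> extensional I" by (simp add: space_PiM PiE_def)
      hence "(indicator (Pi\<^sub>E I A) x :: ennreal) = (\<Prod>i\<in>I. indicator (A i) (x i))"
        using I by (auto simp: indicator_def PiE_iff prod.If_cases)
      thus "(\<Prod>i\<in>I. ennreal (f (x i))) * indicator (Pi\<^sub>E I A) x = (\<Prod>i\<in>I. ennreal (f (x i)) * indicator (A i) (x i))"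
        by (simp add: prod.distrib)
    qed
    also have "\<dots> = (\<Prod>i\<in>I. \<integral>\<^sup>+x. ennreal (f x) * indicator (A i) x \<partial>lborel)"
      using A mf by (intro leb.product_nn_integral_prod[OF I] borel_measurable_times_ennreal borel_measurable_indicator)
    also have "\<dots> = (\<Prod>i\<in>I. emeasure ?N (A i))"
      by (intro prod.cong refl emeasure_density[OF mf, symmetric] A)
    finally show "emeasure (density (LB I) (\<lambda>x. \<Prod>i\<in>I. ennreal (f (x i)))) (Pi\<^sub>E I A) = (\<Prod>i\<in>I. emeasure ?N (A i))" .
  qed
qed

text \<open>Multiplication by \<open>sqrt n\<close> makes the entries standard Gaussian without
  changing the number of real eigenvalues. By independence their joint law has the product density,
  which is \<open>gw\<close> with the normalisation in \<open>An\<close>; for the empty list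
  \<open>absprod\<close> is 1.\<close>

lemma real_ginibre_prob:
  assumes P: "prob_space P" and M: "real_ginibre P n M" and n: "n \<ge> 1"
  shows "ennreal (prob_real_eigenvalues P M k) = An n k []"
proof -
  interpret prob_space P by (rule P)
  let ?I = "sq2 n"
  define c where "c = sqrt (real n)"
  have c: "c > 0" using n by (simp add: c_def)
  \<comment> \<open>The summand 0 matches the affine form in
    \<open>normal_density_affine\<close>.\<close>
  define Y where "Y p \<omega> = 0 + c * M \<omega> $$ p" for p \<omega>
  define f where "f = std_normal_density"
  let ?N = "density lborel (\<lambda>x. ennreal (f x))"
  have car: "M \<omega> \<in> carrier_mat n n" if "\<omega> \<in> space P" for \<omega> using M that by (simp add: real_ginibre_def)
  have dist: "distributed P lborel (Y p) (\<lambda>x. ennreal (f x))" if p: "p \<in> ?I" for p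
  proof -
    obtain i j where ij: "p = (i, j)" "i < n" "j < n" using p by auto
    have "distributed P lborel (\<lambda>\<omega>. M \<omega> $$ (i, j)) (normal_density 0 (1 / sqrt (real n)))"
      using M ij by (simp add: real_ginibre_def)
    hence "distributed P lborel (\<lambda>\<omega>. 0 + c * M \<omega> $$ (i, j)) (normal_density (0 + c * 0) (\<bar>c\<bar> * (1 / sqrt (real n))))"
      by (rule normal_density_affine) (use c n in auto)
    thus ?thesis using c n by (simp add: Y_def[abs_def] ij f_def c_def)
  qed
  have law: "distr P lborel (Y p) = ?N" if "p \<in> ?I" for p
    using distributed_distr_eq_density[OF dist[OF that]] .
  have mY: "Y p \<in> measurable P lborel" if "p \<in> ?I" for p
    using distributed_measurable[OF dist[OF that]] .
  have indep: "indep_vars (\<lambda>_. lborel) Y ?I"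
  proof -
    have "indep_vars (\<lambda>_. borel) (\<lambda>(i, j) \<omega>. M \<omega> $$ (i, j)) ?I" using M by (simp add: real_ginibre_def)
    hence "indep_vars (\<lambda>_. lborel) (\<lambda>p \<omega>. 0 + c * (case p of (i, j) \<Rightarrow> \<lambda>\<omega>. M \<omega> $$ (i, j)) \<omega>) ?I"
      by (rule indep_vars_compose2) auto
    also have "(\<lambda>p \<omega>. 0 + c * (case p of (i, j) \<Rightarrow> \<lambda>\<omega>. M \<omega> $$ (i, j)) \<omega>) = Y" by (auto simp: Y_def fun_eq_iff)
    finally show ?thesis .
  qed
  have ne: "?I \<noteq> {}" using n by (auto simp: lessThan_empty_iff)
  have joint: "distr P (LM n) (\<lambda>\<omega>. \<lambda>p\<in>?I. Y p \<omega>) = density (LM n) (\<lambda>x. \<Prod>p\<in>?I. ennreal (f (x p)))"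
  proof -
    have "distr P (LM n) (\<lambda>\<omega>. \<lambda>p\<in>?I. Y p \<omega>) = PiM ?I (\<lambda>p. distr P lborel (Y p))"
      using indep_vars_iff_distr_eq_PiM'[OF ne, where M' = "\<lambda>_. lborel" and X = Y] mY indep by simp
    also have "\<dots> = PiM ?I (\<lambda>_. ?N)" by (intro PiM_cong refl law)
    also have "\<dots> = density (LM n) (\<lambda>x. \<Prod>p\<in>?I. ennreal (f (x p)))"
      by (rule PiM_density_lborel) (auto simp: f_def prob_space_normal_density)
    finally show ?thesis .
  qed
  define S where "S = {B \<in> space (LM n). nr (cp n B) = k}"
  have S: "S \<in> sets (LM n)"
  proof -
    have "(\<lambda>B. nr (cp n B)) \<in> measurable (LM n) (count_space UNIV)" by (intro measurable_nr_cp measurable_entry)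
    hence "(\<lambda>B. nr (cp n B)) -` {k} \<inter> space (LM n) \<in> sets (LM n)" by (rule measurable_sets) simp
    thus ?thesis by (simp add: S_def vimage_def Int_def conj_commute)
  qed
  have mYY: "(\<lambda>\<omega>. \<lambda>p\<in>?I. Y p \<omega>) \<in> measurable P (LM n)" by (intro measurable_restrict mY)
  have eig: "num_real_eigenvalues (M \<omega>) = nr (cp n (\<lambda>p\<in>?I. Y p \<omega>))" if "\<omega> \<in> space P" for \<omega>
  proof -
    have "num_real_eigenvalues (M \<omega>) = nr (char_poly (M \<omega>))" by (rule num_real_eigenvalues_nr[OF car[OF that]])
    also have "M \<omega> = mat n n (\<lambda>p. M \<omega> $$ p)" using car[OF that] by (intro eq_matI) auto
    hence "char_poly (M \<omega>) = cp n (\<lambda>p. M \<omega> $$ p)" by (simp add: cp_def)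
    also have "nr (cp n (\<lambda>p. M \<omega> $$ p)) = nr (cp n (\<lambda>p. c * M \<omega> $$ p))" by (rule nr_cp_scale[OF c, symmetric])
    also have "cp n (\<lambda>p. c * M \<omega> $$ p) = cp n (\<lambda>p\<in>?I. Y p \<omega>)" by (rule cp_cong) (simp add: Y_def)
    finally show ?thesis .
  qed
  have "ennreal (prob_real_eigenvalues P M k) = emeasure P {\<omega> \<in> space P. num_real_eigenvalues (M \<omega>) = k}"
    by (simp add: prob_real_eigenvalues_def emeasure_eq_measure)
  also have "{\<omega> \<in> space P. num_real_eigenvalues (M \<omega>) = k} = (\<lambda>\<omega>. \<lambda>p\<in>?I. Y p \<omega>) -` S \<inter> space P"
    using eig measurable_space[OF mYY] by (auto simp: S_def)
  also have "emeasure P \<dots> = emeasure (distr P (LM n) (\<lambda>\<omega>. \<lambda>p\<in>?I. Y p \<omega>)) S"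
    by (rule emeasure_distr[OF mYY S, symmetric])
  also have "\<dots> = (\<integral>\<^sup>+B. (\<Prod>p\<in>?I. ennreal (f (B p))) * indicator S B \<partial>LM n)"
    unfolding joint
    by (intro emeasure_density S borel_measurable_prod_ennreal measurable_compose[OF measurable_coord] measurable_compose[OF _ measurable_ennreal])
      (auto simp: f_def)
  also have "\<dots> = (\<integral>\<^sup>+B. ennreal (1 / sqrt (2 * pi) ^ n\<^sup>2) * ((if nr (cp n B) = k then ennreal (absprod [] (cp n B)) else 0) * ennreal (gw ?I B)) \<partial>LM n)"
  proof (rule nn_integral_cong)
    fix B assume B: "B \<in> space (LM n)"
    have "(\<Prod>p\<in>?I. ennreal (f (B p))) = ennreal (\<Prod>p\<in>?I. f (B p))" by (rule prod_ennreal) (simp add: f_def)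
    also have "(\<Prod>p\<in>?I. f (B p)) = (\<Prod>p\<in>?I. 1 / sqrt (2 * pi)) * (\<Prod>p\<in>?I. exp (- (B p)\<^sup>2 / 2))"
      unfolding prod.distrib[symmetric] by (simp add: f_def normal_density_def)
    also have "\<dots> = 1 / sqrt (2 * pi) ^ n\<^sup>2 * gw ?I B"
      by (simp add: gw_prod card_cartesian_product power2_eq_square power_one_over)
    finally show "(\<Prod>p\<in>?I. ennreal (f (B p))) * indicator S B
       = ennreal (1 / sqrt (2 * pi) ^ n\<^sup>2) * ((if nr (cp n B) = k then ennreal (absprod [] (cp n B)) else 0) * ennreal (gw ?I B))"
      using B by (auto simp: S_def absprod_def ennreal_mult'[symmetric] gw_def)
  qed
  also have "\<dots> = An n k []"
    unfolding An_def
    by (intro nn_integral_cmult borel_measurable_times_ennreal measurable_An_integrand_const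
        measurable_compose[OF _ measurable_ennreal] measurable_gw measurable_coord)
  finally show ?thesis .
qed

text \<open>Divided by \<open>n\<^sup>2\<close>, the error is
  \<open>10816 (1 - \<phi> n / n)\<close> plus a term of order \<open>ln n / n\<close>, and the main
  term is \<open>(\<phi> n / n)\<^sup>2 / 4 * ln 2\<close>.\<close>

lemma tendsto_ln_over_square:
  fixes q :: "nat \<Rightarrow> real" and \<phi> :: "nat \<Rightarrow> nat"
  assumes le: "\<And>n. n \<ge> 1 \<Longrightarrow> \<phi> n \<le> n" and lim: "(\<lambda>n. real (\<phi> n) / real n) \<longlonglongrightarrow> 1"
    and b: "\<And>n. n \<ge> 1 \<Longrightarrow> \<bar>ln (q n) + (real (\<phi> n))\<^sup>2 / 4 * ln 2\<bar>
      \<le> 10816 * real (n - \<phi> n) * real n + 2 * real n * ln (real n + 4) + 5 * real n"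
  shows "(\<lambda>n. 1 / (real n)\<^sup>2 * ln (q n)) \<longlonglongrightarrow> - (1 / 4) * ln 2"
proof -
  define a where "a n = real (\<phi> n) / real n" for n
  have a: "a \<longlonglongrightarrow> 1" using lim by (simp add: a_def[abs_def])
  have "(\<lambda>n. 1 / (real n)\<^sup>2 * ln (q n) + (a n)\<^sup>2 / 4 * ln 2) \<longlonglongrightarrow> 0"
  proof (rule Lim_null_comparison)
    show "eventually (\<lambda>n. norm (1 / (real n)\<^sup>2 * ln (q n) + (a n)\<^sup>2 / 4 * ln 2)
        \<le> 10816 * (1 - a n) + 2 * (ln (real n + 4) / real n) + 5 / real n) sequentially"
      using eventually_ge_at_top[of 1]
    proof eventually_elim
      case (elim n)
      have "norm (1 / (real n)\<^sup>2 * ln (q n) + (a n)\<^sup>2 / 4 * ln 2) = \<bar>ln (q n) + (real (\<phi> n))\<^sup>2 / 4 * ln 2\<bar> / (real n)\<^sup>2"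
      proof -
        have "1 / (real n)\<^sup>2 * ln (q n) + (a n)\<^sup>2 / 4 * ln 2 = (ln (q n) + (real (\<phi> n))\<^sup>2 / 4 * ln 2) / (real n)\<^sup>2"
          by (simp add: a_def power_divide add_divide_distrib)
        thus ?thesis by (simp add: abs_divide)
      qed
      also have "\<dots> \<le> (10816 * real (n - \<phi> n) * real n + 2 * real n * ln (real n + 4) + 5 * real n) / (real n)\<^sup>2"
        by (intro divide_right_mono b elim) auto
      also have "\<dots> = 10816 * (1 - a n) + 2 * (ln (real n + 4) / real n) + 5 / real n"
        using elim le[OF elim] by (simp add: a_def of_nat_diff power2_eq_square add_divide_distrib diff_divide_distrib right_diff_distrib)
      finally show ?case .
    qed
    have "(\<lambda>n. ln (real n + 4) / real n) \<longlonglongrightarrow> 0" by real_asymp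
    moreover have "(\<lambda>n. 5 / real n) \<longlonglongrightarrow> 0" by real_asymp
    ultimately have "(\<lambda>n. 10816 * (1 - a n) + 2 * (ln (real n + 4) / real n) + 5 / real n) \<longlonglongrightarrow> 10816 * (1 - 1) + 2 * 0 + 0"
      by (intro tendsto_intros a)
    thus "(\<lambda>n. 10816 * (1 - a n) + 2 * (ln (real n + 4) / real n) + 5 / real n) \<longlonglongrightarrow> 0" by simp
  qed
  moreover have "(\<lambda>n. (a n)\<^sup>2 / 4 * ln 2) \<longlonglongrightarrow> 1\<^sup>2 / 4 * ln 2" by (intro tendsto_intros a) auto
  ultimately have "(\<lambda>n. (1 / (real n)\<^sup>2 * ln (q n) + (a n)\<^sup>2 / 4 * ln 2) - (a n)\<^sup>2 / 4 * ln 2) \<longlonglongrightarrow> 0 - 1\<^sup>2 / 4 * ln 2"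
    by (rule tendsto_diff)
  thus ?thesis by simp
qed

theorem mainTheorem4:
  fixes P :: "'a measure" and M :: "nat \<Rightarrow> 'a \<Rightarrow> real mat" and p :: "nat \<Rightarrow> nat \<Rightarrow> real"
  assumes "prob_space P"
    and "\<And>n. n \<ge> 1 \<Longrightarrow> real_ginibre P n (M n)"
  defines "p \<equiv> (\<lambda>n k. prob_real_eigenvalues P (M n) k)"
  shows "(\<forall>\<phi> :: nat \<Rightarrow> nat.
            (\<forall>n\<ge>1. \<phi> n \<le> n \<and> (even (\<phi> n) \<longleftrightarrow> even n)) \<longrightarrow>
            (\<lambda>n. real (\<phi> n) / real n) \<longlonglongrightarrow> 1 \<longrightarrow>
            (\<lambda>n. ln (p n (\<phi> n))) \<sim>[at_top] (\<lambda>n. - ((real n)\<^sup>2 / 4) * ln 2) \<and>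
            (\<lambda>n. 1 / (real n)\<^sup>2 * ln (p n (\<phi> n))) \<longlonglongrightarrow> - (1 / 4) * ln 2)
       \<and> (\<forall>r :: nat. (\<lambda>n. ln (p n (n - 2 * r))) \<sim>[at_top] (\<lambda>n. - ((real n)\<^sup>2 / 4) * ln 2))"
proof -
  have bound: "\<bar>ln (p n k) + (real k)\<^sup>2 / 4 * ln 2\<bar> \<le> 10816 * real (n - k) * real n + 2 * real n * ln (real n + 4) + 5 * real n"
    if n: "n \<ge> 1" "k \<le> n" "even k \<longleftrightarrow> even n" for n k
  proof -
    obtain q where q: "q > 0" "An n k [] = ennreal q"
      "\<bar>ln q + (real k)\<^sup>2 / 4 * ln 2\<bar> \<le> 10816 * real (n - k) * real n + 2 * real n * ln (real n + 4) + 5 * real n"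
      using ln_An_bounds[of n "n - k" k] n by auto
    have "p n k = q"
      using real_ginibre_prob[OF assms(1) assms(2)[OF n(1)] n(1), of k] q
      by (simp add: p_def prob_real_eigenvalues_def)
    thus ?thesis using q(3) by simp
  qed
  have limit: "(\<lambda>n. 1 / (real n)\<^sup>2 * ln (p n (\<phi> n))) \<longlonglongrightarrow> - (1 / 4) * ln 2"
    if "\<forall>n\<ge>1. \<phi> n \<le> n \<and> (even (\<phi> n) \<longleftrightarrow> even n)" "(\<lambda>n. real (\<phi> n) / real n) \<longlonglongrightarrow> 1" for \<phi> :: "nat \<Rightarrow> nat"
    by (rule tendsto_ln_over_square[OF _ that(2)]) (use that(1) bound in auto)
  have equiv: "(\<lambda>n. ln (p n (\<phi> n))) \<sim>[at_top] (\<lambda>n. - ((real n)\<^sup>2 / 4) * ln 2)"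
    if "(\<lambda>n. 1 / (real n)\<^sup>2 * ln (p n (\<phi> n))) \<longlonglongrightarrow> - (1 / 4) * ln 2" for \<phi> :: "nat \<Rightarrow> nat"
  proof (rule asymp_equivI')
    have "(\<lambda>n. (1 / (real n)\<^sup>2 * ln (p n (\<phi> n))) / (- (1 / 4) * ln 2)) \<longlonglongrightarrow> (- (1 / 4) * ln 2) / (- (1 / 4) * ln 2)"
      by (intro tendsto_divide that tendsto_const) simp
    thus "(\<lambda>n. ln (p n (\<phi> n)) / (- ((real n)\<^sup>2 / 4) * ln 2)) \<longlonglongrightarrow> 1" by (simp add: field_simps)
  qed
  have "(\<lambda>n. ln (p n (n - 2 * r))) \<sim>[at_top] (\<lambda>n. - ((real n)\<^sup>2 / 4) * ln 2)" for r
  proof -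
    \<comment> \<open>For \<open>n < 2 * r\<close> the truncated difference is 0, which has the
      wrong parity when \<open>n\<close> is odd; \<open>n mod 2\<close> is admissible there, and
      only finitely many \<open>n\<close> are affected.\<close>
    define \<phi> where "\<phi> n = (if n < 2 * r then n mod 2 else n - 2 * r)" for n
    have ev: "eventually (\<lambda>n. \<phi> n = n - 2 * r) at_top"
      using eventually_ge_at_top[of "2 * r"] by eventually_elim (simp add: \<phi>_def)
    have par: "\<forall>n\<ge>1. \<phi> n \<le> n \<and> (even (\<phi> n) \<longleftrightarrow> even n)" by (auto simp: \<phi>_def)
    have "(\<lambda>n. 1 - real (2 * r) / real n) \<longlonglongrightarrow> 1" by real_asymp
    moreover have "eventually (\<lambda>n. 1 - real (2 * r) / real n = real (\<phi> n) / real n) at_top"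
      using eventually_gt_at_top[of "2 * r"]
      by eventually_elim (simp add: \<phi>_def of_nat_diff diff_divide_distrib)
    ultimately have "(\<lambda>n. real (\<phi> n) / real n) \<longlonglongrightarrow> 1" by (rule Lim_transform_eventually)
    hence "(\<lambda>n. ln (p n (\<phi> n))) \<sim>[at_top] (\<lambda>n. - ((real n)\<^sup>2 / 4) * ln 2)" using equiv limit par by blast
    thus ?thesis
      by (rule asymp_equiv_transfer) (use ev in \<open>auto elim: eventually_mono\<close>)
  qed
  thus ?thesis using equiv limit by blast
qed

end
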